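(* For each of the primitive complex reflection groups $G_9,G_{10},G_{11},G_{14},G_{17},G_{18},G_{19},G_{21}$ (Shephard--Todd notation), with field of definition $k$, there is a unique genus of distinguished $\mathbb{Z}_k$-root systems. Indeed, for each of these groups let $C$ be the Cartan matrix (listed in the context) corresponding to the standard generators; then every matrix $DCD^{-1}$ with $D$ an invertible diagonal matrix over $k$ and with all entries in $\mathbb{Z}_k$ is conjugate to $C$ by a diagonal matrix with entries in $\mathbb{Z}_k^\times$.
   Context: $\zeta_n=\exp(2\pi i/n)$, $\phi=\frac{1+\sqrt5}{2}$. The field of definition $k$ of a complex reflection group $(V,G)$ is the field generated by the traces on $V$ of the elements of $G$; $V$ is taken over $k$, and $\mathbb{Z}_k$ is the ring of integers (a principal ideal domain for these groups). $\lambda\mapsto\lambda^*$ is complex conjugation. $W$ is a $k$-vector space with a Hermitian pairing $\langle\cdot,\cdot\rangle:V\times W\to k$ (linear in $V$, semi-linear in $W$, non-degenerate); for $g\in\mathrm{GL}(V)$, $g^\vee\in\mathrm{GL}(W)$ satisfies $\langle gv,g^\vee w\rangle=\langle v,w\rangle$. A $\mathbb{Z}_k$-root is a triple $\mathfrak r=(I,J,\zeta)$ with $I\subset V$, $J\subset W$ rank one finitely generated $\mathbb{Z}_k$-submodules, $\zeta\ne1$ a root of unity in $k$, and $\langle I,J\rangle=(1-\zeta)\mathbb{Z}_k$ (fractional ideal generated by all $\langle\alpha,\beta\rangle$). Its reflection is $s_{\mathfrak r}(x)=x-\langle x,w\rangle v$ for $v\in kI,w\in kJ$, $\langle v,w\rangle=1-\zeta$.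 Put $g\cdot(I,J,\zeta)=(g(I),g^\vee(J),\zeta)$ and, for a nonzero fractional ideal $\mathfrak a$, $\mathfrak a\cdot(I,J,\zeta)=(\mathfrak aI,(\mathfrak a^{-1})^*J,\zeta)$. A $\mathbb{Z}_k$-root system for $G$ is a finite set $\mathfrak R$ of $\mathbb{Z}_k$-roots whose $I_{\mathfrak r}$ generate $V$, with $s_{\mathfrak r}\cdot\mathfrak R=\mathfrak R$ for $\mathfrak r\in\mathfrak R$, $\langle I_{\mathfrak r_1},J_{\mathfrak r_2}\rangle\subseteq\mathbb{Z}_k$ for $\mathfrak r_1,\mathfrak r_2\in\mathfrak R$, and such that the $s_{\mathfrak r}$ generate $G$. It is distinguished if $\mathfrak r\mapsto s_{\mathfrak r}$ is injective and each $s=s_{\mathfrak r}$ has $\det s=\exp(2\pi i/c)$, $c$ the order of the pointwise stabilizer in $G$ of $\ker(s-1)$. Two root systems are of the same genus if $\mathfrak R_2=\mathfrak a\cdot\mathfrak R_1$ for some fractional ideal $\mathfrak a$. A Cartan matrix for a list of reflections with roots $(\mathbb{Z}_k\alpha_s,\mathbb{Z}_k\beta_s,\zeta_s)$, $\langle\alpha_s,\beta_s\rangle=1-\zeta_s$, is $(\langle\alpha_s,\beta_t\rangle)_{s,t}$. The matrices $C$ for the standard generators (up to transposition, depending on conventions) are: $G_9$, $\mathbb{Z}_k=\mathbb{Z}[\zeta_8]$: $\begin{pmatrix}2&-\frac{2+\sqrt2}{i+1}\\-1&1-i\end{pmatrix}$; $G_{10}$, $\mathbb{Z}[\zeta_{12}]$: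 $\begin{pmatrix}1-\zeta_3&1\\-i-\zeta_3&1-i\end{pmatrix}$; $G_{11}$, $\mathbb{Z}[\zeta_{24}]$: $\begin{pmatrix}2&\zeta_3^2(\sqrt{-3}-\sqrt{-2})&1-\zeta_{24}\\1&1-\zeta_3&\zeta_{24}^{13}\\1+\zeta_{24}^5&\zeta_{24}^7+\zeta_{24}^5&1-i\end{pmatrix}$; $G_{14}$, $\mathbb{Z}[\zeta_3,\sqrt{-2}]$: $\begin{pmatrix}2&-1\\-\zeta_3^2(\sqrt{-3}+\sqrt{-2})&1-\zeta_3\end{pmatrix}$; $G_{17}$, $\mathbb{Z}[\zeta_{20}]$: $\begin{pmatrix}2&1\\1-\zeta_5-\zeta_{20}^7&1-\zeta_5\end{pmatrix}$; $G_{18}$, $\mathbb{Z}[\zeta_{15}]$: $\begin{pmatrix}1-\zeta_3&-\zeta_{15}^4\\\zeta_{15}^{-1}+\zeta_{15}&1-\zeta_5\end{pmatrix}$; $G_{19}$, $\mathbb{Z}[\zeta_{60}]$: $\begin{pmatrix}2&1-\zeta_3\zeta_{60}^{-1}&-1\\1+\zeta_{60}&1-\zeta_3&-\zeta_{60}\\\zeta_5-1+\zeta_{20}^7&\zeta_{60}^{19}+\zeta_{60}^{11}&1-\zeta_5\end{pmatrix}$; $G_{21}$, $\mathbb{Z}[\zeta_{12},\phi]$: $\begin{pmatrix}2&1\\1-\zeta_3+\phi\zeta_{12}^{-1}&1-\zeta_3\end{pmatrix}$. *)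

theory Defs
  imports "HOL-Analysis.Analysis" "HOL-Computational_Algebra.Polynomial"
begin

section \<open>Subfields of the complex numbers and modules over subrings\<close>

definition zeta :: "nat \<Rightarrow> complex" where
  "zeta n = exp (2 * of_real pi * \<i> / of_nat n)"

definition golden :: complex where
  "golden = (1 + csqrt 5) / 2"

definition is_subfield :: "complex set \<Rightarrow> bool" where
  "is_subfield K \<longleftrightarrow> 1 \<in> K \<and> (\<forall>x\<in>K. \<forall>y\<in>K. x - y \<in> K \<and> x * y \<in> K) \<and> (\<forall>x\<in>K. inverse x \<in> K)"

definition ring_of_integers :: "complex set \<Rightarrow> complex set" where
  "ring_of_integers k = {x \<in> k. algebraic_int x}"

definition integral_units :: "complex set \<Rightarrow> complex set" where
  "integral_units k = {x \<in> ring_of_integers k. \<exists>y\<in>ring_of_integers k. x * y = 1}"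

definition submodule_over ::
    "complex set \<Rightarrow> (complex \<Rightarrow> 'v \<Rightarrow> 'v) \<Rightarrow> 'v::ab_group_add set \<Rightarrow> bool" where
  "submodule_over R scl M \<longleftrightarrow>
     0 \<in> M \<and> (\<forall>x\<in>M. \<forall>y\<in>M. x + y \<in> M) \<and> (\<forall>r\<in>R. \<forall>x\<in>M. scl r x \<in> M)"

definition span_over ::
    "complex set \<Rightarrow> (complex \<Rightarrow> 'v \<Rightarrow> 'v) \<Rightarrow> 'v::ab_group_add set \<Rightarrow> 'v set" where
  "span_over R scl S = submodule_over R scl hull S"

text \<open>A nonzero fractional ideal is a nonzero finitely generated submodule of the field.\<close>

definition fractional_ideal :: "complex set \<Rightarrow> complex set \<Rightarrow> bool" where
  "fractional_ideal k a \<longleftrightarrow>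
     a \<noteq> {0} \<and> (\<exists>F. finite F \<and> F \<subseteq> k \<and> a = span_over (ring_of_integers k) (*) F)"

definition ideal_inverse :: "complex set \<Rightarrow> complex set \<Rightarrow> complex set" where
  "ideal_inverse k a = {x \<in> k. \<forall>y\<in>a. x * y \<in> ring_of_integers k}"

definition ideal_times :: "complex set \<Rightarrow> complex set \<Rightarrow> (complex^'n) set \<Rightarrow> (complex^'n) set" where
  "ideal_times k a M = span_over (ring_of_integers k) (*s) {c *s x | c x. c \<in> a \<and> x \<in> M}"

section \<open>Matrix groups over a field of definition\<close>

inductive_set generated_group :: "(complex^'n^'n) set \<Rightarrow> (complex^'n^'n) set"
  for S :: "(complex^'n^'n) set" where
  one: "mat 1 \<in> generated_group S"
| incl: "A \<in> S \<Longrightarrow> A \<in> generated_group S"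
| inv: "A \<in> S \<Longrightarrow> matrix_inv A \<in> generated_group S"
| mult: "A \<in> generated_group S \<Longrightarrow> B \<in> generated_group S \<Longrightarrow> A ** B \<in> generated_group S"

definition field_of_definition :: "(complex^'n^'n) set \<Rightarrow> complex set" where
  "field_of_definition G = is_subfield hull (trace ` G)"

text \<open>A finite-dimensional vector space over a subfield k of the complex numbers is represented
  as a k-form of complex n-space, that is, the k-span of a complex basis (up to isomorphism this
  is no restriction: embed the space into its scalar extension).  Elements of GL(V) are
  represented by the matrices of their complex-linear extensions; these have the same trace and
  determinant.\<close>

definition k_form :: "complex set \<Rightarrow> (complex^'n) set \<Rightarrow> bool" where
  "k_form k V \<longleftrightarrow> (\<exists>B. vec.independent B \<and> vec.span B = UNIV \<and> V = span_over k (*s) B)"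

text \<open>Likewise a non-degenerate k-valued Hermitian pairing of V and W is represented by its unique
  extension to a non-degenerate sesquilinear pairing over the complex numbers.\<close>

definition hermitian_pairing ::
    "complex set \<Rightarrow> (complex^'n) set \<Rightarrow> (complex^'n) set \<Rightarrow> (complex^'n \<Rightarrow> complex^'n \<Rightarrow> complex) \<Rightarrow> bool"
  where
  "hermitian_pairing k V W p \<longleftrightarrow>
     (\<forall>x y z. p (x + y) z = p x z + p y z) \<and> (\<forall>c x z. p (c *s x) z = c * p x z) \<and>
     (\<forall>x y z. p x (y + z) = p x y + p x z) \<and> (\<forall>c x z. p x (c *s z) = cnj c * p x z) \<and>
     (\<forall>x. (\<forall>z. p x z = 0) \<longrightarrow> x = 0) \<and> (\<forall>z. (\<forall>x. p x z = 0) \<longrightarrow> z = 0) \<and>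
     (\<forall>x\<in>V. \<forall>z\<in>W. p x z \<in> k)"

text \<open>The group G acting on a space V over k = k(G), together with a space W
  in Hermitian duality with V.\<close>

definition realization ::
    "(complex^'n^'n) set \<Rightarrow> (complex^'n) set \<Rightarrow> (complex^'n) set \<Rightarrow> (complex^'n \<Rightarrow> complex^'n \<Rightarrow> complex) \<Rightarrow> bool"
  where
  "realization G V W p \<longleftrightarrow>
     k_form (field_of_definition G) V \<and> (\<forall>g\<in>G. \<forall>x\<in>V. g *v x \<in> V) \<and>
     k_form (field_of_definition G) W \<and> hermitian_pairing (field_of_definition G) V W p"

definition contragredient ::
    "(complex^'n \<Rightarrow> complex^'n \<Rightarrow> complex) \<Rightarrow> complex^'n^'n \<Rightarrow> complex^'n^'n" where
  "contragredient p g = (THE h. \<forall>x z. p (g *v x) (h *v z) = p x z)"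

section \<open>Root systems\<close>

type_synonym 'n zk_root = "(complex^'n) set \<times> (complex^'n) set \<times> complex"

definition fg_rank_one :: "complex set \<Rightarrow> (complex^'n) set \<Rightarrow> (complex^'n) set \<Rightarrow> bool" where
  "fg_rank_one k V I \<longleftrightarrow>
     (\<exists>F. finite F \<and> F \<subseteq> V \<and> I = span_over (ring_of_integers k) (*s) F) \<and>
     (\<exists>v. v \<noteq> 0 \<and> span_over k (*s) I = span_over k (*s) {v})"

definition pairing_ideal ::
    "complex set \<Rightarrow> (complex^'n \<Rightarrow> complex^'n \<Rightarrow> complex) \<Rightarrow> (complex^'n) set \<Rightarrow> (complex^'n) set \<Rightarrow> complex set"
  where
  "pairing_ideal k p I J = span_over (ring_of_integers k) (*) {p x z | x z. x \<in> I \<and> z \<in> J}"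

fun is_root ::
    "complex set \<Rightarrow> (complex^'n) set \<Rightarrow> (complex^'n) set \<Rightarrow> (complex^'n \<Rightarrow> complex^'n \<Rightarrow> complex) \<Rightarrow>
      'n zk_root \<Rightarrow> bool" where
  "is_root k V W p (I, J, \<zeta>) \<longleftrightarrow>
     fg_rank_one k V I \<and> fg_rank_one k W J \<and>
     \<zeta> \<in> k \<and> \<zeta> \<noteq> 1 \<and> (\<exists>m>0. \<zeta> ^ m = 1) \<and>
     pairing_ideal k p I J = (\<lambda>x. (1 - \<zeta>) * x) ` ring_of_integers k"

text \<open>For a root, the matrix below does not depend on the choice of v and w.\<close>

fun root_reflection ::
    "complex set \<Rightarrow> (complex^'n \<Rightarrow> complex^'n \<Rightarrow> complex) \<Rightarrow> 'n zk_root \<Rightarrow> complex^'n^'n" where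
  "root_reflection k p (I, J, \<zeta>) =
     (THE s. \<exists>v\<in>span_over k (*s) I. \<exists>w\<in>span_over k (*s) J.
        p v w = 1 - \<zeta> \<and> (\<forall>x. s *v x = x - p x w *s v))"

fun group_act ::
    "(complex^'n \<Rightarrow> complex^'n \<Rightarrow> complex) \<Rightarrow> complex^'n^'n \<Rightarrow> 'n zk_root \<Rightarrow> 'n zk_root" where
  "group_act p g (I, J, \<zeta>) = ((\<lambda>x. g *v x) ` I, (\<lambda>z. contragredient p g *v z) ` J, \<zeta>)"

fun ideal_act :: "complex set \<Rightarrow> complex set \<Rightarrow> 'n::finite zk_root \<Rightarrow> 'n zk_root" where
  "ideal_act k a (I, J, \<zeta>) = (ideal_times k a I, ideal_times k (cnj ` ideal_inverse k a) J, \<zeta>)"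

definition root_system ::
    "(complex^'n^'n) set \<Rightarrow> (complex^'n) set \<Rightarrow> (complex^'n) set \<Rightarrow>
      (complex^'n \<Rightarrow> complex^'n \<Rightarrow> complex) \<Rightarrow> 'n zk_root set \<Rightarrow> bool" where
  "root_system G V W p \<RR> \<longleftrightarrow> (let k = field_of_definition G in
     finite \<RR> \<and> (\<forall>r\<in>\<RR>. is_root k V W p r) \<and>
     span_over k (*s) (\<Union>r\<in>\<RR>. fst r) = V \<and>
     (\<forall>r\<in>\<RR>. group_act p (root_reflection k p r) ` \<RR> = \<RR>) \<and>
     (\<forall>r1\<in>\<RR>. \<forall>r2\<in>\<RR>. pairing_ideal k p (fst r1) (fst (snd r2)) \<subseteq> ring_of_integers k) \<and>
     generated_group (root_reflection k p ` \<RR>) = G)"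

text \<open>The condition, for a reflection s, of being distinguished in G.\<close>

definition distinguished_in ::
    "(complex^'n^'n) set \<Rightarrow> (complex^'n) set \<Rightarrow> complex^'n^'n \<Rightarrow> bool" where
  "distinguished_in G V s \<longleftrightarrow>
     det s = zeta (card {g \<in> G. \<forall>x\<in>V. s *v x = x \<longrightarrow> g *v x = x})"

definition distinguished_root_system ::
    "(complex^'n^'n) set \<Rightarrow> (complex^'n) set \<Rightarrow> (complex^'n) set \<Rightarrow>
      (complex^'n \<Rightarrow> complex^'n \<Rightarrow> complex) \<Rightarrow> 'n zk_root set \<Rightarrow> bool" where
  "distinguished_root_system G V W p \<RR> \<longleftrightarrow>
     root_system G V W p \<RR> \<and>
     inj_on (root_reflection (field_of_definition G) p) \<RR> \<and>
     (\<forall>r\<in>\<RR>. distinguished_in G V (root_reflection (field_of_definition G) p r))"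

definition same_genus :: "complex set \<Rightarrow> 'n::finite zk_root set \<Rightarrow> 'n zk_root set \<Rightarrow> bool" where
  "same_genus k \<RR>1 \<RR>2 \<longleftrightarrow> (\<exists>a. fractional_ideal k a \<and> \<RR>2 = ideal_act k a ` \<RR>1)"

definition unique_genus ::
    "(complex^'n^'n) set \<Rightarrow> (complex^'n) set \<Rightarrow> (complex^'n) set \<Rightarrow>
      (complex^'n \<Rightarrow> complex^'n \<Rightarrow> complex) \<Rightarrow> bool" where
  "unique_genus G V W p \<longleftrightarrow>
     (\<exists>\<RR>. distinguished_root_system G V W p \<RR>) \<and>
     (\<forall>\<RR>1 \<RR>2. distinguished_root_system G V W p \<RR>1 \<and> distinguished_root_system G V W p \<RR>2 \<longrightarrow>
        same_genus (field_of_definition G) \<RR>1 \<RR>2)"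

section \<open>Cartan matrices\<close>

text \<open>A matrix is the list of its rows; the entry in row s and column t is the pairing of
  the vector of s with the covector of t.\<close>

definition is_cartan_matrix ::
    "complex set \<Rightarrow> (complex^'n) set \<Rightarrow> (complex^'n) set \<Rightarrow> (complex^'n \<Rightarrow> complex^'n \<Rightarrow> complex) \<Rightarrow>
      (complex^'n^'n) list \<Rightarrow> complex list list \<Rightarrow> bool" where
  "is_cartan_matrix k V W p ss C \<longleftrightarrow>
     length C = length ss \<and> (\<forall>row\<in>set C. length row = length ss) \<and>
     (\<exists>\<alpha> \<beta> \<zeta>. \<forall>i<length ss.
        (let r = (span_over (ring_of_integers k) (*s) {\<alpha> i},
                  span_over (ring_of_integers k) (*s) {\<beta> i}, \<zeta> i)
         in is_root k V W p r \<and> root_reflection k p r = ss ! i) \<and>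
        p (\<alpha> i) (\<beta> i) = 1 - \<zeta> i \<and>
        (\<forall>j<length ss. C ! i ! j = p (\<alpha> i) (\<beta> j)))"

text \<open>Entry (i, j) of the conjugate of C by the diagonal matrix with diagonal d.\<close>

definition diag_conj :: "(nat \<Rightarrow> complex) \<Rightarrow> complex list list \<Rightarrow> nat \<Rightarrow> nat \<Rightarrow> complex" where
  "diag_conj d C i j = d i * C ! i ! j * inverse (d j)"

section \<open>The groups and their standard generators\<close>

datatype st_type = G9 | G10 | G11 | G14 | G17 | G18 | G19 | G21

text \<open>Generators of the octahedral and icosahedral collineation groups, as given by Shephard and
  Todd (Finite unitary reflection groups, 1954).  They define each of the groups below by two
  scalar multiples of these matrices.\<close>

definition oct_S :: "complex^2^2" where
  "oct_S = mat (1 / csqrt 2) ** vector [vector [\<i>, 1], vector [-1, -\<i>]]"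

definition oct_T :: "complex^2^2" where
  "oct_T = mat (1 / csqrt 2) ** vector [vector [zeta 8, zeta 8], vector [zeta 8 ^ 3, zeta 8 ^ 7]]"

definition ico_S :: "complex^2^2" where
  "ico_S = mat (1 / csqrt 5) **
     vector [vector [zeta 5 ^ 4 - zeta 5, zeta 5 ^ 2 - zeta 5 ^ 3],
             vector [zeta 5 ^ 2 - zeta 5 ^ 3, zeta 5 - zeta 5 ^ 4]]"

definition ico_T :: "complex^2^2" where
  "ico_T = mat (1 / csqrt 5) **
     vector [vector [zeta 5 ^ 2 - zeta 5 ^ 4, zeta 5 ^ 4 - 1],
             vector [1 - zeta 5, zeta 5 ^ 3 - zeta 5]]"

fun st_group :: "st_type \<Rightarrow> (complex^2^2) set" where
  "st_group G9 = generated_group {mat \<i> ** oct_S, mat (zeta 8) ** oct_T}"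
| "st_group G10 = generated_group {mat (zeta 8 ^ 7 * zeta 3 ^ 2) ** oct_S, mat (- zeta 3) ** oct_T}"
| "st_group G11 = generated_group {mat \<i> ** oct_S, mat (zeta 8 * zeta 3) ** oct_T}"
| "st_group G14 = generated_group {mat \<i> ** oct_S, mat (- zeta 3) ** oct_T}"
| "st_group G17 = generated_group {mat \<i> ** ico_S, mat (\<i> * zeta 5 ^ 3) ** ico_T}"
| "st_group G18 = generated_group {mat (- (zeta 3 * zeta 5 ^ 3)) ** ico_S, mat (zeta 3 ^ 2) ** ico_T}"
| "st_group G19 = generated_group {mat \<i> ** ico_S, mat (\<i> * zeta 3 * zeta 5 ^ 3) ** ico_T}"
| "st_group G21 = generated_group {mat \<i> ** ico_S, mat (zeta 3 ^ 2) ** ico_T}"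

text \<open>Orders of the standard generators s, t (and u when there are three), numbered 0, 1, 2, and
  the braid relations they satisfy, following the diagrams of Broue, Malle and Rouquier.\<close>

fun st_orders :: "st_type \<Rightarrow> nat list" where
  "st_orders G9 = [2, 4]"
| "st_orders G10 = [3, 4]"
| "st_orders G11 = [2, 3, 4]"
| "st_orders G14 = [2, 3]"
| "st_orders G17 = [2, 5]"
| "st_orders G18 = [3, 5]"
| "st_orders G19 = [2, 3, 5]"
| "st_orders G21 = [2, 3]"

fun st_braid_relations :: "st_type \<Rightarrow> (nat list \<times> nat list) list" where
  "st_braid_relations G9 = [([0,1,0,1,0,1], [1,0,1,0,1,0])]"
| "st_braid_relations G10 = [([0,1,0,1], [1,0,1,0])]"
| "st_braid_relations G11 = [([0,1,2], [1,2,0]), ([1,2,0], [2,0,1])]"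
| "st_braid_relations G14 = [([0,1,0,1,0,1,0,1], [1,0,1,0,1,0,1,0])]"
| "st_braid_relations G17 = [([0,1,0,1,0,1], [1,0,1,0,1,0])]"
| "st_braid_relations G18 = [([0,1,0,1], [1,0,1,0])]"
| "st_braid_relations G19 = [([0,1,2], [1,2,0]), ([1,2,0], [2,0,1])]"
| "st_braid_relations G21 = [([0,1,0,1,0,1,0,1,0,1], [1,0,1,0,1,0,1,0,1,0])]"

definition word_product :: "(complex^'n^'n) list \<Rightarrow> nat list \<Rightarrow> complex^'n^'n" where
  "word_product ss w = foldr (\<lambda>i A. ss ! i ** A) w (mat 1)"

definition is_reflection :: "complex^'n^'n \<Rightarrow> bool" where
  "is_reflection s \<longleftrightarrow> invertible s \<and> vec.dim (range (\<lambda>x. s *v x - x)) = 1"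

definition standard_generators :: "st_type \<Rightarrow> (complex^2) set \<Rightarrow> (complex^2^2) list \<Rightarrow> bool" where
  "standard_generators T V ss \<longleftrightarrow>
     length ss = length (st_orders T) \<and>
     (\<forall>i<length ss. is_reflection (ss ! i) \<and> distinguished_in (st_group T) V (ss ! i) \<and>
        det (ss ! i) = zeta (st_orders T ! i)) \<and>
     generated_group (set ss) = st_group T \<and>
     (\<forall>(w1, w2)\<in>set (st_braid_relations T). word_product ss w1 = word_product ss w2)"

fun st_cartan :: "st_type \<Rightarrow> complex list list" where
  "st_cartan G9 =
    [[2, - ((2 + csqrt 2) / (\<i> + 1))],
     [-1, 1 - \<i>]]"
| "st_cartan G10 =
    [[1 - zeta 3, 1],
     [- \<i> - zeta 3, 1 - \<i>]]"
| "st_cartan G11 =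
    [[2, zeta 3 ^ 2 * (csqrt (-3) - csqrt (-2)), 1 - zeta 24],
     [1, 1 - zeta 3, zeta 24 ^ 13],
     [1 + zeta 24 ^ 5, zeta 24 ^ 7 + zeta 24 ^ 5, 1 - \<i>]]"
| "st_cartan G14 =
    [[2, -1],
     [- (zeta 3 ^ 2) * (csqrt (-3) + csqrt (-2)), 1 - zeta 3]]"
| "st_cartan G17 =
    [[2, 1],
     [1 - zeta 5 - zeta 20 ^ 7, 1 - zeta 5]]"
| "st_cartan G18 =
    [[1 - zeta 3, - (zeta 15 ^ 4)],
     [inverse (zeta 15) + zeta 15, 1 - zeta 5]]"
| "st_cartan G19 =
    [[2, 1 - zeta 3 * inverse (zeta 60), -1],
     [1 + zeta 60, 1 - zeta 3, - zeta 60],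
     [zeta 5 - 1 + zeta 20 ^ 7, zeta 60 ^ 19 + zeta 60 ^ 11, 1 - zeta 5]]"
| "st_cartan G21 =
    [[2, 1],
     [1 - zeta 3 + golden * inverse (zeta 12), 1 - zeta 3]]"

end

theory Submission
  imports Defs
begin

text \<open>Each of the groups is generated by two or all three of reflections \<open>A 0\<close>, \<open>A 1\<close>, \<open>A 2\<close> of orders
  2, 3 and c = 4 or 5 whose product is a scalar z, in a fixed octahedral or icosahedral family.  Counting
  the lines fixed by the elements of the whole family (Burnside) shows that every distinguished reflection
  of the group is conjugate to one of the generators: a reflection that is not would contribute too many
  fixed lines.  Hence a distinguished root system is determined by the ideals of the roots
  of the generators.  As the off-diagonal entries of the Cartan matrix are units, integrality of the
  pairings forces all these ideals to be the same up to one common fractional ideal, which is the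
  uniqueness of the genus; the same units give the statement on diagonal conjugates.  The Cartan matrix
  itself is determined by traces: products of its entries over cycles are traces of products of the
  \<open>1 - A i\<close>, which depend on z only.\<close>

section \<open>Algebraic integers\<close>

text \<open>Neither the finiteness nor the order of the groups is given, and their elements are
  never listed. Both are controlled by an invariant binary form (degree 6 or 12) whose zeros are the
  m vertices of the octahedron or icosahedron: the vertices bound the orbit of the axis of
  \<open>A 2\<close>, and the moduli of their coordinates control the stabilizers of the axes of
  orders 2 and c. The stabilizer of the axis of order 3 is bounded by the Burnside count itself,
  which is sharp because 1/2 + 1/3 + 1/c exceeds 1 by exactly 2 / (m c). A fourth class of fixed
  lines would violate the same count. Lines see the groups only modulo scalars, where two generators
  already give everything. The linear characters \<open>\<psi> i\<close> therefore have to show that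
  a subgroup contains no conjugate of a nontrivial power of a generator that it omits. On the
  arithmetic side an ideal and its inverse are carried together, so that ideals are compared by
  multiplying inclusions. Traces fix the Cartan matrix only up to diagonal conjugation over k;
  rescaling the roots absorbs this.\<close>

lemma ascending_int_subgroups:
  fixes J :: "nat \<Rightarrow> int set"
  assumes sub: "\<And>k. 0 \<in> J k" "\<And>k x y. x \<in> J k \<Longrightarrow> y \<in> J k \<Longrightarrow> x - y \<in> J k"
    and mono: "\<And>k l. k \<le> l \<Longrightarrow> J k \<subseteq> J l"
  shows "\<exists>K. \<forall>k\<ge>K. J k = J K"
proof (cases "\<forall>k. J k = {0}")
  case False
  have neg: "- x \<in> J k" if "x \<in> J k" for x k using sub(2)[OF sub(1) that] by simp
  have add: "x + y \<in> J k" if "x \<in> J k" "y \<in> J k" for x y k using sub(2)[OF that(1) neg[OF that(2)]] by simp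
  have mult: "int n * x \<in> J k" if "x \<in> J k" for x n k
    using that by (induction n) (auto simp: distrib_right sub(1) intro: add)
  have mult': "m * x \<in> J k" if "x \<in> J k" for x m k
    using mult[OF that, of "nat m"] mult[OF neg[OF that], of "nat (- m)"] by (cases "m \<ge> 0") auto
  \<comment> \<open>The positive numbers that occur somewhere in the chain. The least of them lies
    in some \<open>J K\<close>, and from \<open>K\<close> on every group consists of its
    multiples.\<close>
  define P where "P n \<longleftrightarrow> n > 0 \<and> (\<exists>k. int n \<in> J k)" for n
  obtain k x where x: "x \<in> J k" "x \<noteq> 0" using False sub(1) by blast
  then have "P (nat \<bar>x\<bar>)" unfolding P_def using neg[OF x(1)] by (auto simp: abs_if intro!: exI[of _ k])
  then have "P (Least P)" by (rule LeastI)
  then obtain d K where d: "d = int (Least P)" "d > 0" "d \<in> J K" by (auto simp: P_def)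
  have "J k = J K" if k: "k \<ge> K" for k
  proof
    show "J K \<subseteq> J k" by (rule mono[OF k])
    show "J k \<subseteq> J K"
    proof
      fix y assume y: "y \<in> J k"
      have "y - (y div d) * d \<in> J k" using sub(2)[OF y mult'] d(3) mono[OF k] by blast
      then have "y mod d \<in> J k" by (simp add: minus_div_mult_eq_mod)
      moreover have "\<not> P (nat (y mod d))"
      proof
        assume "P (nat (y mod d))"
        then have "Least P \<le> nat (y mod d)" by (rule Least_le)
        then show False using pos_mod_bound[OF d(2), of y] pos_mod_sign[OF d(2), of y] d(1) by linarith
      qed
      ultimately have "y mod d = 0" unfolding P_def using pos_mod_sign[OF d(2), of y] by force
      then have "y = (y div d) * d" by (metis div_mult_mod_eq add_0_right)
      then show "y \<in> J K" using mult'[OF d(3)] by metis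
    qed
  qed
  then show ?thesis by blast
qed auto

text \<open>Induction on the generators: the chain is controlled by the coefficients of one
  generator \<open>a\<close> together with its intersection with the lattice of the others.\<close>

lemma ascending_subgroups:
  fixes v :: "'s \<Rightarrow> complex"
  assumes "finite S" and sub: "\<And>k. 0 \<in> N k" "\<And>k x y. x \<in> N k \<Longrightarrow> y \<in> N k \<Longrightarrow> x - y \<in> N k"
    and mono: "\<And>k l. k \<le> l \<Longrightarrow> N k \<subseteq> N l"
    and "\<And>k. N k \<subseteq> {\<Sum>s\<in>S. of_int (n s) * v s | n. True}"
  shows "\<exists>K. \<forall>k\<ge>K. N k = N (K::nat)"
  using assms
proof (induction S arbitrary: N rule: finite_induct)
  case empty
  have "N k = {0}" for k using empty.prems(1,4)[of k] by fastforce
  then show ?case by simp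
next
  case (insert a S)
  note sub = insert.prems(1,2) and mono = insert.prems(3)
  define L where "L = {\<Sum>s\<in>S. of_int (n s) * v s | n. True}"
  have L0: "0 \<in> L" unfolding L_def by (intro CollectI exI[of _ "\<lambda>_. 0"]) simp
  have Ld: "x - y \<in> L" if "x \<in> L" "y \<in> L" for x y
  proof -
    obtain m n where "x = (\<Sum>s\<in>S. of_int (m s) * v s)" "y = (\<Sum>s\<in>S. of_int (n s) * v s)"
      using \<open>x \<in> L\<close> \<open>y \<in> L\<close> unfolding L_def by blast
    then have "x - y = (\<Sum>s\<in>S. of_int (m s - n s) * v s)" by (simp add: sum_subtractf left_diff_distrib)
    then show ?thesis unfolding L_def by (intro CollectI exI[of _ "\<lambda>s. m s - n s"]) simp
  qed
  have split: "\<exists>m. \<exists>l\<in>L. x = of_int m * v a + l" if x: "x \<in> N k" for x k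
  proof -
    obtain n where "x = (\<Sum>s\<in>insert a S. of_int (n s) * v s)" using insert.prems(4)[of k] x by blast
    then have "x = of_int (n a) * v a + (\<Sum>s\<in>S. of_int (n s) * v s)" using insert.hyps by simp
    then show ?thesis unfolding L_def by blast
  qed
  \<comment> \<open>The numbers \<open>v s\<close> may be linearly dependent, so a coefficient of
    \<open>v a\<close> is not a function of the element; all coefficients that occur in some
    representation are collected.\<close>
  define J where "J k = {m. \<exists>l\<in>L. of_int m * v a + l \<in> N k}" for k
  have "\<exists>K. \<forall>k\<ge>K. J k = J K"
  proof (rule ascending_int_subgroups)
    show "0 \<in> J k" for k using L0 sub(1) by (auto simp: J_def intro!: bexI[of _ 0])
    show "J k \<subseteq> J l" if "k \<le> l" for k l using mono[OF that] by (auto simp: J_def)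
    fix k x y assume "x \<in> J k" "y \<in> J k"
    then obtain l l' where l: "l \<in> L" "l' \<in> L" "of_int x * v a + l \<in> N k" "of_int y * v a + l' \<in> N k" by (auto simp: J_def)
    have "of_int (x - y) * v a + (l - l') = (of_int x * v a + l) - (of_int y * v a + l')" by (simp add: algebra_simps)
    then show "x - y \<in> J k" unfolding J_def using sub(2)[OF l(3,4)] Ld[OF l(1,2)] by (metis (mono_tags, lifting) mem_Collect_eq)
  qed
  then obtain K where K: "\<And>k. k \<ge> K \<Longrightarrow> J k = J K" by blast
  have "\<exists>K. \<forall>k\<ge>K. N k \<inter> L = N K \<inter> L"
  proof (rule insert.IH)
    show "0 \<in> N k \<inter> L" for k using sub(1) L0 by blast
    show "x - y \<in> N k \<inter> L" if "x \<in> N k \<inter> L" "y \<in> N k \<inter> L" for k x y using that sub(2) Ld by blast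
    show "N k \<inter> L \<subseteq> N l \<inter> L" if "k \<le> l" for k l using mono[OF that] by blast
    show "N k \<inter> L \<subseteq> {\<Sum>s\<in>S. of_int (n s) * v s | n. True}" for k unfolding L_def by blast
  qed
  then obtain K' where K': "\<And>k. k \<ge> K' \<Longrightarrow> N k \<inter> L = N K' \<inter> L" by blast
  define M where "M = max K K'"
  have "N k = N M" if k: "k \<ge> M" for k
  proof
    show "N M \<subseteq> N k" by (rule mono[OF k])
    show "N k \<subseteq> N M"
    proof
      fix x assume x: "x \<in> N k"
      obtain m l where l: "l \<in> L" "x = of_int m * v a + l" using split[OF x] by blast
      have "J k = J M" "N k \<inter> L = N M \<inter> L" using K[of k] K[of M] K'[of k] K'[of M] k by (auto simp: M_def)
      moreover have "m \<in> J k" using x l by (auto simp: J_def)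
      ultimately obtain l' where l': "l' \<in> L" "of_int m * v a + l' \<in> N M" by (auto simp: J_def)
      have "x - (of_int m * v a + l') \<in> N k" using sub(2)[OF x] l'(2) mono[OF k] by blast
      then have "l - l' \<in> N k \<inter> L" using Ld[OF l(1) l'(1)] by (simp add: l(2))
      then have "l - l' \<in> N M" using \<open>N k \<inter> L = N M \<inter> L\<close> by blast
      then have "(l - l') - (0 - (of_int m * v a + l')) \<in> N M" using sub(2)[OF _ sub(2)[OF sub(1) l'(2)]] by blast
      then show "x \<in> N M" by (simp add: l(2) add.commute)
    qed
  qed
  then show ?case by blast
qed

text \<open>The groups generated by the first few of the numbers \<open>u\<close>, \<open>x * u\<close>, \<open>x\<^sup>2 * u\<close>, ... form an
  ascending chain in the lattice; where it becomes stationary an integral equation for x appears.\<close>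

lemma algebraic_int_if_stable_lattice:
  fixes x :: complex and M :: "'s \<Rightarrow> 's \<Rightarrow> int"
  assumes S: "finite S" and ne: "\<exists>s\<in>S. v s \<noteq> 0"
    and M: "\<And>s. s \<in> S \<Longrightarrow> x * v s = (\<Sum>t\<in>S. of_int (M s t) * v t)"
  shows "algebraic_int x"
proof -
  obtain s where s: "s \<in> S" "v s \<noteq> 0" using ne by blast
  define L where "L = {\<Sum>s\<in>S. of_int (n s) * v s | n. True}"
  define N where "N k = {(\<Sum>i<k. of_int (n i) * x ^ i) * v s | n. True}" for k :: nat
  have pow: "\<exists>n. x ^ i * v s = (\<Sum>t\<in>S. of_int (n t) * v t)" for i
  proof (induction i)
    case 0
    have "v s = (\<Sum>t\<in>S. if t = s then v t else 0)" using S s(1) by simp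
    also have "\<dots> = (\<Sum>t\<in>S. of_int (if t = s then 1 else 0) * v t)" by (intro sum.cong) auto
    finally show ?case by (intro exI[of _ "\<lambda>t. if t = s then 1 else 0"]) simp
  next
    case (Suc i)
    then obtain n where n: "x ^ i * v s = (\<Sum>t\<in>S. of_int (n t) * v t)" by blast
    have "x ^ Suc i * v s = (\<Sum>t\<in>S. of_int (n t) * (x * v t))"
      using arg_cong[OF n, of "\<lambda>y. x * y"] by (simp add: sum_distrib_left mult_ac)
    also have "\<dots> = (\<Sum>t\<in>S. \<Sum>t'\<in>S. of_int (n t) * (of_int (M t t') * v t'))"
      by (intro sum.cong refl) (simp add: M sum_distrib_left)
    also have "\<dots> = (\<Sum>t'\<in>S. \<Sum>t\<in>S. of_int (n t) * (of_int (M t t') * v t'))" by (rule sum.swap)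
    also have "\<dots> = (\<Sum>t'\<in>S. of_int (\<Sum>t\<in>S. n t * M t t') * v t')" by (simp add: sum_distrib_right mult.assoc)
    finally show ?case by (intro exI)
  qed
  then obtain c where c: "\<And>i. x ^ i * v s = (\<Sum>t\<in>S. of_int (c i t) * v t)" by metis
  have "\<exists>K. \<forall>k\<ge>K. N k = N K"
  proof (rule ascending_subgroups[OF S])
    show "0 \<in> N k" for k unfolding N_def by (intro CollectI exI[of _ "\<lambda>_. 0"]) simp
    show "y - y' \<in> N k" if y: "y \<in> N k" "y' \<in> N k" for k y y'
    proof -
      obtain n n' where "y = (\<Sum>i<k. of_int (n i) * x ^ i) * v s" "y' = (\<Sum>i<k. of_int (n' i) * x ^ i) * v s"
        using y unfolding N_def by blast
      then have "y - y' = (\<Sum>i<k. of_int (n i - n' i) * x ^ i) * v s" by (simp add: sum_subtractf left_diff_distrib)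
      then show ?thesis unfolding N_def by (intro CollectI exI[of _ "\<lambda>i. n i - n' i"]) simp
    qed
    show "N k \<subseteq> N l" if "k \<le> l" for k l
    proof
      fix y assume "y \<in> N k"
      then obtain n where "y = (\<Sum>i<k. of_int (n i) * x ^ i) * v s" unfolding N_def by blast
      also have "(\<Sum>i<k. of_int (n i) * x ^ i) = (\<Sum>i<l. of_int (if i < k then n i else 0) * x ^ i)"
        using that by (intro sum.mono_neutral_cong_left) auto
      finally show "y \<in> N l" unfolding N_def by (intro CollectI exI[of _ "\<lambda>i. if i < k then n i else 0"]) simp
    qed
    show "N k \<subseteq> {\<Sum>s\<in>S. of_int (n s) * v s | n. True}" for k
    proof
      fix y assume "y \<in> N k"
      then obtain n where "y = (\<Sum>i<k. of_int (n i) * x ^ i) * v s" unfolding N_def by blast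
      then have "y = (\<Sum>i<k. of_int (n i) * (\<Sum>t\<in>S. of_int (c i t) * v t))"
        by (simp add: sum_distrib_right mult.assoc c)
      also have "\<dots> = (\<Sum>i<k. \<Sum>t\<in>S. of_int (n i) * (of_int (c i t) * v t))" by (simp only: sum_distrib_left)
      also have "\<dots> = (\<Sum>t\<in>S. \<Sum>i<k. of_int (n i) * (of_int (c i t) * v t))" by (rule sum.swap)
      also have "\<dots> = (\<Sum>t\<in>S. of_int (\<Sum>i<k. n i * c i t) * v t)" by (simp add: sum_distrib_right mult.assoc)
      finally show "y \<in> {\<Sum>s\<in>S. of_int (n s) * v s | n. True}"
        by (intro CollectI exI[of _ "\<lambda>t. \<Sum>i<k. n i * c i t"]) simp
    qed
  qed
  then obtain K where K: "N (Suc K) = N K" by (metis le_add1 plus_1_eq_Suc add.commute)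
  have "(\<Sum>i<K. of_int (if i = K then 1 else 0) * x ^ i) = 0" by (intro sum.neutral) simp
  then have e: "(\<Sum>i<Suc K. of_int (if i = K then 1 else 0) * x ^ i) = x ^ K" by simp
  \<comment> \<open>The new generator of \<open>N (Suc K) = N K\<close>. Dividing by
    \<open>v s \<noteq> 0\<close> expresses \<open>x ^ K\<close> by lower powers, a monic
    equation.\<close>
  have "x ^ K * v s \<in> N K"
    unfolding K[symmetric] unfolding N_def by (intro CollectI exI[of _ "\<lambda>i. if i = K then 1 else 0"]) (simp only: e simp_thms)
  then obtain n where n: "x ^ K * v s = (\<Sum>i<K. of_int (n i) * x ^ i) * v s" unfolding N_def by blast
  then have n: "x ^ K = (\<Sum>i<K. of_int (n i) * x ^ i)" using s(2) by simp
  define q :: "complex poly" where "q = (\<Sum>i<K. monom (of_int (n i)) i)"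
  have cq: "coeff q i = (if i < K then of_int (n i) else 0)" for i
    by (simp add: q_def coeff_sum)
  have cp: "coeff (monom 1 K - q) i = (if i < K then - of_int (n i) else if i = K then 1 else 0)" for i
    by (simp add: cq)
  have "degree (monom 1 K - q) = K"
    by (rule antisym[OF degree_le le_degree]) (simp_all only: cp, simp_all)
  then have "lead_coeff (monom 1 K - q) = 1" by (simp only: cp) simp
  moreover have "poly (monom 1 K - q) x = 0" using n by (simp add: q_def poly_monom poly_sum)
  moreover have "coeff (monom 1 K - q) i \<in> \<int>" for i unfolding cp by simp
  ultimately show ?thesis unfolding algebraic_int.simps by blast
qed

lemma algebraic_int_power_basis:
  assumes "algebraic_int (x :: complex)"
  obtains n M where "n > 0"
    "\<And>i. i < n \<Longrightarrow> x * x ^ i = (\<Sum>j<n. of_int (M i j) * x ^ j)"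
proof -
  obtain p where p: "poly (map_poly of_int p) x = 0" "lead_coeff p = 1"
    using assms by (auto simp: algebraic_int_altdef_ipoly)
  define n where "n = degree p"
  \<comment> \<open>The companion matrix: a shift, except in the last row, which rewrites
    \<open>x ^ n\<close> by the polynomial.\<close>
  define M where "M i j = (if Suc i < n then (if j = Suc i then 1 else 0) else - coeff p j)" for i j
  have "poly (map_poly of_int p) x = (\<Sum>j\<le>n. of_int (coeff p j) * x ^ j)"
    by (simp add: poly_altdef n_def degree_map_poly coeff_map_poly)
  then have e: "x ^ n = - (\<Sum>j<n. of_int (coeff p j) * x ^ j)"
    using p by (simp add: lessThan_Suc_atMost[symmetric] n_def add_eq_0_iff)
  have n: "n > 0"
  proof (rule ccontr)
    assume "\<not> n > 0"
    then have "p = 1" using p(2) by (auto simp: n_def elim!: degree_eq_zeroE)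
    then show False using p(1) by simp
  qed
  have "x * x ^ i = (\<Sum>j<n. of_int (M i j) * x ^ j)" if i: "i < n" for i
  proof (cases "Suc i < n")
    case True
    then have "(\<Sum>j<n. of_int (M i j) * x ^ j) = (\<Sum>j<n. if j = Suc i then x ^ j else 0)"
      by (intro sum.cong) (auto simp: M_def)
    then show ?thesis using True by simp
  next
    case False
    then have "Suc i = n" using i by simp
    then show ?thesis using e by (auto simp: M_def sum_negf)
  qed
  then show ?thesis using that[OF n] by blast
qed

text \<open>The products of powers of x and y span a lattice stable under both operations.
  \<open>?P\<close> and \<open>?D\<close> are the Kronecker product and the Kronecker sum of the
  matrices \<open>A\<close> and \<open>B\<close> by which x and y act on their power bases.\<close>

lemma algebraic_int_add_mult:
  assumes "algebraic_int (x :: complex)" "algebraic_int y"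
  shows "algebraic_int (x + y)" "algebraic_int (x * y)"
proof -
  obtain n A where n: "n > 0"
    and A: "\<And>i. i < n \<Longrightarrow> x * x ^ i = (\<Sum>j<n. of_int (A i j) * x ^ j)"
    using algebraic_int_power_basis[OF assms(1)] by metis
  obtain m B where m: "m > 0"
    and B: "\<And>i. i < m \<Longrightarrow> y * y ^ i = (\<Sum>j<m. of_int (B i j) * y ^ j)"
    using algebraic_int_power_basis[OF assms(2)] by metis
  define S where "S = {..<n} \<times> {..<m}"
  define v where "v = (\<lambda>(i,k). x ^ i * y ^ k)"
  have S: "finite S" by (simp add: S_def)
  have ne: "\<exists>s\<in>S. v s \<noteq> 0"
    using n m by (intro bexI[of _ "(0,0)"]) (auto simp: S_def v_def)
  let ?P = "\<lambda>s t. A (fst s) (fst t) * B (snd s) (snd t)"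
  let ?D = "\<lambda>s t. (if snd t = snd s then A (fst s) (fst t) else 0) +
      (if fst t = fst s then B (snd s) (snd t) else 0)"
  have "x * y * v s = (\<Sum>t\<in>S. of_int (?P s t) * v t)" if sS: "s \<in> S" for s
  proof -
    obtain i k where s: "s = (i,k)" "i < n" "k < m" using sS by (auto simp: S_def)
    have "x * y * v s = (x * x ^ i) * (y * y ^ k)" by (simp add: s v_def)
    also have "\<dots> = (\<Sum>j<n. \<Sum>l<m. (of_int (A i j) * x ^ j) * (of_int (B k l) * y ^ l))"
      unfolding A[OF s(2)] B[OF s(3)] sum_product ..
    also have "\<dots> = (\<Sum>t\<in>S. of_int (?P s t) * v t)"
      by (simp add: S_def s(1) v_def sum.cartesian_product split_def mult_ac)
    finally show ?thesis .
  qed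
  from algebraic_int_if_stable_lattice[OF S ne this] show "algebraic_int (x * y)" .
  have "(x + y) * v s = (\<Sum>t\<in>S. of_int (?D s t) * v t)" if sS: "s \<in> S" for s
  proof -
    obtain i k where s: "s = (i,k)" "i < n" "k < m" using sS by (auto simp: S_def)
    have "(\<Sum>t\<in>S. of_int (?D s t) * v t) =
      (\<Sum>t\<in>S. (if snd t = k then of_int (A i (fst t)) * v t else 0)) +
      (\<Sum>t\<in>S. (if fst t = i then of_int (B k (snd t)) * v t else 0))"
      unfolding sum.distrib[symmetric] by (intro sum.cong) (auto simp: s algebra_simps)
    also have "(\<Sum>t\<in>S. (if snd t = k then of_int (A i (fst t)) * v t else 0)) =
      (\<Sum>j<n. \<Sum>l<m. if l = k then of_int (A i j) * (x ^ j * y ^ l) else 0)"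
      unfolding S_def sum.cartesian_product by (intro sum.cong) (auto simp: v_def)
    also have "\<dots> = (\<Sum>j<n. of_int (A i j) * x ^ j) * y ^ k"
      using s by (subst sum_distrib_right) (simp add: mult_ac)
    also have "\<dots> = x * v s" by (simp add: A[OF s(2), symmetric] s v_def)
    also have "(\<Sum>t\<in>S. (if fst t = i then of_int (B k (snd t)) * v t else 0)) =
      (\<Sum>j<n. \<Sum>l<m. if j = i then of_int (B k l) * (x ^ j * y ^ l) else 0)"
      unfolding S_def sum.cartesian_product by (intro sum.cong) (auto simp: v_def)
    also have "\<dots> = (\<Sum>l<m. \<Sum>j<n. if j = i then of_int (B k l) * (x ^ j * y ^ l) else 0)"
      by (rule sum.swap)
    also have "\<dots> = x ^ i * (\<Sum>l<m. of_int (B k l) * y ^ l)"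
      using s by (subst sum_distrib_left) (simp add: mult_ac)
    also have "\<dots> = y * v s" by (simp add: B[OF s(3), symmetric] s v_def)
    finally show ?thesis by (simp add: algebra_simps)
  qed
  from algebraic_int_if_stable_lattice[OF S ne this] show "algebraic_int (x + y)" .
qed

lemma algebraic_int_diff:
  "algebraic_int (x :: complex) \<Longrightarrow> algebraic_int y \<Longrightarrow> algebraic_int (x - y)"
  using algebraic_int_add_mult(1)[of x "- y"] by simp

lemma algebraic_int_pow:
  "algebraic_int (x :: complex) \<Longrightarrow> algebraic_int (x ^ n)"
  by (induction n) (auto intro: algebraic_int_add_mult int_imp_algebraic_int)

lemma algebraic_int_root_of_unity:
  assumes "(x :: complex) ^ n = 1" "n > 0"
  shows "algebraic_int x"
proof (rule algebraic_int_root[of 1 "monom 1 n"])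
qed (use assms in \<open>auto simp: poly_monom degree_monom_eq coeff_monom\<close>)

section \<open>Two by two matrices\<close>

lemma mat2_eq_iff:
  "(A :: 'a^2^2) = B \<longleftrightarrow> A$1$1 = B$1$1 \<and> A$1$2 = B$1$2 \<and> A$2$1 = B$2$1 \<and> A$2$2 = B$2$2"
  by (auto simp: vec_eq_iff forall_2)

lemma vec2_eq_iff: "(x :: 'a^2) = y \<longleftrightarrow> x$1 = y$1 \<and> x$2 = y$2"
  by (auto simp: vec_eq_iff forall_2)

lemma mat2_mult_nth:
  "((A :: 'a::semiring_1^2^2) ** B) $ i $ j = A$i$1 * B$1$j + A$i$2 * B$2$j"
  by (simp add: matrix_matrix_mult_def sum_2)

lemma mat2_vec_nth: "((A :: 'a::semiring_1^2^2) *v x) $ i = A$i$1 * x$1 + A$i$2 * x$2"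
  by (simp add: matrix_vector_mult_def sum_2)

lemma mat2_nth:
  "(mat c :: 'a::zero^2^2) $ 1 $ 1 = c" "(mat c :: 'a^2^2) $ 1 $ 2 = 0"
  "(mat c :: 'a^2^2) $ 2 $ 1 = 0" "(mat c :: 'a^2^2) $ 2 $ 2 = c"
  by (simp_all add: mat_def)

lemma trace2: "trace (A :: 'a::comm_semiring_1^2^2) = A$1$1 + A$2$2"
  by (simp add: trace_def sum_2)

lemmas mat2_simps = mat2_eq_iff vec2_eq_iff mat2_mult_nth mat2_vec_nth mat2_nth trace2 det_2

lemma mat_mult_mat: "(mat a :: complex^2^2) ** mat b = mat (a * b)"
  by (simp add: mat2_simps)

lemma mat_comm: "(A :: complex^2^2) ** mat c = mat c ** A"
  by (simp add: mat2_simps algebra_simps)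

lemma mat_vec: "(mat c :: complex^2^2) *v x = c *s x"
  by (simp add: mat2_simps)

lemma det_mat2: "det (mat c :: complex^2^2) = c * c"
  by (simp add: mat2_simps)

lemma mv_scale: "(A :: complex^2^2) *v (c *s x) = c *s (A *v x)"
  by (simp add: mat2_simps algebra_simps)

lemma mv_add: "(A :: complex^2^2) *v (x + y) = A *v x + A *v y"
  by (simp add: matrix_vector_right_distrib)

lemma cancel_scale: "a *s x = b *s x \<longleftrightarrow> a = b" if "x \<noteq> 0" for x :: "complex^2"
  using that by (auto simp: vec2_eq_iff)

text \<open>Powers with respect to \<open>**\<close>; the operation \<open>^\<close> on this type is
  entrywise.\<close>

primrec mpow :: "complex^2^2 \<Rightarrow> nat \<Rightarrow> complex^2^2" where
  "mpow A 0 = mat 1"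
| "mpow A (Suc n) = A ** mpow A n"

lemma mpow_1 [simp]: "mpow A (Suc 0) = A"
  by simp

lemma mpow_eigen: "A *v x = c *s x \<Longrightarrow> mpow A n *v x = (c ^ n) *s x"
  by (induction n) (simp_all add: mv_scale matrix_vector_mul_assoc[symmetric] vector_smult_assoc mult.commute)

lemma mpow_add: "mpow A (m + n) = mpow A m ** mpow A n"
  by (induction m) (simp_all add: matrix_mul_assoc)

lemma mpow_scaled: "mpow (mat c ** A) n = mat (c ^ n) ** mpow A n"
proof (induction n)
  case (Suc n)
  have "mpow (mat c ** A) (Suc n) = (mat c ** A) ** (mat (c ^ n) ** mpow A n)" by (simp add: Suc)
  also have "\<dots> = mat c ** (A ** mat (c ^ n)) ** mpow A n" by (simp add: matrix_mul_assoc)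
  also have "\<dots> = mat (c ^ Suc n) ** mpow A (Suc n)"
    unfolding mat_comm[of A] by (simp add: matrix_mul_assoc mat_mult_mat)
  finally show ?case .
qed simp

subsection \<open>Matrix groups\<close>

definition mat_group :: "(complex^2^2) set \<Rightarrow> bool" where
  "mat_group H \<longleftrightarrow> mat 1 \<in> H \<and> (\<forall>A\<in>H. \<forall>B\<in>H. A ** B \<in> H) \<and>
     (\<forall>A\<in>H. \<exists>B\<in>H. A ** B = mat 1 \<and> B ** A = mat 1)"

lemma matrix_inv_inverse:
  assumes "invertible (A :: complex^2^2)"
  shows "matrix_inv A ** A = mat 1" "A ** matrix_inv A = mat 1"
  using someI_ex[OF assms[unfolded invertible_def]] by (simp_all add: matrix_inv_def)

lemma matrix_inv_eqI:
  assumes "(A :: complex^2^2) ** B = mat 1"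
  shows "matrix_inv A = B" "invertible A" "B ** A = mat 1"
proof -
  show "B ** A = mat 1" using assms by (simp add: matrix_left_right_inverse)
  then show "invertible A" using assms by (auto simp: invertible_def)
  then have "matrix_inv A ** A = mat 1" by (rule matrix_inv_inverse)
  then have "matrix_inv A = matrix_inv A ** (A ** B)" using assms by simp
  also have "\<dots> = B" using \<open>matrix_inv A ** A = mat 1\<close> by (simp add: matrix_mul_assoc)
  finally show "matrix_inv A = B" .
qed

lemma mat_groupD:
  assumes "mat_group H"
  shows "mat 1 \<in> H" "A \<in> H \<Longrightarrow> B \<in> H \<Longrightarrow> A ** B \<in> H" "A \<in> H \<Longrightarrow> matrix_inv A \<in> H"
    "A \<in> H \<Longrightarrow> invertible A" "A \<in> H \<Longrightarrow> mpow A n \<in> H"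
proof -
  show one: "mat 1 \<in> H" and mult: "A \<in> H \<Longrightarrow> B \<in> H \<Longrightarrow> A ** B \<in> H" for A B
    using assms by (auto simp: mat_group_def)
  have inv: "matrix_inv A \<in> H \<and> invertible A" if A: "A \<in> H"
  proof -
    obtain B where "B \<in> H" "A ** B = mat 1" using assms A by (auto simp: mat_group_def)
    then show ?thesis using matrix_inv_eqI[of A B] by simp
  qed
  show "A \<in> H \<Longrightarrow> matrix_inv A \<in> H" "A \<in> H \<Longrightarrow> invertible A"
    using inv by blast+
  show "A \<in> H \<Longrightarrow> mpow A n \<in> H" by (induction n) (auto intro: one mult)
qed

lemma inv_cancel:
  assumes "invertible (A :: complex^2^2)"
  shows "matrix_inv A ** A = mat 1" "A ** matrix_inv A = mat 1"
    "matrix_inv A ** (A ** B) = B" "A ** (matrix_inv A ** B) = B"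
    "matrix_inv A *v (A *v x) = x" "A *v (matrix_inv A *v x) = x"
    "B ** A ** matrix_inv A = B" "B ** matrix_inv A ** A = B"
proof -
  show l: "matrix_inv A ** A = mat 1" and r: "A ** matrix_inv A = mat 1"
    using assms by (simp_all add: matrix_inv_inverse)
  show "matrix_inv A ** (A ** B) = B" "A ** (matrix_inv A ** B) = B"
    "matrix_inv A *v (A *v x) = x" "A *v (matrix_inv A *v x) = x"
    by (simp_all add: matrix_mul_assoc matrix_vector_mul_assoc l r)
  show "B ** A ** matrix_inv A = B" "B ** matrix_inv A ** A = B"
    by (simp_all add: matrix_mul_assoc[symmetric] l r)
qed

lemma generated_group_subset:
  assumes "mat_group H" "X \<subseteq> H"
  shows "generated_group X \<subseteq> H"
proof
  fix A assume "A \<in> generated_group X"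
  then show "A \<in> H"
  proof induction
    case one
    show ?case by (rule mat_groupD(1)[OF assms(1)])
  next
    case (incl A)
    then show ?case using assms(2) by blast
  next
    case (inv A)
    then show ?case using assms(2) mat_groupD(3)[OF assms(1)] by blast
  next
    case (mult A B)
    then show ?case using mat_groupD(2)[OF assms(1)] by blast
  qed
qed

lemma mat_group_generated:
  assumes "\<And>A. A \<in> X \<Longrightarrow> invertible A"
  shows "mat_group (generated_group X)"
proof -
  have "\<exists>B\<in>generated_group X. A ** B = mat 1 \<and> B ** A = mat 1" if "A \<in> generated_group X" for A
    using that
  proof induction
    case one
    show ?case by (intro bexI[of _ "mat 1"]) (auto intro: generated_group.one)
  next
    case (incl A)
    then show ?case using assms inv_cancel generated_group.inv by blast
  next
    case (inv A)
    then show ?case using assms inv_cancel generated_group.incl by blast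
  next
    case (mult A B)
    then obtain A' B' where *: "A' \<in> generated_group X" "B' \<in> generated_group X"
      "A ** A' = mat 1" "A' ** A = mat 1" "B ** B' = mat 1" "B' ** B = mat 1" by blast
    have "A ** B ** (B' ** A') = A ** (B ** B') ** A'" "B' ** A' ** (A ** B) = B' ** (A' ** A) ** B"
      by (simp_all add: matrix_mul_assoc)
    then show ?case using * by (intro bexI[of _ "B' ** A'"]) (auto intro: generated_group.mult)
  qed
  then show ?thesis
    unfolding mat_group_def by (auto intro: generated_group.intros)
qed

lemma generated_group_eqI:
  fixes X Y :: "(complex^2^2) set"
  assumes "\<And>A. A \<in> X \<Longrightarrow> invertible A" "\<And>A. A \<in> Y \<Longrightarrow> invertible A"
    and "X \<subseteq> generated_group Y" "Y \<subseteq> generated_group X"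
  shows "generated_group X = generated_group Y"
proof
  show "generated_group X \<subseteq> generated_group Y"
    by (intro generated_group_subset mat_group_generated) (use assms in auto)
  show "generated_group Y \<subseteq> generated_group X"
    by (intro generated_group_subset mat_group_generated) (use assms in auto)
qed

subsection \<open>Unitary matrices\<close>

definition hip :: "complex^2 \<Rightarrow> complex^2 \<Rightarrow> complex" where
  "hip x y = x$1 * cnj (y$1) + x$2 * cnj (y$2)"

definition mat_adjoint :: "complex^2^2 \<Rightarrow> complex^2^2" where
  "mat_adjoint A = (\<chi> i j. cnj (A$j$i))"

definition unitary :: "complex^2^2 \<Rightarrow> bool" where
  "unitary A \<longleftrightarrow> A ** mat_adjoint A = mat 1"

lemma unitaryD:
  assumes "unitary A"
  shows "invertible A" "matrix_inv A = mat_adjoint A" "mat_adjoint A ** A = mat 1"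
  using assms matrix_inv_eqI[of A "mat_adjoint A"] by (auto simp: unitary_def)

lemma mat_adjoint_mult: "mat_adjoint (A ** B) = mat_adjoint B ** mat_adjoint A"
  by (simp add: mat2_simps mat_adjoint_def algebra_simps)

lemma mat_group_unitary: "mat_group {A. unitary A}"
  unfolding mat_group_def
proof (intro conjI ballI)
  show "mat 1 \<in> {A. unitary A}" by (simp add: unitary_def mat2_simps mat_adjoint_def)
next
  fix A B assume AB: "A \<in> {A. unitary A}" "B \<in> {A. unitary A}"
  have "A ** B ** mat_adjoint (A ** B) = A ** (B ** mat_adjoint B) ** mat_adjoint A"
    by (simp add: mat_adjoint_mult matrix_mul_assoc)
  then show "A ** B \<in> {A. unitary A}" using AB by (simp add: unitary_def)
next
  fix A assume A: "A \<in> {A. unitary A}"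
  have "mat_adjoint (mat_adjoint A) = A" by (simp add: mat2_simps mat_adjoint_def)
  then show "\<exists>B\<in>{A. unitary A}. A ** B = mat 1 \<and> B ** A = mat 1"
    using A unitaryD(3)[of A] by (intro bexI[of _ "mat_adjoint A"]) (auto simp: unitary_def)
qed

lemma hip_adjoint: "hip (A *v x) y = hip x (mat_adjoint A *v y)"
  by (simp add: hip_def mat2_simps mat_adjoint_def algebra_simps)

lemma unitary_hip: "unitary A \<Longrightarrow> hip (A *v x) (A *v y) = hip x y"
  by (simp add: hip_adjoint matrix_vector_mul_assoc unitaryD(3))

text \<open>Orthogonal to \<open>v\<close> for \<open>hip\<close> and of the same length. With
  \<open>v\<close> it forms a frame in which every unitary matrix that preserves the line of
  \<open>v\<close> is diagonal.\<close>

definition perp :: "complex^2 \<Rightarrow> complex^2" where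
  "perp v = vector [- cnj (v$2), cnj (v$1)]"

lemma perp_nth [simp]: "perp v $ 1 = - cnj (v$2)" "perp v $ 2 = cnj (v$1)"
  by (simp_all add: perp_def)

lemma perp_eq_0_iff [simp]: "perp v = 0 \<longleftrightarrow> v = 0"
  by (auto simp: vec2_eq_iff)

text \<open>A unitary matrix preserves orthogonality, hence carries the orthogonal complement of the
  line of \<open>v\<close> to that of the line of \<open>w\<close>.\<close>

lemma unitary_perp:
  assumes g: "unitary g" and v: "v \<noteq> 0" and gv: "g *v v = c *s w"
  obtains d where "g *v perp v = d *s perp w"
proof -
  have "c *s w \<noteq> 0"
    using v gv inv_cancel(5)[OF unitaryD(1)[OF g], of v] by (metis matrix_vector_mult_0_right)
  then have c: "c \<noteq> 0" and w: "w \<noteq> 0" by auto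
  define x where "x = g *v perp v"
  have "hip x (c *s w) = hip (perp v) v"
    unfolding x_def gv[symmetric] by (rule unitary_hip[OF g])
  also have "\<dots> = 0" by (simp add: hip_def)
  finally have "cnj c * hip x w = 0" by (simp add: hip_def algebra_simps)
  then have h: "x$1 * cnj (w$1) + x$2 * cnj (w$2) = 0" using c by (simp add: hip_def)
  have "\<exists>d. x = d *s perp w"
  proof (cases "w$1 = 0")
    case False
    then have "x = (x$2 / cnj (w$1)) *s perp w"
      using h by (simp add: vec2_eq_iff field_simps add_eq_0_iff)
    then show ?thesis ..
  next
    case True
    then have "w$2 \<noteq> 0" using w by (simp add: vec2_eq_iff)
    then have "x = (- x$1 / cnj (w$2)) *s perp w"
      using h True by (simp add: vec2_eq_iff field_simps)
    then show ?thesis ..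
  qed
  then show ?thesis using that by (auto simp: x_def)
qed

lemma frame_decomp:
  assumes "v \<noteq> 0"
  shows "x = (hip x v / hip v v) *s v + (hip x (perp v) / hip v v) *s perp v"
proof -
  have "hip v v = of_real ((cmod (v$1))\<^sup>2 + (cmod (v$2))\<^sup>2)"
    by (simp only: hip_def complex_norm_square of_real_add)
  moreover have "(cmod (v$1))\<^sup>2 + (cmod (v$2))\<^sup>2 \<noteq> 0"
    using assms by (auto simp: vec2_eq_iff sum_power2_eq_zero_iff)
  ultimately have n: "hip v v \<noteq> 0" by (metis of_real_eq_0_iff)
  have "x$1 * hip v v = hip x v * v$1 - hip x (perp v) * cnj (v$2)"
    "x$2 * hip v v = hip x v * v$2 + hip x (perp v) * cnj (v$1)"
    by (simp_all add: hip_def algebra_simps)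
  then show ?thesis using n by (simp add: vec2_eq_iff field_simps)
qed

lemma frame_eqI:
  assumes "v \<noteq> 0" "(g :: complex^2^2) *v v = h *v v" "g *v perp v = h *v perp v"
  shows "g = h"
proof -
  have "g *v x = h *v x" for x
    by (subst (1 2) frame_decomp[OF assms(1), of x]) (simp only: mv_add mv_scale assms)
  then show ?thesis by (simp add: matrix_eq)
qed

lemma frame_det:
  assumes "v \<noteq> 0" "(g :: complex^2^2) *v v = a *s v" "g *v perp v = b *s perp v"
  shows "det g = a * b" "trace g = a + b"
proof -
  have g: "g$1$1 * v$1 + g$1$2 * v$2 = a * v$1" "g$2$1 * v$1 + g$2$2 * v$2 = a * v$2"
    "- g$1$1 * cnj (v$2) + g$1$2 * cnj (v$1) = - b * cnj (v$2)"
    "- g$2$1 * cnj (v$2) + g$2$2 * cnj (v$1) = b * cnj (v$1)"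
    using assms(2,3) by (simp_all add: mat2_simps)
  define n where "n = v$1 * cnj (v$1) + v$2 * cnj (v$2)"
  have "n = of_real ((cmod (v$1))\<^sup>2 + (cmod (v$2))\<^sup>2)"
    by (simp only: n_def complex_norm_square of_real_add)
  moreover have "(cmod (v$1))\<^sup>2 + (cmod (v$2))\<^sup>2 \<noteq> 0"
    using assms(1) by (auto simp: vec2_eq_iff sum_power2_eq_zero_iff)
  ultimately have n: "n \<noteq> 0" by (metis of_real_eq_0_iff)
  have "n * (g$1$1 + g$2$2) =
      (g$1$1 * v$1 + g$1$2 * v$2) * cnj (v$1) + (g$2$1 * v$1 + g$2$2 * v$2) * cnj (v$2) -
      (- g$1$1 * cnj (v$2) + g$1$2 * cnj (v$1)) * v$2 + (- g$2$1 * cnj (v$2) + g$2$2 * cnj (v$1)) * v$1"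
    by (simp add: n_def algebra_simps)
  also have "\<dots> = n * (a + b)" unfolding g by (simp add: n_def algebra_simps)
  finally show "trace g = a + b" using n by (simp add: trace2)
  \<comment> \<open>The change of basis to the frame: its columns are \<open>v\<close> and
    \<open>perp v\<close>, its determinant is the squared length of \<open>v\<close>.\<close>
  define P :: "complex^2^2" where "P = vector [vector [v$1, - cnj (v$2)], vector [v$2, cnj (v$1)]]"
  define D :: "complex^2^2" where "D = vector [vector [a, 0], vector [0, b]]"
  have "g ** P = P ** D" using g by (simp add: mat2_eq_iff mat2_mult_nth P_def D_def mult_ac)
  then have "det g * det P = det P * det D" by (metis det_mul)
  moreover have "det P = n" "det D = a * b" by (simp_all add: P_def D_def det_2 n_def mult_ac)
  ultimately show "det g = a * b" using n by simp
qed

text \<open>A nonzero row (a, b) annihilates (b, -a), and the vanishing determinant makes the other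
  row annihilate it too.\<close>

lemma singular_kernel:
  assumes "det (B :: complex^2^2) = 0"
  obtains v where "v \<noteq> 0" "B *v v = 0"
proof -
  have d: "B$1$1 * B$2$2 = B$1$2 * B$2$1" using assms by (simp add: det_2)
  consider "B$1$1 \<noteq> 0 \<or> B$1$2 \<noteq> 0" | "B$2$1 \<noteq> 0 \<or> B$2$2 \<noteq> 0" | "B = 0"
    by (auto simp: mat2_eq_iff)
  then show ?thesis
  proof cases
    case 1
    let ?v = "vector [B$1$2, - B$1$1] :: complex^2"
    have "?v \<noteq> 0" using 1 by (auto simp: vec2_eq_iff)
    moreover have "B *v ?v = 0" using d by (simp add: vec2_eq_iff mat2_vec_nth mult.commute)
    ultimately show ?thesis by (rule that)
  next
    case 2
    let ?v = "vector [B$2$2, - B$2$1] :: complex^2"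
    have "?v \<noteq> 0" using 2 by (auto simp: vec2_eq_iff)
    moreover have "B *v ?v = 0" using d by (simp add: vec2_eq_iff mat2_vec_nth mult.commute)
    ultimately show ?thesis by (rule that)
  next
    case 3
    then show ?thesis by (intro that[of "vector [1, 0]"]) (simp_all add: vec2_eq_iff mat2_vec_nth)
  qed
qed

lemma unitary_reflection_frame:
  assumes "unitary A" "trace A = 1 + d" "det A = d"
  obtains v where "v \<noteq> 0" "A *v v = v" "A *v perp v = d *s perp v"
proof -
  \<comment> \<open>The characteristic polynomial at 1; for trace 1 + d and determinant d it
    vanishes, so 1 is an eigenvalue.\<close>
  have "det (A - mat 1) = det A - trace A + 1"
    by (simp add: det_2 trace2 mat2_nth algebra_simps)
  then have "det (A - mat 1) = 0" using assms(2,3) by simp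
  then obtain v where v: "v \<noteq> 0" "(A - mat 1) *v v = 0" by (rule singular_kernel)
  then have "A *v v = v" by (simp add: matrix_vector_mult_diff_rdistrib)
  then have Av: "A *v v = 1 *s v" by simp
  obtain b where b: "A *v perp v = b *s perp v"
    by (rule unitary_perp[OF assms(1) v(1) Av])
  have "det A = 1 * b" using frame_det(1)[OF v(1) Av b] .
  then have "b = d" using assms(3) by simp
  then show ?thesis using that[OF v(1) \<open>A *v v = v\<close>] b by simp
qed

section \<open>Lines fixed by the elements of a finite matrix group\<close>

definition line :: "complex^2 \<Rightarrow> (complex^2) set" where
  "line v = range (\<lambda>c. c *s v)"

definition act :: "complex^2^2 \<Rightarrow> (complex^2) set \<Rightarrow> (complex^2) set" where
  "act g L = (\<lambda>x. g *v x) ` L"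

definition stab :: "(complex^2^2) set \<Rightarrow> (complex^2) set \<Rightarrow> (complex^2^2) set" where
  "stab G L = {g \<in> G. act g L = L}"

definition scalars :: "(complex^2^2) set \<Rightarrow> (complex^2^2) set" where
  "scalars G = {g \<in> G. \<exists>c. g = mat c}"

lemma line_eq_iff:
  assumes "v \<noteq> 0" "w \<noteq> 0"
  shows "line v = line w \<longleftrightarrow> (\<exists>c. v = c *s w)"
proof
  assume "line v = line w"
  moreover have "v \<in> line v" unfolding line_def by (rule image_eqI[of _ _ 1]) auto
  ultimately show "\<exists>c. v = c *s w" by (auto simp: line_def)
next
  assume "\<exists>c. v = c *s w"
  then obtain c where c: "v = c *s w" by blast
  then have "c \<noteq> 0" using assms by auto
  then have 1: "d *s w = (d / c) *s v" for d by (simp add: c vector_smult_assoc)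
  have 2: "d *s v = (d * c) *s w" for d by (simp add: c vector_smult_assoc)
  show "line v = line w"
  proof
    show "line v \<subseteq> line w" unfolding line_def using 2 by blast
    show "line w \<subseteq> line v" unfolding line_def using 1 by blast
  qed
qed

lemma act_line: "act g (line v) = line (g *v v)"
  by (simp add: act_def line_def image_image mv_scale)

lemma act_mult: "act (g ** h) L = act g (act h L)"
  by (simp add: act_def image_image matrix_vector_mul_assoc)

lemma act_one: "act (mat 1) L = L"
  by (simp add: act_def)

lemma mult_vec_nonzero: "invertible (g :: complex^2^2) \<Longrightarrow> v \<noteq> 0 \<Longrightarrow> g *v v \<noteq> 0"
  by (metis inv_cancel(5) matrix_vector_mult_0_right)

lemma stab_line_iff:
  assumes "mat_group G" "v \<noteq> 0"
  shows "g \<in> stab G (line v) \<longleftrightarrow> g \<in> G \<and> (\<exists>c. g *v v = c *s v)"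
  using line_eq_iff[of "g *v v" v] mult_vec_nonzero[of g v] assms mat_groupD(4)[OF assms(1)]
  by (auto simp: stab_def act_line)

text \<open>Cramer's rule (\<open>vv\<close>) expresses the third eigenvector by the first two with
  nonzero coefficients, the determinants \<open>D i j\<close>. Comparing coefficients after applying
  g shows that the three eigenvalues agree.\<close>

lemma three_eigenlines_scalar:
  assumes g: "\<And>i. i < (3::nat) \<Longrightarrow> g *v v i = c i *s v i"
    and ne: "\<And>i. i < 3 \<Longrightarrow> v i \<noteq> 0"
    and ind: "\<And>i j. i < 3 \<Longrightarrow> j < 3 \<Longrightarrow> i \<noteq> j \<Longrightarrow> line (v i) \<noteq> line (v j)"
  shows "g = mat (c 0)"
proof -
  define D where "D i j = v i $ 1 * v j $ 2 - v i $ 2 * v j $ 1" for i j :: nat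
  have D: "D i j \<noteq> 0" if "i < 3" "j < 3" "i \<noteq> j" for i j
  proof
    assume d: "D i j = 0"
    have "\<exists>c. v i = c *s v j"
    proof (cases "v j $ 1 = 0")
      case False
      then have "v i = (v i $ 1 / v j $ 1) *s v j"
        using d by (simp add: D_def vec2_eq_iff field_simps)
      then show ?thesis ..
    next
      case True
      then have "v j $ 2 \<noteq> 0" using ne[OF that(2)] by (simp add: vec2_eq_iff)
      then have "v i = (v i $ 2 / v j $ 2) *s v j"
        using d True by (simp add: D_def vec2_eq_iff field_simps)
      then show ?thesis ..
    qed
    then show False using line_eq_iff[of "v i" "v j"] ne ind that by simp
  qed
  have vv: "D i j *s v k = D k j *s v i + D i k *s v j" for i j k
    by (simp add: vec2_eq_iff D_def algebra_simps)
  have g': "g *v v 0 = c 0 *s v 0" "g *v v 1 = c 1 *s v 1" "g *v v 2 = c 2 *s v 2"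
    using g[of 0] g[of 1] g[of 2] by simp_all
  have "c 2 *s (D 2 1 *s v 0 + D 0 2 *s v 1) = c 2 *s (D 0 1 *s v 2)"
    by (simp only: vv[of 0 1 2])
  also have "\<dots> = g *v (D 0 1 *s v 2)"
    by (simp only: mv_scale g' vector_smult_assoc mult.commute)
  also have "\<dots> = D 2 1 *s (c 0 *s v 0) + D 0 2 *s (c 1 *s v 1)"
    by (simp only: vv[of 0 1 2] mv_add mv_scale g')
  finally have "(c 2 *s (D 2 1 *s v 0 + D 0 2 *s v 1)) $ i =
      (D 2 1 *s (c 0 *s v 0) + D 0 2 *s (c 1 *s v 1)) $ i" for i by simp
  then have e: "c 2 * (D 2 1 * v 0 $ i + D 0 2 * v 1 $ i) =
      D 2 1 * (c 0 * v 0 $ i) + D 0 2 * (c 1 * v 1 $ i)" for i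
    by (simp only: vector_smult_component vector_add_component)
  have "D 2 1 * (c 2 - c 0) * D 0 1 = 0" "D 0 2 * (c 2 - c 1) * D 0 1 = 0"
    using e[of 1] e[of 2] unfolding D_def by algebra+
  then have c: "c 2 = c 0" "c 1 = c 0" using D[of 2 1] D[of 0 1] D[of 0 2] by auto
  have "D 0 1 *s (g *v x) = D 0 1 *s (c 0 *s x)" for x
  proof -
    define X Y where "X = x$1 * v 1$2 - x$2 * v 1$1" and "Y = v 0$1 * x$2 - v 0$2 * x$1"
    have x: "D 0 1 *s x = X *s v 0 + Y *s v 1"
      by (simp add: vec2_eq_iff D_def X_def Y_def algebra_simps)
    have "D 0 1 *s (g *v x) = g *v (D 0 1 *s x)" by (simp add: mv_scale)
    also have "\<dots> = X *s (c 0 *s v 0) + Y *s (c 0 *s v 1)"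
      by (simp only: x mv_add mv_scale g' c)
    also have "\<dots> = c 0 *s (X *s v 0 + Y *s v 1)"
      by (simp add: vec2_eq_iff algebra_simps)
    also have "\<dots> = D 0 1 *s (c 0 *s x)"
      unfolding x[symmetric] by (simp add: vector_smult_assoc mult.commute)
    finally show ?thesis .
  qed
  then have "g *v x = mat (c 0) *v x" for x
    using D[of 0 1] by (simp add: mat_vec vec2_eq_iff)
  then show ?thesis by (simp add: matrix_eq)
qed

lemma card_fixed_lines_le_2:
  assumes "finite S" "\<And>L. L \<in> S \<Longrightarrow> \<exists>v. v \<noteq> 0 \<and> L = line v"
    and "\<And>c. g \<noteq> mat c" and inv: "invertible g"
  shows "card {L \<in> S. act g L = L} \<le> 2"
proof (rule ccontr)
  assume "\<not> ?thesis"
  then have "3 \<le> card {L \<in> S. act g L = L}" by simp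
  then obtain T where T: "T \<subseteq> {L \<in> S. act g L = L}" "card T = 3" "finite T"
    by (rule obtain_subset_with_card_n)
  obtain h where h: "bij_betw h {0..<3::nat} T"
    using ex_bij_betw_nat_finite[OF T(3)] T(2) by auto
  have hT: "h i \<in> T" if "i < 3" for i using bij_betwE[OF h] that by simp
  then have "\<forall>i\<in>{..<3}. \<exists>v. v \<noteq> 0 \<and> h i = line v" using T assms(2) by blast
  then obtain v where v: "\<And>i. i < 3 \<Longrightarrow> v i \<noteq> 0 \<and> h i = line (v i)" by (metis lessThan_iff)
  have "\<exists>c. g *v v i = c *s v i" if "i < 3" for i
  proof -
    have "act g (line (v i)) = line (v i)"
      using v[OF that] hT[OF that] T(1) by auto
    then show ?thesis
      using line_eq_iff[of "g *v v i" "v i"] v[OF that] mult_vec_nonzero[OF inv] by (simp add: act_line)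
  qed
  then have "\<forall>i\<in>{..<3}. \<exists>c. g *v v i = c *s v i" by simp
  then obtain c where c: "\<And>i. i < 3 \<Longrightarrow> g *v v i = c i *s v i" by (metis lessThan_iff)
  have "g = mat (c 0)"
  proof (rule three_eigenlines_scalar[OF c])
    fix i j :: nat assume "i < 3" "j < 3" "i \<noteq> j"
    then show "line (v i) \<noteq> line (v j)"
      using v h by (metis bij_betw_def inj_on_def atLeastLessThan_iff zero_le)
  qed (use v in auto)
  then show False using assms(3) by blast
qed

lemma act_bij_cancel:
  assumes "invertible g"
  shows "act (matrix_inv g) (act g L) = L" "act g (act (matrix_inv g) L) = L"
  by (simp_all add: act_mult[symmetric] inv_cancel[OF assms] act_one)

context
  fixes G :: "(complex^2^2) set"
  assumes fin: "finite G" and G: "mat_group G"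
begin

lemma card_transporter:
  assumes h: "h \<in> G"
  shows "card {g \<in> G. act g L = act h L} = card (stab G L)"
proof -
  have "bij_betw (\<lambda>g. h ** g) (stab G L) {g \<in> G. act g L = act h L}"
    by (rule bij_betw_byWitness[where f' = "\<lambda>g. matrix_inv h ** g"])
      (use h in \<open>auto simp: stab_def act_mult inv_cancel[OF mat_groupD(4)[OF G h]]
        act_bij_cancel[OF mat_groupD(4)[OF G h]] intro!: mat_groupD[OF G]\<close>)
  from bij_betw_same_card[OF this] show ?thesis by simp
qed

lemma card_stab_act:
  assumes h: "h \<in> G"
  shows "card (stab G (act h L)) = card (stab G L)"
proof -
  note hi = inv_cancel[OF mat_groupD(4)[OF G h]]
  have "bij_betw (\<lambda>g. h ** g ** matrix_inv h) (stab G L) (stab G (act h L))"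
  proof (rule bij_betw_byWitness[where f' = "\<lambda>g. matrix_inv h ** g ** h"])
    show "\<forall>a\<in>stab G L. matrix_inv h ** (h ** a ** matrix_inv h) ** h = a"
      by (simp add: hi matrix_mul_assoc)
    show "\<forall>a\<in>stab G (act h L). h ** (matrix_inv h ** a ** h) ** matrix_inv h = a"
      by (simp add: hi matrix_mul_assoc)
  qed (use h in \<open>auto simp: stab_def act_mult act_bij_cancel[OF mat_groupD(4)[OF G h]]
      intro!: mat_groupD[OF G]\<close>)
  from bij_betw_same_card[OF this] show ?thesis by simp
qed

lemma orbit_stabilizer:
  "card ((\<lambda>g. act g L) ` G) * card (stab G L) = card G"
proof -
  have "card G = (\<Sum>M\<in>(\<lambda>g. act g L) ` G. \<Sum>g\<in>{g\<in>G. act g L = M}. 1)"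
    using sum.image_gen[OF fin, of "\<lambda>_. 1::nat" "\<lambda>g. act g L"] by simp
  also have "\<dots> = (\<Sum>M\<in>(\<lambda>g. act g L) ` G. card (stab G L))"
    by (rule sum.cong) (auto simp: card_transporter)
  finally show ?thesis by simp
qed

lemma scalars_subset_stab: "scalars G \<subseteq> stab G (line v)"
proof
  fix g assume "g \<in> scalars G"
  then obtain c where c: "g \<in> G" "g = mat c" by (auto simp: scalars_def)
  then have "c \<noteq> 0" using mat_groupD(4)[OF G, of g] by (auto simp: invertible_det_nz det_mat2)
  then have "act g (line v) = line v"
    by (cases "v = 0") (auto simp: c(2) act_line mat_vec line_eq_iff)
  then show "g \<in> stab G (line v)" using c by (simp add: stab_def)
qed

lemma card_scalars_pos: "card (scalars G) > 0"
  using fin mat_groupD(1)[OF G] by (auto simp: scalars_def card_gt_0_iff)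

text \<open>Burnside's count of the pairs of a non-scalar group element and a line fixed by it: each
  element contributes at most two, the orbit of the line of \<open>v i\<close> contributes one summand.\<close>

theorem fixed_lines_inequality:
  assumes I: "finite I" and v: "\<And>i. i \<in> I \<Longrightarrow> v i \<noteq> 0"
    and ineq: "\<And>i j g. i \<in> I \<Longrightarrow> j \<in> I \<Longrightarrow> i \<noteq> j \<Longrightarrow> g \<in> G \<Longrightarrow> act g (line (v i)) \<noteq> line (v j)"
  shows "(\<Sum>i\<in>I. real (card G) - real (card G) * real (card (scalars G)) / card (stab G (line (v i))))
    \<le> 2 * (real (card G) - card (scalars G))"
proof -
  define Orb where "Orb i = (\<lambda>g. act g (line (v i))) ` G" for i
  define S where "S = (\<Union>i\<in>I. Orb i)"
  define N where "N = G - scalars G"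
  have finO: "finite (Orb i)" for i using fin by (simp add: Orb_def)
  have finS: "finite S" using finO I by (simp add: S_def)
  have S: "\<exists>w. w \<noteq> 0 \<and> L = line w" if LS: "L \<in> S" for L
  proof -
    obtain i g where "i \<in> I" "g \<in> G" "L = line (g *v v i)"
      using LS by (auto simp: S_def Orb_def act_line)
    then show ?thesis using mult_vec_nonzero[OF mat_groupD(4)[OF G] v] by blast
  qed
  have disj: "Orb i \<inter> Orb j = {}" if "i \<in> I" "j \<in> I" "i \<noteq> j" for i j
  proof (rule ccontr)
    assume "Orb i \<inter> Orb j \<noteq> {}"
    then obtain g h where gh: "g \<in> G" "h \<in> G" "act g (line (v i)) = act h (line (v j))"
      by (auto simp: Orb_def)
    then have "act (matrix_inv h ** g) (line (v i)) = line (v j)"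
      by (simp add: act_mult act_bij_cancel[OF mat_groupD(4)[OF G]])
    then show False using ineq[OF that, of "matrix_inv h ** g"] gh mat_groupD(2,3)[OF G] by blast
  qed
  have cardN: "card N = card G - card (scalars G)"
    unfolding N_def by (rule card_Diff_subset) (auto simp: scalars_def intro: finite_subset[OF _ fin])
  have le: "card (scalars G) \<le> card G"
    by (rule card_mono) (auto simp: scalars_def fin)
  have fixN: "{g \<in> N. act g L = L} = stab G L - scalars G" for L
    by (auto simp: N_def stab_def)
  \<comment> \<open>By the orbit-stabilizer theorem the summand for i is the size of the orbit times
    the number of nonscalar elements in each stabilizer; scalars lie in every stabilizer and are
    subtracted.\<close>
  have "(\<Sum>i\<in>I. real (card G) - real (card G) * real (card (scalars G)) / card (stab G (line (v i)))) =
      (\<Sum>i\<in>I. \<Sum>L\<in>Orb i. real (card {g \<in> N. act g L = L}))"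
  proof (rule sum.cong[OF refl])
    fix i assume i: "i \<in> I"
    define s where "s = card (stab G (line (v i)))"
    have "card (stab G L - scalars G) = s - card (scalars G)" if L: "L \<in> Orb i" for L
    proof -
      obtain g where g: "g \<in> G" "L = act g (line (v i))" using L by (auto simp: Orb_def)
      have "scalars G \<subseteq> stab G L" using g scalars_subset_stab by (simp add: act_line)
      then show ?thesis
        using card_stab_act[OF g(1), of "line (v i)"] g(2) fin
        by (subst card_Diff_subset) (auto simp: s_def scalars_def intro: finite_subset[OF _ fin])
    qed
    then have *: "(\<Sum>L\<in>Orb i. real (card {g \<in> N. act g L = L})) = card (Orb i) * real (s - card (scalars G))"
      by (simp add: fixN)
    have "card (scalars G) \<le> s" unfolding s_def
      by (rule card_mono) (auto simp: stab_def fin scalars_subset_stab[unfolded stab_def])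
    moreover have "real (card (Orb i)) * real s = card G"
      using orbit_stabilizer[of "line (v i)"] by (simp add: Orb_def s_def flip: of_nat_mult)
    moreover have "s > 0" using \<open>card (scalars G) \<le> s\<close> card_scalars_pos by linarith
    ultimately show "real (card G) - real (card G) * real (card (scalars G)) / card (stab G (line (v i))) =
        (\<Sum>L\<in>Orb i. real (card {g \<in> N. act g L = L}))"
      unfolding * s_def[symmetric] by (simp add: of_nat_diff field_simps)
  qed
  also have "\<dots> = (\<Sum>L\<in>S. real (card {g \<in> N. act g L = L}))"
    unfolding S_def by (rule sum.UNION_disjoint[symmetric]) (use I finO disj in auto)
  also have "\<dots> = (\<Sum>L\<in>S. \<Sum>g\<in>N. if act g L = L then 1 else 0)"
    using fin by (simp add: sum.If_cases N_def Int_def)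
  also have "\<dots> = (\<Sum>g\<in>N. \<Sum>L\<in>S. if act g L = L then 1 else 0)" by (rule sum.swap)
  also have "\<dots> = (\<Sum>g\<in>N. real (card {L \<in> S. act g L = L}))"
    using finS by (simp add: sum.If_cases Int_def)
  also have "\<dots> \<le> (\<Sum>g\<in>N. 2)"
  proof (rule sum_mono)
    fix g assume g: "g \<in> N"
    then have "card {L \<in> S. act g L = L} \<le> 2"
      by (intro card_fixed_lines_le_2[OF finS S]) (auto simp: N_def scalars_def mat_groupD(4)[OF G])
    then show "real (card {L \<in> S. act g L = L}) \<le> 2" by simp
  qed
  also have "\<dots> = 2 * (real (card G) - card (scalars G))" using le by (simp add: cardN of_nat_diff)
  finally show ?thesis .
qed

end

section \<open>Roots of unity\<close>

lemma zeta_pow: "zeta n ^ k = exp (2 * of_real pi * \<i> * of_nat k / of_nat n)"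
  by (simp add: zeta_def exp_of_nat_mult[symmetric] field_simps)

lemma zeta_pow_eq_1_iff:
  assumes "n > 0"
  shows "zeta n ^ k = 1 \<longleftrightarrow> n dvd k"
proof -
  have "zeta n ^ k = 1 \<longleftrightarrow> (\<exists>j::int. 2 * pi * k / n = of_int (2 * j) * pi)"
    by (simp add: zeta_pow exp_eq_1)
  also have "\<dots> \<longleftrightarrow> (\<exists>j::int. int k = j * int n)"
  proof (rule ex_cong1)
    fix j :: int
    have "2 * pi * k / n = of_int (2 * j) * pi \<longleftrightarrow> real k = of_int j * real n"
      using assms by (simp add: field_simps)
    also have "\<dots> \<longleftrightarrow> real_of_int (int k) = real_of_int (j * int n)" by simp
    finally show "2 * pi * k / n = of_int (2 * j) * pi \<longleftrightarrow> int k = j * int n"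
      by (simp only: of_int_eq_iff)
  qed
  also have "\<dots> \<longleftrightarrow> n dvd k"
    by (metis dvd_def int_dvd_int_iff mult.commute)
  finally show ?thesis .
qed

lemma zeta_pow_self: "n > 0 \<Longrightarrow> zeta n ^ n = 1"
  by (simp add: zeta_pow_eq_1_iff)

lemma zeta_nonzero [simp]: "zeta n \<noteq> 0"
  by (simp add: zeta_def)

lemma norm_zeta [simp]: "norm (zeta n) = 1"
  by (simp add: zeta_def norm_exp_eq_Re)

lemma root_of_unity_zeta_pow:
  assumes "n > 0" "x ^ n = 1"
  shows "\<exists>j<n. x = zeta n ^ j"
proof -
  have "x \<in> {z. z ^ n = 1}" using assms by simp
  then obtain j where "j < n" "x = exp (2 * of_real pi * \<i> * of_nat j / of_nat n)"
    using complex_roots_unity[of n] assms by auto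
  then show ?thesis by (auto simp: zeta_pow)
qed

lemma zeta_pow_inj:
  assumes "zeta n ^ i = zeta n ^ j" "i < n" "j < n"
  shows "i = j"
proof -
  have *: "i = j" if le: "i \<le> j" and e: "zeta n ^ i = zeta n ^ j" and j: "j < n" for i j
  proof -
    have "zeta n ^ j = zeta n ^ i * zeta n ^ (j - i)"
      using le by (metis le_add_diff_inverse power_add)
    then have "zeta n ^ (j - i) = 1" using e by simp
    then have "n dvd j - i" using j by (simp add: zeta_pow_eq_1_iff)
    then have "j - i = 0" using j by (metis dvd_imp_le less_imp_diff_less not_less zero_less_iff_neq_zero)
    then show ?thesis using le by simp
  qed
  show ?thesis using *[of i j] *[of j i] assms by (cases "i \<le> j") auto
qed

section \<open>Unitary triangle groups\<close>

lemma scale_left_cancel: "d \<noteq> 0 \<Longrightarrow> d *s u = d *s v \<Longrightarrow> u = v" for u v :: "complex^2"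
  by (auto simp: vec2_eq_iff)

text \<open>The assumptions are facts that an invariant form makes checkable; finiteness of
  \<open>G\<close> is not among them. \<open>LL\<close> stands for the vertices of the octahedron or
  icosahedron, one line for each, and contains the orbit of the fixed line of \<open>A 2\<close>.
  \<open>exact\<close> says that modulo scalars an element preserving the fixed line of
  \<open>A 0\<close> or \<open>A 2\<close> has order dividing 2 or c; for \<open>A 1\<close> this
  will follow from the count. \<open>\<psi> i\<close> is a linear character that detects every
  nontrivial power of \<open>A i\<close> and ignores the other generators.\<close>

locale triangle_group =
  fixes A :: "nat \<Rightarrow> complex^2^2" and z :: complex and c m :: nat
    and \<psi> :: "nat \<Rightarrow> complex^2^2 \<Rightarrow> complex" and LL :: "(complex^2) set set"
    and od :: "nat \<Rightarrow> nat" and G :: "(complex^2^2) set"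
  defines "od \<equiv> \<lambda>i. [2, 3, c] ! i"
    and "G \<equiv> generated_group (A ` {..<3})"
  assumes unitary: "i < 3 \<Longrightarrow> unitary (A i)"
    and det_A: "i < 3 \<Longrightarrow> det (A i) = zeta (od i)"
    and trace_A: "i < 3 \<Longrightarrow> trace (A i) = 1 + zeta (od i)"
    and prod_A: "A 0 ** A 1 ** A 2 = mat z"
    and cm: "(c = 4 \<and> m = 6) \<or> (c = 5 \<and> m = 12)"
    and LL: "finite LL" "card LL \<le> m"
    and orbit_LL: "g \<in> G \<Longrightarrow> v \<noteq> 0 \<Longrightarrow> A 2 *v v = v \<Longrightarrow> line (g *v v) \<in> LL"
    and exact: "i = 0 \<or> i = 2 \<Longrightarrow> g \<in> G \<Longrightarrow> v \<noteq> 0 \<Longrightarrow> A i *v v = v \<Longrightarrow>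
      g *v v = x *s v \<Longrightarrow> g *v perp v = y *s perp v \<Longrightarrow> x ^ od i = y ^ od i"
    and psi_mult: "g \<in> G \<Longrightarrow> h \<in> G \<Longrightarrow> \<psi> i (g ** h) = \<psi> i g * \<psi> i h"
    and psi_other: "i < 3 \<Longrightarrow> j < 3 \<Longrightarrow> i \<noteq> j \<Longrightarrow> \<psi> i (A j) = 1"
    and psi_own: "i < 3 \<Longrightarrow> 0 < k \<Longrightarrow> k < od i \<Longrightarrow> \<psi> i (A i) ^ k \<noteq> 1"
begin

lemma less_3: "i < (3::nat) \<longleftrightarrow> i = 0 \<or> i = 1 \<or> i = 2"
  by auto

lemma od_simps: "od 0 = 2" "od (Suc 0) = 3" "od 2 = c"
  by (simp_all add: od_def)

lemma od_bounds: "i < 3 \<Longrightarrow> 2 \<le> od i" "i < 3 \<Longrightarrow> od i dvd 60" "i < 3 \<Longrightarrow> 0 < od i"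
  using cm by (auto simp: less_3 od_simps)

lemma od_inj: "i < 3 \<Longrightarrow> j < 3 \<Longrightarrow> od i = od j \<Longrightarrow> i = j"
  using cm by (auto simp: less_3 od_simps)

lemma zeta_od: "i < 3 \<Longrightarrow> zeta (od i) \<noteq> 1"
  using zeta_pow_eq_1_iff[of "od i" 1] od_bounds[of i] by auto

lemma A_in_G: "i < 3 \<Longrightarrow> A i \<in> G"
  by (auto simp: G_def intro: generated_group.incl)

lemma mat_group_G: "mat_group G"
  unfolding G_def by (rule mat_group_generated) (auto intro: unitaryD(1) unitary)

lemmas GD = mat_groupD[OF mat_group_G]

lemma G_unitary: "g \<in> G \<Longrightarrow> unitary g"
  using generated_group_subset[OF mat_group_unitary, of "A ` {..<3}"] unitary by (auto simp: G_def)

text \<open>60 is the least common multiple of 2, 3, 4 and 5, so one exponent serves both families.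
  Bounded determinants turn the bound on eigenvalue ratios in \<open>exact\<close> into
  finiteness.\<close>

lemma det_G: 
  assumes "g \<in> G"
  shows "det g ^ 60 = 1"
proof -
  have "mat_group {g. invertible g \<and> det g ^ 60 = 1}"
    unfolding mat_group_def
  proof (intro conjI ballI)
    show "mat 1 \<in> {g::complex^2^2. invertible g \<and> det g ^ 60 = 1}" by (simp add: invertible_det_nz)
  next
    fix g h :: "complex^2^2" assume "g \<in> {g. invertible g \<and> det g ^ 60 = 1}" "h \<in> {g. invertible g \<and> det g ^ 60 = 1}"
    then show "g ** h \<in> {g. invertible g \<and> det g ^ 60 = 1}"
      by (simp add: invertible_mult det_mul power_mult_distrib)
  next
    fix g :: "complex^2^2" assume g: "g \<in> {g. invertible g \<and> det g ^ 60 = 1}"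
    then have gi: "matrix_inv g ** g = mat 1" "g ** matrix_inv g = mat 1" using inv_cancel by auto
    then have "det (matrix_inv g) * det g = 1" by (metis det_I det_mul)
    then have "(det (matrix_inv g) * det g) ^ 60 = 1" by simp
    then have "det (matrix_inv g) ^ 60 = 1" using g by (simp add: power_mult_distrib)
    then have "matrix_inv g \<in> {g. invertible g \<and> det g ^ 60 = 1}"
      using matrix_inv_eqI(2)[OF gi(1)] by simp
    then show "\<exists>h\<in>{g. invertible g \<and> det g ^ 60 = 1}. g ** h = mat 1 \<and> h ** g = mat 1"
      using gi by blast
  qed
  moreover have "det (A i) ^ 60 = 1" if "i < 3" for i
    using od_bounds[OF that] by (simp add: det_A that zeta_pow_eq_1_iff)
  ultimately have "generated_group (A ` {..<3}) \<subseteq> {g. invertible g \<and> det g ^ 60 = 1}"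
    by (intro generated_group_subset) (auto intro: unitaryD(1) unitary)
  then show ?thesis using assms by (auto simp: G_def)
qed

definition axis :: "nat \<Rightarrow> complex^2" where
  "axis i = (SOME v. v \<noteq> 0 \<and> A i *v v = v \<and> A i *v perp v = zeta (od i) *s perp v)"

lemma axis:
  assumes "i < 3"
  shows "axis i \<noteq> 0" "A i *v axis i = axis i" "A i *v perp (axis i) = zeta (od i) *s perp (axis i)"
proof -
  obtain v where "v \<noteq> 0" "A i *v v = v" "A i *v perp v = zeta (od i) *s perp v"
    by (rule unitary_reflection_frame[OF unitary trace_A det_A]) (use assms in auto)
  then have "\<exists>v. v \<noteq> 0 \<and> A i *v v = v \<and> A i *v perp v = zeta (od i) *s perp v" by blast
  from someI_ex[OF this] show "axis i \<noteq> 0" "A i *v axis i = axis i"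
      "A i *v perp (axis i) = zeta (od i) *s perp (axis i)"
    by (simp_all add: axis_def)
qed

lemma stab_frame:
  assumes "g \<in> stab G (line v)" "v \<noteq> 0"
  obtains x y where "g \<in> G" "g *v v = x *s v" "g *v perp v = y *s perp v" "x * y = det g"
proof -
  obtain x where g: "g \<in> G" "g *v v = x *s v"
    using stab_line_iff[OF mat_group_G assms(2)] assms(1) by auto
  obtain y where y: "g *v perp v = y *s perp v"
    by (rule unitary_perp[OF G_unitary[OF g(1)] assms(2) g(2)])
  show ?thesis using that[OF g y] frame_det(1)[OF assms(2) g(2) y] by simp
qed

text \<open>By \<open>exact\<close> the eigenvalues satisfy x^c = y^c, and (x y)^60 = 1 by
  \<open>det_G\<close>; hence both are roots of unity of order dividing 120 c. In the frame of the
  axis the two eigenvalues determine the matrix.\<close>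

lemma finite_stab_axis_2: "finite (stab G (line (axis 2)))"
proof -
  let ?v = "axis 2"
  note v = axis[of 2, simplified]
  define R where "R = {x :: complex. x ^ (120 * c) = 1}"
  have "finite R" unfolding R_def using cm by (intro finite_roots_unity) auto
  have "stab G (line ?v) \<subseteq> (\<lambda>(x,y). THE g. g *v ?v = x *s ?v \<and> g *v perp ?v = y *s perp ?v) ` (R \<times> R)"
  proof
    fix g assume "g \<in> stab G (line ?v)"
    then obtain x y where g: "g \<in> G" "g *v ?v = x *s ?v" "g *v perp ?v = y *s perp ?v" "x * y = det g"
      by (rule stab_frame[OF _ v(1)])
    have "x ^ c = y ^ c" using exact[of 2 g ?v x y] g v by (simp add: od_simps)
    moreover have "(x * y) ^ 60 = 1" using det_G g by simp
    then have "((x * y) ^ 60) ^ c = 1" by simp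
    then have "(x ^ c) ^ 60 * (y ^ c) ^ 60 = 1"
      by (simp add: power_mult_distrib power_mult[symmetric] mult.commute)
    ultimately have "(x ^ c) ^ 120 = 1" "(y ^ c) ^ 120 = 1"
      by (simp_all flip: power_add)
    then have "x \<in> R" "y \<in> R" by (simp_all add: R_def power_mult[symmetric] mult.commute)
    moreover have "g = (THE g. g *v ?v = x *s ?v \<and> g *v perp ?v = y *s perp ?v)"
      by (rule the_equality[symmetric]) (use g frame_eqI[OF v(1)] in auto)
    ultimately show "g \<in> (\<lambda>(x,y). THE g. g *v ?v = x *s ?v \<and> g *v perp ?v = y *s perp ?v) ` (R \<times> R)"
      by (intro image_eqI[of _ _ "(x,y)"]) auto
  qed
  then show ?thesis using \<open>finite R\<close> finite_subset by blast
qed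

lemma orbit_axis_2: "(\<lambda>g. act g (line (axis 2))) ` G \<subseteq> LL"
  using orbit_LL axis[of 2] by (auto simp: act_line)

text \<open>The orbit of the axis of \<open>A 2\<close> lies in the finite set \<open>LL\<close>,
  and the elements with a prescribed image of that axis form a coset of its finite
  stabilizer.\<close>

lemma finite_G: "finite G"
proof -
  let ?L = "line (axis 2)"
  have "finite {g \<in> G. act g ?L = M}" if M: "M \<in> LL" for M
  proof (cases "\<exists>h\<in>G. act h ?L = M")
    case False
    then have "{g \<in> G. act g ?L = M} = {}" by auto
    then show ?thesis by (simp only: finite.emptyI)
  next
    case True
    then obtain h where h: "h \<in> G" "act h ?L = M" by blast
    have "{g \<in> G. act g ?L = M} \<subseteq> (\<lambda>g. h ** g) ` stab G ?L"
    proof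
      fix g assume g: "g \<in> {g \<in> G. act g ?L = M}"
      have "matrix_inv h ** g \<in> stab G ?L"
        using g h GD(2,3) act_bij_cancel(1)[OF GD(4)[OF h(1)], of ?L] by (simp add: stab_def act_mult)
      then show "g \<in> (\<lambda>g. h ** g) ` stab G ?L"
        by (rule image_eqI[rotated]) (simp add: inv_cancel(4)[OF GD(4)[OF h(1)]])
    qed
    then show ?thesis using finite_stab_axis_2 finite_subset by blast
  qed
  then have "finite (\<Union>M\<in>LL. {g \<in> G. act g ?L = M})" using LL(1) by blast
  moreover have "G \<subseteq> (\<Union>M\<in>LL. {g \<in> G. act g ?L = M})" using orbit_axis_2 by blast
  ultimately show ?thesis by (rule finite_subset[rotated])
qed

abbreviation "b \<equiv> card (scalars G)"

lemma finite_scalars: "finite (scalars G)" and b_pos: "b > 0"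
  using card_scalars_pos[OF finite_G mat_group_G] by (auto simp: card_gt_0_iff)

definition powers :: "nat \<Rightarrow> (complex^2^2) set" where
  "powers i = (\<lambda>(j,s). mpow (A i) j ** s) ` ({..<od i} \<times> scalars G)"

lemma powers_axis:
  assumes "i < 3"
  shows "(mpow (A i) j ** mat x) *v axis i = x *s axis i"
    "(mpow (A i) j ** mat x) *v perp (axis i) = (x * zeta (od i) ^ j) *s perp (axis i)"
  using mpow_eigen[of "A i" "axis i" 1 j] mpow_eigen[of "A i" "perp (axis i)" "zeta (od i)" j] axis[OF assms]
  by (simp_all add: matrix_vector_mul_assoc[symmetric] mat_vec mv_scale vector_smult_assoc)

text \<open>The eigenvalue on the axis recovers the scalar, and then the eigenvalue on the
  orthogonal line recovers the exponent.\<close>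

lemma card_powers:
  assumes i: "i < 3"
  shows "card (powers i) = od i * b"
proof -
  have "inj_on (\<lambda>(j,s). mpow (A i) j ** s) ({..<od i} \<times> scalars G)"
  proof (rule inj_onI)
    fix p q assume p: "p \<in> {..<od i} \<times> scalars G" "q \<in> {..<od i} \<times> scalars G"
      and pq: "(case p of (j,s) \<Rightarrow> mpow (A i) j ** s) = (case q of (j,s) \<Rightarrow> mpow (A i) j ** s)"
    obtain j s j' s' where ps: "p = (j,s)" "q = (j',s')" by (cases p, cases q) blast
    have j: "j \<in> {..<od i}" "j' \<in> {..<od i}" and s: "s \<in> scalars G" "s' \<in> scalars G"
      and e: "mpow (A i) j ** s = mpow (A i) j' ** s'" using p pq by (auto simp: ps)
    obtain x x' where x: "s = mat x" "s' = mat x'" using s by (auto simp: scalars_def)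
    have "x *s axis i = x' *s axis i"
      using powers_axis(1)[OF i, of j x] powers_axis(1)[OF i, of j' x'] e unfolding x by metis
    then have xx: "x = x'" using cancel_scale axis(1)[OF i] by blast
    have "(x * zeta (od i) ^ j) *s perp (axis i) = (x' * zeta (od i) ^ j') *s perp (axis i)"
      using powers_axis(2)[OF i, of j x] powers_axis(2)[OF i, of j' x'] e unfolding x by metis
    then have "x * zeta (od i) ^ j = x' * zeta (od i) ^ j'"
      using cancel_scale[of "perp (axis i)"] axis(1)[OF i] by simp
    moreover have "x \<noteq> 0" using s(1) GD(4)[of s] by (auto simp: scalars_def x invertible_det_nz det_mat2)
    ultimately have "j = j'" using xx j zeta_pow_inj[of "od i" j j'] by simp
    then show "p = q" using x xx ps by simp
  qed
  then show ?thesis by (simp add: powers_def card_image card_cartesian_product)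
qed

lemma powers_subset_stab:
  assumes i: "i < 3"
  shows "powers i \<subseteq> stab G (line (axis i))"
proof
  fix g assume "g \<in> powers i"
  then obtain j x where g: "g = mpow (A i) j ** mat x" "mat x \<in> G" by (auto simp: powers_def scalars_def)
  then have "g \<in> G" using GD(2) GD(5)[OF A_in_G[OF i]] by blast
  then show "g \<in> stab G (line (axis i))"
    using powers_axis(1)[OF i, of j x] g axis(1)[OF i] by (auto simp: stab_line_iff[OF mat_group_G])
qed

lemma finite_stab: "finite (stab G L)"
  using finite_G by (simp add: stab_def)

text \<open>By \<open>exact\<close> the ratio of the eigenvalues is a power of
  \<open>zeta (od i)\<close>, so the element agrees with a power of \<open>A i\<close> up to a
  scalar, and that scalar again lies in the group.\<close>

lemma stab_exact:
  assumes i: "i = 0 \<or> i = 2"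
  shows "stab G (line (axis i)) = powers i"
proof
  have i3: "i < 3" using i by auto
  note ax = axis[OF i3]
  show "powers i \<subseteq> stab G (line (axis i))" by (rule powers_subset_stab[OF i3])
  show "stab G (line (axis i)) \<subseteq> powers i"
  proof
    fix g assume "g \<in> stab G (line (axis i))"
    then obtain x y where g: "g \<in> G" "g *v axis i = x *s axis i"
        "g *v perp (axis i) = y *s perp (axis i)" "x * y = det g"
      by (rule stab_frame[OF _ ax(1)])
    have e: "x ^ od i = y ^ od i" using exact[OF i g(1) ax(1,2) g(2,3)] .
    have "det g \<noteq> 0" using GD(4)[OF g(1)] by (simp add: invertible_det_nz)
    then have nz: "x \<noteq> 0" "y \<noteq> 0" using g(4) by auto
    have "(y / x) ^ od i = 1" using e nz by (simp add: power_divide)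
    then obtain j where j: "j < od i" "y / x = zeta (od i) ^ j"
      using root_of_unity_zeta_pow od_bounds(3)[OF i3] by blast
    have gj: "g = mpow (A i) j ** mat x"
      by (rule frame_eqI[OF ax(1)]) (use powers_axis[OF i3] g j nz in \<open>simp_all add: field_simps\<close>)
    have "mat x = matrix_inv (mpow (A i) j) ** g"
      unfolding gj by (rule inv_cancel(3)[symmetric, OF GD(4)[OF GD(5)[OF A_in_G[OF i3]]]])
    then have "mat x \<in> G"
      using GD(2)[OF GD(3)[OF GD(5)[OF A_in_G[OF i3]]] g(1), of j] by simp
    then have "mat x \<in> scalars G" by (auto simp: scalars_def)
    then show "g \<in> powers i" using j(1) gj by (auto simp: powers_def)
  qed
qed

text \<open>Conjugating \<open>A i\<close> by g gives a reflection that fixes the axis of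
  \<open>A j\<close> and has eigenvalue \<open>zeta (od i)\<close> on its complement;
  \<open>exact\<close> for j bounds the order of that eigenvalue.\<close>

lemma axis_transport:
  assumes i: "i < 3" and j: "j = 0 \<or> j = 2" and g: "g \<in> G" and e: "act g (line (axis i)) = line (axis j)"
  shows "od i dvd od j"
proof -
  have j3: "j < 3" using j by auto
  note ai = axis[OF i] and aj = axis[OF j3]
  have gi: "invertible g" using GD(4)[OF g] .
  obtain d where d: "g *v axis i = d *s axis j"
    using e line_eq_iff[OF mult_vec_nonzero[OF gi ai(1)] aj(1)] by (auto simp: act_line)
  then have d0: "d \<noteq> 0" using mult_vec_nonzero[OF gi ai(1)] by auto
  obtain d' where d': "g *v perp (axis i) = d' *s perp (axis j)"
    by (rule unitary_perp[OF G_unitary[OF g] ai(1) d])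
  then have d0': "d' \<noteq> 0" using mult_vec_nonzero[OF gi, of "perp (axis i)"] ai(1) by auto
  define h where "h = g ** A i ** matrix_inv g"
  have h: "h *v (g *v x) = g *v (A i *v x)" for x
    by (simp add: h_def matrix_vector_mul_assoc[symmetric] inv_cancel(5)[OF gi])
  have "d *s (h *v axis j) = d *s axis j"
    using h[of "axis i"] by (simp add: d ai(2) mv_scale)
  then have h1: "h *v axis j = 1 *s axis j" using d0 by simp
  have "d' *s (h *v perp (axis j)) = d' *s (zeta (od i) *s perp (axis j))"
    using h[of "perp (axis i)"] by (simp add: d' ai(3) mv_scale vector_smult_assoc mult.commute)
  then have h2: "h *v perp (axis j) = zeta (od i) *s perp (axis j)"
    by (rule scale_left_cancel[OF d0'])
  have hG: "h \<in> G" unfolding h_def by (intro GD(2) GD(3) A_in_G i g)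
  have "1 ^ od j = zeta (od i) ^ od j" using exact[OF j hG aj(1,2) h1 h2] .
  then show ?thesis using zeta_pow_eq_1_iff[OF od_bounds(3)[OF i]] by simp
qed

text \<open>Divisibility in one direction is not always contradictory: for c = 4 the order 2 divides
  4. So the transport is applied to g and to its inverse, as far as \<open>exact\<close> is
  available.\<close>

lemma axes_inequivalent:
  assumes i: "i < 3" and j: "j < 3" and ij: "i \<noteq> j" and g: "g \<in> G"
  shows "act g (line (axis i)) \<noteq> line (axis j)"
proof
  assume e: "act g (line (axis i)) = line (axis j)"
  then have e': "act (matrix_inv g) (line (axis j)) = line (axis i)"
    using act_bij_cancel(1)[OF GD(4)[OF g]] by metis
  have "j = 0 \<or> j = 2 \<Longrightarrow> od i dvd od j" using axis_transport[OF i _ g e] .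
  moreover have "i = 0 \<or> i = 2 \<Longrightarrow> od j dvd od i" using axis_transport[OF j _ GD(3)[OF g] e'] .
  ultimately show False using i j ij cm by (auto simp: less_3 od_simps)
qed

text \<open>After \<open>stab_exact\<close> only i = 1 is open. The orbit of the axis of
  \<open>A 2\<close> has at most m lines, each with stabilizer of order c b, so the group has order
  at most m c b. The fixed line inequality for the three axes then leaves no room for a stabilizer
  of order greater than 3 b.\<close>

lemma stab_axis_eq_powers:
  assumes "i < 3"
  shows "stab G (line (axis i)) = powers i"
proof (cases "i = 1")
  case False
  then show ?thesis using stab_exact[of i] assms by (auto simp: less_3)
next
  case True
  let ?a = "real (card G)" and ?s = "real (card (stab G (line (axis 1))))"
  have apos: "?a > 0" using finite_G GD(1) by (auto simp: card_gt_0_iff)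
  have s0: "card (stab G (line (axis 0))) = 2 * b" and s2: "card (stab G (line (axis 2))) = c * b"
    using stab_exact[of 0] stab_exact[of 2] card_powers[of 0] card_powers[of 2] by (simp_all add: od_simps)
  have spos: "?s > 0"
    using card_mono[OF finite_stab powers_subset_stab[of 1]] card_powers[of 1] b_pos by (auto simp: od_simps)
  have "card ((\<lambda>g. act g (line (axis 2))) ` G) \<le> m"
    using card_mono[OF LL(1) orbit_axis_2] LL(2) by linarith
  then have "card G \<le> m * (c * b)"
    using orbit_stabilizer[OF finite_G mat_group_G, of "line (axis 2)"] s2
    by (metis mult_le_mono1)
  then have le: "?a \<le> real m * real c * real b" by (metis mult.assoc of_nat_le_iff of_nat_mult)
  have "(\<Sum>i\<in>{0,1,2}. ?a - ?a * real b / real (card (stab G (line (axis i))))) \<le> 2 * (?a - real b)"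
    by (rule fixed_lines_inequality[where v = axis and I = "{0,1,2}", OF finite_G mat_group_G]) (use axis axes_inequivalent in auto)
  then have "(?a - ?a / 2) + (?a - ?a * real b / ?s) + (?a - ?a / c) \<le> 2 * (?a - real b)"
    using b_pos by (simp add: s0 s2 field_simps)
  then have "?a * (1/2 - 1 / c) + 2 * real b \<le> ?a * real b / ?s" by (simp add: field_simps)
  \<comment> \<open>Equivalent to \<open>?a \<le> 24 * b\<close> for c = 4 and to
    \<open>?a \<le> 60 * b\<close> for c = 5, which is the bound m c b just obtained.\<close>
  moreover have "?a * (1/3) \<le> ?a * (1/2 - 1 / c) + 2 * real b" using le cm by auto
  ultimately have "?a * (1/3) \<le> ?a * real b / ?s" by linarith
  then have "?a * (1/3) \<le> ?a * (real b / ?s)" by (simp only: times_divide_eq_right)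
  then have "1/3 \<le> real b / ?s" using apos by (simp only: mult_le_cancel_left_pos)
  then have "?s \<le> 3 * real b" using spos by (simp add: field_simps)
  then have "card (stab G (line (axis 1))) \<le> card (powers 1)"
    using card_powers[of 1] by (simp add: od_simps)
  then have "powers 1 = stab G (line (axis 1))"
    by (intro card_seteq finite_stab powers_subset_stab) auto
  then show ?thesis using True by simp
qed

lemma fixing_axis:
  assumes i: "i < 3" and g: "g \<in> G" "g *v axis i = axis i"
  shows "\<exists>j<od i. g = mpow (A i) j"
proof -
  have "g \<in> stab G (line (axis i))"
    using g axis(1)[OF i] by (auto simp: stab_line_iff[OF mat_group_G] intro: exI[of _ 1])
  then obtain j x where jx: "j < od i" "g = mpow (A i) j ** mat x"
    unfolding stab_axis_eq_powers[OF i] by (auto simp: powers_def scalars_def)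
  then have "x *s axis i = 1 *s axis i" using powers_axis(1)[OF i] g(2) by simp
  then have "x = 1" using cancel_scale axis(1)[OF i] by blast
  then show ?thesis using jx by auto
qed

text \<open>A line outside the three orbits that is preserved by a nonscalar element has a
  stabilizer of order at least 2 b. The four orbits together would then contribute at least 1/2 +
  2/3 + 3/4 + 1/2 times the group order, more than the permitted factor 2.\<close>

lemma fixed_line_axis:
  assumes g: "g \<in> G" and ns: "\<And>x. g \<noteq> mat x" and v: "v \<noteq> 0" and gv: "g *v v = x *s v"
  shows "\<exists>i<3. \<exists>h\<in>G. \<exists>d. v = d *s (h *v axis i)"
proof (rule ccontr)
  assume no: "\<not> ?thesis"
  \<comment> \<open>Index 3 adds the hypothetical line to the three axes, so that the inequality can
    be applied to a single family.\<close>
  define w where "w i = (if i < 3 then axis i else v)" for i :: nat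
  let ?a = "real (card G)" and ?s = "card (stab G (line v))"
  have apos: "?a > 0" using finite_G GD(1) by (auto simp: card_gt_0_iff)
  have inq: "act h (line (axis i)) \<noteq> line v" if "i < 3" "h \<in> G" for i h
  proof
    assume "act h (line (axis i)) = line v"
    then have "line v = line (h *v axis i)" by (simp add: act_line)
    then have "\<exists>d. v = d *s (h *v axis i)"
      using line_eq_iff[OF v mult_vec_nonzero[OF GD(4)[OF that(2)] axis(1)[OF that(1)]]] by simp
    then show False using no that by blast
  qed
  have inq': "act h (line v) \<noteq> line (axis i)" if "i < 3" "h \<in> G" for i h
    using inq[OF that(1) GD(3)[OF that(2)]] act_bij_cancel(1)[OF GD(4)[OF that(2)], of "line v"] by metis
  have "(\<Sum>i\<in>{0,1,2,3}. ?a - ?a * real b / real (card (stab G (line (w i))))) \<le> 2 * (?a - real b)"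
  proof (rule fixed_lines_inequality[where v = w and I = "{0,1,2,3}", OF finite_G mat_group_G])
    fix i j :: nat and h assume ij: "i \<in> {0,1,2,3}" "j \<in> {0,1,2,3}" "i \<noteq> j" and h: "h \<in> G"
    then show "act h (line (w i)) \<noteq> line (w j)"
      using axes_inequivalent[of i j h] inq[of i h] inq'[of j h]
      by (cases "i < 3"; cases "j < 3") (auto simp: w_def)
  qed (use axis v in \<open>auto simp: w_def\<close>)
  then have "(?a - ?a / 2) + (?a - ?a / 3) + (?a - ?a / c) + (?a - ?a * real b / ?s) \<le> 2 * (?a - real b)"
    using b_pos cm card_powers[of 0] card_powers[of 1] card_powers[of 2]
      stab_axis_eq_powers[of 0] stab_axis_eq_powers[of 1] stab_axis_eq_powers[of 2]
    by (simp add: w_def od_simps)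
  moreover have "?a / c \<le> ?a / 4" using cm by auto
  moreover have "?a * real b / ?s \<le> ?a / 2"
  proof -
    \<comment> \<open>The scalars and their translate by g are two disjoint sets of the same size
      inside the stabilizer.\<close>
    have gs: "(\<lambda>s. g ** s) ` scalars G \<union> scalars G \<subseteq> stab G (line v)"
    proof -
      have "g ** mat y \<in> stab G (line v)" if "mat y \<in> G" for y
        using GD(2)[OF g that] v gv
        by (auto simp: stab_line_iff[OF mat_group_G] matrix_vector_mul_assoc[symmetric] mat_vec mv_scale vector_smult_assoc)
      then show ?thesis using scalars_subset_stab[OF finite_G mat_group_G] by (auto simp: scalars_def)
    qed
    have disj: "(\<lambda>s. g ** s) ` scalars G \<inter> scalars G = {}"
    proof (rule ccontr)
      assume "\<not> ?thesis"
      then obtain y y' where y: "mat y \<in> G" "g ** mat y = mat y'" by (auto simp: scalars_def)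
      have "g = mat y' ** matrix_inv (mat y)" using inv_cancel(7)[OF GD(4)[OF y(1)], of g] y(2) by simp
      moreover have "matrix_inv (mat y :: complex^2^2) = mat (1 / y)"
        using GD(4)[OF y(1)] by (intro matrix_inv_eqI(1)) (simp add: mat_mult_mat invertible_det_nz det_mat2)
      ultimately show False using ns by (simp add: mat_mult_mat)
    qed
    have "inj_on (\<lambda>s. g ** s) (scalars G)"
      using inv_cancel(3)[OF GD(4)[OF g]] by (metis inj_onI)
    then have "card ((\<lambda>s. g ** s) ` scalars G \<union> scalars G) = 2 * b"
      using finite_scalars disj by (simp add: card_Un_disjoint card_image)
    then have "2 * b \<le> ?s" using card_mono[OF finite_stab gs] by simp
    then have "real b / ?s \<le> 1 / 2" using b_pos by (simp add: divide_le_eq)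
    then have "?a * (real b / ?s) \<le> ?a * (1 / 2)" using apos by (intro mult_left_mono) auto
    then show ?thesis by simp
  qed
  moreover have "real b > 0" using b_pos by simp
  ultimately show False using apos by argo
qed

end

lemma mat_mult_swap: "(mat x ** (g :: complex^2^2)) ** (mat y ** h) = mat (x * y) ** (g ** (h :: complex^2^2))"
proof -
  have "(mat x ** g) ** (mat y ** h) = mat x ** (g ** mat y) ** h" by (simp add: matrix_mul_assoc)
  also have "\<dots> = (mat x ** mat y) ** (g ** h)"
    unfolding mat_comm[of g] by (simp add: matrix_mul_assoc)
  finally show ?thesis by (simp add: mat_mult_mat)
qed

definition conj_in :: "(complex^2^2) set \<Rightarrow> complex^2^2 \<Rightarrow> complex^2^2 \<Rightarrow> bool" where
  "conj_in H p q \<longleftrightarrow> (\<exists>g\<in>H. q = g ** p ** matrix_inv g)"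

section \<open>Subgroups generated by two or three of the reflections\<close>

context triangle_group
begin

definition sub :: "nat set \<Rightarrow> (complex^2^2) set" where
  "sub I = generated_group (A ` I)"

context
  fixes I :: "nat set"
  assumes I: "I \<subseteq> {..<3}" and two: "{0,1} \<subseteq> I \<or> {0,2} \<subseteq> I \<or> {1,2} \<subseteq> I"
begin

lemma less_3_I: "i \<in> I \<Longrightarrow> i < 3"
  using I by auto

lemma mat_group_sub: "mat_group (sub I)"
  unfolding sub_def by (rule mat_group_generated) (auto intro: unitaryD(1) unitary less_3_I)

lemmas SD = mat_groupD[OF mat_group_sub]

lemma A_in_sub: "i \<in> I \<Longrightarrow> A i \<in> sub I"
  by (auto simp: sub_def intro: generated_group.incl)

lemma sub_subset_G: "sub I \<subseteq> G"
  unfolding sub_def by (rule generated_group_subset[OF mat_group_G]) (use less_3_I A_in_G in auto)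

lemma z_nonzero: "z \<noteq> 0"
proof -
  have "mat z \<in> G" unfolding prod_A[symmetric] by (intro GD(2) A_in_G) auto
  then show ?thesis using GD(4)[of "mat z"] by (auto simp: invertible_det_nz det_mat2)
qed

text \<open>The product relation turns an omitted generator into a scalar times an element of
  \<open>sub I\<close>, so \<open>scaled\<close> contains all of \<open>G\<close>. Scalars preserve
  every line; this is how statements about fixed lines of \<open>G\<close> descend to
  \<open>sub I\<close>, with conjugating elements taken from \<open>sub I\<close>.\<close>

definition scaled :: "(complex^2^2) set" where
  "scaled = {mat x ** h | x h. x \<noteq> 0 \<and> h \<in> sub I}"

lemma scaledI: "x \<noteq> 0 \<Longrightarrow> h \<in> sub I \<Longrightarrow> mat x ** h \<in> scaled"
  by (auto simp: scaled_def)

lemma mat_group_scaled: "mat_group scaled"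
  unfolding mat_group_def
proof (intro conjI ballI)
  show "mat 1 \<in> scaled" using scaledI[of 1 "mat 1"] SD(1) by simp
next
  fix g h assume "g \<in> scaled" "h \<in> scaled"
  then obtain x g' y h' where "g = mat x ** g'" "x \<noteq> 0" "g' \<in> sub I" "h = mat y ** h'" "y \<noteq> 0" "h' \<in> sub I"
    by (auto simp: scaled_def)
  then show "g ** h \<in> scaled" using scaledI[of "x * y" "g' ** h'"] SD(2) by (simp add: mat_mult_swap)
next
  fix g assume "g \<in> scaled"
  then obtain x g' where g: "g = mat x ** g'" "x \<noteq> 0" "g' \<in> sub I" by (auto simp: scaled_def)
  define h where "h = mat (1 / x) ** matrix_inv g'"
  have "g ** h = mat 1" "h ** g = mat 1"
    using g inv_cancel(1,2)[OF SD(4)[OF g(3)]] by (simp_all add: h_def mat_mult_swap)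
  moreover have "h \<in> scaled" unfolding h_def using g SD(3) by (intro scaledI) auto
  ultimately show "\<exists>h\<in>scaled. g ** h = mat 1 \<and> h ** g = mat 1" by blast
qed

lemma scalar_in_scaled: "x \<noteq> 0 \<Longrightarrow> mat x \<in> scaled"
  using scaledI[OF _ SD(1)] by simp

lemma sub_in_scaled: "g \<in> sub I \<Longrightarrow> g \<in> scaled"
  using scaledI[of 1 g] by simp

lemma A_in_scaled:
  assumes "i < 3"
  shows "A i \<in> scaled"
proof (cases "i \<in> I")
  case True
  then show ?thesis using A_in_sub sub_in_scaled by blast
next
  case False
  note C = mat_groupD[OF mat_group_scaled]
  have in_I: "j \<in> I" if "j < 3" "j \<noteq> i" for j
    using two that assms False by (auto simp: less_3)
  have inv: "invertible (A j)" if "j < 3" for j using unitaryD(1)[OF unitary[OF that]] .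
  have z: "mat z \<in> scaled" using scalar_in_scaled z_nonzero by blast
  have s: "A j \<in> scaled" if "j < 3" "j \<noteq> i" for j using A_in_sub sub_in_scaled in_I[OF that] by blast
  consider "i = 0" | "i = 1" | "i = 2" using assms by linarith
  then show ?thesis
  proof cases
    case 1
    have "A 0 = mat z ** matrix_inv (A 2) ** matrix_inv (A 1)"
      unfolding prod_A[symmetric] using inv_cancel(7)[OF inv, of 2] inv_cancel(7)[OF inv, of 1] by simp
    then show ?thesis using C(2,3) z s[of 1] s[of 2] 1 by auto
  next
    case 2
    have "A 1 = matrix_inv (A 0) ** mat z ** matrix_inv (A 2)"
      unfolding prod_A[symmetric] matrix_mul_assoc
      using inv_cancel(7)[OF inv, of 2] inv_cancel(1)[OF inv, of 0] by simp
    then show ?thesis using C(2,3) z s[of 0] s[of 2] 2 by auto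
  next
    case 3
    have "A 2 = matrix_inv (A 1) ** (matrix_inv (A 0) ** mat z)"
      unfolding prod_A[symmetric] matrix_mul_assoc[symmetric]
      using inv_cancel(3)[OF inv, of 0] inv_cancel(3)[OF inv, of 1] by simp
    then show ?thesis using C(2,3) z s[of 0] s[of 1] 3 by auto
  qed
qed

lemma G_subset_scaled: "G \<subseteq> scaled"
  unfolding G_def by (rule generated_group_subset[OF mat_group_scaled]) (use A_in_scaled in auto)

text \<open>Multiplicativity alone would allow \<open>\<psi> i\<close> to vanish identically; a
  generator on which it has the value 1 excludes that.\<close>

lemma psi_one: 
  assumes "i < 3"
  shows "\<psi> i (mat 1) = 1"
proof -
  obtain j where j: "j < 3" "i \<noteq> j" using that[of 0] that[of 1] by force
  have "\<psi> i (mat 1 ** A j) = \<psi> i (mat 1) * \<psi> i (A j)" by (rule psi_mult) (use GD(1) A_in_G j in auto)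
  then show ?thesis using psi_other[OF assms j] by simp
qed

lemma psi_power: "i < 3 \<Longrightarrow> g \<in> G \<Longrightarrow> \<psi> i (mpow g k) = \<psi> i g ^ k"
  by (induction k) (simp_all add: psi_one psi_mult GD(5))

lemma psi_kernel:
  assumes "i < 3" "X \<subseteq> G" "\<And>g. g \<in> X \<Longrightarrow> \<psi> i g = 1" "g \<in> generated_group X"
  shows "\<psi> i g = 1"
proof -
  have "mat_group {g \<in> G. \<psi> i g = 1}"
    unfolding mat_group_def
  proof (intro conjI ballI)
    fix g assume g: "g \<in> {g \<in> G. \<psi> i g = 1}"
    then have gi: "g ** matrix_inv g = mat 1" "matrix_inv g ** g = mat 1" "matrix_inv g \<in> G"
      using inv_cancel(1,2) GD(3,4) by auto
    then have "\<psi> i (g ** matrix_inv g) = \<psi> i g * \<psi> i (matrix_inv g)" using g by (intro psi_mult) auto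
    then have "\<psi> i (matrix_inv g) = 1" using g gi psi_one[OF assms(1)] by simp
    then show "\<exists>h\<in>{g \<in> G. \<psi> i g = 1}. g ** h = mat 1 \<and> h ** g = mat 1" using gi by blast
  qed (use psi_one[OF assms(1)] psi_mult GD in auto)
  then have "generated_group X \<subseteq> {g \<in> G. \<psi> i g = 1}"
    by (rule generated_group_subset) (use assms in auto)
  then show ?thesis using assms(4) by auto
qed

lemma psi_conj:
  assumes "i < 3" "g \<in> G" "p \<in> G"
  shows "\<psi> i (g ** p ** matrix_inv g) = \<psi> i p"
proof -
  have "\<psi> i (g ** matrix_inv g) = \<psi> i g * \<psi> i (matrix_inv g)"
    by (rule psi_mult) (use assms GD(3) in auto)
  then have "\<psi> i g * \<psi> i (matrix_inv g) = 1"
    using psi_one[OF assms(1)] inv_cancel(2)[OF GD(4)[OF assms(2)]] by simp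
  moreover have "\<psi> i (g ** p ** matrix_inv g) = \<psi> i g * \<psi> i p * \<psi> i (matrix_inv g)"
    using assms GD(2,3) by (simp add: psi_mult)
  ultimately show ?thesis by (simp add: mult_ac)
qed

lemma card_fixing_axis:
  assumes i: "i \<in> I"
  shows "card {g \<in> sub I. g *v axis i = axis i} = od i"
proof -
  have i3: "i < 3" using i less_3_I by blast
  note ax = axis[OF i3]
  have "{g \<in> sub I. g *v axis i = axis i} = mpow (A i) ` {..<od i}"
  proof
    show "{g \<in> sub I. g *v axis i = axis i} \<subseteq> mpow (A i) ` {..<od i}"
      using fixing_axis[OF i3] sub_subset_G by blast
    show "mpow (A i) ` {..<od i} \<subseteq> {g \<in> sub I. g *v axis i = axis i}"
      using mpow_eigen[of "A i" "axis i" 1] ax SD(5)[OF A_in_sub[OF i]] by auto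
  qed
  moreover have "inj_on (mpow (A i)) {..<od i}"
  proof (rule inj_onI)
    fix j k assume jk: "j \<in> {..<od i}" "k \<in> {..<od i}" "mpow (A i) j = mpow (A i) k"
    have "zeta (od i) ^ j *s perp (axis i) = zeta (od i) ^ k *s perp (axis i)"
      using mpow_eigen[OF ax(3), of j] mpow_eigen[OF ax(3), of k] jk(3) by metis
    then have "zeta (od i) ^ j = zeta (od i) ^ k" using cancel_scale[of "perp (axis i)"] ax(1) by simp
    then show "j = k" using zeta_pow_inj jk by auto
  qed
  ultimately show ?thesis by (simp add: card_image)
qed

text \<open>The fixed line of q is a translate of an axis, so q is conjugate to a power of
  \<open>A i\<close> for some i. The geometry of lines cannot tell whether i belongs to
  \<open>I\<close>; the character \<open>\<psi> i\<close> can.\<close>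

lemma fixer_conj:
  assumes q: "q \<in> sub I" "q \<noteq> mat 1" and v: "v \<noteq> 0" "q *v v = v"
  obtains i g j where "i \<in> I" "g \<in> sub I" "0 < j" "j < od i" "q = g ** mpow (A i) j ** matrix_inv g"
    "card {h \<in> sub I. h *v v = v} = od i"
proof -
  have ns: "q \<noteq> mat x" for x
  proof
    assume x: "q = mat x"
    then have "x *s v = 1 *s v" using v by (simp add: mat_vec)
    then have "x = 1" using cancel_scale[OF v(1)] by blast
    then show False using q x by simp
  qed
  obtain i h d where i: "i < 3" and h: "h \<in> G" and vd: "v = d *s (h *v axis i)"
    using fixed_line_axis[of q v 1, OF _ ns v(1)] q(1) sub_subset_G v(2) by auto
  obtain x g where g: "x \<noteq> 0" "g \<in> sub I" "h = mat x ** g"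
    using h G_subset_scaled by (auto simp: scaled_def)
  \<comment> \<open>The element of \<open>G\<close> that moves the axis is replaced by an element of
    \<open>sub I\<close>, and the scalar between them is absorbed into the multiple of the
    vector.\<close>
  define e where "e = d * x"
  have ve: "v = e *s (g *v axis i)"
    by (simp add: vd g(3) e_def matrix_vector_mul_assoc[symmetric] mat_vec vector_smult_assoc)
  have e: "e \<noteq> 0" using ve v by auto
  have gi: "invertible g" using SD(4)[OF g(2)] .
  have fix_iff: "h *v v = v \<longleftrightarrow> (matrix_inv g ** h ** g) *v axis i = axis i" for h
  proof -
    have "h *v v = v \<longleftrightarrow> e *s (h *v (g *v axis i)) = e *s (g *v axis i)"
      by (simp only: ve mv_scale)
    also have "\<dots> \<longleftrightarrow> h *v (g *v axis i) = g *v axis i" using scale_left_cancel[OF e] by auto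
    also have "\<dots> \<longleftrightarrow> matrix_inv g *v (h *v (g *v axis i)) = axis i"
      using inv_cancel(5,6)[OF gi] by metis
    finally show ?thesis by (simp add: matrix_vector_mul_assoc matrix_mul_assoc)
  qed
  define q' where "q' = matrix_inv g ** q ** g"
  have q': "q' \<in> sub I" "q' *v axis i = axis i"
    using fix_iff[of q] v SD(2,3) g q by (auto simp: q'_def)
  then obtain j where j: "j < od i" "q' = mpow (A i) j" using fixing_axis[OF i] sub_subset_G by blast
  have qq: "q = g ** q' ** matrix_inv g"
    by (simp add: q'_def matrix_mul_assoc inv_cancel[OF gi])
  have "j \<noteq> 0" using qq j q inv_cancel(2)[OF gi] by (cases "j = 0") auto
  then have j0: "0 < j" by simp
  \<comment> \<open>For i outside \<open>I\<close> the character \<open>\<psi> i\<close> is trivial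
    on the generators of \<open>sub I\<close>, hence on q', but not on a nontrivial power of
    \<open>A i\<close>.\<close>
  have iI: "i \<in> I"
  proof (rule ccontr)
    assume "i \<notin> I"
    have "\<psi> i q' = 1"
    proof (rule psi_kernel[OF i])
      show "A ` I \<subseteq> G" using less_3_I A_in_G by blast
      show "q' \<in> generated_group (A ` I)" using q'(1) by (simp add: sub_def)
      fix p assume "p \<in> A ` I"
      then obtain k where "k \<in> I" "p = A k" by blast
      then show "\<psi> i p = 1" using psi_other[OF i less_3_I, of k] \<open>i \<notin> I\<close> by metis
    qed
    then show False using psi_own[OF i j0 j(1)] psi_power[OF i A_in_G[OF i]] j(2) by simp
  qed
  have "bij_betw (\<lambda>h. g ** h ** matrix_inv g) {h \<in> sub I. h *v axis i = axis i} {h \<in> sub I. h *v v = v}"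
  proof (rule bij_betw_byWitness[where f' = "\<lambda>h. matrix_inv g ** h ** g"])
    have 1: "matrix_inv g ** (g ** h ** matrix_inv g) ** g = h" for h
      by (simp add: matrix_mul_assoc inv_cancel[OF gi])
    have 2: "g ** (matrix_inv g ** h ** g) ** matrix_inv g = h" for h
      by (simp add: matrix_mul_assoc inv_cancel[OF gi])
    show "\<forall>h\<in>{h \<in> sub I. h *v axis i = axis i}. matrix_inv g ** (g ** h ** matrix_inv g) ** g = h"
      "\<forall>h\<in>{h \<in> sub I. h *v v = v}. g ** (matrix_inv g ** h ** g) ** matrix_inv g = h"
      using 1 2 by blast+
    have "g ** h ** matrix_inv g \<in> sub I \<and> (g ** h ** matrix_inv g) *v v = v"
      if "h \<in> sub I" "h *v axis i = axis i" for h
      using that fix_iff[of "g ** h ** matrix_inv g"] 1[of h] SD(2)[OF SD(2)[OF g(2) that(1)] SD(3)[OF g(2)]]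
      by simp
    then show "(\<lambda>h. g ** h ** matrix_inv g) ` {h \<in> sub I. h *v axis i = axis i} \<subseteq> {h \<in> sub I. h *v v = v}"
      by blast
    have "matrix_inv g ** h ** g \<in> sub I \<and> (matrix_inv g ** h ** g) *v axis i = axis i"
      if "h \<in> sub I" "h *v v = v" for h
      using that fix_iff[of h] SD(2)[OF SD(2)[OF SD(3)[OF g(2)] that(1)] g(2)] by blast
    then show "(\<lambda>h. matrix_inv g ** h ** g) ` {h \<in> sub I. h *v v = v} \<subseteq> {h \<in> sub I. h *v axis i = axis i}"
      by blast
  qed
  from bij_betw_same_card[OF this] have "card {h \<in> sub I. h *v v = v} = od i"
    using card_fixing_axis[OF iI] by simp
  then show ?thesis using that[OF iI g(2) j0 j(1)] qq j(2) by simp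
qed

text \<open>By \<open>fixer_conj\<close> the element q is conjugate to \<open>mpow (A i) j\<close>
  and the fixer of v has order \<open>od i\<close>. The prescribed determinant gives
  \<open>zeta (od i) ^ j = zeta (od i)\<close>, so j = 1.\<close>

theorem distinguished_reflection_conj:
  assumes q: "q \<in> sub I" "q \<noteq> mat 1" and v: "v \<noteq> 0" "q *v v = v"
    and det: "det q = zeta (card {h \<in> sub I. h *v v = v})"
  shows "\<exists>i\<in>I. conj_in (sub I) (A i) q"
proof -
  obtain i g j where i: "i \<in> I" and g: "g \<in> sub I" and j: "0 < j" "j < od i"
    and qe: "q = g ** mpow (A i) j ** matrix_inv g" and c: "card {h \<in> sub I. h *v v = v} = od i"
    by (rule fixer_conj[OF q v])
  have i3: "i < 3" using less_3_I i by blast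
  have "det g * det (matrix_inv g) = 1"
    using inv_cancel(2)[OF SD(4)[OF g]] by (metis det_I det_mul)
  then have "det q = det (mpow (A i) j)" by (simp add: qe det_mul mult_ac)
  also have "\<dots> = 1 ^ j * zeta (od i) ^ j"
    using mpow_eigen[of "A i" "axis i" 1 j] mpow_eigen[OF axis(3)[OF i3], of j] axis[OF i3]
    by (intro frame_det(1)) auto
  finally have "zeta (od i) ^ 1 = zeta (od i) ^ j" using det c by simp
  then have "j = 1" using zeta_pow_inj[of "od i" 1 j] j by auto
  then show ?thesis using i g qe by (auto simp: conj_in_def)
qed

text \<open>As Q is closed under conjugation, missing \<open>A i\<close> means missing all its
  conjugates. Then \<open>\<psi> i\<close> is trivial on Q and on the group generated by Q, which
  nevertheless contains \<open>A i\<close>.\<close>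

theorem generating_reflections:
  assumes Q: "generated_group Q = sub I"
    and conj: "\<And>q. q \<in> Q \<Longrightarrow> \<exists>i\<in>I. conj_in (sub I) (A i) q"
    and closed: "\<And>q g. q \<in> Q \<Longrightarrow> g \<in> sub I \<Longrightarrow> g ** q ** matrix_inv g \<in> Q"
    and i: "i \<in> I"
  shows "A i \<in> Q"
proof (rule ccontr)
  assume no: "A i \<notin> Q"
  have i3: "i < 3" using less_3_I i by blast
  have QG: "Q \<subseteq> G" using Q sub_subset_G generated_group.incl by blast
  have "\<psi> i q = 1" if q: "q \<in> Q" for q
  proof -
    obtain j g where j: "j \<in> I" and g: "g \<in> sub I" and qe: "q = g ** A j ** matrix_inv g"
      using conj[OF q] by (auto simp: conj_in_def)
    have "matrix_inv g ** q ** matrix_inv (matrix_inv g) \<in> Q" using closed[OF q SD(3)[OF g]] .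
    moreover have "matrix_inv (matrix_inv g) = g"
      by (rule matrix_inv_eqI(1)) (rule inv_cancel(1)[OF SD(4)[OF g]])
    ultimately have "A j \<in> Q"
      by (simp add: qe matrix_mul_assoc inv_cancel[OF SD(4)[OF g]])
    then have "i \<noteq> j" using no by blast
    then show ?thesis
      unfolding qe using psi_conj[OF i3, of g "A j"] psi_other[OF i3, of j] sub_subset_G g j less_3_I A_in_G by auto
  qed
  then have "\<psi> i (A i) = 1" using psi_kernel[OF i3 QG, of "A i"] Q A_in_sub[OF i] by simp
  then show False using psi_own[OF i3, of 1] od_bounds[OF i3] by simp
qed

end

end

section \<open>Modules over subrings of the complex numbers\<close>

lemma Inter_submodule_over:
  "(\<And>M. M \<in> MM \<Longrightarrow> submodule_over R scl M) \<Longrightarrow> submodule_over R scl (\<Inter>MM)"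
  unfolding submodule_over_def by blast

lemma submodule_span_over: "submodule_over R scl (span_over R scl S)"
  unfolding span_over_def by (rule hull_in) (auto intro!: Inter_submodule_over)

lemma span_over_superset: "S \<subseteq> span_over R scl S"
  unfolding span_over_def by (rule hull_subset)

lemma span_over_least: "S \<subseteq> M \<Longrightarrow> submodule_over R scl M \<Longrightarrow> span_over R scl S \<subseteq> M"
  unfolding span_over_def by (rule hull_minimal)

lemma span_over_mono: "S \<subseteq> T \<Longrightarrow> span_over R scl S \<subseteq> span_over R scl T"
  unfolding span_over_def by (rule hull_mono)

lemma submodule_overD:
  assumes "submodule_over R scl M"
  shows "0 \<in> M" "x \<in> M \<Longrightarrow> y \<in> M \<Longrightarrow> x + y \<in> M" "r \<in> R \<Longrightarrow> x \<in> M \<Longrightarrow> scl r x \<in> M"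
  using assms by (auto simp: submodule_over_def)

lemmas span_overD = submodule_overD[OF submodule_span_over]

lemma span_over_base: "x \<in> S \<Longrightarrow> x \<in> span_over R scl S"
  using span_over_superset by blast

text \<open>The twist \<sigma> covers conjugate-linear maps as well, with \<sigma> =
  \<open>cnj\<close>; they arise on the second side of a Hermitian pairing.\<close>

lemma span_over_image:
  fixes f :: "'a::ab_group_add \<Rightarrow> 'b::ab_group_add"
  assumes add: "\<And>x y. f (x + y) = f x + f y"
    and scl: "\<And>r x. f (scl1 r x) = scl2 (\<sigma> r) (f x)" and \<sigma>: "\<sigma> ` R = R"
  shows "f ` span_over R scl1 S = span_over R scl2 (f ` S)"
proof
  have f0: "f 0 = 0" using add[of 0 0] by simp
  have "submodule_over R scl1 (f -` span_over R scl2 (f ` S))"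
    unfolding submodule_over_def vimage_eq f0 add scl
    using span_overD(1)[of R scl2] span_overD(2)[of _ R scl2] span_overD(3)[of _ R _ scl2] \<sigma> by blast
  then have "span_over R scl1 S \<subseteq> f -` span_over R scl2 (f ` S)"
    by (rule span_over_least[rotated]) (auto intro: span_over_base)
  then show "f ` span_over R scl1 S \<subseteq> span_over R scl2 (f ` S)" by blast
  have "submodule_over R scl2 (f ` span_over R scl1 S)"
    unfolding submodule_over_def
  proof (intro conjI ballI)
    show "0 \<in> f ` span_over R scl1 S" using f0 span_overD(1) by (metis image_eqI)
  next
    fix u v assume "u \<in> f ` span_over R scl1 S" "v \<in> f ` span_over R scl1 S"
    then obtain x y where "u = f x" "v = f y" "x \<in> span_over R scl1 S" "y \<in> span_over R scl1 S" by blast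
    then show "u + v \<in> f ` span_over R scl1 S" using add span_overD(2) by (metis image_eqI)
  next
    fix t u assume t: "t \<in> R" and "u \<in> f ` span_over R scl1 S"
    then obtain x where x: "u = f x" "x \<in> span_over R scl1 S" by blast
    obtain r where "r \<in> R" "t = \<sigma> r" using t \<sigma> by blast
    then show "scl2 t u \<in> f ` span_over R scl1 S" using scl x span_overD(3) by (metis image_eqI)
  qed
  then show "span_over R scl2 (f ` S) \<subseteq> f ` span_over R scl1 S"
    by (rule span_over_least[rotated]) (auto intro: span_over_base)
qed

definition ring_set :: "complex set \<Rightarrow> bool" where
  "ring_set R \<longleftrightarrow> 0 \<in> R \<and> 1 \<in> R \<and> (\<forall>x\<in>R. \<forall>y\<in>R. x + y \<in> R \<and> x * y \<in> R)"

lemma ring_setD: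
  assumes "ring_set R"
  shows "0 \<in> R" "1 \<in> R" "x \<in> R \<Longrightarrow> y \<in> R \<Longrightarrow> x + y \<in> R" "x \<in> R \<Longrightarrow> y \<in> R \<Longrightarrow> x * y \<in> R"
    "submodule_over R (*) R"
  using assms by (auto simp: ring_set_def submodule_over_def)

lemma span_over_singleton:
  assumes "ring_set R"
  shows "span_over R (*s) {v :: complex^'n} = {c *s v | c. c \<in> R}"
proof
  have "submodule_over R (*s) {c *s v | c. c \<in> R}"
    unfolding submodule_over_def
  proof (intro conjI ballI)
    show "0 \<in> {c *s v | c. c \<in> R}" using ring_setD(1)[OF assms] by force
  next
    fix x y assume "x \<in> {c *s v | c. c \<in> R}" "y \<in> {c *s v | c. c \<in> R}"
    then obtain a b where ab: "x = a *s v" "y = b *s v" "a \<in> R" "b \<in> R" by blast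
    have "x + y = (a + b) *s v" by (simp add: ab vector_sadd_rdistrib)
    then show "x + y \<in> {c *s v | c. c \<in> R}" using ring_setD(3)[OF assms] ab by blast
  next
    fix r x assume "r \<in> R" "x \<in> {c *s v | c. c \<in> R}"
    then obtain a where a: "r \<in> R" "x = a *s v" "a \<in> R" by blast
    have "r *s x = (r * a) *s v" by (simp add: a vector_smult_assoc)
    then show "r *s x \<in> {c *s v | c. c \<in> R}" using ring_setD(4)[OF assms] a by blast
  qed
  moreover have "v \<in> {c *s v | c. c \<in> R}" using ring_setD(2)[OF assms] by force
  ultimately show "span_over R (*s) {v} \<subseteq> {c *s v | c. c \<in> R}" by (intro span_over_least) auto
  show "{c *s v | c. c \<in> R} \<subseteq> span_over R (*s) {v}"
  proof -
    have "c *s v \<in> span_over R (*s) {v}" if "c \<in> R" for c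
      by (rule span_overD(3)[OF that]) (simp add: span_over_base)
    then show ?thesis by blast
  qed
qed

definition mprod :: "complex set \<Rightarrow> complex set \<Rightarrow> complex set \<Rightarrow> complex set" where
  "mprod R a b = span_over R (*) {x * y | x y. x \<in> a \<and> y \<in> b}"

lemma mprod_submodule: "submodule_over R (*) (mprod R a b)"
  unfolding mprod_def by (rule submodule_span_over)

lemma mprodI: "x \<in> a \<Longrightarrow> y \<in> b \<Longrightarrow> x * y \<in> mprod R a b"
  unfolding mprod_def by (intro span_over_base) blast

lemma mprod_least:
  "(\<And>x y. x \<in> a \<Longrightarrow> y \<in> b \<Longrightarrow> x * y \<in> M) \<Longrightarrow> submodule_over R (*) M \<Longrightarrow> mprod R a b \<subseteq> M"
  unfolding mprod_def by (intro span_over_least) auto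

lemma mprod_comm: "mprod R a b = mprod R b a"
proof -
  have "{x * y | x y. x \<in> a \<and> y \<in> b} = {x * y | x y. x \<in> b \<and> y \<in> a}"
    using mult.commute by blast
  then show ?thesis by (simp add: mprod_def)
qed

text \<open>Extends a bound on products of generators to products with a whole span, one factor at a
  time.\<close>

lemma submodule_colon:
  "submodule_over R (*) M \<Longrightarrow> submodule_over R (*) {x. \<forall>y\<in>b. x * y \<in> M}"
  unfolding submodule_over_def by (auto simp: algebra_simps)

lemma mprod_assoc_subset: "mprod R (mprod R a b) c \<subseteq> mprod R a (mprod R b c)"
proof (rule mprod_least[OF _ mprod_submodule])
  fix x z assume x: "x \<in> mprod R a b" and z: "z \<in> c"
  have "mprod R a b \<subseteq> {x. \<forall>z\<in>c. x * z \<in> mprod R a (mprod R b c)}"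
  proof (rule mprod_least[OF _ submodule_colon[OF mprod_submodule]])
    fix u v assume "u \<in> a" "v \<in> b"
    then show "u * v \<in> {x. \<forall>z\<in>c. x * z \<in> mprod R a (mprod R b c)}"
      by (auto simp: mult.assoc intro!: mprodI)
  qed
  then show "x * z \<in> mprod R a (mprod R b c)" using x z by blast
qed

lemma mprod_assoc: "mprod R (mprod R a b) c = mprod R a (mprod R b c)"
proof
  show "mprod R a (mprod R b c) \<subseteq> mprod R (mprod R a b) c"
    using mprod_assoc_subset[of R c b a] by (metis mprod_comm)
qed (rule mprod_assoc_subset)

lemma mprod_unit:
  assumes "ring_set R" "submodule_over R (*) a"
  shows "mprod R R a = a"
proof
  show "mprod R R a \<subseteq> a" by (rule mprod_least) (use assms submodule_overD in auto)
  show "a \<subseteq> mprod R R a" using mprodI[OF ring_setD(2)[OF assms(1)], of _ a R] by auto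
qed

text \<open>Expand 1 in the product of the module and its inverse.\<close>

lemma invertible_finitely_generated:
  assumes R: "ring_set R" and a: "submodule_over R (*) a" and ab: "mprod R a b = R"
  shows "\<exists>F. finite F \<and> F \<subseteq> a \<and> a = span_over R (*) F"
proof -
  \<comment> \<open>The multipliers that push \<open>a\<close> into the span of finitely many of its
    own elements. For x in \<open>a\<close> and y in \<open>b\<close> the identity (x y) u = (u y) x
    with u y in R shows that x y is such a multiplier, with the single element x.\<close>
  define M where "M = {t. \<exists>F. finite F \<and> F \<subseteq> a \<and> (\<forall>x\<in>a. t * x \<in> span_over R (*) F)}"
  have "submodule_over R (*) M"
    unfolding submodule_over_def
  proof (intro conjI ballI)
    show "0 \<in> M" unfolding M_def by (auto intro!: exI[of _ "{}"] span_overD)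
  next
    fix s t assume "s \<in> M" "t \<in> M"
    then obtain F F' where F: "finite F" "F \<subseteq> a" "\<And>x. x \<in> a \<Longrightarrow> s * x \<in> span_over R (*) F"
      "finite F'" "F' \<subseteq> a" "\<And>x. x \<in> a \<Longrightarrow> t * x \<in> span_over R (*) F'"
      by (auto simp: M_def)
    have "s * x + t * x \<in> span_over R (*) (F \<union> F')" if "x \<in> a" for x
      using F(3)[OF that] F(6)[OF that] span_over_mono[of F "F \<union> F'" R "(*)"] span_over_mono[of F' "F \<union> F'" R "(*)"]
      by (intro span_overD(2)) auto
    then show "s + t \<in> M" using F unfolding M_def
      by (auto simp: distrib_right intro!: exI[of _ "F \<union> F'"])
  next
    fix r t assume "r \<in> R" "t \<in> M"
    then show "r * t \<in> M" unfolding M_def by (auto simp: mult.assoc intro: span_overD(3))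
  qed
  moreover have "x * y \<in> M" if "x \<in> a" "y \<in> b" for x y
  proof -
    have "(x * y) * u \<in> span_over R (*) {x}" if u: "u \<in> a" for u
    proof -
      have "u * y \<in> R" using mprodI[OF u \<open>y \<in> b\<close>, of R] ab by simp
      then have "(u * y) * x \<in> span_over R (*) {x}" by (rule span_overD(3)) (simp add: span_over_base)
      then show ?thesis by (simp add: mult_ac)
    qed
    then show ?thesis using that unfolding M_def by (auto intro!: exI[of _ "{x}"])
  qed
  ultimately have "mprod R a b \<subseteq> M" by (intro mprod_least)
  then have "1 \<in> M" using ab ring_setD(2)[OF R] by blast
  then obtain F where "finite F" "F \<subseteq> a" "a \<subseteq> span_over R (*) F" by (auto simp: M_def)
  then show ?thesis using span_over_least[OF _ a] by blast
qed

section \<open>Subfields\<close>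

lemma is_subfieldD:
  assumes "is_subfield K"
  shows "1 \<in> K" "0 \<in> K" "x \<in> K \<Longrightarrow> y \<in> K \<Longrightarrow> x - y \<in> K" "x \<in> K \<Longrightarrow> - x \<in> K"
    "x \<in> K \<Longrightarrow> y \<in> K \<Longrightarrow> x + y \<in> K" "x \<in> K \<Longrightarrow> y \<in> K \<Longrightarrow> x * y \<in> K" "x \<in> K \<Longrightarrow> inverse x \<in> K"
    "x \<in> K \<Longrightarrow> y \<in> K \<Longrightarrow> x / y \<in> K" "x \<in> K \<Longrightarrow> x ^ n \<in> K" "of_nat n \<in> K" "numeral w \<in> K"
proof -
  show 1: "1 \<in> K" and d: "\<And>x y. x \<in> K \<Longrightarrow> y \<in> K \<Longrightarrow> x - y \<in> K"
    and m: "\<And>x y. x \<in> K \<Longrightarrow> y \<in> K \<Longrightarrow> x * y \<in> K" and i: "\<And>x. x \<in> K \<Longrightarrow> inverse x \<in> K"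
    using assms by (auto simp: is_subfield_def)
  show 0: "0 \<in> K" using d[OF 1 1] by simp
  show n: "\<And>x. x \<in> K \<Longrightarrow> - x \<in> K" using d[OF 0] by simp
  show p: "\<And>x y. x \<in> K \<Longrightarrow> y \<in> K \<Longrightarrow> x + y \<in> K" using d[OF _ n] by simp
  show "\<And>x y. x \<in> K \<Longrightarrow> y \<in> K \<Longrightarrow> x / y \<in> K" using m[OF _ i] by (simp add: divide_inverse)
  show "x \<in> K \<Longrightarrow> x ^ n \<in> K" by (induction n) (auto intro: 1 m)
  show *: "of_nat n \<in> K" for n by (induction n) (auto intro: 0 p 1)
  show "numeral w \<in> K" using *[of "numeral w"] by simp
qed

lemma subfield_ring_set: "is_subfield K \<Longrightarrow> ring_set K"
  using is_subfieldD by (simp add: ring_set_def)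

lemma subfield_hull: "is_subfield (is_subfield hull S)"
  by (rule hull_in) (auto simp: is_subfield_def)

lemma ring_of_integers_ring_set:
  assumes "is_subfield k"
  shows "ring_set (ring_of_integers k)"
  using is_subfieldD[OF assms] algebraic_int_add_mult
  by (auto simp: ring_set_def ring_of_integers_def int_imp_algebraic_int)

lemma ring_of_integers_minus:
  assumes "is_subfield k" "x \<in> ring_of_integers k"
  shows "- x \<in> ring_of_integers k"
  using is_subfieldD(4)[OF assms(1)] assms(2) by (auto simp: ring_of_integers_def)

lemma field_of_definition_trace: "g \<in> G \<Longrightarrow> trace g \<in> field_of_definition G"
  using hull_subset[of "trace ` G" is_subfield] by (auto simp: field_of_definition_def)

text \<open>The inverse of a unitary matrix has the conjugate trace, so the set of traces generating
  the field is stable under conjugation.\<close>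

lemma field_of_definition_cnj:
  assumes G: "mat_group G" "\<And>g. g \<in> G \<Longrightarrow> unitary g" and x: "x \<in> field_of_definition G"
  shows "cnj x \<in> field_of_definition G"
proof -
  have k: "is_subfield (field_of_definition G)" by (simp add: field_of_definition_def subfield_hull)
  have "is_subfield {x. cnj x \<in> field_of_definition G}"
    unfolding is_subfield_def using is_subfieldD[OF k] by auto
  moreover have "cnj (trace g) \<in> field_of_definition G" if "g \<in> G" for g
  proof -
    have "trace (matrix_inv g) = cnj (trace g)"
      unfolding unitaryD(2)[OF G(2)[OF that]] by (simp add: trace2 mat_adjoint_def)
    then show ?thesis using field_of_definition_trace[OF mat_groupD(3)[OF G(1) that]] by simp
  qed
  ultimately have "is_subfield hull (trace ` G) \<subseteq> {x. cnj x \<in> field_of_definition G}"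
    by (intro hull_minimal) auto
  then show ?thesis using x by (auto simp: field_of_definition_def)
qed

lemma cramer:
  assumes k: "is_subfield k" and "a * d - b * c \<noteq> 0" "a \<in> k" "b \<in> k" "c \<in> k" "d \<in> k"
    and "a * x + b * y \<in> k" "c * x + d * y \<in> k"
  shows "x \<in> k" "y \<in> k"
proof -
  have "x = ((a * x + b * y) * d - b * (c * x + d * y)) / (a * d - b * c)"
    "y = (a * (c * x + d * y) - (a * x + b * y) * c) / (a * d - b * c)"
    using assms(2) by (simp_all add: divide_simps) (simp_all add: algebra_simps)
  then show "x \<in> k" "y \<in> k" using assms(3-) is_subfieldD(3,6,8)[OF k] by metis+
qed

lemma basis_coords:
  assumes "v$1 * w$2 - v$2 * w$1 \<noteq> 0"
  obtains a b where "(x :: complex^2) = a *s v + b *s w"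
proof -
  let ?d = "v$1 * w$2 - v$2 * w$1"
  have "x = ((x$1 * w$2 - x$2 * w$1) / ?d) *s v + ((v$1 * x$2 - v$2 * x$1) / ?d) *s w"
    using assms by (simp add: vec2_eq_iff divide_simps) (simp add: algebra_simps)
  then show ?thesis using that by blast
qed

section \<open>Realizations of unitary groups\<close>

locale realized =
  fixes G :: "(complex^2^2) set" and V W :: "(complex^2) set"
    and p :: "complex^2 \<Rightarrow> complex^2 \<Rightarrow> complex" and k :: "complex set"
  assumes real: "realization G V W p" and k_def: "k = field_of_definition G"
    and mat_group_G: "mat_group G" and finite_G: "finite G" and unitary_G: "\<And>g. g \<in> G \<Longrightarrow> unitary g"
begin

lemmas GD = mat_groupD[OF mat_group_G]

lemma subfield_k: "is_subfield k"
  by (simp add: k_def field_of_definition_def subfield_hull)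

lemmas kD = is_subfieldD[OF subfield_k]

abbreviation "R \<equiv> ring_of_integers k"

lemma R_ring: "ring_set R"
  by (rule ring_of_integers_ring_set[OF subfield_k])

lemmas RD = ring_setD[OF R_ring]

lemma R_subset_k: "R \<subseteq> k"
  by (auto simp: ring_of_integers_def)

lemma cnj_k: "x \<in> k \<Longrightarrow> cnj x \<in> k"
  unfolding k_def by (rule field_of_definition_cnj[OF mat_group_G unitary_G])

lemma cnj_R: "x \<in> R \<Longrightarrow> cnj x \<in> R"
  using cnj_k by (auto simp: ring_of_integers_def)

lemma cnj_image_R: "cnj ` R = R"
  using cnj_R by (metis (no_types, lifting) complex_cnj_cnj image_eqI image_subsetI subsetI subset_antisym)

lemma p_linear:
  "p (x + y) z = p x z + p y z" "p (c *s x) z = c * p x z"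
  "p x (y + z) = p x y + p x z" "p x (c *s z) = cnj c * p x z"
  and p_nondeg: "(\<And>z. p x z = 0) \<Longrightarrow> x = 0" "(\<And>x. p x z = 0) \<Longrightarrow> z = 0"
  and p_in_k: "x \<in> V \<Longrightarrow> z \<in> W \<Longrightarrow> p x z \<in> k"
  using real by (auto simp: realization_def hermitian_pairing_def k_def)

lemma p_zero: "p 0 z = 0" "p x 0 = 0"
  using p_linear(2)[of 0 0 z] p_linear(4)[of x 0 0] by simp_all

lemma p_minus: "p (x - y) z = p x z - p y z"
  using p_linear(1)[of "x - y" y z] by simp

lemma G_V: "g \<in> G \<Longrightarrow> x \<in> V \<Longrightarrow> g *v x \<in> V"
  using real by (auto simp: realization_def)

lemma p_coords: "p x z = x$1 * p (vector [1, 0]) z + x$2 * p (vector [0, 1]) z"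
proof -
  have "x = x$1 *s vector [1, 0] + x$2 *s vector [0, 1]" by (simp add: vec2_eq_iff)
  then have "p x z = p (x$1 *s vector [1, 0] + x$2 *s vector [0, 1]) z" by simp
  then show ?thesis by (simp only: p_linear)
qed

lemma p_coords_right: "p x z = cnj (z$1) * p x (vector [1, 0]) + cnj (z$2) * p x (vector [0, 1])"
proof -
  have "z = z$1 *s vector [1, 0] + z$2 *s vector [0, 1]" by (simp add: vec2_eq_iff)
  then have "p x z = p x (z$1 *s vector [1, 0] + z$2 *s vector [0, 1])" by simp
  then show ?thesis by (simp only: p_linear)
qed

text \<open>\<open>P\<close> is the Gram matrix of p in the standard basis. Because p is semi-linear
  on the right, the solution of the linear system enters conjugated.\<close>

lemma riesz:
  assumes "\<And>x y. f (x + y) = f x + f y" "\<And>c x. f (c *s x) = c * f x"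
  shows "\<exists>z. \<forall>x. f x = p x z"
proof -
  let ?e = "vector [1, 0] :: complex^2" and ?e' = "vector [0, 1] :: complex^2"
  define P :: "complex^2^2" where "P = vector [vector [p ?e ?e, p ?e ?e'], vector [p ?e' ?e, p ?e' ?e']]"
  have P: "(P *v y) $ 1 = p ?e (vector [cnj (y$1), cnj (y$2)])"
    "(P *v y) $ 2 = p ?e' (vector [cnj (y$1), cnj (y$2)])" for y
    by (simp_all add: P_def mat2_vec_nth p_coords_right[of _ "vector [cnj (y$1), cnj (y$2)]"] mult.commute)
  have "det P \<noteq> 0"
  proof
    assume "det P = 0"
    then obtain y where y: "y \<noteq> 0" "P *v y = 0" by (rule singular_kernel)
    have "p x (vector [cnj (y$1), cnj (y$2)]) = 0" for x
      by (subst p_coords) (use P[of y] y(2) in simp)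
    then have "vector [cnj (y$1), cnj (y$2)] = (0 :: complex^2)" by (rule p_nondeg(2))
    then show False using y(1) by (simp add: vec2_eq_iff)
  qed
  then have "invertible P" by (simp add: invertible_det_nz)
  define y where "y = matrix_inv P *v vector [f ?e, f ?e']"
  have Py: "P *v y = vector [f ?e, f ?e']" unfolding y_def by (rule inv_cancel(6)[OF \<open>invertible P\<close>])
  have "f x = p x (vector [cnj (y$1), cnj (y$2)])" for x
  proof -
    have "x = x$1 *s ?e + x$2 *s ?e'" by (simp add: vec2_eq_iff)
    then have "f x = f (x$1 *s ?e + x$2 *s ?e')" by simp
    also have "\<dots> = x$1 * f ?e + x$2 * f ?e'" by (simp only: assms)
    also have "\<dots> = p x (vector [cnj (y$1), cnj (y$2)])"
      by (subst p_coords) (simp add: P[symmetric] Py)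
    finally show ?thesis .
  qed
  then show ?thesis by blast
qed

lemma contragredient_unique:
  assumes "invertible g" "\<And>x z. p (g *v x) (h *v z) = p x z" "\<And>x z. p (g *v x) (h' *v z) = p x z"
  shows "h = h'"
proof -
  have "h *v z = h' *v z" for z
  proof -
    have "p y (h *v z - h' *v z) = 0" for y
    proof -
      have y: "y = g *v (matrix_inv g *v y)" by (simp add: inv_cancel(6)[OF assms(1)])
      have "p y (h *v z) = p y (h' *v z)" by (subst (1 2) y) (simp only: assms)
      moreover have "p y (h *v z) = p y (h *v z - h' *v z) + p y (h' *v z)"
        by (simp flip: p_linear(3))
      ultimately show ?thesis by simp
    qed
    then have "h *v z - h' *v z = 0" by (rule p_nondeg(2))
    then show ?thesis by simp
  qed
  then show ?thesis by (simp add: matrix_eq)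
qed

lemma contragredient:
  assumes g: "invertible g"
  shows "p (g *v x) (contragredient p g *v z) = p x z"
proof -
  let ?e = "vector [1, 0] :: complex^2" and ?e' = "vector [0, 1] :: complex^2"
  have "\<exists>z'. \<forall>x. p (matrix_inv g *v x) z = p x z'" for z
    by (rule riesz) (simp_all add: mv_add mv_scale p_linear)
  then obtain z1 z2 where z: "\<And>x. p (matrix_inv g *v x) ?e = p x z1" "\<And>x. p (matrix_inv g *v x) ?e' = p x z2"
    by metis
  \<comment> \<open>The columns of h represent the functionals that pair the preimage of a vector
    under g with the two standard basis vectors.\<close>
  define h :: "complex^2^2" where "h = vector [vector [z1$1, z2$1], vector [z1$2, z2$2]]"
  have h: "h *v z = z$1 *s z1 + z$2 *s z2" for z
    by (simp add: h_def vec2_eq_iff mat2_vec_nth mult.commute)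
  have *: "p (g *v x) (h *v z) = p x z" for x z
  proof -
    have "p (g *v x) (h *v z) = cnj (z$1) * p (g *v x) z1 + cnj (z$2) * p (g *v x) z2"
      by (simp only: h p_linear)
    also have "\<dots> = p x z"
      unfolding z[symmetric] inv_cancel(5)[OF g] by (rule p_coords_right[symmetric])
    finally show ?thesis .
  qed
  have "contragredient p g = h"
    unfolding contragredient_def
    by (rule the_equality) (use * contragredient_unique[OF g] in blast)+
  then show ?thesis using * by simp
qed

lemma contragredient_eqI:
  "invertible g \<Longrightarrow> (\<And>x z. p (g *v x) (h *v z) = p x z) \<Longrightarrow> contragredient p g = h"
  using contragredient_unique contragredient by blast

lemma contragredient_mult:
  assumes "invertible g" "invertible h"
  shows "contragredient p (g ** h) = contragredient p g ** contragredient p h"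
  by (rule contragredient_eqI)
    (simp_all add: assms invertible_mult contragredient flip: matrix_vector_mul_assoc)

lemma contragredient_one: "contragredient p (mat 1) = mat 1"
  by (rule contragredient_eqI) (simp_all add: invertible_det_nz)

lemma k_form_basis:
  assumes "k_form k (U :: (complex^2) set)"
  obtains v w where "U = {a *s v + b *s w | a b. a \<in> k \<and> b \<in> k}"
    "v$1 * w$2 - v$2 * w$1 \<noteq> 0"
proof -
  obtain B where B: "vec.independent B" "vec.span B = UNIV" "U = span_over k (*s) (B :: (complex^2) set)"
    using assms by (auto simp: k_form_def)
  \<comment> \<open>A k-form is given by an arbitrary complex basis B; the dimension forces it to
    have exactly two elements.\<close>
  have "card B = vec.dim (UNIV :: (complex^2) set)"
    using vec.dim_eq_card[of B UNIV] B(1,2) by simp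
  also have "\<dots> = 2" by (simp add: vec_dim_card[simplified])
  finally have "card B = 2" .
  then obtain v w where vw: "B = {v, w}" "v \<noteq> w" by (auto simp: card_2_iff)
  have "submodule_over k (*s) {a *s v + b *s w | a b. a \<in> k \<and> b \<in> k}"
    unfolding submodule_over_def
  proof (intro conjI ballI)
    have "0 = 0 *s v + 0 *s w" by simp
    then show "0 \<in> {a *s v + b *s w | a b. a \<in> k \<and> b \<in> k}" using kD(2) by blast
  next
    fix x y assume "x \<in> {a *s v + b *s w | a b. a \<in> k \<and> b \<in> k}" "y \<in> {a *s v + b *s w | a b. a \<in> k \<and> b \<in> k}"
    then obtain a b a' b' where ab: "x = a *s v + b *s w" "y = a' *s v + b' *s w" "a \<in> k" "b \<in> k" "a' \<in> k" "b' \<in> k"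
      by blast
    have "x + y = (a + a') *s v + (b + b') *s w" by (simp add: ab vector_sadd_rdistrib)
    then show "x + y \<in> {a *s v + b *s w | a b. a \<in> k \<and> b \<in> k}" using kD(5) ab by blast
  next
    fix r x assume r: "r \<in> k" and "x \<in> {a *s v + b *s w | a b. a \<in> k \<and> b \<in> k}"
    then obtain a b where ab: "x = a *s v + b *s w" "a \<in> k" "b \<in> k" by blast
    have "r *s x = (r * a) *s v + (r * b) *s w" by (simp add: ab vector_add_ldistrib vector_smult_assoc)
    then show "r *s x \<in> {a *s v + b *s w | a b. a \<in> k \<and> b \<in> k}" using kD(6) r ab by blast
  qed
  moreover have "v = 1 *s v + 0 *s w" "w = 0 *s v + 1 *s w" by simp_all
  then have "B \<subseteq> {a *s v + b *s w | a b. a \<in> k \<and> b \<in> k}" unfolding vw using kD(1,2) by blast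
  ultimately have 1: "U \<subseteq> {a *s v + b *s w | a b. a \<in> k \<and> b \<in> k}"
    unfolding B(3) by (intro span_over_least)
  have 2: "{a *s v + b *s w | a b. a \<in> k \<and> b \<in> k} \<subseteq> U"
  proof -
    have "a *s v + b *s w \<in> span_over k (*s) {v, w}" if "a \<in> k" "b \<in> k" for a b
      by (rule span_overD(2); rule span_overD(3)[OF that(1)] span_overD(3)[OF that(2)]; rule span_over_base; simp)
    then show ?thesis unfolding B(3) vw by blast
  qed
  have 3: "v$1 * w$2 - v$2 * w$1 \<noteq> 0"
  proof
    assume d: "v$1 * w$2 - v$2 * w$1 = 0"
    have "w \<noteq> 0" using B(1) vw vec.dependent_zero by blast
    have "\<exists>c. v = c *s w"
    proof (cases "w$1 = 0")
      case False
      then have "v = (v$1 / w$1) *s w" using d by (simp add: vec2_eq_iff field_simps)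
      then show ?thesis ..
    next
      case True
      then have "w$2 \<noteq> 0" using \<open>w \<noteq> 0\<close> by (simp add: vec2_eq_iff)
      then have "v = (v$2 / w$2) *s w" using d True by (simp add: vec2_eq_iff)
      then show ?thesis ..
    qed
    then obtain c where "v = c *s w" by blast
    then have "v \<in> vec.span {w}" by (simp add: vec.span_base vec.span_scale)
    moreover have "B - {v} = {w}" using vw by auto
    ultimately show False using B(1) vw by (auto simp: vec.dependent_def)
  qed
  show ?thesis by (rule that[OF subset_antisym[OF 1 2] 3])
qed

lemma V_zero: "0 \<in> V" and V_add: "x \<in> V \<Longrightarrow> y \<in> V \<Longrightarrow> x + y \<in> V"
  and V_scale: "c \<in> k \<Longrightarrow> x \<in> V \<Longrightarrow> c *s x \<in> V"
  and W_zero: "0 \<in> W" and W_add: "x \<in> W \<Longrightarrow> y \<in> W \<Longrightarrow> x + y \<in> W"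
  and W_scale: "c \<in> k \<Longrightarrow> x \<in> W \<Longrightarrow> c *s x \<in> W"
  using real span_overD unfolding realization_def k_form_def k_def by metis+

lemma V_submodule: "submodule_over k (*s) V" and W_submodule: "submodule_over k (*s) W"
  using V_zero V_add V_scale W_zero W_add W_scale by (auto simp: submodule_over_def)

lemma V_diff: "x \<in> V \<Longrightarrow> y \<in> V \<Longrightarrow> x - y \<in> V"
  using V_add[of x "(-1) *s y"] V_scale[of "-1" y] kD(1,4) by simp

text \<open>Compare coordinates in a k-basis of V. This is how scalars that were found over the
  complex numbers are seen to lie in k.\<close>

lemma V_scalar:
  assumes "x \<in> V" "x \<noteq> 0" "c *s x \<in> V"
  shows "c \<in> k"
proof -
  have "k_form k V" using real by (simp add: realization_def k_def)
  then obtain v w where V: "V = {a *s v + b *s w | a b. a \<in> k \<and> b \<in> k}" and d: "v$1 * w$2 - v$2 * w$1 \<noteq> 0"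
    by (rule k_form_basis)
  obtain a b a' b' where ab: "x = a *s v + b *s w" "a \<in> k" "b \<in> k" "c *s x = a' *s v + b' *s w" "a' \<in> k" "b' \<in> k"
    using assms(1,3) V by blast
  have e: "(c * a - a') * v$i + (c * b - b') * w$i = 0" for i
    using arg_cong[OF ab(4), of "\<lambda>y. y $ i"] by (simp add: ab(1) algebra_simps)
  have "(c * a - a') * (v$1 * w$2 - v$2 * w$1) =
      ((c * a - a') * v$1 + (c * b - b') * w$1) * w$2 - ((c * a - a') * v$2 + (c * b - b') * w$2) * w$1"
    "(c * b - b') * (v$1 * w$2 - v$2 * w$1) =
      v$1 * ((c * a - a') * v$2 + (c * b - b') * w$2) - v$2 * ((c * a - a') * v$1 + (c * b - b') * w$1)"
    by (simp_all add: algebra_simps)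
  then have ca: "c * a = a'" "c * b = b'" using d by (simp_all add: e)
  have "a \<noteq> 0 \<or> b \<noteq> 0" using ab(1) assms(2) by auto
  then have "c = a' / a \<or> c = b' / b" using ca by (auto simp: field_simps)
  then show ?thesis using kD(8) ab by metis
qed

lemma V_spans:
  assumes "\<And>x. x \<in> V \<Longrightarrow> (f :: complex^2^2) *v x = g *v x"
  shows "f = g"
proof -
  have "k_form k V" using real by (simp add: realization_def k_def)
  then obtain v w where V: "V = {a *s v + b *s w | a b. a \<in> k \<and> b \<in> k}" and d: "v$1 * w$2 - v$2 * w$1 \<noteq> 0"
    by (rule k_form_basis)
  have "v = 1 *s v + 0 *s w" "w = 0 *s v + 1 *s w" by simp_all
  then have vw: "v \<in> V" "w \<in> V" unfolding V using kD(1,2) by blast+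
  have "f *v x = g *v x" for x
  proof -
    obtain a b where "x = a *s v + b *s w" by (rule basis_coords[OF d])
    then show ?thesis using assms[OF vw(1)] assms[OF vw(2)] by (simp add: mv_add mv_scale)
  qed
  then show ?thesis by (simp add: matrix_eq)
qed

text \<open>The conjugated coordinates of z in a k-basis of W solve a linear system with
  coefficients in k. If its determinant vanished, the vectors u and u' would pair to zero with that
  basis and be zero themselves; this kills all four coefficients and then the basis vector
  v.\<close>

lemma W_dual:
  assumes "\<And>x. x \<in> V \<Longrightarrow> p x z \<in> k"
  shows "z \<in> W"
proof -
  have kf: "k_form k V" "k_form k W" using real by (simp_all add: realization_def k_def)
  obtain v w where V: "V = {a *s v + b *s w | a b. a \<in> k \<and> b \<in> k}" "v$1 * w$2 - v$2 * w$1 \<noteq> 0"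
    by (rule k_form_basis[OF kf(1)])
  obtain v' w' where W: "W = {a *s v' + b *s w' | a b. a \<in> k \<and> b \<in> k}" "v'$1 * w'$2 - v'$2 * w'$1 \<noteq> 0"
    by (rule k_form_basis[OF kf(2)])
  have "v = 1 *s v + 0 *s w" "w = 0 *s v + 1 *s w" by simp_all
  then have vw: "v \<in> V" "w \<in> V" unfolding V(1) using kD(1,2) by blast+
  have "v' = 1 *s v' + 0 *s w'" "w' = 0 *s v' + 1 *s w'" by simp_all
  then have vw': "v' \<in> W" "w' \<in> W" unfolding W(1) using kD(1,2) by blast+
  obtain a b where z: "z = a *s v' + b *s w'" by (rule basis_coords[OF W(2)])
  have pk: "p v v' * cnj a + p v w' * cnj b \<in> k" "p w v' * cnj a + p w w' * cnj b \<in> k"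
    using assms[OF vw(1)] assms[OF vw(2)] by (simp_all add: z p_linear mult.commute)
  have det: "p v v' * p w w' - p v w' * p w v' \<noteq> 0"
  proof
    assume d0: "p v v' * p w w' - p v w' * p w v' = 0"
    define u where "u = p w v' *s v - p v v' *s w"
    define u' where "u' = p w w' *s v - p v w' *s w"
    have zero: "y = 0" if "p y v' = 0" "p y w' = 0" for y
    proof (rule p_nondeg(1))
      fix x
      obtain a b where "x = a *s v' + b *s w'" by (rule basis_coords[OF W(2)])
      then show "p y x = 0" using that by (simp add: p_linear)
    qed
    have "u = 0" "u' = 0"
      by (rule zero; use d0 in \<open>simp add: u_def u'_def p_minus p_linear algebra_simps\<close>)+
    then have "p w v' * (v$1 * w$2 - v$2 * w$1) = 0" "p v v' * (v$1 * w$2 - v$2 * w$1) = 0"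
      "p w w' * (v$1 * w$2 - v$2 * w$1) = 0" "p v w' * (v$1 * w$2 - v$2 * w$1) = 0"
      unfolding u_def u'_def vec2_eq_iff by (simp_all, algebra+)
    then have "p v v' = 0" "p v w' = 0" using V(2) by auto
    then have "v = 0" by (rule zero)
    then show False using V(2) by simp
  qed
  have "cnj a \<in> k" "cnj b \<in> k"
    by (rule cramer[OF subfield_k det _ _ _ _ pk]; intro p_in_k vw vw')+
  then have "a \<in> k" "b \<in> k" using cnj_k by (metis complex_cnj_cnj)+
  then show ?thesis unfolding W(1) z by blast
qed

lemma contragredient_W:
  assumes "g \<in> G" "z \<in> W"
  shows "contragredient p g *v z \<in> W"
proof (rule W_dual)
  fix x assume x: "x \<in> V"
  have "p x (contragredient p g *v z) = p (g *v (matrix_inv g *v x)) (contragredient p g *v z)"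
    by (simp add: inv_cancel(6)[OF GD(4)[OF assms(1)]])
  also have "\<dots> = p (matrix_inv g *v x) z" by (rule contragredient[OF GD(4)[OF assms(1)]])
  also have "\<dots> \<in> k" by (rule p_in_k) (use G_V GD(3) assms x in auto)
  finally show "p x (contragredient p g *v z) \<in> k" .
qed

end

section \<open>Root systems\<close>

lemma parallel_vectors:
  assumes "x$1 * u$2 = x$2 * u$1" "(u :: complex^2) \<noteq> 0"
  obtains c where "x = c *s u"
proof (cases "u$1 = 0")
  case False
  then have "x = (x$1 / u$1) *s u" using assms(1) by (simp add: vec2_eq_iff field_simps)
  then show ?thesis by (rule that)
next
  case True
  then have "u$2 \<noteq> 0" using assms(2) by (simp add: vec2_eq_iff)
  then have "x = (x$2 / u$2) *s u" using assms(1) True by (simp add: vec2_eq_iff)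
  then show ?thesis by (rule that)
qed

section \<open>Reflections attached to roots, their uniqueness and their fixed vectors\<close>

context realized
begin

definition rmat :: "complex^2 \<Rightarrow> complex^2 \<Rightarrow> complex^2^2" where
  "rmat v w = mat 1 - vector [vector [v$1 * p (vector [1, 0]) w, v$1 * p (vector [0, 1]) w],
     vector [v$2 * p (vector [1, 0]) w, v$2 * p (vector [0, 1]) w]]"

lemma rmat: "rmat v w *v x = x - p x w *s v"
  by (subst p_coords)
    (simp add: rmat_def vec2_eq_iff mat2_vec_nth mat2_nth algebra_simps)

lemma rmat_eqI: "(\<And>x. s *v x = x - p x w *s v) \<Longrightarrow> s = rmat v w"
  by (simp add: matrix_eq rmat)

lemma mat_minus_rmat: "(mat 1 - rmat v w) *v x = p x w *s v"
  by (simp add: matrix_vector_mult_diff_rdistrib rmat)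

lemma rmat_conj:
  assumes g: "invertible g"
  shows "rmat (g *v v) (contragredient p g *v w) = g ** rmat v w ** matrix_inv g"
proof (rule rmat_eqI[symmetric])
  fix x
  have "p x (contragredient p g *v w) = p (g *v (matrix_inv g *v x)) (contragredient p g *v w)"
    by (simp add: inv_cancel(6)[OF g])
  then have e: "p x (contragredient p g *v w) = p (matrix_inv g *v x) w"
    by (simp only: contragredient[OF g])
  have "(g ** rmat v w ** matrix_inv g) *v x = g *v (rmat v w *v (matrix_inv g *v x))"
    by (simp only: matrix_vector_mul_assoc[symmetric])
  also have "\<dots> = g *v (matrix_inv g *v x) - p (matrix_inv g *v x) w *s (g *v v)"
    by (simp only: rmat matrix_vector_mult_diff_distrib mv_scale)
  finally show "(g ** rmat v w ** matrix_inv g) *v x =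
      x - p x (contragredient p g *v w) *s (g *v v)"
    by (simp only: e inv_cancel(6)[OF g])
qed

text \<open>Equal reflections differ from the identity by the same map of rank one, which determines
  its vector and its functional up to a factor and its inverse. On the covector side the factor
  appears conjugated.\<close>

lemma rmat_eq_scale:
  assumes e: "rmat v w = rmat a b" and vw: "p v w \<noteq> 0"
  shows "v = (p v b / p v w) *s a" "p v b / p v w \<noteq> 0" "b = cnj (p v b / p v w) *s w" "p v w = p a b"
proof -
  have eq: "p x w *s v = p x b *s a" for x
    using arg_cong[OF e, of "\<lambda>s. s *v x"] by (simp add: rmat)
  have "p v w *s v = p v w *s ((p v b / p v w) *s a)" using eq[of v] vw by (simp add: vector_smult_assoc)
  then show v: "v = (p v b / p v w) *s a" by (rule scale_left_cancel[OF vw])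
  have "v \<noteq> 0" using vw p_zero by auto
  then show c: "p v b / p v w \<noteq> 0" using v by auto
  define c where "c = p v b / p v w"
  have va: "v = c *s a" using v by (simp add: c_def)
  have a: "a \<noteq> 0" using va \<open>v \<noteq> 0\<close> by auto
  have "(c * p x w) *s a = p x b *s a" for x
    using eq[of x] va by (simp add: vector_smult_assoc mult.commute)
  then have cp: "c * p x w = p x b" for x using cancel_scale[OF a] by blast
  have "b - cnj c *s w = 0"
  proof (rule p_nondeg(2))
    fix x
    have "p x b = p x (b - cnj c *s w) + p x (cnj c *s w)" by (simp flip: p_linear(3))
    then show "p x (b - cnj c *s w) = 0" using cp[of x] by (simp add: p_linear)
  qed
  then show "b = cnj (p v b / p v w) *s w" by (simp add: c_def)
  have "p v w = c * p a w" by (simp add: va p_linear)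
  then show "p v w = p a b" using cp[of a] by simp
qed

text \<open>Normalized generators of the two k-lines. The modules of the root may be any rank one
  modules on these lines: v and w carry the reflection, not the ideal.\<close>

definition root_gen :: "2 zk_root \<Rightarrow> complex^2 \<Rightarrow> complex^2 \<Rightarrow> bool" where
  "root_gen r v w \<longleftrightarrow> v \<noteq> 0 \<and> w \<noteq> 0 \<and> p v w = 1 - snd (snd r) \<and> snd (snd r) \<noteq> 1 \<and>
     span_over k (*s) (fst r) = {c *s v | c. c \<in> k} \<and>
     span_over k (*s) (fst (snd r)) = {c *s w | c. c \<in> k}"

text \<open>Any other admissible pair is a v, b w with \<open>a * cnj b = 1\<close>, and these
  factors cancel in the reflection formula.\<close>

lemma root_gen_reflection:
  assumes "root_gen r v w"
  shows "root_reflection k p r = rmat v w"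
proof -
  obtain I J \<zeta> where r: "r = (I, J, \<zeta>)" by (cases r) blast
  have g: "p v w = 1 - \<zeta>" "\<zeta> \<noteq> 1" "span_over k (*s) I = {c *s v | c. c \<in> k}"
    "span_over k (*s) J = {c *s w | c. c \<in> k}"
    using assms by (auto simp: root_gen_def r)
  show ?thesis unfolding r root_reflection.simps
  proof (rule the_equality)
    have "v = 1 *s v" "w = 1 *s w" by simp_all
    then have "v \<in> span_over k (*s) I" "w \<in> span_over k (*s) J" unfolding g using kD(1) by blast+
    then show "\<exists>v'\<in>span_over k (*s) I. \<exists>w'\<in>span_over k (*s) J. p v' w' = 1 - \<zeta> \<and>
        (\<forall>x. rmat v w *v x = x - p x w' *s v')" using g(1) rmat by blast
  next
    fix s assume "\<exists>v'\<in>span_over k (*s) I. \<exists>w'\<in>span_over k (*s) J. p v' w' = 1 - \<zeta> \<and>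
        (\<forall>x. s *v x = x - p x w' *s v')"
    then obtain a b where ab: "p (a *s v) (b *s w) = 1 - \<zeta>"
      and s: "\<And>x. s *v x = x - p x (b *s w) *s (a *s v)" unfolding g by blast
    have "(a * cnj b) * (1 - \<zeta>) = 1 * (1 - \<zeta>)" using ab by (simp add: p_linear g(1) mult_ac)
    then have ab1: "cnj b * a = 1" using g(2) by (simp add: mult.commute)
    have "p x (b *s w) *s (a *s v) = p x w *s v" for x
    proof -
      have "p x (b *s w) *s (a *s v) = (p x w * (cnj b * a)) *s v"
        by (simp add: p_linear vector_smult_assoc mult_ac)
      then show ?thesis by (simp add: ab1)
    qed
    then show "s = rmat v w" using s by (intro rmat_eqI) simp
  qed
qed

lemma span_in_V: "S \<subseteq> V \<Longrightarrow> span_over k (*s) S \<subseteq> V" and span_in_W: "S \<subseteq> W \<Longrightarrow> span_over k (*s) S \<subseteq> W"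
  using span_over_least V_submodule W_submodule by blast+

lemma R_span_in_V: "S \<subseteq> V \<Longrightarrow> span_over R (*s) S \<subseteq> V" and R_span_in_W: "S \<subseteq> W \<Longrightarrow> span_over R (*s) S \<subseteq> W"
proof -
  have "submodule_over R (*s) V" "submodule_over R (*s) W"
    using V_submodule W_submodule R_subset_k by (auto simp: submodule_over_def)
  then show "S \<subseteq> V \<Longrightarrow> span_over R (*s) S \<subseteq> V" "S \<subseteq> W \<Longrightarrow> span_over R (*s) S \<subseteq> W"
    using span_over_least by blast+
qed

lemma k_line_scale:
  assumes "t \<in> k" "t \<noteq> 0"
  shows "{c *s (t *s v) | c. c \<in> k} = {c *s v | c. c \<in> k}"
proof
  show "{c *s (t *s v) | c. c \<in> k} \<subseteq> {c *s v | c. c \<in> k}"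
    using kD(6) assms(1) by (auto simp: vector_smult_assoc)
  show "{c *s v | c. c \<in> k} \<subseteq> {c *s (t *s v) | c. c \<in> k}"
  proof
    fix x assume "x \<in> {c *s v | c. c \<in> k}"
    then obtain c where c: "x = c *s v" "c \<in> k" by blast
    have "x = (c / t) *s (t *s v)" using assms(2) by (simp add: c(1) vector_smult_assoc)
    then show "x \<in> {c *s (t *s v) | c. c \<in> k}" using kD(8)[OF c(2) assms(1)] by blast
  qed
qed

text \<open>The two lines cannot be orthogonal, because the pairing ideal contains 1 - \<zeta>,
  which is not 0. So one generator can be rescaled by an element t of k to normalize the
  pairing.\<close>

lemma is_root_gen:
  assumes "is_root k V W p r"
  obtains v w where "root_gen r v w" "v \<in> V" "w \<in> W"
proof -
  obtain I J \<zeta> where r: "r = (I, J, \<zeta>)" by (cases r) blast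
  have g: "fg_rank_one k V I" "fg_rank_one k W J" "\<zeta> \<in> k" "\<zeta> \<noteq> 1"
    "pairing_ideal k p I J = (\<lambda>x. (1 - \<zeta>) * x) ` R" using assms by (auto simp: r)
  obtain v where v: "v \<noteq> 0" "span_over k (*s) I = {c *s v | c. c \<in> k}"
    using g(1) unfolding fg_rank_one_def span_over_singleton[OF subfield_ring_set[OF subfield_k]] by blast
  obtain w where w: "w \<noteq> 0" "span_over k (*s) J = {c *s w | c. c \<in> k}"
    using g(2) unfolding fg_rank_one_def span_over_singleton[OF subfield_ring_set[OF subfield_k]] by blast
  have "I \<subseteq> V" "J \<subseteq> W" using g(1,2) R_span_in_V R_span_in_W unfolding fg_rank_one_def by blast+
  then have "span_over k (*s) I \<subseteq> V" "span_over k (*s) J \<subseteq> W" using span_in_V span_in_W by blast+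
  moreover have "v = 1 *s v" "w = 1 *s w" by simp_all
  ultimately have vV: "v \<in> V" "w \<in> W" unfolding v w using kD(1) by blast+
  have pvw: "p v w \<noteq> 0"
  proof
    assume 0: "p v w = 0"
    have "p x z = 0" if x: "x \<in> I" and z: "z \<in> J" for x z
    proof -
      obtain a where "x = a *s v" using span_over_base[OF x, of k "(*s)"] v(2) by blast
      moreover obtain b where "z = b *s w" using span_over_base[OF z, of k "(*s)"] w(2) by blast
      ultimately show ?thesis by (simp add: p_linear 0)
    qed
    then have "pairing_ideal k p I J \<subseteq> {0}"
      unfolding pairing_ideal_def by (intro span_over_least) (auto simp: submodule_over_def)
    moreover have "(1 - \<zeta>) * 1 \<in> pairing_ideal k p I J" unfolding g(5) using RD(2) by blast
    ultimately show False using g(4) by auto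
  qed
  define t where "t = (1 - \<zeta>) / p v w"
  have t: "t \<in> k" "t \<noteq> 0"
    unfolding t_def using g(3,4) pvw kD(8)[OF kD(3)[OF kD(1) g(3)] p_in_k[OF vV]] by auto
  have "p (t *s v) w = 1 - \<zeta>" using pvw by (simp add: p_linear t_def)
  then have "root_gen r (t *s v) w"
    using v w g(4) t(2) unfolding root_gen_def r k_line_scale[OF t] by simp
  then show ?thesis using that V_scale[OF t(1) vV(1)] vV(2) by blast
qed

lemma group_act_one: "group_act p (mat 1) r = r"
  by (cases r) (simp add: contragredient_one)

lemma group_act_mult:
  "invertible g \<Longrightarrow> invertible h \<Longrightarrow> group_act p (g ** h) r = group_act p g (group_act p h r)"
  by (cases r) (simp add: contragredient_mult image_image matrix_vector_mul_assoc)

lemma span_over_matrix_image: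
  "span_over K (*s) ((\<lambda>x. (g :: complex^2^2) *v x) ` I) = (\<lambda>x. g *v x) ` span_over K (*s) I"
  by (rule span_over_image[where \<sigma> = "\<lambda>r. r", symmetric]) (simp_all add: mv_add mv_scale)

lemma line_image: "(\<lambda>x. (g :: complex^2^2) *v x) ` {c *s v | c. c \<in> K} = {c *s (g *v v) | c. c \<in> K}"
proof -
  have "(\<lambda>x. g *v x) ` {c *s v | c. c \<in> K} = {g *v (c *s v) | c. c \<in> K}" by blast
  then show ?thesis by (simp only: mv_scale)
qed

lemma root_gen_act:
  assumes g: "invertible g" and r: "root_gen r v w"
  shows "root_gen (group_act p g r) (g *v v) (contragredient p g *v w)"
proof -
  obtain I J \<zeta> where rr: "r = (I, J, \<zeta>)" by (cases r) blast
  have e: "p (g *v v) (contragredient p g *v w) = 1 - \<zeta>"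
    using r by (simp add: contragredient[OF g] root_gen_def rr)
  have "1 - \<zeta> \<noteq> 0" using r by (simp add: root_gen_def rr)
  then have "g *v v \<noteq> 0" "contragredient p g *v w \<noteq> 0" using e p_zero by auto
  then show ?thesis using r e
    by (simp add: root_gen_def rr span_over_matrix_image line_image)
qed

lemma root_reflection_act:
  assumes "invertible g" "root_gen r v w"
  shows "root_reflection k p (group_act p g r) = g ** root_reflection k p r ** matrix_inv g"
  using root_gen_reflection[OF root_gen_act[OF assms]] root_gen_reflection[OF assms(2)]
  by (simp add: rmat_conj[OF assms(1)])

lemma is_root_act:
  assumes g: "g \<in> G" and r: "is_root k V W p r"
  shows "is_root k V W p (group_act p g r)"
proof -
  obtain I J \<zeta> where rr: "r = (I, J, \<zeta>)" by (cases r) blast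
  note gi = GD(4)[OF g]
  obtain v w where vw: "root_gen r v w" by (rule is_root_gen[OF r])
  have fg: "fg_rank_one k U' ((\<lambda>x. h *v x) ` I')"
    if fgI: "fg_rank_one k U I'" and hU: "\<And>x. x \<in> U \<Longrightarrow> h *v x \<in> U'" and hi: "invertible h"
    for U U' I' :: "(complex^2) set" and h :: "complex^2^2"
  proof -
    obtain F where F: "finite F" "F \<subseteq> U" "I' = span_over R (*s) F" using fgI by (auto simp: fg_rank_one_def)
    obtain u where u: "u \<noteq> 0" "span_over k (*s) I' = span_over k (*s) {u}" using fgI by (auto simp: fg_rank_one_def)
    have "(\<lambda>x. h *v x) ` I' = span_over R (*s) ((\<lambda>x. h *v x) ` F)"
      by (simp add: F(3) span_over_matrix_image)
    moreover have "span_over k (*s) ((\<lambda>x. h *v x) ` I') = span_over k (*s) {h *v u}"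
      using span_over_matrix_image[of k h I'] span_over_matrix_image[of k h "{u}"] u(2) by simp
    moreover have "h *v u \<noteq> 0" using mult_vec_nonzero[OF hi u(1)] .
    ultimately show ?thesis using F hU unfolding fg_rank_one_def
      by (intro conjI exI[of _ "(\<lambda>x. h *v x) ` F"] exI[of _ "h *v u"]) auto
  qed
  have hG: "contragredient p g ** contragredient p (matrix_inv g) = mat 1"
    using contragredient_mult[OF gi GD(4)[OF GD(3)[OF g]]] by (simp add: inv_cancel(2)[OF gi] contragredient_one)
  have fgIJ: "fg_rank_one k V I" "fg_rank_one k W J" using r unfolding rr is_root.simps by blast+
  have 1: "fg_rank_one k V ((\<lambda>x. g *v x) ` I)"
    by (rule fg[OF fgIJ(1) G_V[OF g] gi])
  have 2: "fg_rank_one k W ((\<lambda>z. contragredient p g *v z) ` J)"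
    by (rule fg[OF fgIJ(2) contragredient_W[OF g] matrix_inv_eqI(2)[OF hG]])
  have "{p x z | x z. x \<in> (\<lambda>x. g *v x) ` I \<and> z \<in> (\<lambda>z. contragredient p g *v z) ` J} =
      {p (g *v x) (contragredient p g *v z) | x z. x \<in> I \<and> z \<in> J}" by blast
  also have "\<dots> = {p x z | x z. x \<in> I \<and> z \<in> J}" by (simp only: contragredient[OF gi])
  finally have "{p x z | x z. x \<in> (\<lambda>x. g *v x) ` I \<and> z \<in> (\<lambda>z. contragredient p g *v z) ` J} =
      {p x z | x z. x \<in> I \<and> z \<in> J}" .
  then have 3: "pairing_ideal k p ((\<lambda>x. g *v x) ` I) ((\<lambda>z. contragredient p g *v z) ` J) = pairing_ideal k p I J"
    by (simp add: pairing_ideal_def)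
  show ?thesis using r 1 2 unfolding rr group_act.simps is_root.simps 3 by blast
qed

text \<open>All vectors \<open>p v w *s x - p x w *s v\<close> lie in the kernel of the functional
  of w. If they vanished for every x in V, the nonzero scalar matrix of \<open>p v w\<close> would
  have rank one.\<close>

lemma fixed_vector:
  assumes v: "v \<in> V" and w: "w \<in> W" and vw: "p v w \<noteq> 0"
  obtains u where "u \<in> V" "u \<noteq> 0" "p u w = 0"
proof -
  have "\<exists>x\<in>V. p v w *s x - p x w *s v \<noteq> 0"
  proof (rule ccontr)
    assume no: "\<not> ?thesis"
    have "mat (p v w) *v x = (mat 1 - rmat v w) *v x" if "x \<in> V" for x
      using no that by (simp add: mat_minus_rmat mat_vec)
    then have "mat (p v w) = mat 1 - rmat v w" by (rule V_spans)
    then have "det (mat (p v w) :: complex^2^2) = 0" by (simp add: rmat_def det_2)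
    then show False using vw by (simp add: det_mat2)
  qed
  then obtain x where x: "x \<in> V" "p v w *s x - p x w *s v \<noteq> 0" by blast
  have "p (p v w *s x - p x w *s v) w = 0" by (simp add: p_minus p_linear)
  moreover have "p v w *s x - p x w *s v \<in> V" by (intro V_diff V_scale p_in_k v w x)
  ultimately show ?thesis using that x by blast
qed

lemma kernel_line:
  assumes vw: "p v w \<noteq> 0" and "p u w = 0" "u \<noteq> 0" "p x w = 0"
  obtains c where "x = c *s u"
proof -
  define f g where "f = p (vector [1, 0]) w" and "g = p (vector [0, 1]) w"
  have e: "u$1 * f + u$2 * g = 0" "x$1 * f + x$2 * g = 0"
    using assms(2,4) p_coords[of u w] p_coords[of x w] by (simp_all add: f_def g_def)
  have "f \<noteq> 0 \<or> g \<noteq> 0" using vw p_coords[of v w] by (auto simp: f_def g_def)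
  moreover have "(x$1 * u$2 - x$2 * u$1) * g = x$1 * (u$1 * f + u$2 * g) - u$1 * (x$1 * f + x$2 * g)"
    "(x$1 * u$2 - x$2 * u$1) * f = u$2 * (x$1 * f + x$2 * g) - x$2 * (u$1 * f + u$2 * g)"
    by (simp_all add: algebra_simps)
  ultimately have "x$1 * u$2 = x$2 * u$1" unfolding e by auto
  then show ?thesis using parallel_vectors[OF _ assms(3)] that by blast
qed

lemma rmat_fix: "v \<noteq> 0 \<Longrightarrow> rmat v w *v x = x \<longleftrightarrow> p x w = 0"
  by (simp add: rmat)

text \<open>The fixed vectors of the reflection are the multiples of u, so its pointwise fixer in G
  is the fixer of a single vector, the form in which the group theory describes it.\<close>

lemma distinguished_in_iff:
  assumes v: "v \<in> V" and w: "w \<in> W" and vw: "p v w \<noteq> 0" and u: "u \<in> V" "u \<noteq> 0" "p u w = 0"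
  shows "distinguished_in G V (rmat v w) \<longleftrightarrow> det (rmat v w) = zeta (card {h \<in> G. h *v u = u})"
proof -
  have v0: "v \<noteq> 0" using vw p_zero by auto
  have "(\<forall>x\<in>V. rmat v w *v x = x \<longrightarrow> h *v x = x) \<longleftrightarrow> h *v u = u" for h
  proof
    assume "\<forall>x\<in>V. rmat v w *v x = x \<longrightarrow> h *v x = x"
    then show "h *v u = u" using u rmat_fix[OF v0] by blast
  next
    assume hu: "h *v u = u"
    show "\<forall>x\<in>V. rmat v w *v x = x \<longrightarrow> h *v x = x"
    proof (intro ballI impI)
      fix x assume "x \<in> V" "rmat v w *v x = x"
      then have "p x w = 0" using rmat_fix[OF v0] by blast
      then obtain c where "x = c *s u" by (rule kernel_line[OF vw u(3,2)])
      then show "h *v x = x" by (simp add: mv_scale hu)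
    qed
  qed
  then show ?thesis by (simp add: distinguished_in_def)
qed

end

subsection \<open>Groups with a Cartan matrix whose off-diagonal entries are units\<close>

text \<open>The interface between group theory and arithmetic: \<open>conjugate\<close> and
  \<open>generating\<close> summarize the counting argument, while \<open>cartan_R\<close>,
  \<open>cartan_unit\<close> and \<open>cartan_det\<close> are read off from the Cartan matrix.
  \<open>det_inj\<close> reflects the distinct orders of the standard generators and keeps their
  conjugacy classes apart.\<close>

locale cartan_data = realized +
  fixes r :: nat and s :: "nat \<Rightarrow> complex^2^2" and \<alpha> \<beta> :: "nat \<Rightarrow> complex^2" and \<zeta> :: "nat \<Rightarrow> complex"
  assumes r2: "2 \<le> r"
    and s_G: "i < r \<Longrightarrow> s i \<in> G" and alpha_V: "i < r \<Longrightarrow> \<alpha> i \<in> V" and beta_W: "i < r \<Longrightarrow> \<beta> i \<in> W"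
    and s_rmat: "i < r \<Longrightarrow> s i = rmat (\<alpha> i) (\<beta> i)"
    and p_diag: "i < r \<Longrightarrow> p (\<alpha> i) (\<beta> i) = 1 - \<zeta> i"
    and zeta_ne: "i < r \<Longrightarrow> \<zeta> i \<noteq> 1" and zeta_root: "i < r \<Longrightarrow> \<exists>n>0. \<zeta> i ^ n = 1"
    and cartan_R: "i < r \<Longrightarrow> j < r \<Longrightarrow> p (\<alpha> i) (\<beta> j) \<in> R"
    and cartan_unit: "i < r \<Longrightarrow> j < r \<Longrightarrow> i \<noteq> j \<Longrightarrow> \<exists>y\<in>R. p (\<alpha> i) (\<beta> j) * y = 1"
    and cartan_det: "p (\<alpha> 0) (\<beta> 0) * p (\<alpha> 1) (\<beta> 1) - p (\<alpha> 0) (\<beta> 1) * p (\<alpha> 1) (\<beta> 0) \<noteq> 0"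
    and gen: "generated_group (s ` {..<r}) = G"
    and dist: "i < r \<Longrightarrow> distinguished_in G V (s i)"
    and conjugate: "q \<in> G \<Longrightarrow> q \<noteq> mat 1 \<Longrightarrow> v \<noteq> 0 \<Longrightarrow> q *v v = v \<Longrightarrow>
      det q = zeta (card {h \<in> G. h *v v = v}) \<Longrightarrow> \<exists>i<r. conj_in G (s i) q"
    and generating: "generated_group Q = G \<Longrightarrow> (\<And>q. q \<in> Q \<Longrightarrow> \<exists>i<r. conj_in G (s i) q) \<Longrightarrow>
      (\<And>q g. q \<in> Q \<Longrightarrow> g \<in> G \<Longrightarrow> g ** q ** matrix_inv g \<in> Q) \<Longrightarrow> i < r \<Longrightarrow> s i \<in> Q"
    and det_inj: "i < r \<Longrightarrow> j < r \<Longrightarrow> det (s i) = det (s j) \<Longrightarrow> i = j"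
begin

text \<open>The conjugation on the side of \<open>\<beta> i\<close> makes the pairing of
  \<open>x *s \<alpha> i\<close> with \<open>cnj y *s \<beta> i\<close> equal to x y (1 -
  \<open>\<zeta> i\<close>), so the condition on the pairing ideal becomes that a and b have product
  R.\<close>

definition rroot :: "complex set \<Rightarrow> complex set \<Rightarrow> nat \<Rightarrow> 2 zk_root" where
  "rroot a b i = ((\<lambda>x. x *s \<alpha> i) ` a, (\<lambda>y. cnj y *s \<beta> i) ` b, \<zeta> i)"

definition RS :: "complex set \<Rightarrow> complex set \<Rightarrow> 2 zk_root set" where
  "RS a b = {group_act p g (rroot a b i) | g i. g \<in> G \<and> i < r}"

text \<open>A fractional ideal together with its inverse. A root supplies both, so invertibility
  comes with the data and finite generation follows from it.\<close>

definition inverse_pair :: "complex set \<Rightarrow> complex set \<Rightarrow> bool" where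
  "inverse_pair a b \<longleftrightarrow> submodule_over R (*) a \<and> submodule_over R (*) b \<and> a \<subseteq> k \<and> b \<subseteq> k \<and> mprod R a b = R"

lemma p_diag_nonzero: "i < r \<Longrightarrow> p (\<alpha> i) (\<beta> i) \<noteq> 0"
  using p_diag zeta_ne by simp

lemma alpha_nonzero: "i < r \<Longrightarrow> \<alpha> i \<noteq> 0" and beta_nonzero: "i < r \<Longrightarrow> \<beta> i \<noteq> 0"
  using p_diag_nonzero p_zero by metis+

lemma k_submodule: "submodule_over R (*) k"
  using R_subset_k kD by (auto simp: submodule_over_def)

lemma inverse_pair_units: "mprod R R a = a \<and> mprod R a R = a" if "submodule_over R (*) a"
  using mprod_unit[OF R_ring that] mprod_comm[of R a R] by simp

lemma mprod_subset_k: "a \<subseteq> k \<Longrightarrow> b \<subseteq> k \<Longrightarrow> mprod R a b \<subseteq> k"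
  by (rule mprod_least[OF _ k_submodule]) (use kD(6) in blast)

lemma mprod_swap4: "mprod R (mprod R a b) (mprod R c d) = mprod R (mprod R a c) (mprod R b d)"
  by (metis mprod_assoc mprod_comm)

lemma inverse_pair_mprod:
  assumes "inverse_pair a b" "inverse_pair c d"
  shows "inverse_pair (mprod R a c) (mprod R b d)"
  using assms inverse_pair_units[OF RD(5)]
  by (simp add: inverse_pair_def mprod_submodule mprod_subset_k mprod_swap4)

lemma inverse_pair_commute: "inverse_pair a b \<Longrightarrow> inverse_pair b a"
  by (auto simp: inverse_pair_def mprod_comm)

lemma fractional_ideal_if_inverse_pair:
  assumes "inverse_pair a b"
  shows "fractional_ideal k a"
  unfolding fractional_ideal_def
proof
  have a: "submodule_over R (*) a" "mprod R a b = R" "a \<subseteq> k" using assms by (auto simp: inverse_pair_def)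
  show "a \<noteq> {0}"
  proof
    assume "a = {0}"
    then have "mprod R a b \<subseteq> {0}" by (intro mprod_least) (auto simp: submodule_over_def)
    then show False using a RD(2) by auto
  qed
  show "\<exists>F. finite F \<and> F \<subseteq> k \<and> a = span_over R (*) F"
    using invertible_finitely_generated[OF R_ring a(1,2)] a(3) by blast
qed

text \<open>If x a is contained in R, then multiplying by b gives x R = x a b, which is contained in
  R b = b; evaluate at 1.\<close>

lemma ideal_inverse_eq:
  assumes "inverse_pair a b"
  shows "ideal_inverse k a = b"
proof
  have ab: "submodule_over R (*) b" "mprod R a b = R" "b \<subseteq> k" using assms by (auto simp: inverse_pair_def)
  show "b \<subseteq> ideal_inverse k a"
  proof
    fix y assume y: "y \<in> b"
    have "y * x \<in> R" if "x \<in> a" for x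
      using mprodI[OF that y, of R] ab(2) by (simp add: mult.commute)
    then show "y \<in> ideal_inverse k a" using ab(3) y by (auto simp: ideal_inverse_def)
  qed
  show "ideal_inverse k a \<subseteq> b"
  proof
    fix x assume x: "x \<in> ideal_inverse k a"
    have "mprod R a b \<subseteq> {t. \<forall>y\<in>{x}. t * y \<in> b}"
    proof (rule mprod_least[OF _ submodule_colon[OF ab(1)]])
      fix u v assume uv: "u \<in> a" "v \<in> b"
      then have "x * u \<in> R" using x by (simp add: ideal_inverse_def)
      then have "(x * u) * v \<in> b" using submodule_overD(3)[OF ab(1)] uv by blast
      then show "u * v \<in> {t. \<forall>y\<in>{x}. t * y \<in> b}" by (simp add: mult_ac)
    qed
    then have "1 \<in> {t. \<forall>y\<in>{x}. t * y \<in> b}" using RD(2) ab(2) by blast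
    then show "x \<in> b" by simp
  qed
qed

lemma ideal_times_alpha: "ideal_times k c ((\<lambda>x. x *s v) ` a) = (\<lambda>x. x *s v) ` mprod R c a"
proof -
  have "{t *s y | t y. t \<in> c \<and> y \<in> (\<lambda>x. x *s v) ` a} = {t *s (x *s v) | t x. t \<in> c \<and> x \<in> a}" by blast
  also have "\<dots> = (\<lambda>x. x *s v) ` {t * x | t x. t \<in> c \<and> x \<in> a}" unfolding vector_smult_assoc by blast
  finally have "{t *s y | t y. t \<in> c \<and> y \<in> (\<lambda>x. x *s v) ` a} = (\<lambda>x. x *s v) ` {t * x | t x. t \<in> c \<and> x \<in> a}" .
  then show ?thesis unfolding ideal_times_def mprod_def
    using span_over_image[of "\<lambda>x. x *s v" "(*)" "(*s)" "\<lambda>r. r" R "{t * x | t x. t \<in> c \<and> x \<in> a}"]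
    by (simp add: vector_sadd_rdistrib vector_smult_assoc)
qed

lemma ideal_times_beta: "ideal_times k (cnj ` d) ((\<lambda>y. cnj y *s v) ` b) = (\<lambda>y. cnj y *s v) ` mprod R d b"
proof -
  have "{t *s y | t y. t \<in> cnj ` d \<and> y \<in> (\<lambda>y. cnj y *s v) ` b} = {cnj t *s (cnj x *s v) | t x. t \<in> d \<and> x \<in> b}" by blast
  also have "\<dots> = (\<lambda>y. cnj y *s v) ` {t * x | t x. t \<in> d \<and> x \<in> b}"
    unfolding vector_smult_assoc complex_cnj_mult[symmetric] by blast
  finally have "{t *s y | t y. t \<in> cnj ` d \<and> y \<in> (\<lambda>y. cnj y *s v) ` b} = (\<lambda>y. cnj y *s v) ` {t * x | t x. t \<in> d \<and> x \<in> b}" .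
  then show ?thesis unfolding ideal_times_def mprod_def
    using span_over_image[of "\<lambda>y. cnj y *s v" "(*)" "(*s)" cnj R "{t * x | t x. t \<in> d \<and> x \<in> b}"] cnj_image_R
    by (simp add: vector_sadd_rdistrib vector_smult_assoc)
qed

lemma ideal_times_matrix: "ideal_times k c ((\<lambda>x. (g :: complex^2^2) *v x) ` I) = (\<lambda>x. g *v x) ` ideal_times k c I"
proof -
  have "{t *s y | t y. t \<in> c \<and> y \<in> (\<lambda>x. g *v x) ` I} = {t *s (g *v x) | t x. t \<in> c \<and> x \<in> I}" by blast
  also have "\<dots> = (\<lambda>x. g *v x) ` {t *s x | t x. t \<in> c \<and> x \<in> I}" unfolding mv_scale[symmetric] by blast
  finally have "{t *s y | t y. t \<in> c \<and> y \<in> (\<lambda>x. g *v x) ` I} = (\<lambda>x. g *v x) ` {t *s x | t x. t \<in> c \<and> x \<in> I}" .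
  then show ?thesis unfolding ideal_times_def by (simp add: span_over_matrix_image)
qed

lemma ideal_act_RS:
  assumes "inverse_pair c d"
  shows "ideal_act k c ` RS a b = RS (mprod R c a) (mprod R d b)"
proof -
  have e: "ideal_act k c (group_act p g (rroot a b i)) = group_act p g (rroot (mprod R c a) (mprod R d b) i)" for g i
    by (simp add: rroot_def ideal_times_matrix ideal_times_alpha ideal_times_beta ideal_inverse_eq[OF assms])
  have "ideal_act k c ` RS a b = {ideal_act k c (group_act p g (rroot a b i)) | g i. g \<in> G \<and> i < r}"
    unfolding RS_def by blast
  then show ?thesis unfolding e by (simp add: RS_def)
qed

text \<open>The ideal that carries one system to the other is the quotient of a' by a, presented as
  \<open>mprod R a' b\<close>; its inverse is \<open>mprod R b' a\<close>.\<close>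

lemma same_genus_RS:
  assumes ab: "inverse_pair a b" and ab': "inverse_pair a' b'"
  shows "same_genus k (RS a b) (RS a' b')"
proof -
  have sub: "submodule_over R (*) a'" "submodule_over R (*) b'" "mprod R a b = R"
    using assms by (auto simp: inverse_pair_def)
  have cd: "inverse_pair (mprod R a' b) (mprod R b' a)"
    by (rule inverse_pair_mprod[OF ab' inverse_pair_commute[OF ab]])
  have "mprod R (mprod R a' b) a = a'"
    using inverse_pair_units[OF sub(1)] sub(3) by (simp add: mprod_assoc mprod_comm[of R b a])
  moreover have "mprod R (mprod R b' a) b = b'"
    using inverse_pair_units[OF sub(2)] sub(3) by (simp add: mprod_assoc)
  ultimately have "ideal_act k (mprod R a' b) ` RS a b = RS a' b'"
    using ideal_act_RS[OF cd, of a b] by simp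
  then show ?thesis using fractional_ideal_if_inverse_pair[OF cd] by (auto simp: same_genus_def)
qed

end

section \<open>Uniqueness: a distinguished root system comes from one pair of inverse ideals\<close>

context cartan_data
begin

text \<open>Stability of a root system under its own reflections thereby extends to the whole group
  that they generate.\<close>

lemma mat_group_symmetries: "mat_group {g. invertible g \<and> group_act p g ` RR = RR}"
  unfolding mat_group_def
proof (intro conjI ballI)
  show "mat 1 \<in> {g. invertible g \<and> group_act p g ` RR = RR}"
    by (simp add: group_act_one GD(4)[OF GD(1)])
next
  fix g h assume gh: "g \<in> {g. invertible g \<and> group_act p g ` RR = RR}" "h \<in> {g. invertible g \<and> group_act p g ` RR = RR}"
  have "group_act p (g ** h) ` RR = group_act p g ` group_act p h ` RR"
  proof -
    have "group_act p (g ** h) x = group_act p g (group_act p h x)" for x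
      using gh by (intro group_act_mult) auto
    then have "group_act p (g ** h) ` RR = (\<lambda>x. group_act p g (group_act p h x)) ` RR"
      by (intro image_cong) auto
    then show ?thesis by (simp only: image_image)
  qed
  then show "g ** h \<in> {g. invertible g \<and> group_act p g ` RR = RR}"
    using gh by (simp add: invertible_mult)
next
  fix g assume g: "g \<in> {g. invertible g \<and> group_act p g ` RR = RR}"
  then have gi: "invertible g" and gR: "group_act p g ` RR = RR" by auto
  have ii: "invertible (matrix_inv g)" by (rule matrix_inv_eqI(2)[OF inv_cancel(1)[OF gi]])
  have "group_act p (matrix_inv g) ` RR = group_act p (matrix_inv g) ` group_act p g ` RR" by (simp only: gR)
  also have "\<dots> = (\<lambda>x. group_act p (matrix_inv g ** g) x) ` RR"
    by (simp only: image_image group_act_mult[OF ii gi])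
  also have "\<dots> = RR" by (simp add: inv_cancel(1)[OF gi] group_act_one)
  finally show "\<exists>h\<in>{g. invertible g \<and> group_act p g ` RR = RR}. g ** h = mat 1 \<and> h ** g = mat 1"
    using inv_cancel(1,2)[OF gi] ii by blast
qed

lemma distinguished_conjugate:
  assumes v: "v \<in> V" and w: "w \<in> W" and vw: "p v w \<noteq> 0" and q: "rmat v w \<in> G"
    and d: "distinguished_in G V (rmat v w)"
  shows "\<exists>i<r. conj_in G (s i) (rmat v w)"
proof -
  obtain u where u: "u \<in> V" "u \<noteq> 0" "p u w = 0" by (rule fixed_vector[OF v w vw])
  have v0: "v \<noteq> 0" using vw p_zero by auto
  show ?thesis
  proof (rule conjugate[OF q _ u(2)])
    show "rmat v w \<noteq> mat 1"
    proof
      assume "rmat v w = mat 1"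
      then have "rmat v w *v v = v" by simp
      then show False using rmat_fix[OF v0] vw by blast
    qed
    show "rmat v w *v u = u" using rmat_fix[OF v0] u(3) by blast
    show "det (rmat v w) = zeta (card {h \<in> G. h *v u = u})"
      using distinguished_in_iff[OF v w vw u] d by blast
  qed
qed

text \<open>The reflection determines the k-lines and the eigenvalue of the root. Coordinates with
  respect to \<open>\<alpha> i\<close> and \<open>\<beta> i\<close> turn the two modules into
  submodules a and b of k, and cancelling 1 - z in the pairing ideal leaves the product R.\<close>

lemma root_shape:
  assumes root: "is_root k V W p \<rho>" and refl: "root_reflection k p \<rho> = s i" and i: "i < r"
  obtains a b where "\<rho> = rroot a b i" "submodule_over R (*) a" "submodule_over R (*) b" "a \<subseteq> k" "b \<subseteq> k"
    "mprod R a b = R"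
proof -
  obtain I J z where rho: "\<rho> = (I, J, z)" by (cases \<rho>) blast
  have isr: "fg_rank_one k V I" "fg_rank_one k W J"
    "pairing_ideal k p I J = (\<lambda>x. (1 - z) * x) ` R" using root unfolding rho by auto
  obtain v w where g: "root_gen \<rho> v w" by (rule is_root_gen[OF root])
  have ee: "rmat v w = rmat (\<alpha> i) (\<beta> i)"
    using root_gen_reflection[OF g] refl s_rmat[OF i] by simp
  have pvw: "p v w = 1 - z" "z \<noteq> 1" using g by (simp_all add: root_gen_def rho)
  then have pn: "p v w \<noteq> 0" by simp
  note sc = rmat_eq_scale[OF ee pn]
  define c where "c = p v (\<beta> i) / p v w"
  have zz: "z = \<zeta> i" using sc(4) pvw p_diag[OF i] by simp
  have IJ: "span_over k (*s) I = {x *s v | x. x \<in> k}" "span_over k (*s) J = {x *s w | x. x \<in> k}"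
    using g by (simp_all add: root_gen_def rho)
  have "I \<subseteq> V" "J \<subseteq> W" using isr(1,2) R_span_in_V R_span_in_W unfolding fg_rank_one_def by blast+
  then have "span_over k (*s) I \<subseteq> V" using span_in_V by blast
  moreover have "v = 1 *s v" by simp
  ultimately have "v \<in> V" unfolding IJ using kD(1) by blast
  then have "c *s \<alpha> i \<in> V" using sc(1) by (simp add: c_def)
  then have ck: "c \<in> k" by (rule V_scalar[OF alpha_V[OF i] alpha_nonzero[OF i]])
  have c0: "c \<noteq> 0" using sc(2) by (simp add: c_def)
  have v: "v = c *s \<alpha> i" using sc(1) by (simp add: c_def)
  have b: "\<beta> i = cnj c *s w" using sc(3) by (simp add: c_def)
  have Ik: "span_over k (*s) I = {x *s \<alpha> i | x. x \<in> k}"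
    unfolding IJ v by (rule k_line_scale[OF ck c0])
  have Jk: "span_over k (*s) J = {x *s \<beta> i | x. x \<in> k}"
    unfolding IJ b by (rule k_line_scale[symmetric]) (use cnj_k ck c0 in auto)
  have Isub: "submodule_over R (*s) I" and Jsub: "submodule_over R (*s) J"
    using isr(1,2) submodule_span_over unfolding fg_rank_one_def by blast+
  define a where "a = {x. x *s \<alpha> i \<in> I}"
  define b where "b = {y. cnj y *s \<beta> i \<in> J}"
  have Ia: "I = (\<lambda>x. x *s \<alpha> i) ` a"
  proof
    show "I \<subseteq> (\<lambda>x. x *s \<alpha> i) ` a"
    proof
      fix u assume u: "u \<in> I"
      then obtain x where "u = x *s \<alpha> i" using span_over_base[OF u, of k "(*s)"] unfolding Ik by blast
      then show "u \<in> (\<lambda>x. x *s \<alpha> i) ` a" using u by (auto simp: a_def)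
    qed
  qed (auto simp: a_def)
  have Jb: "J = (\<lambda>y. cnj y *s \<beta> i) ` b"
  proof
    show "J \<subseteq> (\<lambda>y. cnj y *s \<beta> i) ` b"
    proof
      fix u assume u: "u \<in> J"
      then obtain x where x: "u = x *s \<beta> i" using span_over_base[OF u, of k "(*s)"] unfolding Jk by blast
      have "cnj x \<in> b" using u x by (simp add: b_def)
      moreover have "u = cnj (cnj x) *s \<beta> i" using x by simp
      ultimately show "u \<in> (\<lambda>y. cnj y *s \<beta> i) ` b" by blast
    qed
  qed (auto simp: b_def)
  have ak: "a \<subseteq> k"
  proof
    fix x assume "x \<in> a"
    then have "x *s \<alpha> i \<in> V" using \<open>I \<subseteq> V\<close> by (auto simp: a_def)
    then show "x \<in> k" by (rule V_scalar[OF alpha_V[OF i] alpha_nonzero[OF i]])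
  qed
  have bk: "b \<subseteq> k"
  proof
    fix y assume "y \<in> b"
    then have "cnj y *s \<beta> i \<in> J" by (simp add: b_def)
    then obtain x where "cnj y *s \<beta> i = x *s \<beta> i" "x \<in> k"
      using span_over_base[of _ J k "(*s)"] unfolding Jk by blast
    then have "cnj y \<in> k" using cancel_scale[OF beta_nonzero[OF i]] by simp
    then show "y \<in> k" using cnj_k[of "cnj y"] by simp
  qed
  have asub: "submodule_over R (*) a"
    unfolding submodule_over_def
  proof (intro conjI ballI)
    show "0 \<in> a" using submodule_overD(1)[OF Isub] by (simp add: a_def)
    show "x + y \<in> a" if "x \<in> a" "y \<in> a" for x y
      using submodule_overD(2)[OF Isub] that by (simp add: a_def vector_sadd_rdistrib)
    show "t * x \<in> a" if "t \<in> R" "x \<in> a" for t x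
      using submodule_overD(3)[OF Isub that(1), of "x *s \<alpha> i"] that(2) by (simp add: a_def)
  qed
  have bsub: "submodule_over R (*) b"
    unfolding submodule_over_def
  proof (intro conjI ballI)
    show "0 \<in> b" using submodule_overD(1)[OF Jsub] by (simp add: b_def)
    show "x + y \<in> b" if "x \<in> b" "y \<in> b" for x y
      using submodule_overD(2)[OF Jsub] that by (simp add: b_def vector_sadd_rdistrib)
    show "t * x \<in> b" if "t \<in> R" "x \<in> b" for t x
      using submodule_overD(3)[OF Jsub cnj_R[OF that(1)], of "cnj x *s \<beta> i"] that(2) by (simp add: b_def)
  qed
  have "{p x z | x z. x \<in> I \<and> z \<in> J} = {p (x *s \<alpha> i) (cnj y *s \<beta> i) | x y. x \<in> a \<and> y \<in> b}"
    unfolding Ia Jb by blast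
  also have "\<dots> = {(1 - z) * (x * y) | x y. x \<in> a \<and> y \<in> b}"
    by (simp add: p_linear p_diag[OF i] zz mult_ac)
  also have "\<dots> = (\<lambda>t. (1 - z) * t) ` {x * y | x y. x \<in> a \<and> y \<in> b}" by blast
  finally have "pairing_ideal k p I J = span_over R (*) ((\<lambda>t. (1 - z) * t) ` {x * y | x y. x \<in> a \<and> y \<in> b})"
    by (simp only: pairing_ideal_def)
  also have "\<dots> = (\<lambda>t. (1 - z) * t) ` mprod R a b"
    unfolding mprod_def
    by (rule span_over_image[where \<sigma> = "\<lambda>r. r", symmetric]) (simp_all add: algebra_simps)
  finally have "(\<lambda>t. (1 - z) * t) ` mprod R a b = (\<lambda>t. (1 - z) * t) ` R" using isr(3) by simp
  moreover have "inj (\<lambda>t. (1 - z) * t)" using pvw(2) by (auto intro: injI)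
  ultimately have "mprod R a b = R" by (simp only: inj_image_eq_iff)
  moreover have "\<rho> = rroot a b i" by (simp add: rho rroot_def zz Ia[symmetric] Jb[symmetric])
  ultimately show ?thesis using that asub bsub ak bk by blast
qed

text \<open>The group theory puts every \<open>s i\<close> among the reflections of the system,
  integrality makes the ideals of the corresponding roots coincide, and injectivity of the
  reflection map identifies every remaining root with a translate of one of these.\<close>

lemma distinguished_structure:
  assumes D: "distinguished_root_system G V W p RR"
  shows "\<exists>a b. inverse_pair a b \<and> RR = RS a b"
proof -
  define q where "q = root_reflection k p"
  have D': "root_system G V W p RR" "inj_on q RR" "\<And>\<rho>. \<rho> \<in> RR \<Longrightarrow> distinguished_in G V (q \<rho>)"
    using D by (auto simp: distinguished_root_system_def k_def q_def)
  have root: "\<And>\<rho>. \<rho> \<in> RR \<Longrightarrow> is_root k V W p \<rho>"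
    and stable: "\<And>\<rho>. \<rho> \<in> RR \<Longrightarrow> group_act p (q \<rho>) ` RR = RR"
    and int: "\<And>\<rho> \<rho>'. \<rho> \<in> RR \<Longrightarrow> \<rho>' \<in> RR \<Longrightarrow> pairing_ideal k p (fst \<rho>) (fst (snd \<rho>')) \<subseteq> R"
    and genq: "generated_group (q ` RR) = G"
    using D'(1) by (auto simp: root_system_def Let_def k_def q_def)
  have qG: "q \<rho> \<in> G" if "\<rho> \<in> RR" for \<rho>
    using generated_group.incl[of "q \<rho>" "q ` RR"] that genq by simp
  have "G \<subseteq> {g. invertible g \<and> group_act p g ` RR = RR}"
    unfolding genq[symmetric]
  proof (rule generated_group_subset[OF mat_group_symmetries])
    show "q ` RR \<subseteq> {g. invertible g \<and> group_act p g ` RR = RR}"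
      using stable GD(4)[OF qG] by blast
  qed
  then have act: "group_act p g \<rho> \<in> RR" if "g \<in> G" "\<rho> \<in> RR" for g \<rho> using that by blast
  have q_act: "q (group_act p g \<rho>) = g ** q \<rho> ** matrix_inv g" if g: "g \<in> G" and \<rho>: "\<rho> \<in> RR" for g \<rho>
  proof -
    obtain v w where "root_gen \<rho> v w" by (rule is_root_gen[OF root[OF \<rho>]])
    then show ?thesis unfolding q_def by (rule root_reflection_act[OF GD(4)[OF g]])
  qed
  have conj: "\<exists>i<r. conj_in G (s i) (q \<rho>)" if \<rho>: "\<rho> \<in> RR" for \<rho>
  proof -
    obtain v w where vw: "root_gen \<rho> v w" "v \<in> V" "w \<in> W" by (rule is_root_gen[OF root[OF \<rho>]])
    have e: "q \<rho> = rmat v w" unfolding q_def by (rule root_gen_reflection[OF vw(1)])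
    have "p v w \<noteq> 0" using vw(1) by (simp add: root_gen_def)
    then show ?thesis using distinguished_conjugate[OF vw(2,3)] qG[OF \<rho>] D'(3)[OF \<rho>] unfolding e by blast
  qed
  have "s i \<in> q ` RR" if i: "i < r" for i
  proof (rule generating[OF genq _ _ i])
    show "\<And>x. x \<in> q ` RR \<Longrightarrow> \<exists>i<r. conj_in G (s i) x" using conj by blast
    fix x g assume "x \<in> q ` RR" "g \<in> G"
    then obtain \<rho> where "\<rho> \<in> RR" "x = q \<rho>" by blast
    then show "g ** x ** matrix_inv g \<in> q ` RR"
      using q_act[OF \<open>g \<in> G\<close>, of \<rho>] act[OF \<open>g \<in> G\<close>, of \<rho>] by (metis image_eqI)
  qed
  then have "\<forall>i\<in>{..<r}. \<exists>\<rho>\<in>RR. q \<rho> = s i" by (metis imageE lessThan_iff)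
  then obtain \<rho> where \<rho>: "\<And>i. i < r \<Longrightarrow> \<rho> i \<in> RR" "\<And>i. i < r \<Longrightarrow> q (\<rho> i) = s i"
    by (metis lessThan_iff)
  have "\<exists>a b. \<rho> i = rroot a b i \<and> inverse_pair a b" if i: "i < r" for i
    using root_shape[OF root[OF \<rho>(1)[OF i]] _ i] \<rho>(2)[OF i]
    unfolding q_def inverse_pair_def by metis
  then obtain a b where ab: "\<And>i. i < r \<Longrightarrow> \<rho> i = rroot (a i) (b i) i" "\<And>i. i < r \<Longrightarrow> inverse_pair (a i) (b i)"
    by metis
  \<comment> \<open>The integral pairing of the two roots is an off-diagonal Cartan entry times x y.
    The entry is a unit and can be cancelled, so \<open>a i\<close> times \<open>b j\<close> is
    integral.\<close>
  have cross: "mprod R (a i) (b j) \<subseteq> R" if ij: "i < r" "j < r" "i \<noteq> j" for i j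
  proof (rule mprod_least[OF _ RD(5)])
    fix x y assume x: "x \<in> a i" and y: "y \<in> b j"
    obtain t where t: "t \<in> R" "p (\<alpha> i) (\<beta> j) * t = 1" using cartan_unit[OF ij] by blast
    have "p (x *s \<alpha> i) (cnj y *s \<beta> j) \<in> pairing_ideal k p (fst (\<rho> i)) (fst (snd (\<rho> j)))"
      unfolding pairing_ideal_def ab(1)[OF ij(1)] ab(1)[OF ij(2)] rroot_def
      using x y by (intro span_over_base) auto
    then have "p (x *s \<alpha> i) (cnj y *s \<beta> j) \<in> R" using int[OF \<rho>(1)[OF ij(1)] \<rho>(1)[OF ij(2)]] by blast
    then have "p (x *s \<alpha> i) (cnj y *s \<beta> j) * t \<in> R" using RD(4) t(1) by blast
    moreover have "p (x *s \<alpha> i) (cnj y *s \<beta> j) * t = x * y * (p (\<alpha> i) (\<beta> j) * t)" by (simp add: p_linear mult_ac)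
    ultimately show "x * y \<in> R" using t(2) by simp
  qed
  \<comment> \<open>\<open>a i\<close> equals \<open>a i\<close> times \<open>a j\<close> times
    \<open>b j\<close>, where \<open>a i\<close> times \<open>b j\<close> is integral; so it lies in
    \<open>a j\<close>. Exchanging i and j gives equality, and the same works for
    \<open>b\<close>.\<close>
  have a_le: "a i \<subseteq> a j" and b_le: "b i \<subseteq> b j" if ij: "i < r" "j < r" "i \<noteq> j" for i j
  proof -
    have sub: "submodule_over R (*) (a i)" "submodule_over R (*) (b i)" "submodule_over R (*) (a j)" "submodule_over R (*) (b j)"
      "mprod R (a j) (b j) = R" using ab(2) ij by (auto simp: inverse_pair_def)
    have mono: "mprod R A B \<subseteq> mprod R A C" if "B \<subseteq> C" for A B C
      unfolding mprod_def using that by (intro span_over_mono) blast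
    have "a i = mprod R (mprod R (a j) (b j)) (a i)" using inverse_pair_units[OF sub(1)] sub(5) by simp
    also have "\<dots> = mprod R (a j) (mprod R (a i) (b j))" by (simp add: mprod_assoc mprod_comm[of R "b j"])
    also have "\<dots> \<subseteq> mprod R (a j) R" by (rule mono[OF cross[OF ij]])
    finally show "a i \<subseteq> a j" using inverse_pair_units[OF sub(3)] by simp
    have "b i = mprod R (mprod R (b j) (a j)) (b i)"
      using inverse_pair_units[OF sub(2)] sub(5) by (simp add: mprod_comm[of R "b j"])
    also have "\<dots> = mprod R (b j) (mprod R (a j) (b i))" by (simp add: mprod_assoc)
    also have "\<dots> \<subseteq> mprod R (b j) R" using cross[of j i] ij by (intro mono) auto
    finally show "b i \<subseteq> b j" using inverse_pair_units[OF sub(4)] by simp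
  qed
  have r0: "0 < r" using r2 by simp
  have eq0: "a i = a 0" "b i = b 0" if "i < r" for i
    using a_le[of i 0] a_le[of 0 i] b_le[of i 0] b_le[of 0 i] that r0 by (cases "i = 0"; auto)+
  have rho0: "\<rho> i = rroot (a 0) (b 0) i" if "i < r" for i using ab(1)[OF that] eq0[OF that] by simp
  have "RR = RS (a 0) (b 0)"
  proof
    show "RS (a 0) (b 0) \<subseteq> RR"
    proof
      fix \<sigma> assume "\<sigma> \<in> RS (a 0) (b 0)"
      then obtain g i where "g \<in> G" "i < r" "\<sigma> = group_act p g (rroot (a 0) (b 0) i)" unfolding RS_def by blast
      then show "\<sigma> \<in> RR" using act[OF _ \<rho>(1)] rho0 by metis
    qed
    show "RR \<subseteq> RS (a 0) (b 0)"
    proof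
      fix \<sigma> assume \<sigma>: "\<sigma> \<in> RR"
      obtain i g where i: "i < r" and g: "g \<in> G" "q \<sigma> = g ** s i ** matrix_inv g"
        using conj[OF \<sigma>] by (auto simp: conj_in_def)
      have "q \<sigma> = q (group_act p g (\<rho> i))" using q_act[OF g(1) \<rho>(1)[OF i]] \<rho>(2)[OF i] g(2) by simp
      then have "\<sigma> = group_act p g (\<rho> i)" using D'(2) \<sigma> act[OF g(1) \<rho>(1)[OF i]] by (auto dest: inj_onD)
      then show "\<sigma> \<in> RS (a 0) (b 0)" unfolding RS_def using i g(1) rho0[OF i] by auto
    qed
  qed
  then show ?thesis using ab(2)[OF r0] by blast
qed

subsection \<open>Existence\<close>

abbreviation "std i \<equiv> rroot R R i"

text \<open>The ring of integers is stable under conjugation, so for a = b = R the conjugation in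
  \<open>rroot\<close> leaves no trace.\<close>

lemma std_eq: "std i = (span_over R (*s) {\<alpha> i}, span_over R (*s) {\<beta> i}, \<zeta> i)"
proof -
  have "(\<lambda>y. cnj y *s \<beta> i) ` R = (\<lambda>y. y *s \<beta> i) ` (cnj ` R)" by (simp only: image_image)
  then have "(\<lambda>y. cnj y *s \<beta> i) ` R = (\<lambda>y. y *s \<beta> i) ` R" by (simp only: cnj_image_R)
  then show ?thesis unfolding rroot_def span_over_singleton[OF R_ring] by blast
qed

lemma zeta_in_k: "i < r \<Longrightarrow> \<zeta> i \<in> k"
proof -
  assume i: "i < r"
  have "\<zeta> i = 1 - p (\<alpha> i) (\<beta> i)" using p_diag[OF i] by simp
  then show ?thesis using kD(3)[OF kD(1) p_in_k[OF alpha_V[OF i] beta_W[OF i]]] by simp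
qed

lemma k_line: "span_over k (*s) (span_over R (*s) {v}) = span_over k (*s) {v}" for v :: "complex^2"
proof
  have "submodule_over R (*s) (span_over k (*s) {v})"
    using submodule_span_over[of k "(*s)" "{v}"] R_subset_k unfolding submodule_over_def by blast
  then have "span_over R (*s) {v} \<subseteq> span_over k (*s) {v}"
    by (rule span_over_least[OF span_over_superset])
  then show "span_over k (*s) (span_over R (*s) {v}) \<subseteq> span_over k (*s) {v}"
    by (rule span_over_least[OF _ submodule_span_over])
  show "span_over k (*s) {v} \<subseteq> span_over k (*s) (span_over R (*s) {v})"
    by (intro span_over_mono span_over_superset)
qed

lemma is_root_std:
  assumes i: "i < r"
  shows "is_root k V W p (std i)"
proof -
  have "pairing_ideal k p ((\<lambda>x. x *s \<alpha> i) ` R) ((\<lambda>y. cnj y *s \<beta> i) ` R) = (\<lambda>x. (1 - \<zeta> i) * x) ` R"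
  proof -
    have "{p x z | x z. x \<in> (\<lambda>x. x *s \<alpha> i) ` R \<and> z \<in> (\<lambda>y. cnj y *s \<beta> i) ` R} =
        {p (x *s \<alpha> i) (cnj y *s \<beta> i) | x y. x \<in> R \<and> y \<in> R}" by blast
    also have "\<dots> = {(1 - \<zeta> i) * (x * y) | x y. x \<in> R \<and> y \<in> R}"
      by (simp add: p_linear p_diag[OF i] mult_ac)
    also have "\<dots> = (\<lambda>t. (1 - \<zeta> i) * t) ` {x * y | x y. x \<in> R \<and> y \<in> R}" by blast
    finally have "pairing_ideal k p ((\<lambda>x. x *s \<alpha> i) ` R) ((\<lambda>y. cnj y *s \<beta> i) ` R) =
        span_over R (*) ((\<lambda>t. (1 - \<zeta> i) * t) ` {x * y | x y. x \<in> R \<and> y \<in> R})"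
      by (simp only: pairing_ideal_def)
    also have "\<dots> = (\<lambda>t. (1 - \<zeta> i) * t) ` mprod R R R"
      unfolding mprod_def
      by (rule span_over_image[where \<sigma> = "\<lambda>r. r", symmetric]) (simp_all add: algebra_simps)
    finally show ?thesis using inverse_pair_units[OF RD(5)] by simp
  qed
  then have pair: "pairing_ideal k p (span_over R (*s) {\<alpha> i}) (span_over R (*s) {\<beta> i}) = (\<lambda>x. (1 - \<zeta> i) * x) ` R"
    using std_eq[of i] by (simp add: rroot_def)
  have "fg_rank_one k V (span_over R (*s) {\<alpha> i})"
    unfolding fg_rank_one_def k_line using alpha_V[OF i] alpha_nonzero[OF i]
    by (intro conjI exI[of _ "{\<alpha> i}"] exI[of _ "\<alpha> i"]) auto
  moreover have "fg_rank_one k W (span_over R (*s) {\<beta> i})"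
    unfolding fg_rank_one_def k_line using beta_W[OF i] beta_nonzero[OF i]
    by (intro conjI exI[of _ "{\<beta> i}"] exI[of _ "\<beta> i"]) auto
  ultimately show ?thesis
    unfolding std_eq is_root.simps pair using zeta_in_k[OF i] zeta_ne[OF i] zeta_root[OF i] by blast
qed

lemma root_gen_std:
  assumes i: "i < r"
  shows "root_gen (std i) (\<alpha> i) (\<beta> i)"
proof -
  note k_lines = k_line[unfolded span_over_singleton[OF subfield_ring_set[OF subfield_k]]]
  show ?thesis unfolding root_gen_def std_eq
    using alpha_nonzero[OF i] beta_nonzero[OF i] p_diag[OF i] zeta_ne[OF i] by (simp add: k_lines)
qed

lemma refl_std: "i < r \<Longrightarrow> root_reflection k p (std i) = s i"
  using root_gen_reflection[OF root_gen_std] s_rmat by simp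

lemma refl_act_std:
  "i < r \<Longrightarrow> g \<in> G \<Longrightarrow> root_reflection k p (group_act p g (std i)) = g ** s i ** matrix_inv g"
  using root_reflection_act[OF GD(4) root_gen_std] refl_std by simp

lemma finite_order:
  assumes g: "g \<in> G"
  shows "\<exists>n>0. mpow g n = mat 1"
proof -
  have "mpow g ` UNIV \<subseteq> G" using GD(5)[OF g] by blast
  then have "\<not> inj (mpow g)" using finite_G by (meson finite_subset infinite_UNIV_nat finite_imageD)
  then obtain i j where ij: "mpow g i = mpow g j" "i < j" unfolding inj_def by (metis linorder_neqE_nat)
  have "mpow g j = mpow g i ** mpow g (j - i)" using ij(2) by (simp flip: mpow_add)
  then have "mpow g i ** mpow g (j - i) = mpow g i ** mat 1" using ij(1) by simp
  then have "mpow g (j - i) = mat 1" using inv_cancel(3)[OF GD(4)[OF GD(5)[OF g]]] by metis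
  then show ?thesis using ij(2) by (intro exI[of _ "j - i"]) auto
qed

text \<open>The reflection \<open>s i\<close> changes x by \<open>p x (\<beta> i)\<close> times
  \<open>\<alpha> i\<close>, and that coefficient is integral on the lattice because the Cartan
  entries are. Inverses are covered as powers, by finite order.\<close>

lemma lattice_stable:
  assumes g: "g \<in> G" and x: "x \<in> span_over R (*s) (\<alpha> ` {..<r})"
  shows "g *v x \<in> span_over R (*s) (\<alpha> ` {..<r})"
proof -
  let ?L = "span_over R (*s) (\<alpha> ` {..<r})"
  have pL: "p x (\<beta> j) \<in> R" if "x \<in> ?L" "j < r" for x j
  proof -
    have "submodule_over R (*s) {x. p x (\<beta> j) \<in> R}"
      using RD by (auto simp: submodule_over_def p_linear p_zero)
    then have "?L \<subseteq> {x. p x (\<beta> j) \<in> R}"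
      by (rule span_over_least[rotated]) (use cartan_R that(2) in auto)
    then show ?thesis using that(1) by blast
  qed
  have minus: "x - y \<in> ?L" if "x \<in> ?L" "y \<in> ?L" for x y
  proof -
    have "x - y = x + (-1) *s y" by simp
    moreover have "-1 \<in> R" using ring_of_integers_minus[OF subfield_k RD(2)] .
    ultimately show ?thesis using span_overD(2,3) that by metis
  qed
  have gens: "s i *v x \<in> ?L" if "i < r" "x \<in> ?L" for i x
    unfolding s_rmat[OF that(1)] rmat
    by (rule minus[OF that(2)], rule span_overD(3)[OF pL[OF that(2,1)]]) (use that(1) in \<open>auto intro: span_over_base\<close>)
  have inv: "matrix_inv (s i) *v x \<in> ?L" if i: "i < r" and x: "x \<in> ?L" for i x
  proof -
    obtain n where n: "n > 0" "mpow (s i) n = mat 1"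
      using finite_order[OF s_G[OF i]] by blast
    have "mpow (s i) n = s i ** mpow (s i) (n - 1)" using n(1) by (cases n) auto
    then have "matrix_inv (s i) = mpow (s i) (n - 1)" using n(2) by (intro matrix_inv_eqI(1)) simp
    moreover have "mpow (s i) m *v x \<in> ?L" for m
      by (induction m) (simp_all add: x gens[OF i] matrix_vector_mul_assoc[symmetric])
    ultimately show ?thesis by simp
  qed
  have "g \<in> generated_group (s ` {..<r})" using g gen by simp
  then have "\<forall>x\<in>?L. g *v x \<in> ?L"
    by induction (auto simp: gens inv matrix_vector_mul_assoc[symmetric])
  then show ?thesis using x by blast
qed

lemma pairing_lattice:
  assumes "x \<in> span_over R (*s) (\<alpha> ` {..<r})" "j < r"
  shows "p x (\<beta> j) \<in> R"
proof -
  have "submodule_over R (*s) {x. p x (\<beta> j) \<in> R}"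
    using RD by (auto simp: submodule_over_def p_linear p_zero)
  then have "span_over R (*s) (\<alpha> ` {..<r}) \<subseteq> {x. p x (\<beta> j) \<in> R}"
    by (rule span_over_least[rotated]) (use cartan_R assms(2) in auto)
  then show ?thesis using assms(1) by blast
qed

text \<open>An element that centralizes \<open>s i\<close> scales \<open>\<alpha> i\<close> by some
  l. As the element has finite order, l is a root of unity in k, hence a unit of R, so both modules
  are preserved. This makes the reflection map injective on the orbit.\<close>

lemma stabilizes_std:
  assumes i: "i < r" and x: "x \<in> G" and comm: "x ** s i ** matrix_inv x = s i"
  shows "group_act p x (std i) = std i"
proof -
  note xi = GD(4)[OF x]
  have e: "rmat (x *v \<alpha> i) (contragredient p x *v \<beta> i) = rmat (\<alpha> i) (\<beta> i)"
    using rmat_conj[OF xi] comm s_rmat[OF i] by simp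
  define l where "l = p (x *v \<alpha> i) (\<beta> i) / p (\<alpha> i) (\<beta> i)"
  have pd: "p (x *v \<alpha> i) (contragredient p x *v \<beta> i) \<noteq> 0"
    using p_diag_nonzero[OF i] contragredient[OF xi] by simp
  note sc = rmat_eq_scale[OF e pd, unfolded contragredient[OF xi], folded l_def]
  have xa: "x *v \<alpha> i = l *s \<alpha> i" and l0: "l \<noteq> 0" and xb: "\<beta> i = cnj l *s (contragredient p x *v \<beta> i)"
    using sc by blast+
  obtain n where n: "n > 0" "mpow x n = mat 1" using finite_order[OF x] by blast
  have "l ^ n *s \<alpha> i = 1 *s \<alpha> i" using mpow_eigen[OF xa, of n] n(2) by simp
  then have ln: "l ^ n = 1" using cancel_scale[OF alpha_nonzero[OF i]] by blast
  have lk: "l \<in> k"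
    using V_scalar[OF alpha_V[OF i] alpha_nonzero[OF i]] G_V[OF x alpha_V[OF i]] xa by simp
  have lR: "l \<in> R" using lk algebraic_int_root_of_unity[OF ln n(1)] by (simp add: ring_of_integers_def)
  have "inverse l ^ n = 1" using ln by (simp add: power_inverse)
  then have liR: "inverse l \<in> R"
    using kD(7)[OF lk] algebraic_int_root_of_unity[OF _ n(1)] by (simp add: ring_of_integers_def)
  have scale: "{c *s (t *s v) | c. c \<in> R} = {c *s v | c. c \<in> R}"
    if t: "t \<in> R" "inverse t \<in> R" "t \<noteq> 0" for t and v :: "complex^2"
  proof
    show "{c *s (t *s v) | c. c \<in> R} \<subseteq> {c *s v | c. c \<in> R}"
      unfolding vector_smult_assoc using RD(4)[OF _ t(1)] by blast
    show "{c *s v | c. c \<in> R} \<subseteq> {c *s (t *s v) | c. c \<in> R}"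
    proof
      fix y assume "y \<in> {c *s v | c. c \<in> R}"
      then obtain c where c: "y = c *s v" "c \<in> R" by blast
      have "y = (c * inverse t) *s (t *s v)" using t(3) by (simp add: c(1) vector_smult_assoc)
      then show "y \<in> {c *s (t *s v) | c. c \<in> R}" using RD(4)[OF c(2) t(2)] by blast
    qed
  qed
  have "(\<lambda>u. x *v u) ` span_over R (*s) {\<alpha> i} = span_over R (*s) {\<alpha> i}"
    unfolding span_over_singleton[OF R_ring] line_image xa by (rule scale[OF lR liR l0])
  moreover have "(\<lambda>u. contragredient p x *v u) ` span_over R (*s) {\<beta> i} = span_over R (*s) {\<beta> i}"
  proof -
    have "cnj l \<in> R" "inverse (cnj l) \<in> R" "cnj l \<noteq> 0"
      using cnj_R[OF lR] cnj_R[OF liR] l0 by simp_all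
    from scale[OF this, of "contragredient p x *v \<beta> i"] show ?thesis
      unfolding span_over_singleton[OF R_ring] line_image xb[symmetric] by simp
  qed
  ultimately show ?thesis unfolding std_eq group_act.simps by simp
qed

lemma distinguished_in_conj:
  assumes g: "g \<in> G" and d: "distinguished_in G V q"
  shows "distinguished_in G V (g ** q ** matrix_inv g)"
proof -
  note gi = inv_cancel[OF GD(4)[OF g]]
  let ?F = "\<lambda>q. {h \<in> G. \<forall>x\<in>V. q *v x = x \<longrightarrow> h *v x = x}"
  have sub: "g' ** h ** matrix_inv g' \<in> ?F (g' ** q' ** matrix_inv g')" if "g' \<in> G" "h \<in> ?F q'" for g' h q'
  proof -
    note g'i = inv_cancel[OF GD(4)[OF that(1)]]
    have h: "h \<in> G" "\<And>x. x \<in> V \<Longrightarrow> q' *v x = x \<Longrightarrow> h *v x = x" using that(2) by blast+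
    have "(g' ** h ** matrix_inv g') *v x = x" if x: "x \<in> V" "(g' ** q' ** matrix_inv g') *v x = x" for x
    proof -
      have "g' *v (q' *v (matrix_inv g' *v x)) = x" using x(2) by (simp only: matrix_vector_mul_assoc[symmetric])
      then have "q' *v (matrix_inv g' *v x) = matrix_inv g' *v x" using g'i(5) by metis
      then have "h *v (matrix_inv g' *v x) = matrix_inv g' *v x"
        using h(2)[OF G_V[OF GD(3)[OF \<open>g' \<in> G\<close>] x(1)]] by blast
      then show ?thesis using g'i(6)[of x] by (simp add: matrix_vector_mul_assoc[symmetric])
    qed
    then show ?thesis using GD(2)[OF GD(2)[OF that(1) h(1)] GD(3)[OF that(1)]] by blast
  qed
  have mi: "matrix_inv (matrix_inv g) = g" by (rule matrix_inv_eqI(1)) (rule gi(1))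
  have rev_conj: "matrix_inv g ** (g ** h ** matrix_inv g) ** matrix_inv (matrix_inv g) = h"
    "g ** (matrix_inv g ** h ** matrix_inv (matrix_inv g)) ** matrix_inv g = h" for h
    unfolding mi by (simp_all add: matrix_mul_assoc gi)
  have "bij_betw (\<lambda>h. g ** h ** matrix_inv g) (?F q) (?F (g ** q ** matrix_inv g))"
  proof (rule bij_betw_byWitness[where f' = "\<lambda>h. matrix_inv g ** h ** matrix_inv (matrix_inv g)"])
    show "\<forall>h\<in>?F q. matrix_inv g ** (g ** h ** matrix_inv g) ** matrix_inv (matrix_inv g) = h"
      by (intro ballI rev_conj)
    show "\<forall>h\<in>?F (g ** q ** matrix_inv g). g ** (matrix_inv g ** h ** matrix_inv (matrix_inv g)) ** matrix_inv g = h"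
      by (intro ballI rev_conj)
    show "(\<lambda>h. g ** h ** matrix_inv g) ` ?F q \<subseteq> ?F (g ** q ** matrix_inv g)"
      by (intro image_subsetI sub[OF g])
    show "(\<lambda>h. matrix_inv g ** h ** matrix_inv (matrix_inv g)) ` ?F (g ** q ** matrix_inv g) \<subseteq> ?F q"
      using sub[OF GD(3)[OF g], of _ "g ** q ** matrix_inv g"] unfolding rev_conj by (intro image_subsetI)
  qed
  from bij_betw_same_card[OF this] have c: "card (?F q) = card (?F (g ** q ** matrix_inv g))" .
  have "det g * det (matrix_inv g) = 1" using gi(2) by (metis det_I det_mul)
  then have "det (g ** q ** matrix_inv g) = det q" by (simp add: det_mul mult_ac)
  then show ?thesis using d c by (simp add: distinguished_in_def)
qed

theorem distinguished_std: "distinguished_root_system G V W p (RS R R)"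
proof -
  define q where "q = root_reflection k p"
  have q_act: "q (group_act p g (std i)) = g ** s i ** matrix_inv g" if "i < r" "g \<in> G" for g i
    unfolding q_def by (rule refl_act_std[OF that])
  have RSE: "\<exists>g i. g \<in> G \<and> i < r \<and> \<rho> = group_act p g (std i)" if "\<rho> \<in> RS R R" for \<rho>
    using that unfolding RS_def by blast
  have RSI: "group_act p g (std i) \<in> RS R R" if "g \<in> G" "i < r" for g i
    using that unfolding RS_def by blast
  have stdI: "std i \<in> RS R R" if "i < r" for i
    using RSI[OF GD(1) that] by (simp add: group_act_one)
  have qG: "q \<rho> \<in> G" if mem: "\<rho> \<in> RS R R" for \<rho>
  proof -
    obtain g i where g: "g \<in> G" "i < r" "\<rho> = group_act p g (std i)" using RSE[OF mem] by blast
    show ?thesis unfolding g(3) q_act[OF g(2,1)] by (intro GD(2) GD(3) s_G g)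
  qed
  have fin: "finite (RS R R)"
  proof -
    have "RS R R = (\<lambda>(g,i). group_act p g (std i)) ` (G \<times> {..<r})"
      unfolding RS_def by auto
    then show ?thesis using finite_G by simp
  qed
  have root: "is_root k V W p \<rho>" if mem: "\<rho> \<in> RS R R" for \<rho>
  proof -
    obtain g i where g: "g \<in> G" "i < r" "\<rho> = group_act p g (std i)" using RSE[OF mem] by blast
    show ?thesis unfolding g(3) by (rule is_root_act[OF g(1) is_root_std[OF g(2)]])
  qed
  have 1: "group_act p g ` RS R R \<subseteq> RS R R" if g: "g \<in> G" for g
  proof
    fix \<sigma> assume "\<sigma> \<in> group_act p g ` RS R R"
    then obtain \<tau> where \<tau>: "\<tau> \<in> RS R R" "\<sigma> = group_act p g \<tau>" by blast
    obtain h i where h: "h \<in> G" "i < r" "\<tau> = group_act p h (std i)" using RSE[OF \<tau>(1)] by blast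
    have "\<sigma> = group_act p (g ** h) (std i)"
      unfolding \<tau>(2) h(3) by (rule group_act_mult[OF GD(4)[OF g] GD(4)[OF h(1)], symmetric])
    then show "\<sigma> \<in> RS R R" using RSI[OF GD(2)[OF g h(1)] h(2)] by simp
  qed
  have act: "group_act p g ` RS R R = RS R R" if g: "g \<in> G" for g
  proof
    show "group_act p g ` RS R R \<subseteq> RS R R" by (rule 1[OF g])
    show "RS R R \<subseteq> group_act p g ` RS R R"
    proof
      fix \<sigma> assume s: "\<sigma> \<in> RS R R"
      have "\<sigma> = group_act p g (group_act p (matrix_inv g) \<sigma>)"
        using group_act_mult[OF GD(4)[OF g] GD(4)[OF GD(3)[OF g]], of \<sigma>]
        by (simp only: inv_cancel(2)[OF GD(4)[OF g]] group_act_one)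
      then show "\<sigma> \<in> group_act p g ` RS R R" using 1[OF GD(3)[OF g]] s by blast
    qed
  qed
  have span: "span_over k (*s) (\<Union>\<rho>\<in>RS R R. fst \<rho>) = V"
  proof
    have "fst \<rho> \<subseteq> V" if \<rho>: "\<rho> \<in> RS R R" for \<rho>
    proof -
      have "fg_rank_one k V (fst \<rho>)" using root[OF \<rho>] by (cases \<rho>) simp
      then show ?thesis using R_span_in_V unfolding fg_rank_one_def by blast
    qed
    then show "span_over k (*s) (\<Union>\<rho>\<in>RS R R. fst \<rho>) \<subseteq> V" by (intro span_in_V) blast
    have a: "\<alpha> i \<in> span_over k (*s) (\<Union>\<rho>\<in>RS R R. fst \<rho>)" if "i < r" for i
    proof (rule span_over_base)
      have "\<alpha> i \<in> fst (std i)" unfolding std_eq by (simp add: span_over_base)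
      then show "\<alpha> i \<in> (\<Union>\<rho>\<in>RS R R. fst \<rho>)" using stdI[OF that] by blast
    qed
    have r01: "0 < r" "1 < r" using r2 by auto
    have ind: "\<alpha> 0 $ 1 * \<alpha> 1 $ 2 - \<alpha> 0 $ 2 * \<alpha> 1 $ 1 \<noteq> 0"
    proof
      assume "\<alpha> 0 $ 1 * \<alpha> 1 $ 2 - \<alpha> 0 $ 2 * \<alpha> 1 $ 1 = 0"
      then have "\<alpha> 0 $ 1 * \<alpha> 1 $ 2 = \<alpha> 0 $ 2 * \<alpha> 1 $ 1" by simp
      then obtain c where "\<alpha> 0 = c *s \<alpha> 1" by (rule parallel_vectors[OF _ alpha_nonzero[OF r01(2)]])
      then show False using cartan_det by (simp add: p_linear)
    qed
    show "V \<subseteq> span_over k (*s) (\<Union>\<rho>\<in>RS R R. fst \<rho>)"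
    proof
      fix x assume x: "x \<in> V"
      obtain c d where cd: "x = c *s \<alpha> 0 + d *s \<alpha> 1" by (rule basis_coords[OF ind])
      have det: "p (\<alpha> 0) (\<beta> 0) * p (\<alpha> 1) (\<beta> 1) - p (\<alpha> 1) (\<beta> 0) * p (\<alpha> 0) (\<beta> 1) \<noteq> 0"
        using cartan_det by (simp add: mult.commute)
      \<comment> \<open>The pairings of x with \<open>\<beta> 0\<close> and \<open>\<beta> 1\<close>
        form a linear system over k for the coordinates of x, with nonzero determinant by
        \<open>cartan_det\<close>.\<close>
      have px: "p (\<alpha> 0) (\<beta> 0) * c + p (\<alpha> 1) (\<beta> 0) * d \<in> k" "p (\<alpha> 0) (\<beta> 1) * c + p (\<alpha> 1) (\<beta> 1) * d \<in> k"
        using p_in_k[OF x beta_W[OF r01(1)]] p_in_k[OF x beta_W[OF r01(2)]]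
        by (simp_all add: cd p_linear mult.commute)
      have "c \<in> k" "d \<in> k"
        by (rule cramer[OF subfield_k det _ _ _ _ px]; intro p_in_k alpha_V beta_W r01)+
      then show "x \<in> span_over k (*s) (\<Union>\<rho>\<in>RS R R. fst \<rho>)"
        unfolding cd using a[OF r01(1)] a[OF r01(2)] span_overD(2,3) by metis
    qed
  qed
  have integral: "pairing_ideal k p (fst \<rho>) (fst (snd \<rho>')) \<subseteq> R" if mem: "\<rho> \<in> RS R R" "\<rho>' \<in> RS R R" for \<rho> \<rho>'
    unfolding pairing_ideal_def
  proof (rule span_over_least[OF _ RD(5)], safe)
    fix u z assume u: "u \<in> fst \<rho>" and z: "z \<in> fst (snd \<rho>')"
    obtain g i where g: "g \<in> G" "i < r" "\<rho> = group_act p g (std i)" using RSE[OF mem(1)] by blast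
    obtain h j where h: "h \<in> G" "j < r" "\<rho>' = group_act p h (std j)" using RSE[OF mem(2)] by blast
    obtain x where x: "u = g *v (x *s \<alpha> i)" "x \<in> R" using u unfolding g(3) rroot_def by auto
    obtain y where y: "z = contragredient p h *v (cnj y *s \<beta> j)" "y \<in> R" using z unfolding h(3) rroot_def by auto
    have hi: "invertible h" by (rule GD(4)[OF h(1)])
    \<comment> \<open>Cancelling h on both sides of the pairing reduces it to a pairing of a lattice
      vector with \<open>\<beta> j\<close>.\<close>
    have "u = h *v ((matrix_inv h ** g) *v (x *s \<alpha> i))"
      unfolding x(1) by (simp add: matrix_vector_mul_assoc[symmetric] inv_cancel(6)[OF hi])
    then have "p u z = p ((matrix_inv h ** g) *v (x *s \<alpha> i)) (cnj y *s \<beta> j)"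
      unfolding y(1) by (simp only: contragredient[OF hi])
    then have e: "p u z = (x * y) * p ((matrix_inv h ** g) *v \<alpha> i) (\<beta> j)"
      by (simp only: mv_scale p_linear complex_cnj_cnj) (simp add: mult_ac)
    have "(matrix_inv h ** g) *v \<alpha> i \<in> span_over R (*s) (\<alpha> ` {..<r})"
      using lattice_stable[OF GD(2)[OF GD(3)[OF h(1)] g(1)] span_over_base] g(2) by blast
    from pairing_lattice[OF this h(2)] show "p u z \<in> R" unfolding e using RD(4) x(2) y(2) by blast
  qed
  have gen': "generated_group (q ` RS R R) = G"
  proof
    have qG': "q ` RS R R \<subseteq> G" using qG by (rule image_subsetI)
    then show "generated_group (q ` RS R R) \<subseteq> G"
      by (rule generated_group_subset[OF mat_group_G])
    have "mat_group (generated_group (q ` RS R R))"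
      by (rule mat_group_generated) (rule GD(4)[OF subsetD[OF qG']])
    moreover have "s ` {..<r} \<subseteq> generated_group (q ` RS R R)"
    proof
      fix x assume "x \<in> s ` {..<r}"
      then obtain i where i: "i < r" "x = s i" by blast
      have "q (std i) = x" unfolding q_def i(2) by (rule refl_std[OF i(1)])
      then have "x \<in> q ` RS R R" using stdI[OF i(1)] by blast
      then show "x \<in> generated_group (q ` RS R R)" by (rule generated_group.incl)
    qed
    ultimately show "G \<subseteq> generated_group (q ` RS R R)"
      unfolding gen[symmetric] by (rule generated_group_subset)
  qed
  have inj: "inj_on q (RS R R)"
  proof (rule inj_onI)
    fix \<rho> \<rho>' assume \<rho>: "\<rho> \<in> RS R R" "\<rho>' \<in> RS R R" and e: "q \<rho> = q \<rho>'"
    obtain g i where g: "g \<in> G" "i < r" "\<rho> = group_act p g (std i)" using RSE[OF \<rho>(1)] by blast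
    obtain h j where h: "h \<in> G" "j < r" "\<rho>' = group_act p h (std j)" using RSE[OF \<rho>(2)] by blast
    note gi = inv_cancel[OF GD(4)[OF g(1)]] and hi = inv_cancel[OF GD(4)[OF h(1)]]
    have e': "g ** s i ** matrix_inv g = h ** s j ** matrix_inv h"
      using e q_act[OF g(2,1)] q_act[OF h(2,1)] by (simp add: g(3) h(3))
    have "det g * det (matrix_inv g) = 1" "det h * det (matrix_inv h) = 1"
      using gi(2) hi(2) by (metis det_I det_mul)+
    then have "det (g ** s i ** matrix_inv g) = det (s i)" "det (h ** s j ** matrix_inv h) = det (s j)"
      by (simp_all add: det_mul mult_ac)
    \<comment> \<open>Conjugation preserves determinants, and those of the standard generators are
      distinct. It remains that \<open>x\<close> below centralizes \<open>s i\<close>.\<close>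
    then have ij: "i = j" using det_inj[OF g(2) h(2)] e' by simp
    define x where "x = matrix_inv h ** g"
    have xG: "x \<in> G" unfolding x_def by (intro GD(2) GD(3) g h)
    have xinv: "matrix_inv x = matrix_inv g ** h"
      by (rule matrix_inv_eqI(1)) (simp add: x_def matrix_mul_assoc gi hi)
    have "x ** s i ** matrix_inv x = matrix_inv h ** (g ** s i ** matrix_inv g) ** h"
      unfolding xinv unfolding x_def by (simp add: matrix_mul_assoc)
    also have "\<dots> = s i" unfolding e' by (simp add: matrix_mul_assoc gi hi ij)
    finally have "group_act p x (std i) = std i" by (rule stabilizes_std[OF g(2) xG])
    moreover have "g = h ** x" by (simp add: x_def matrix_mul_assoc hi)
    ultimately show "\<rho> = \<rho>'" using group_act_mult[OF GD(4)[OF h(1)] GD(4)[OF xG], of "std i"] g(3) h(3) ij by simp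
  qed
  have dst: "distinguished_in G V (q \<rho>)" if mem: "\<rho> \<in> RS R R" for \<rho>
  proof -
    obtain g i where g: "g \<in> G" "i < r" "\<rho> = group_act p g (std i)" using RSE[OF mem] by blast
    show ?thesis unfolding g(3) q_act[OF g(2,1)] by (rule distinguished_in_conj[OF g(1) dist[OF g(2)]])
  qed
  show ?thesis
    unfolding distinguished_root_system_def root_system_def Let_def k_def[symmetric] q_def[symmetric]
    using fin root act[OF qG] span integral gen' inj dst by blast
qed

theorem unique_genus: "unique_genus G V W p"
  unfolding unique_genus_def k_def[symmetric]
proof (intro conjI allI impI)
  show "\<exists>RR. distinguished_root_system G V W p RR" using distinguished_std by blast
  fix RR1 RR2 assume D: "distinguished_root_system G V W p RR1 \<and> distinguished_root_system G V W p RR2"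
  obtain a b where "inverse_pair a b" "RR1 = RS a b" using distinguished_structure[of RR1] D by blast
  moreover obtain a' b' where "inverse_pair a' b'" "RR2 = RS a' b'" using distinguished_structure[of RR2] D by blast
  ultimately show "same_genus k RR1 RR2" using same_genus_RS by blast
qed

theorem cartan_matrix:
  assumes len: "length ss = r" "\<And>i. i < r \<Longrightarrow> ss ! i = s i"
    and C: "length C = r" "\<And>row. row \<in> set C \<Longrightarrow> length row = r"
      "\<And>i j. i < r \<Longrightarrow> j < r \<Longrightarrow> C ! i ! j = p (\<alpha> i) (\<beta> j)"
  shows "is_cartan_matrix k V W p ss C"
  unfolding is_cartan_matrix_def Let_def
proof (intro conjI exI allI impI)
  fix i assume i: "i < length ss"
  then have i: "i < r" by (simp add: len)
  show "is_root k V W p (span_over R (*s) {\<alpha> i}, span_over R (*s) {\<beta> i}, \<zeta> i)"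
    using is_root_std[OF i] unfolding std_eq .
  show "root_reflection k p (span_over R (*s) {\<alpha> i}, span_over R (*s) {\<beta> i}, \<zeta> i) = ss ! i"
    using refl_std[OF i] len(2)[OF i] unfolding std_eq by simp
  show "p (\<alpha> i) (\<beta> i) = 1 - \<zeta> i" by (rule p_diag[OF i])
  show "C ! i ! j = p (\<alpha> i) (\<beta> j)" if "j < length ss" for j using C(3)[OF i] that by (simp add: len)
qed (use len C in auto)

end

section \<open>From triangle groups to root systems\<close>

lemma k_formI:
  fixes v w :: "complex^2"
  assumes k: "is_subfield k" and d: "v$1 * w$2 - v$2 * w$1 \<noteq> 0"
  shows "k_form k {a *s v + b *s w | a b. a \<in> k \<and> b \<in> (k :: complex set)}"
proof -
  note kD = is_subfieldD[OF k]
  let ?U = "{a *s v + b *s w | a b. a \<in> k \<and> b \<in> k}"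
  have "submodule_over k (*s) ?U"
    unfolding submodule_over_def
  proof (intro conjI ballI)
    have "0 = 0 *s v + 0 *s w" by simp
    then show "0 \<in> ?U" using kD(2) by blast
  next
    fix x y assume "x \<in> ?U" "y \<in> ?U"
    then obtain a b a' b' where ab: "x = a *s v + b *s w" "y = a' *s v + b' *s w" "a \<in> k" "b \<in> k" "a' \<in> k" "b' \<in> k"
      by blast
    have "x + y = (a + a') *s v + (b + b') *s w" by (simp add: ab vector_sadd_rdistrib)
    then show "x + y \<in> ?U" using kD(5) ab by blast
  next
    fix r x assume r: "r \<in> k" and "x \<in> ?U"
    then obtain a b where ab: "x = a *s v + b *s w" "a \<in> k" "b \<in> k" by blast
    have "r *s x = (r * a) *s v + (r * b) *s w" by (simp add: ab vector_add_ldistrib vector_smult_assoc)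
    then show "r *s x \<in> ?U" using kD(6) r ab by blast
  qed
  moreover have "v = 1 *s v + 0 *s w" "w = 0 *s v + 1 *s w" by simp_all
  then have "{v, w} \<subseteq> ?U" using kD(1,2) by blast
  ultimately have 1: "span_over k (*s) {v, w} \<subseteq> ?U" by (intro span_over_least)
  have "a *s v + b *s w \<in> span_over k (*s) {v, w}" if "a \<in> k" "b \<in> k" for a b
    by (rule span_overD(2); rule span_overD(3)[OF that(1)] span_overD(3)[OF that(2)]; rule span_over_base; simp)
  then have 2: "?U = span_over k (*s) {v, w}" using 1 by blast
  have sp: "vec.span {v, w} = UNIV"
  proof -
    have "x \<in> vec.span {v, w}" for x
    proof -
      obtain a b where "x = a *s v + b *s w" by (rule basis_coords[OF d])
      then show ?thesis by (simp add: vec.span_add vec.span_scale vec.span_base)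
    qed
    then show ?thesis by blast
  qed
  have vw: "v \<noteq> w" using d by (auto simp: mult.commute)
  have "vec.independent {v, w}"
  proof (rule vec.card_le_dim_spanning[of "{v,w}" "UNIV"])
    show "UNIV \<subseteq> vec.span {v, w}" using sp by simp
    show "card {v, w} \<le> vec.dim (UNIV :: (complex^2) set)"
      unfolding vec_dim_card using vw by simp
  qed auto
  then show ?thesis unfolding k_form_def using sp 2 by blast
qed

section \<open>Traces of products of reflections, and matrices up to diagonal conjugation\<close>

lemma trace_inverse2:
  assumes "(A :: complex^2^2) ** B = mat 1"
  shows "trace B = trace A / det A"
proof -
  have d: "det A * det B = 1" using assms by (metis det_I det_mul)
  have e: "A$1$1 * B$1$1 + A$1$2 * B$2$1 = 1" "A$1$1 * B$1$2 + A$1$2 * B$2$2 = 0"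
    "A$2$1 * B$1$1 + A$2$2 * B$2$1 = 0" "A$2$1 * B$1$2 + A$2$2 * B$2$2 = 1"
    using assms by (simp_all add: mat2_simps)
  have "det A * B$1$1 = A$2$2 * (A$1$1 * B$1$1 + A$1$2 * B$2$1) - A$1$2 * (A$2$1 * B$1$1 + A$2$2 * B$2$1)"
    "det A * B$2$2 = A$1$1 * (A$2$1 * B$1$2 + A$2$2 * B$2$2) - A$2$1 * (A$1$1 * B$1$2 + A$1$2 * B$2$2)"
    by (simp_all add: det_2 algebra_simps)
  then have "det A * B$1$1 = A$2$2" "det A * B$2$2 = A$1$1" unfolding e by simp_all
  then have "det A * trace B = trace A" unfolding trace2 distrib_left by simp
  moreover have "det A \<noteq> 0" using d by auto
  ultimately show ?thesis by (simp add: field_simps)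
qed

lemma trace_scale: "trace (mat c ** (B :: complex^2^2)) = c * trace B"
  by (simp add: mat2_simps algebra_simps)

lemma trace_mult_comm: "trace ((A :: complex^2^2) ** B) = trace (B ** A)"
  by (simp add: mat2_simps algebra_simps)

lemma trace_complement_pair:
  "trace ((mat 1 - (A :: complex^2^2)) ** (mat 1 - B)) = 2 - trace A - trace B + trace (A ** B)"
  by (simp add: mat2_simps algebra_simps)

lemma trace_complement_triple:
  "trace ((mat 1 - (A :: complex^2^2)) ** (mat 1 - B) ** (mat 1 - C)) =
    2 - trace A - trace B - trace C + trace (A ** B) + trace (A ** C) + trace (B ** C) - trace (A ** B ** C)"
  by (simp add: mat2_simps algebra_simps)

text \<open>A product of maps of rank one has rank one, and the map that sends x to f x times a has
  trace f a. For the maps \<open>mat 1 - A i\<close> this turns cyclic products of Cartan entries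
  into traces.\<close>

lemma trace_rank_one:
  fixes M N L :: "complex^2^2"
  assumes M: "\<And>x. M *v x = f x *s a" and N: "\<And>x. N *v x = g x *s b" and L: "\<And>x. L *v x = h x *s d"
    and f: "\<And>x y. f (x + y) = f x + f y" "\<And>c x. f (c *s x) = c * f x"
    and g: "\<And>x y. g (x + y) = g x + g y" "\<And>c x. g (c *s x) = c * g x"
    and h: "\<And>x y. h (x + y) = h x + h y" "\<And>c x. h (c *s x) = c * h x"
  shows "trace (M ** N) = f b * g a" "trace (M ** N ** L) = f b * g d * h a"
proof -
  let ?e = "vector [1, 0] :: complex^2" and ?e' = "vector [0, 1] :: complex^2"
  have x: "x = x$1 *s ?e + x$2 *s ?e'" for x by (simp add: vec2_eq_iff)
  have nth: "M' $ i $ 1 = (M' *v ?e) $ i" "M' $ i $ 2 = (M' *v ?e') $ i" for M' :: "complex^2^2" and i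
    by (simp_all add: mat2_vec_nth)
  have c: "f x = x$1 * f ?e + x$2 * f ?e'" "g x = x$1 * g ?e + x$2 * g ?e'" "h x = x$1 * h ?e + x$2 * h ?e'" for x
    using arg_cong[OF x[of x], of f] arg_cong[OF x[of x], of g] arg_cong[OF x[of x], of h]
    by (simp_all only: f g h)
  have MN: "(M ** N) *v x = (g x * f b) *s a" "(M ** N ** L) *v x = (h x * g d * f b) *s a" for x
    by (simp_all add: matrix_vector_mul_assoc[symmetric] M N L mv_scale f g vector_smult_assoc mult.assoc)
  have "trace (M ** N) = f b * (a$1 * g ?e + a$2 * g ?e')"
    unfolding trace2 nth MN by (simp add: algebra_simps)
  then show "trace (M ** N) = f b * g a" using c(2)[of a] by simp
  have "trace (M ** N ** L) = f b * g d * (a$1 * h ?e + a$2 * h ?e')"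
    unfolding trace2 nth MN by (simp add: algebra_simps)
  then show "trace (M ** N ** L) = f b * g d * h a" using c(3)[of a] by simp
qed

text \<open>The factors l normalize the first row. The other entries are then forced by the products
  over 2-cycles and over one 3-cycle; the opposite 3-cycle is determined by these.\<close>

lemma diagonal_scaling:
  fixes a C :: "nat \<Rightarrow> nat \<Rightarrow> complex"
  assumes r: "r = 2 \<or> r = 3"
    and diag: "\<And>i. i < r \<Longrightarrow> a i i = C i i"
    and pair: "\<And>i j. i < r \<Longrightarrow> j < r \<Longrightarrow> i \<noteq> j \<Longrightarrow> a i j * a j i = C i j * C j i"
    and nz: "\<And>i j. i < r \<Longrightarrow> j < r \<Longrightarrow> i \<noteq> j \<Longrightarrow> C i j \<noteq> 0"
    and triple: "r = 3 \<Longrightarrow> a 0 2 * a 2 1 * a 1 0 = C 0 2 * C 2 1 * C 1 0"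
    and ij: "i < r" "j < r"
  defines "l \<equiv> \<lambda>i. if i = 0 then 1 else a 0 i / C 0 i"
  shows "l i * a i j / l j = C i j" "l i \<noteq> 0"
proof -
  have anz: "a i j \<noteq> 0" if "i < r" "j < r" "i \<noteq> j" for i j
    using pair[OF that] nz[OF that] nz[of j i] that by auto
  have r0: "0 < r" using r by auto
  show "l i \<noteq> 0" using anz[of 0 i] nz[of 0 i] ij(1) r0 by (auto simp: l_def)
  show "l i * a i j / l j = C i j"
  proof (cases "i = j")
    case True
    have "l i \<noteq> 0" using anz[of 0 i] nz[of 0 i] ij(1) r0 by (auto simp: l_def)
    then show ?thesis using diag[OF ij(1)] True by simp
  next
    case False
    consider "i = 0" | "j = 0" "i \<noteq> 0" | "i = 1" "j = 2" "r = 3" | "i = 2" "j = 1" "r = 3"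
      using False ij r by fastforce
    then show ?thesis
    proof cases
      case 1
      then show ?thesis using False anz[of 0 j] nz[of 0 j] ij by (simp add: l_def)
    next
      case 2
      then show ?thesis using pair[of 0 i] nz[of 0 i] ij by (simp add: l_def field_simps)
    next
      case 3
      have p: "a 0 1 * a 1 0 = C 0 1 * C 1 0" "a 1 2 * a 2 1 = C 1 2 * C 2 1" using pair 3 by auto
      have n: "C 0 1 \<noteq> 0" "C 0 2 \<noteq> 0" "a 0 2 \<noteq> 0" "a 2 1 \<noteq> 0" "a 1 0 \<noteq> 0" using nz anz 3 by auto
      \<comment> \<open>The nonzero factor \<open>a 2 1 * a 1 0\<close> completes both terms to
        products over cycles, which agree for a and C.\<close>
      have "(a 0 1 * C 0 2 * a 1 2 - C 1 2 * a 0 2 * C 0 1) * (a 2 1 * a 1 0) =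
        C 0 2 * (a 0 1 * a 1 0) * (a 1 2 * a 2 1) - C 1 2 * C 0 1 * (a 0 2 * a 2 1 * a 1 0)"
        by (simp add: algebra_simps)
      also have "\<dots> = 0" unfolding p triple[OF 3(3)] by (simp add: algebra_simps)
      finally have "a 0 1 * C 0 2 * a 1 2 = C 1 2 * a 0 2 * C 0 1" using n by simp
      then show ?thesis using 3 n by (simp add: l_def field_simps)
    next
      case 4
      have p: "a 0 1 * a 1 0 = C 0 1 * C 1 0" using pair 4 by auto
      have n: "C 0 1 \<noteq> 0" "C 0 2 \<noteq> 0" "C 1 0 \<noteq> 0" "a 0 1 \<noteq> 0" "a 1 0 \<noteq> 0" using nz anz 4 by auto
      have "(a 0 2 * C 0 1 * a 2 1 - C 2 1 * a 0 1 * C 0 2) * a 1 0 =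
        C 0 1 * (a 0 2 * a 2 1 * a 1 0) - C 2 1 * C 0 2 * (a 0 1 * a 1 0)"
        by (simp add: algebra_simps)
      also have "\<dots> = 0" unfolding p triple[OF 4(3)] by (simp add: algebra_simps)
      finally have "a 0 2 * C 0 1 * a 2 1 = C 2 1 * a 0 1 * C 0 2" using n by simp
      then show ?thesis using 4 n by (simp add: l_def field_simps)
    qed
  qed
qed

text \<open>Each quotient d i / d j is an integral entry divided by the unit
  \<open>C ! i ! j\<close>. So dividing all d i by d 0 gives units, and a common factor does not
  affect the conjugate.\<close>

lemma unit_off_diagonal_conjugate:
  assumes k: "is_subfield k"
    and C: "\<And>i j. i < r \<Longrightarrow> j < r \<Longrightarrow> i \<noteq> j \<Longrightarrow> \<exists>y\<in>ring_of_integers k. C ! i ! j * y = 1"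
    and d: "\<And>i. i < r \<Longrightarrow> d i \<in> k \<and> d i \<noteq> 0"
    and int: "\<And>i j. i < r \<Longrightarrow> j < r \<Longrightarrow> diag_conj d C i j \<in> ring_of_integers k"
  shows "\<exists>u. (\<forall>i<r. u i \<in> integral_units k) \<and>
    (\<forall>i<r. \<forall>j<r. diag_conj d C i j = diag_conj u C i j)"
proof (intro exI[of _ "\<lambda>i. d i / d 0"] conjI allI impI)
  note RD = ring_setD[OF ring_of_integers_ring_set[OF k]]
  fix i assume i: "i < r"
  then have r0: "0 < r" by simp
  have d0: "d 0 \<noteq> 0" "d i \<noteq> 0" using d i r0 by auto
  show "d i / d 0 \<in> integral_units k"
  proof (cases "i = 0")
    case True
    then show ?thesis using d0 RD(2) by (auto simp: integral_units_def)
  next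
    case False
    have unit: "d i / d j \<in> ring_of_integers k" if ij: "i < r" "j < r" "i \<noteq> j" for i j
    proof -
      obtain y where y: "y \<in> ring_of_integers k" "C ! i ! j * y = 1" using C[OF ij] by blast
      have "diag_conj d C i j * y = d i / d j * (C ! i ! j * y)" by (simp add: diag_conj_def field_simps)
      then have "d i / d j = diag_conj d C i j * y" using y(2) by simp
      then show ?thesis using RD(4)[OF int[OF ij(1,2)] y(1)] by simp
    qed
    have "d i / d 0 * (d 0 / d i) = 1" using d0 by simp
    then show ?thesis using unit[OF i r0 False] unit[OF r0 i] False unfolding integral_units_def by blast
  qed
  fix j assume "j < r"
  then show "diag_conj d C i j = diag_conj (\<lambda>i. d i / d 0) C i j"
    using d0 d by (simp add: diag_conj_def field_simps)
qed

lemma reflection_complement: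
  assumes v0: "v0 \<noteq> 0" and gv: "g *v v0 = v0" "g *v perp v0 = d *s perp v0"
  shows "\<exists>c. (\<forall>x y. c (x + y) = c x + c y) \<and> (\<forall>t x. c (t *s x) = t * c x) \<and>
    c (perp v0) = 1 - d \<and> (\<forall>x. x - g *v x = c x *s perp v0)"
proof (intro exI conjI allI)
  define n where "n = hip v0 v0"
  define c where "c y = hip y (perp v0) / n * (1 - d)" for y
  have "hip (y + y') w = hip y w + hip y' w" "hip (t *s y) w = t * hip y w" for y y' w t
    by (simp_all add: hip_def algebra_simps)
  then show "c (y + y') = c y + c y'" "c (t *s y) = t * c y" for y y' t
    by (simp_all add: c_def add_divide_distrib distrib_right)
  show diff: "y - g *v y = c y *s perp v0" for y
  proof -
    define h where "h = hip y (perp v0) / n"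
    have "y - g *v y = h *s perp v0 - h *s (d *s perp v0)"
      unfolding n_def h_def
      by (subst (1 2) frame_decomp[OF v0, of y]) (simp only: mv_add mv_scale gv add_diff_cancel_left)
    then show ?thesis by (simp add: c_def h_def[symmetric] vec2_eq_iff algebra_simps)
  qed
  have "c (perp v0) *s perp v0 = (1 - d) *s perp v0"
    unfolding diff[symmetric] gv by (simp add: vec2_eq_iff algebra_simps)
  moreover have "perp v0 \<noteq> 0" using v0 by simp
  ultimately show "c (perp v0) = 1 - d" using cancel_scale[THEN iffD1] by blast
qed

context realized
begin

text \<open>The vector \<open>perp v0\<close> may lie outside the k-form V; a = x - g x for a
  suitable x in V lies in it and spans the same complex line. By \<open>V_scalar\<close> the
  pairings of V with b are then in k, which puts b into W.\<close>

lemma reflection_data: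
  assumes g: "g \<in> G" and v0: "v0 \<noteq> 0" and gv: "g *v v0 = v0" "g *v perp v0 = d *s perp v0" and d: "d \<noteq> 1"
  obtains a b where "a \<in> V" "b \<in> W" "g = rmat a b" "p a b = 1 - d"
proof -
  have "\<exists>x\<in>V. g *v x \<noteq> mat 1 *v x"
  proof (rule ccontr)
    assume "\<not> ?thesis"
    then have "g = mat 1" by (intro V_spans) blast
    then have e: "d *s perp v0 = 1 *s perp v0" using gv(2) by simp
    have "perp v0 \<noteq> 0" using v0 by simp
    from cancel_scale[OF this, THEN iffD1, OF e] show False using d by simp
  qed
  then obtain x where x: "x \<in> V" "g *v x \<noteq> x" by auto
  obtain c where lin: "\<And>y y'. c (y + y') = c y + c y'" "\<And>t y. c (t *s y) = t * c y"
    and diff: "\<And>y. y - g *v y = c y *s perp v0"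
    using reflection_complement[OF v0 gv] by blast
  have cx: "c x \<noteq> 0" using x(2) diff[of x] by auto
  define a where "a = x - g *v x"
  have aV: "a \<in> V" unfolding a_def by (rule V_diff[OF x(1) G_V[OF g x(1)]])
  have a: "a = c x *s perp v0" by (simp add: a_def diff)
  have a0: "a \<noteq> 0" unfolding a using cx v0 by simp
  define f where "f y = c y / c x" for y
  have fa: "y - g *v y = f y *s a" for y
    using cx by (simp add: diff a f_def vector_smult_assoc)
  obtain b where b: "\<And>y. f y = p y b"
    using riesz[of f] lin by (auto simp: f_def add_divide_distrib)
  have "g *v y = y - p y b *s a" for y
    using fa[of y] by (simp add: b[symmetric] algebra_simps)
  then have "g = rmat a b" by (rule rmat_eqI)
  moreover have "b \<in> W"
  proof (rule W_dual)
    fix y assume y: "y \<in> V"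
    have "p y b *s a \<in> V" unfolding b[symmetric] fa[symmetric] by (rule V_diff[OF y G_V[OF g y]])
    then show "p y b \<in> k" by (rule V_scalar[OF aV a0])
  qed
  moreover have "p a b = 1 - d"
  proof -
    have "g *v a = d *s a" by (simp add: a mv_scale gv vector_smult_assoc mult.commute)
    then have "f a *s a = (1 - d) *s a" using fa[of a] by (simp add: vec2_eq_iff algebra_simps)
    from cancel_scale[OF a0, THEN iffD1, OF this] show ?thesis using b by simp
  qed
  ultimately show ?thesis using that aV by blast
qed

end

context triangle_group
begin

lemma A_power_od: "i < 3 \<Longrightarrow> mpow (A i) (od i) = mat 1"
proof (rule frame_eqI)
  assume i: "i < 3"
  show "axis i \<noteq> 0" by (rule axis(1)[OF i])
  show "mpow (A i) (od i) *v axis i = mat 1 *v axis i"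
    using mpow_eigen[of "A i" "axis i" 1 "od i"] axis(2)[OF i] by simp
  show "mpow (A i) (od i) *v perp (axis i) = mat 1 *v perp (axis i)"
    using mpow_eigen[OF axis(3)[OF i], of "od i"] zeta_pow_self[OF od_bounds(3)[OF i]] by simp
qed

lemma trace_A_inverse: "i < 3 \<Longrightarrow> A i ** B = mat 1 \<Longrightarrow> trace B = 1 + 1 / zeta (od i)"
  using trace_inverse2[of "A i" B] by (simp add: trace_A det_A field_simps)

lemma prod_A_cyclic: "A 1 ** A 2 ** A 0 = mat z" "A 2 ** A 0 ** A 1 = mat z"
proof -
  have i: "invertible (A j)" if "j < 3" for j using unitaryD(1)[OF unitary[OF that]] .
  have "A 1 ** A 2 ** A 0 = matrix_inv (A 0) ** (A 0 ** A 1 ** A 2) ** A 0"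
    using inv_cancel(3)[OF i, of 0 "A 1 ** A 2"] by (simp add: matrix_mul_assoc)
  also have "\<dots> = mat z"
    unfolding prod_A mat_comm using inv_cancel(8)[OF i, of 0 "mat z"] by simp
  finally show 1: "A 1 ** A 2 ** A 0 = mat z" .
  have "A 2 ** A 0 ** A 1 = matrix_inv (A 1) ** (A 1 ** A 2 ** A 0) ** A 1"
    using inv_cancel(3)[OF i, of 1 "A 2 ** A 0"] by (simp add: matrix_mul_assoc)
  also have "\<dots> = mat z"
    unfolding 1 mat_comm using inv_cancel(8)[OF i, of 1 "mat z"] by simp
  finally show "A 2 ** A 0 ** A 1 = mat z" .
qed

text \<open>Up to cyclic order the product of two generators is z times the inverse of the third,
  and a trace of an inverse is the trace divided by the determinant.\<close>

lemma trace_pairs: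
  "trace (A 0 ** A 1) = z * (1 + 1 / zeta c)" "trace (A 1 ** A 2) = z * (1 + 1 / zeta 2)"
  "trace (A 0 ** A 2) = z * (1 + 1 / zeta 3)" "trace (A 0 ** A 1 ** A 2) = 2 * z"
proof -
  have i: "invertible (A j)" if "j < 3" for j using unitaryD(1)[OF unitary[OF that]] .
  have *: "trace (A a ** A b) = z * (1 + 1 / zeta (od d))"
    if "A a ** A b ** A d = mat z" "d < 3" for a b d
  proof -
    have "A a ** A b = mat z ** matrix_inv (A d)" unfolding that(1)[symmetric] by (rule inv_cancel(7)[OF i[OF that(2)], symmetric])
    moreover have "trace (matrix_inv (A d)) = 1 + 1 / zeta (od d)"
      by (rule trace_A_inverse[OF that(2) inv_cancel(2)[OF i[OF that(2)]]])
    ultimately show ?thesis by (simp add: trace_scale)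
  qed
  show "trace (A 0 ** A 1) = z * (1 + 1 / zeta c)" using *[OF prod_A] by (simp add: od_simps)
  show "trace (A 1 ** A 2) = z * (1 + 1 / zeta 2)" using *[OF prod_A_cyclic(1)] by (simp add: od_simps)
  show "trace (A 0 ** A 2) = z * (1 + 1 / zeta 3)"
    using *[OF prod_A_cyclic(2)] trace_mult_comm[of "A 0" "A 2"] by (simp add: od_simps)
  show "trace (A 0 ** A 1 ** A 2) = 2 * z" unfolding prod_A by (simp add: trace2 mat2_nth)
qed

lemma is_reflection_A:
  assumes i: "i < 3"
  shows "is_reflection (A i)"
proof -
  have inv: "invertible (A i)" using unitaryD(1)[OF unitary[OF i]] .
  let ?w = "perp (axis i)"
  have w0: "?w \<noteq> 0" using axis(1)[OF i] by simp
  have "range (\<lambda>x. A i *v x - x) = vec.span {?w}"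
  proof
    show "range (\<lambda>x. A i *v x - x) \<subseteq> vec.span {?w}"
    proof (rule image_subsetI)
      fix x
      define h l where "h = hip x ?w / hip (axis i) (axis i)" and "l = hip x (axis i) / hip (axis i) (axis i)"
      have x: "x = l *s axis i + h *s ?w" unfolding h_def l_def by (rule frame_decomp[OF axis(1)[OF i]])
      have "A i *v x - x = h *s (zeta (od i) *s ?w) - h *s ?w"
        unfolding x by (simp only: mv_add mv_scale axis[OF i] add_diff_cancel_left)
      also have "\<dots> = (h * zeta (od i) - h) *s ?w" by (simp add: vec2_eq_iff algebra_simps)
      finally have e: "A i *v x - x = (h * zeta (od i) - h) *s ?w" .
      show "A i *v x - x \<in> vec.span {?w}" unfolding e by (rule vec.span_scale[OF vec.span_base]) simp
    qed
    show "vec.span {?w} \<subseteq> range (\<lambda>x. A i *v x - x)"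
    proof
      fix y assume "y \<in> vec.span {?w}"
      then obtain t where t: "y = t *s ?w" by (auto simp: vec.span_singleton)
      define h where "h = t / (zeta (od i) - 1)"
      have "zeta (od i) - 1 \<noteq> 0" using zeta_od[OF i] by simp
      then have "h * (zeta (od i) - 1) = t" by (simp add: h_def)
      then have "h * zeta (od i) - h = t" by (simp add: right_diff_distrib)
      moreover have "A i *v (h *s ?w) - h *s ?w = (h * zeta (od i) - h) *s ?w"
        using axis(3)[OF i] by (simp add: mv_scale vec2_eq_iff algebra_simps)
      ultimately have "y = A i *v (h *s ?w) - h *s ?w" using t by simp
      then show "y \<in> range (\<lambda>x. A i *v x - x)" by blast
    qed
  qed
  moreover have "vec.dim {?w} = 1"
    using vec.dim_eq_card_independent[of "{?w}"] w0 by (simp add: vec.dim_insert)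
  ultimately show ?thesis unfolding is_reflection_def using inv by (simp add: vec.dim_span)
qed

end

text \<open>\<open>idx\<close> selects the generators of the group. \<open>C_pair\<close> and
  \<open>C_triple\<close> compare exactly the cyclic products that determine a matrix up to diagonal
  conjugation, so C is attained by suitable roots without the roots being computed.\<close>

locale cartan_triangle = triangle_group +
  fixes idx :: "nat list" and C :: "complex list list" and k :: "complex set"
  assumes idx: "idx = [0,1] \<or> idx = [0,2] \<or> idx = [1,2] \<or> idx = [0,1,2]"
    and k_def: "k = field_of_definition (sub (set idx))"
    and C_length: "length C = length idx" "\<And>row. row \<in> set C \<Longrightarrow> length row = length idx"
    and C_diag: "i < length idx \<Longrightarrow> C ! i ! i = 1 - zeta (od (idx ! i))"
    and C_pair: "i < j \<Longrightarrow> j < length idx \<Longrightarrow>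
      C ! i ! j * C ! j ! i = trace ((mat 1 - A (idx ! i)) ** (mat 1 - A (idx ! j)))"
    and C_triple: "length idx = 3 \<Longrightarrow> C ! 0 ! 2 * C ! 2 ! 1 * C ! 1 ! 0 =
      trace ((mat 1 - A 0) ** (mat 1 - A 1) ** (mat 1 - A 2))"
    and C_k: "i < length idx \<Longrightarrow> j < length idx \<Longrightarrow> C ! i ! j \<in> k"
    and C_int: "i < length idx \<Longrightarrow> j < length idx \<Longrightarrow> algebraic_int (C ! i ! j)"
    and C_unit: "i < length idx \<Longrightarrow> j < length idx \<Longrightarrow> i \<noteq> j \<Longrightarrow>
      C ! i ! j \<noteq> 0 \<and> algebraic_int (inverse (C ! i ! j))"
    and C_det: "C ! 0 ! 0 * C ! 1 ! 1 - C ! 0 ! 1 * C ! 1 ! 0 \<noteq> 0"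
begin

abbreviation "I \<equiv> set idx"
abbreviation "r \<equiv> length idx"
abbreviation "H \<equiv> sub I"

lemma I3: "I \<subseteq> {..<3}" and I_two: "{0,1} \<subseteq> I \<or> {0,2} \<subseteq> I \<or> {1,2} \<subseteq> I"
  using idx by auto

lemma r_cases: "r = 2 \<or> r = 3" "2 \<le> r" "0 < r" "1 < r"
  using idx by auto

lemma idx_less: "i < r \<Longrightarrow> idx ! i < 3" and idx_in: "i < r \<Longrightarrow> idx ! i \<in> I"
  using subsetD[OF I3 nth_mem[of i idx]] by simp_all

lemma idx_inj: "i < r \<Longrightarrow> j < r \<Longrightarrow> idx ! i = idx ! j \<Longrightarrow> i = j"
  using idx nth_eq_iff_index_eq[of idx i j] by auto

lemma idx_of: "j \<in> I \<Longrightarrow> \<exists>i<r. idx ! i = j"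
  by (auto simp: in_set_conv_nth)

lemma idx_triple: "r = 3 \<Longrightarrow> idx ! 0 = 0 \<and> idx ! 1 = 1 \<and> idx ! 2 = 2"
  using idx by auto

lemmas mat_group_H = mat_group_sub[OF I3 I_two]
lemmas H_subset_G = sub_subset_G[OF I3 I_two]

lemma finite_H: "finite H" and unitary_H: "g \<in> H \<Longrightarrow> unitary g"
  using finite_subset[OF H_subset_G finite_G] H_subset_G G_unitary by auto

lemma subfield_k: "is_subfield k"
  by (simp add: k_def field_of_definition_def subfield_hull)

lemma image_idx: "(\<lambda>i. A (idx ! i)) ` {..<r} = A ` I"
  by (force simp: set_conv_nth)

lemma C_R: "i < r \<Longrightarrow> j < r \<Longrightarrow> C ! i ! j \<in> ring_of_integers k"
  using C_k C_int by (simp add: ring_of_integers_def)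

lemma C_inverse_R: "i < r \<Longrightarrow> j < r \<Longrightarrow> i \<noteq> j \<Longrightarrow> \<exists>y\<in>ring_of_integers k. C ! i ! j * y = 1"
  using C_unit[of i j] is_subfieldD(7)[OF subfield_k C_k[of i j]]
  by (intro bexI[of _ "inverse (C ! i ! j)"]) (auto simp: ring_of_integers_def)

lemma C_pair_sym:
  assumes "i < r" "j < r" "i \<noteq> j"
  shows "C ! i ! j * C ! j ! i = trace ((mat 1 - A (idx ! i)) ** (mat 1 - A (idx ! j)))"
proof (cases "i < j")
  case True
  then show ?thesis using C_pair assms by blast
next
  case False
  then have "C ! j ! i * C ! i ! j = trace ((mat 1 - A (idx ! j)) ** (mat 1 - A (idx ! i)))"
    using C_pair assms by simp
  then show ?thesis using trace_mult_comm by (metis mult.commute)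
qed

lemma fixed_by_A:
  assumes i: "i < 3" and u: "A i *v u = u"
  obtains t where "u = t *s axis i"
proof -
  let ?w = "perp (axis i)"
  define h l where "h = hip u ?w / hip (axis i) (axis i)" and "l = hip u (axis i) / hip (axis i) (axis i)"
  have x: "u = l *s axis i + h *s ?w" unfolding h_def l_def by (rule frame_decomp[OF axis(1)[OF i]])
  have "l *s axis i + h *s (zeta (od i) *s ?w) = l *s axis i + h *s ?w"
    using u unfolding x by (simp only: mv_add mv_scale axis[OF i])
  then have "(h * zeta (od i)) *s ?w = h *s ?w" by (simp add: vector_smult_assoc)
  then have "h * zeta (od i) = h" using cancel_scale[of ?w] axis(1)[OF i] by simp
  then have "h = 0" using zeta_od[OF i] by simp
  then have "u = l *s axis i" using x by simp
  then show ?thesis by (rule that)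
qed

lemma card_fixing:
  assumes i: "i < r" and u: "u \<noteq> 0" "A (idx ! i) *v u = u"
  shows "card {h \<in> H. h *v u = u} = od (idx ! i)"
proof -
  obtain t where t: "u = t *s axis (idx ! i)" by (rule fixed_by_A[OF idx_less[OF i] u(2)])
  have t0: "t \<noteq> 0" using u(1) t by auto
  have "h *v u = u \<longleftrightarrow> h *v axis (idx ! i) = axis (idx ! i)" for h
  proof
    assume "h *v u = u"
    then have "t *s (h *v axis (idx ! i)) = t *s axis (idx ! i)" by (simp add: t mv_scale)
    then show "h *v axis (idx ! i) = axis (idx ! i)" by (rule scale_left_cancel[OF t0])
  qed (simp add: t mv_scale)
  then show ?thesis using card_fixing_axis[OF I3 I_two idx_in[OF i]] by simp
qed

theorem for_realization:
  assumes real: "realization H V W p"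
  shows "unique_genus H V W p \<and> is_cartan_matrix k V W p (map (\<lambda>i. A i) idx) C \<and>
    (\<forall>i<r. distinguished_in H V (A (idx ! i)))"
proof -
  interpret realized H V W p k
    by unfold_locales (use real k_def mat_group_H finite_H unitary_H in auto)
  have "\<exists>ab. fst ab \<in> V \<and> snd ab \<in> W \<and> A (idx ! i) = rmat (fst ab) (snd ab) \<and>
      p (fst ab) (snd ab) = 1 - zeta (od (idx ! i))" if i: "i < r" for i
  proof -
    obtain a b where "a \<in> V" "b \<in> W" "A (idx ! i) = rmat a b" "p a b = 1 - zeta (od (idx ! i))"
      by (rule reflection_data[OF A_in_sub[OF I3 I_two idx_in[OF i]] axis[OF idx_less[OF i]] zeta_od[OF idx_less[OF i]]])
    then show ?thesis by (intro exI[of _ "(a,b)"]) simp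
  qed
  then have "\<forall>i. \<exists>ab. i < r \<longrightarrow> fst ab \<in> V \<and> snd ab \<in> W \<and> A (idx ! i) = rmat (fst ab) (snd ab) \<and>
      p (fst ab) (snd ab) = 1 - zeta (od (idx ! i))" by blast
  then obtain ab where ab: "\<And>i. i < r \<Longrightarrow> fst (ab i) \<in> V \<and> snd (ab i) \<in> W \<and> A (idx ! i) = rmat (fst (ab i)) (snd (ab i)) \<and>
      p (fst (ab i)) (snd (ab i)) = 1 - zeta (od (idx ! i))" by metis
  define a b where "a = (\<lambda>i. fst (ab i))" and "b = (\<lambda>i. snd (ab i))"
  have aV: "a i \<in> V" and bW: "b i \<in> W" and Ai: "A (idx ! i) = rmat (a i) (b i)"
    and pab: "p (a i) (b i) = 1 - zeta (od (idx ! i))" if "i < r" for i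
    using ab[OF that] by (simp_all add: a_def b_def)
  have M: "(mat 1 - A (idx ! i)) *v x = p x (b i) *s a i" if "i < r" for i x
    unfolding Ai[OF that] by (rule mat_minus_rmat)
  define m where "m i j = p (a i) (b j)" for i j
  \<comment> \<open>The factors of \<open>diagonal_scaling\<close>: they conjugate the Cartan matrix
    \<open>m\<close> of the arbitrarily chosen roots into C. They lie in k, so the rescaled roots
    stay in V and W.\<close>
  define l where "l i = (if i = 0 then 1 else m 0 i / C ! 0 ! i)" for i
  have pair: "m i j * m j i = C ! i ! j * C ! j ! i" if ij: "i < r" "j < r" "i \<noteq> j" for i j
    using trace_rank_one(1)[OF M[OF ij(1)] M[OF ij(2)] M[OF ij(1)]] C_pair_sym[OF ij]
    by (simp add: p_linear m_def mult.commute)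
  have triple: "m 0 2 * m 2 1 * m 1 0 = C ! 0 ! 2 * C ! 2 ! 1 * C ! 1 ! 0" if r3: "r = 3"
  proof -
    have "trace ((mat 1 - A (idx ! 0)) ** (mat 1 - A (idx ! 1)) ** (mat 1 - A (idx ! 2))) =
        p (a 1) (b 0) * p (a 2) (b 1) * p (a 0) (b 2)"
      by (rule trace_rank_one(2)) (simp_all add: M r3 p_linear)
    then show ?thesis using C_triple[OF r3] idx_triple[OF r3] by (simp add: m_def mult_ac)
  qed
  have scal: "l i * m i j / l j = C ! i ! j" "l i \<noteq> 0" if "i < r" "j < r" for i j
  proof -
    have *: "i < r \<Longrightarrow> j < r \<Longrightarrow> (if i = 0 then 1 else m 0 i / C ! 0 ! i) * m i j / (if j = 0 then 1 else m 0 j / C ! 0 ! j) = C ! i ! j"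
      "i < r \<Longrightarrow> j < r \<Longrightarrow> (if i = 0 then 1 else m 0 i / C ! 0 ! i) \<noteq> 0" for i j
      by (rule diagonal_scaling[where a = m and C = "\<lambda>i j. C ! i ! j" and r = r];
          use r_cases C_diag pab pair C_unit triple in \<open>simp add: m_def\<close>)+
    show "l i * m i j / l j = C ! i ! j" "l i \<noteq> 0" unfolding l_def by (rule *[OF that])+
  qed
  have lk: "l i \<in> k" if i: "i < r" for i
    unfolding l_def m_def using kD(1) kD(8)[OF p_in_k[OF aV[OF r_cases(3)] bW[OF i]] C_k[OF r_cases(3) i]] by auto
  \<comment> \<open>Scaling the vector by l and the covector by the conjugate of 1 / l keeps the
    reflection and conjugates the matrix of pairings.\<close>
  define \<alpha> \<beta> where "\<alpha> i = l i *s a i" and "\<beta> i = cnj (1 / l i) *s b i" for i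
  have pC: "p (\<alpha> i) (\<beta> j) = C ! i ! j" if "i < r" "j < r" for i j
    using scal(1)[OF that] by (simp add: \<alpha>_def \<beta>_def p_linear m_def)
  have Arm: "A (idx ! i) = rmat (\<alpha> i) (\<beta> i)" if i: "i < r" for i
  proof (rule rmat_eqI)
    fix x
    have "p x (\<beta> i) *s \<alpha> i = p x (b i) *s a i"
      using scal(2)[OF i i] by (simp add: \<alpha>_def \<beta>_def p_linear vector_smult_assoc)
    then show "A (idx ! i) *v x = x - p x (\<beta> i) *s \<alpha> i" unfolding Ai[OF i] rmat by simp
  qed
  have \<alpha>V: "\<alpha> i \<in> V" and \<beta>W: "\<beta> i \<in> W" if i: "i < r" for i
    unfolding \<alpha>_def \<beta>_def using lk[OF i] aV[OF i] bW[OF i] by (auto intro!: V_scale W_scale cnj_k kD(8) kD(1))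
  have dist: "distinguished_in H V (A (idx ! i))" if i: "i < r" for i
  proof -
    have pn: "p (a i) (b i) \<noteq> 0" using pab[OF i] zeta_od[OF idx_less[OF i]] by simp
    have a0: "a i \<noteq> 0" using pn p_zero by metis
    obtain u where u: "u \<in> V" "u \<noteq> 0" "p u (b i) = 0" by (rule fixed_vector[OF aV[OF i] bW[OF i] pn])
    have "A (idx ! i) *v u = u" unfolding Ai[OF i] using rmat_fix[OF a0] u(3) by blast
    then have "card {h \<in> H. h *v u = u} = od (idx ! i)" by (rule card_fixing[OF i u(2)])
    then show ?thesis
      unfolding Ai[OF i] distinguished_in_iff[OF aV[OF i] bW[OF i] pn u]
      using det_A[OF idx_less[OF i]] unfolding Ai[OF i] by simp
  qed
  interpret cartan_data H V W p k r "\<lambda>i. A (idx ! i)" \<alpha> \<beta> "\<lambda>i. zeta (od (idx ! i))"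
  proof
    show "2 \<le> r" by (rule r_cases)
    show "generated_group ((\<lambda>i. A (idx ! i)) ` {..<r}) = H" by (simp add: image_idx sub_def)
    show "p (\<alpha> 0) (\<beta> 0) * p (\<alpha> 1) (\<beta> 1) - p (\<alpha> 0) (\<beta> 1) * p (\<alpha> 1) (\<beta> 0) \<noteq> 0"
      unfolding pC[OF r_cases(3) r_cases(3)] pC[OF r_cases(4) r_cases(4)] pC[OF r_cases(3) r_cases(4)]
        pC[OF r_cases(4) r_cases(3)] by (rule C_det)
  next
    fix i assume i: "i < r"
    show "A (idx ! i) \<in> H" by (rule A_in_sub[OF I3 I_two idx_in[OF i]])
    show "\<alpha> i \<in> V" "\<beta> i \<in> W" by (rule \<alpha>V[OF i] \<beta>W[OF i])+
    show "A (idx ! i) = rmat (\<alpha> i) (\<beta> i)" by (rule Arm[OF i])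
    show "p (\<alpha> i) (\<beta> i) = 1 - zeta (od (idx ! i))" using pC[OF i i] C_diag[OF i] by simp
    show "zeta (od (idx ! i)) \<noteq> 1" by (rule zeta_od[OF idx_less[OF i]])
    show "\<exists>n>0. zeta (od (idx ! i)) ^ n = 1"
      using zeta_pow_self od_bounds(3)[OF idx_less[OF i]] by blast
    show "distinguished_in H V (A (idx ! i))" by (rule dist[OF i])
  next
    fix i j assume ij: "i < r" "j < r"
    show "p (\<alpha> i) (\<beta> j) \<in> ring_of_integers k" unfolding pC[OF ij] by (rule C_R[OF ij])
    show "\<exists>y\<in>ring_of_integers k. p (\<alpha> i) (\<beta> j) * y = 1" if "i \<noteq> j"
      unfolding pC[OF ij] by (rule C_inverse_R[OF ij that])
    show "i = j" if e: "det (A (idx ! i)) = det (A (idx ! j))"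
    proof (rule idx_inj[OF ij], rule od_inj[OF idx_less[OF ij(1)] idx_less[OF ij(2)]])
      have zz: "zeta (od (idx ! i)) = zeta (od (idx ! j))" using e det_A idx_less ij by simp
      have "zeta (od (idx ! i)) ^ od (idx ! j) = 1" "zeta (od (idx ! j)) ^ od (idx ! i) = 1"
        using zz zeta_pow_self od_bounds(3) idx_less ij by metis+
      then have "od (idx ! i) dvd od (idx ! j)" "od (idx ! j) dvd od (idx ! i)"
        using zeta_pow_eq_1_iff od_bounds(3) idx_less ij by blast+
      then show "od (idx ! i) = od (idx ! j)" by (rule dvd_antisym)
    qed
  next
    fix q :: "complex^2^2" and v assume q: "q \<in> H" "q \<noteq> mat 1" "v \<noteq> 0" "q *v v = v" "det q = zeta (card {h \<in> H. h *v v = v})"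
    show "\<exists>i<r. conj_in H (A (idx ! i)) q"
      using distinguished_reflection_conj[OF I3 I_two q] idx_of by metis
  next
    fix Q i assume Q: "generated_group Q = H" "\<And>q. q \<in> Q \<Longrightarrow> \<exists>i<r. conj_in H (A (idx ! i)) q"
      "\<And>q g. q \<in> Q \<Longrightarrow> g \<in> H \<Longrightarrow> g ** q ** matrix_inv g \<in> Q" and i: "i < r"
    have "\<exists>j\<in>I. conj_in H (A j) q" if "q \<in> Q" for q using Q(2)[OF that] idx_in by blast
    from generating_reflections[OF I3 I_two Q(1) this Q(3) idx_in[OF i]] show "A (idx ! i) \<in> Q" by blast
  qed
  have "is_cartan_matrix k V W p (map (\<lambda>i. A i) idx) C"
    by (rule cartan_matrix) (simp_all add: C_length pC)
  then show ?thesis using unique_genus dist by blast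
qed

text \<open>The Cartan matrix itself provides a k-form: after rescaling, the functional
  \<open>f j\<close> takes the value \<open>C ! i ! j\<close> in k on the i-th root vector, so the
  k-span of two root vectors is stable under the group.\<close>

theorem realization_exists: "\<exists>V W p. realization H V W p"
proof -
  note kD = is_subfieldD[OF subfield_k]
  define w where "w i = perp (axis (idx ! i))" for i
  have "\<forall>i. \<exists>c. i < r \<longrightarrow> (\<forall>x y. c (x + y) = c x + c y) \<and> (\<forall>t x. c (t *s x) = t * c x) \<and>
      c (w i) = 1 - zeta (od (idx ! i)) \<and> (\<forall>x. x - A (idx ! i) *v x = c x *s w i)"
    unfolding w_def using reflection_complement axis idx_less by metis
  then obtain c where c: "\<And>i x y. i < r \<Longrightarrow> c i (x + y) = c i x + c i y" "\<And>i t x. i < r \<Longrightarrow> c i (t *s x) = t * c i x"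
    "\<And>i. i < r \<Longrightarrow> c i (w i) = 1 - zeta (od (idx ! i))"
    "\<And>i x. i < r \<Longrightarrow> x - A (idx ! i) *v x = c i x *s w i" by metis
  have M: "(mat 1 - A (idx ! i)) *v x = c i x *s w i" if "i < r" for i x
    using c(4)[OF that] by (simp add: matrix_vector_mult_diff_rdistrib)
  define m where "m i j = c j (w i)" for i j
  define l where "l i = (if i = 0 then 1 else m 0 i / C ! 0 ! i)" for i
  have pair: "m i j * m j i = C ! i ! j * C ! j ! i" if ij: "i < r" "j < r" "i \<noteq> j" for i j
    using trace_rank_one(1)[OF M[OF ij(1)] M[OF ij(2)] M[OF ij(1)]] C_pair_sym[OF ij] c(1,2) ij
    by (simp add: m_def mult.commute)
  have triple: "m 0 2 * m 2 1 * m 1 0 = C ! 0 ! 2 * C ! 2 ! 1 * C ! 1 ! 0" if r3: "r = 3"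
  proof -
    have "trace ((mat 1 - A (idx ! 0)) ** (mat 1 - A (idx ! 1)) ** (mat 1 - A (idx ! 2))) =
        c 0 (w 1) * c 1 (w 2) * c 2 (w 0)"
      by (rule trace_rank_one(2)) (simp_all add: M r3 c(1,2))
    then show ?thesis using C_triple[OF r3] idx_triple[OF r3] by (simp add: m_def mult_ac)
  qed
  have scal: "l i * m i j / l j = C ! i ! j" "l i \<noteq> 0" if "i < r" "j < r" for i j
  proof -
    have *: "i < r \<Longrightarrow> j < r \<Longrightarrow> (if i = 0 then 1 else m 0 i / C ! 0 ! i) * m i j / (if j = 0 then 1 else m 0 j / C ! 0 ! j) = C ! i ! j"
      "i < r \<Longrightarrow> j < r \<Longrightarrow> (if i = 0 then 1 else m 0 i / C ! 0 ! i) \<noteq> 0" for i j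
      by (rule diagonal_scaling[where a = m and C = "\<lambda>i j. C ! i ! j" and r = r];
          use r_cases C_diag c(3) pair C_unit triple in \<open>simp add: m_def\<close>)+
    show "l i * m i j / l j = C ! i ! j" "l i \<noteq> 0" unfolding l_def by (rule *[OF that])+
  qed
  define \<alpha> f where "\<alpha> i = l i *s w i" and "f i x = c i x / l i" for i x
  have fC: "f j (\<alpha> i) = C ! i ! j" if "i < r" "j < r" for i j
    using scal(1)[OF that] c(2)[OF that(2)] by (simp add: \<alpha>_def f_def m_def)
  have f_lin: "f i (a *s x + b *s y) = a * f i x + b * f i y" if "i < r" for i a b x y
    using c(1,2)[OF that] by (simp add: f_def add_divide_distrib)
  have Af: "A (idx ! i) *v x = x - f i x *s \<alpha> i" if "i < r" for i x
  proof -
    have "f i x *s \<alpha> i = c i x *s w i"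
      using scal(2)[OF that that] by (simp add: f_def \<alpha>_def vector_smult_assoc)
    then show ?thesis using c(4)[OF that, of x] by (simp add: algebra_simps)
  qed
  have ind: "\<alpha> 0 $ 1 * \<alpha> 1 $ 2 - \<alpha> 0 $ 2 * \<alpha> 1 $ 1 \<noteq> 0"
  proof
    assume "\<alpha> 0 $ 1 * \<alpha> 1 $ 2 - \<alpha> 0 $ 2 * \<alpha> 1 $ 1 = 0"
    then have e: "\<alpha> 0 $ 1 * \<alpha> 1 $ 2 = \<alpha> 0 $ 2 * \<alpha> 1 $ 1" by simp
    have "w 1 \<noteq> 0" using axis(1)[OF idx_less[OF r_cases(4)]] by (simp add: w_def)
    then have "\<alpha> 1 \<noteq> 0" using scal(2)[OF r_cases(4) r_cases(4)] by (simp add: \<alpha>_def)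
    then obtain t where t: "\<alpha> 0 = t *s \<alpha> 1" by (rule parallel_vectors[OF e])
    have "C ! 0 ! j = t * C ! 1 ! j" if "j < r" for j
      using fC[OF r_cases(3) that] fC[OF r_cases(4) that] f_lin[OF that, of t "\<alpha> 1" 0 "\<alpha> 1"] t by simp
    from this[OF r_cases(3)] this[OF r_cases(4)] show False using C_det by (simp add: mult_ac)
  qed
  define V where "V = {a *s \<alpha> 0 + b *s \<alpha> 1 | a b. a \<in> k \<and> b \<in> k}"
  have VI: "a *s \<alpha> 0 + b *s \<alpha> 1 \<in> V" if "a \<in> k" "b \<in> k" for a b
    using that unfolding V_def by blast
  have diffV: "x - t *s y \<in> V" if xy: "x \<in> V" "y \<in> V" "t \<in> k" for x y t
  proof -
    obtain a b a' b' where ab: "x = a *s \<alpha> 0 + b *s \<alpha> 1" "y = a' *s \<alpha> 0 + b' *s \<alpha> 1" "a \<in> k" "b \<in> k" "a' \<in> k" "b' \<in> k"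
      using xy(1,2) unfolding V_def by blast
    have "x - t *s y = (a - t * a') *s \<alpha> 0 + (b - t * b') *s \<alpha> 1"
      unfolding ab(1,2) by (simp add: vec2_eq_iff algebra_simps)
    then show ?thesis using VI kD(3,6) ab xy(3) by metis
  qed
  have fk: "f i x \<in> k" if i: "i < r" and x: "x \<in> V" for i x
  proof -
    obtain a b where ab: "x = a *s \<alpha> 0 + b *s \<alpha> 1" "a \<in> k" "b \<in> k" using x unfolding V_def by blast
    show ?thesis unfolding ab(1) f_lin[OF i] fC[OF r_cases(3) i] fC[OF r_cases(4) i]
      by (intro kD(5,6) ab C_k r_cases i)
  qed
  have \<alpha>V: "\<alpha> i \<in> V" if i: "i < r" for i
  proof -
    obtain a b where ab: "\<alpha> i = a *s \<alpha> 0 + b *s \<alpha> 1" by (rule basis_coords[OF ind])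
    have "C ! i ! j = C ! 0 ! j * a + C ! 1 ! j * b" if j: "j < r" for j
      using arg_cong[OF ab, of "f j"] fC[OF i j] fC[OF r_cases(3) j] fC[OF r_cases(4) j]
      by (simp add: f_lin[OF j] mult.commute)
    then have e: "C ! 0 ! 0 * a + C ! 1 ! 0 * b \<in> k" "C ! 0 ! 1 * a + C ! 1 ! 1 * b \<in> k"
      using C_k[OF i r_cases(3)] C_k[OF i r_cases(4)] r_cases(3,4) by metis+
    have d: "C ! 0 ! 0 * C ! 1 ! 1 - C ! 1 ! 0 * C ! 0 ! 1 \<noteq> 0" using C_det by (simp add: mult.commute)
    have "a \<in> k" "b \<in> k" by (rule cramer[OF subfield_k d _ _ _ _ e]; intro C_k r_cases)+
    then show ?thesis using VI ab by simp
  qed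
  have AV: "A (idx ! i) *v x \<in> V" if "i < r" "x \<in> V" for i x
    unfolding Af[OF that(1)] by (rule diffV[OF that(2) \<alpha>V[OF that(1)] fk[OF that]])
  have stable: "g *v x \<in> V" if g: "g \<in> H" and x: "x \<in> V" for g x
  proof -
    have "g \<in> generated_group (A ` I)" using g by (simp add: sub_def)
    then have "\<forall>x\<in>V. g *v x \<in> V"
    proof induction
      case (incl B)
      then obtain i where "i < r" "B = A (idx ! i)" using idx_of by blast
      then show ?case using AV by blast
    next
      case (inv B)
      then obtain i where i: "i < r" "B = A (idx ! i)" using idx_of by blast
      have i3: "idx ! i < 3" by (rule idx_less[OF i(1)])
      obtain n where n: "od (idx ! i) = Suc n" using od_bounds(3)[OF i3] by (cases "od (idx ! i)") auto
      have "B ** mpow B n = mat 1" using A_power_od[OF i3] i(2) n by simp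
      then have e: "matrix_inv B = mpow B n" by (rule matrix_inv_eqI(1))
      have "mpow B n *v x \<in> V" if "x \<in> V" for x n
        by (induction n) (use that AV[OF i(1)] i(2) in \<open>auto simp: matrix_vector_mul_assoc[symmetric]\<close>)
      then show ?case unfolding e by blast
    qed (auto simp: matrix_vector_mul_assoc[symmetric])
    then show ?thesis using x by blast
  qed
  define D where "D = \<alpha> 0 $ 1 * \<alpha> 1 $ 2 - \<alpha> 0 $ 2 * \<alpha> 1 $ 1"
  have D: "D \<noteq> 0" using ind by (simp add: D_def)
  \<comment> \<open>u and u' form the basis dual to \<open>\<alpha> 0\<close>,
    \<open>\<alpha> 1\<close> under \<open>hip\<close>; their k-span is the space in Hermitian
    duality with V.\<close>
  define u :: "complex^2" where "u = vector [cnj (\<alpha> 1 $ 2 / D), cnj (- \<alpha> 1 $ 1 / D)]"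
  define u' :: "complex^2" where "u' = vector [cnj (- \<alpha> 0 $ 2 / D), cnj (\<alpha> 0 $ 1 / D)]"
  have dual: "hip (\<alpha> 0) u = 1" "hip (\<alpha> 0) u' = 0" "hip (\<alpha> 1) u = 0" "hip (\<alpha> 1) u' = 1"
  proof -
    have "hip (\<alpha> 0) u = (\<alpha> 0 $ 1 * \<alpha> 1 $ 2 - \<alpha> 0 $ 2 * \<alpha> 1 $ 1) / D"
      "hip (\<alpha> 1) u' = (\<alpha> 0 $ 1 * \<alpha> 1 $ 2 - \<alpha> 0 $ 2 * \<alpha> 1 $ 1) / D"
      unfolding hip_def u_def u'_def by (simp_all add: diff_divide_distrib mult.commute)
    then have "hip (\<alpha> 0) u = D / D" "hip (\<alpha> 1) u' = D / D" unfolding D_def by blast+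
    then show "hip (\<alpha> 0) u = 1" "hip (\<alpha> 1) u' = 1" using D by simp_all
    show "hip (\<alpha> 0) u' = 0" "hip (\<alpha> 1) u = 0"
      unfolding hip_def u_def u'_def by (simp_all add: mult.commute)
  qed
  have hip_lin: "hip (x + y) v = hip x v + hip y v" "hip (t *s x) v = t * hip x v"
    "hip x (v + v') = hip x v + hip x v'" "hip x (t *s v) = cnj t * hip x v" for x y v v' t
    by (simp_all add: hip_def algebra_simps)
  have uu: "u$1 * u'$2 - u$2 * u'$1 \<noteq> 0"
  proof
    assume "u$1 * u'$2 - u$2 * u'$1 = 0"
    then have e: "u$1 * u'$2 = u$2 * u'$1" by simp
    have "u' \<noteq> 0" using dual(4) by (auto simp: hip_def)
    then obtain t where "u = t *s u'" by (rule parallel_vectors[OF e])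
    then show False using dual hip_lin by simp
  qed
  define W where "W = {a *s u + b *s u' | a b. a \<in> k \<and> b \<in> k}"
  have cnjk: "cnj x \<in> k" if "x \<in> k" for x
    using field_of_definition_cnj[OF mat_group_H unitary_H] that unfolding k_def by blast
  have pk: "hip x y \<in> k" if x: "x \<in> V" and y: "y \<in> W" for x y
  proof -
    obtain a b where ab: "x = a *s \<alpha> 0 + b *s \<alpha> 1" "a \<in> k" "b \<in> k" using x unfolding V_def by blast
    obtain a' b' where ab': "y = a' *s u + b' *s u'" "a' \<in> k" "b' \<in> k" using y unfolding W_def by blast
    have "hip x y = a * cnj a' + b * cnj b'" unfolding ab(1) ab'(1) hip_lin dual by simp
    then show ?thesis using kD(5,6) ab ab' cnjk by simp
  qed
  have hipnd: "x = 0" if "hip x x = 0" for x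
  proof (rule ccontr)
    assume "x \<noteq> 0"
    from frame_decomp[OF this, of x] that show False using \<open>x \<noteq> 0\<close> by simp
  qed
  have "hermitian_pairing k V W hip"
    unfolding hermitian_pairing_def using hip_lin pk hipnd by blast
  then have "realization H V W hip"
    unfolding realization_def k_def[symmetric]
    using k_formI[OF subfield_k ind] k_formI[OF subfield_k uu] stable unfolding V_def W_def by blast
  then show ?thesis by blast
qed

theorem main_statement:
  assumes T: "st_group T = H" "st_orders T = map od idx" "st_cartan T = C"
    and braid: "\<And>w1 w2. (w1, w2) \<in> set (st_braid_relations T) \<Longrightarrow> word_product (map A idx) w1 = word_product (map A idx) w2"
  shows "(\<exists>V W p. realization (st_group T) V W p) \<and>
    (\<forall>V W p. realization (st_group T) V W p \<longrightarrow>
       unique_genus (st_group T) V W p \<and>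
       (\<exists>ss. standard_generators T V ss \<and> is_cartan_matrix k V W p ss (st_cartan T))) \<and>
    (\<forall>d. (\<forall>i<r. d i \<in> k \<and> d i \<noteq> 0) \<and>
         (\<forall>i<r. \<forall>j<r. diag_conj d (st_cartan T) i j \<in> ring_of_integers k) \<longrightarrow>
       (\<exists>u. (\<forall>i<r. u i \<in> integral_units k) \<and>
            (\<forall>i<r. \<forall>j<r. diag_conj d (st_cartan T) i j = diag_conj u (st_cartan T) i j)))"
  unfolding T
proof (intro conjI allI impI)
  show "\<exists>V W p. realization H V W p" by (rule realization_exists)
  fix V W p assume real: "realization H V W p"
  note * = for_realization[OF real]
  show "unique_genus H V W p" using * by blast
  have "standard_generators T V (map A idx)"
    unfolding standard_generators_def T
  proof (intro conjI allI impI)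
    fix i assume "i < length (map A idx)"
    then have i: "i < r" by simp
    show "is_reflection (map A idx ! i)" using i is_reflection_A[OF idx_less[OF i]] by simp
    show "distinguished_in H V (map A idx ! i)" using i * by simp
    show "det (map A idx ! i) = zeta (map od idx ! i)" using i det_A[OF idx_less[OF i]] by simp
  qed (use braid in \<open>auto simp: sub_def\<close>)
  then show "\<exists>ss. standard_generators T V ss \<and> is_cartan_matrix k V W p ss C" using * by blast
next
  fix d assume d: "(\<forall>i<r. d i \<in> k \<and> d i \<noteq> 0) \<and> (\<forall>i<r. \<forall>j<r. diag_conj d C i j \<in> ring_of_integers k)"
  show "\<exists>u. (\<forall>i<r. u i \<in> integral_units k) \<and> (\<forall>i<r. \<forall>j<r. diag_conj d C i j = diag_conj u C i j)"
    by (rule unit_off_diagonal_conjugate[OF subfield_k C_inverse_R]) (use d in blast)+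
qed

end

section \<open>The octahedral family\<close>

lemma zeta_eq_pow: "0 < m \<Longrightarrow> zeta n = zeta (m * n) ^ m"
  by (cases "n = 0") (simp_all add: zeta_pow, simp_all add: zeta_def field_simps)

lemma zeta_pow_mod: "n > 0 \<Longrightarrow> zeta n ^ a = zeta n ^ (a mod n)"
proof -
  assume n: "n > 0"
  have "zeta n ^ a = zeta n ^ (a mod n + n * (a div n))" by simp
  also have "\<dots> = zeta n ^ (a mod n) * (zeta n ^ n) ^ (a div n)" by (simp only: power_add power_mult)
  finally show ?thesis by (simp add: zeta_pow_self[OF n])
qed

lemma zeta_2: "zeta 2 = -1"
  by (simp add: zeta_def mult.commute)

lemma zeta_cis: "zeta n = cis (2 * pi / n)"
  by (simp add: zeta_def cis_conv_exp field_simps)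

lemma zeta_4: "zeta 4 = \<i>"
  by (simp add: zeta_cis cis_pi_half)

lemma cnj_zeta: "n > 0 \<Longrightarrow> cnj (zeta n) = zeta n ^ (n - 1)"
proof -
  assume n: "n > 0"
  have "cnj (zeta n) * zeta n = 1" using complex_norm_square[of "zeta n"] by (simp add: mult.commute)
  moreover have "zeta n ^ (n - 1) * zeta n = 1"
    using zeta_pow_self[OF n] n by (metis power_minus_mult)
  ultimately have "cnj (zeta n) * zeta n = zeta n ^ (n - 1) * zeta n" by simp
  then show ?thesis by simp
qed

lemma zeta_3_eq: "zeta 3 ^ 2 = - 1 - zeta 3"
proof -
  have "(zeta 3 - 1) * (1 + zeta 3 + zeta 3 ^ 2) = zeta 3 ^ 3 - 1" by (simp add: algebra_simps power2_eq_square power3_eq_cube)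
  moreover have "zeta 3 ^ 3 = 1" "zeta 3 \<noteq> 1" using zeta_pow_eq_1_iff[of 3 3] zeta_pow_eq_1_iff[of 3 1] by auto
  ultimately have "1 + zeta 3 + zeta 3 ^ 2 = 0" by simp
  then show ?thesis by (simp add: algebra_simps eq_neg_iff_add_eq_0)
qed

lemma zeta_8_pow: "zeta 8 ^ 2 = \<i>" "zeta 8 ^ 4 = -1"
  using zeta_eq_pow[of 2 4] zeta_eq_pow[of 4 2] by (simp_all add: zeta_4 zeta_2)

lemma csqrt_2: "csqrt 2 = zeta 8 - zeta 8 ^ 3" "zeta 8 = (1 + \<i>) / csqrt 2" "csqrt 2 ^ 2 = 2"
  "cnj (csqrt 2) = csqrt 2"
proof -
  have c: "csqrt 2 = of_real (sqrt 2)" using csqrt_of_real_nonneg[of 2] by simp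
  show "csqrt 2 ^ 2 = 2" by (rule power2_csqrt)
  then have s: "csqrt 2 * csqrt 2 = 2" by (simp only: power2_eq_square)
  show "cnj (csqrt 2) = csqrt 2" by (simp add: c)
  have "zeta 8 = cis (pi / 4)" by (simp add: zeta_cis)
  then have z: "zeta 8 = Complex (sqrt 2 / 2) (sqrt 2 / 2)" by (simp add: cis.code cos_45 sin_45)
  show e: "zeta 8 = (1 + \<i>) / csqrt 2"
    unfolding z c by (simp add: complex_eq_iff real_div_sqrt field_simps)
  have "zeta 8 ^ 3 = zeta 8 * \<i>" by (simp add: zeta_8_pow(1)[symmetric] power2_eq_square power3_eq_cube)
  then have "zeta 8 - zeta 8 ^ 3 = zeta 8 * (1 - \<i>)" by (simp add: algebra_simps)
  also have "\<dots> = ((1 + \<i>) * (1 - \<i>)) / csqrt 2" unfolding e by simp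
  also have "(1 + \<i>) * (1 - \<i>) = csqrt 2 * csqrt 2" unfolding s by (simp add: algebra_simps)
  finally show "csqrt 2 = zeta 8 - zeta 8 ^ 3" by simp
qed

text \<open>The scalars here are those that are left over from the two coordinates of the image of an
  isotropic vector; the hypothesis on their moduli forces the ratio of the eigenvalues to be real.\<close>

lemma eigenvalue_ratio_real:
  fixes x y a :: complex and b \<rho> :: real
  assumes xy: "norm x = 1" "norm y = 1" and b: "b \<noteq> 0" "b\<^sup>2 = \<rho> * (norm a)\<^sup>2" and \<rho>: "\<rho> \<ge> 1"
    and W: "u = (x - y) * a" "w = (x + y) + (x - y) * of_real b"
    and cases: "u = 0 \<or> w = 0 \<or> (norm w)\<^sup>2 = \<rho> * (norm u)\<^sup>2 \<or> (norm u)\<^sup>2 = \<rho> * (norm w)\<^sup>2"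
  shows "x ^ 2 = y ^ 2"
proof (cases "x = y")
  case False
  have a0: "norm a \<noteq> 0" using b by auto
  \<comment> \<open>For distinct x and y on the unit circle this Cayley quotient is purely
    imaginary, and it vanishes exactly for x = -y.\<close>
  define t where "t = (x + y) / (x - y)"
  have xx: "x * cnj x = 1" "y * cnj y = 1" using complex_norm_square[of x] complex_norm_square[of y] xy by simp_all
  have d: "x - y \<noteq> 0" using False by simp
  then have d': "cnj (x - y) \<noteq> 0" by (metis complex_cnj_zero_iff)
  have "(x + y) * cnj (x - y) + cnj (x + y) * (x - y) = 2 * (x * cnj x) - 2 * (y * cnj y)"
    by (simp add: algebra_simps)
  then have "(x + y) * cnj (x - y) + cnj (x + y) * (x - y) = 0" by (simp add: xx)
  then have "t + cnj t = 0" using d d' unfolding t_def by (simp add: divide_simps)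
  then have "2 * Re t = 0" by (metis complex_add_cnj of_real_eq_0_iff)
  then have t: "Re t = 0" by simp
  have w: "w = (x - y) * (t + of_real b)" using d by (simp add: W t_def field_simps)
  have n: "(norm w)\<^sup>2 = (norm (x - y))\<^sup>2 * ((Im t)\<^sup>2 + b\<^sup>2)"
    unfolding w norm_mult power_mult_distrib by (simp add: cmod_power2 t)
  have m: "(norm u)\<^sup>2 = (norm (x - y))\<^sup>2 * (norm a)\<^sup>2"
    unfolding W norm_mult power_mult_distrib ..
  have p: "(norm (x - y))\<^sup>2 > 0" using d by simp
  have "(Im t)\<^sup>2 = 0"
    using cases
  proof (elim disjE)
    assume "u = 0"
    then show ?thesis using m p a0 by simp
  next
    assume "w = 0"
    then have "(Im t)\<^sup>2 + b\<^sup>2 = 0" using n p by simp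
    then show ?thesis using b(1) by (simp add: sum_power2_eq_zero_iff)
  next
    assume "(norm w)\<^sup>2 = \<rho> * (norm u)\<^sup>2"
    then have "(norm (x - y))\<^sup>2 * ((Im t)\<^sup>2 + b\<^sup>2) = (norm (x - y))\<^sup>2 * b\<^sup>2" using b(2) by (simp add: n m)
    then show ?thesis using p by simp
  next
    \<comment> \<open>Here |a|^2 = \<rho> (Im t^2 + b^2), while \<rho> is at least 1 and b^2 is at
      least |a|^2; all these inequalities are equalities and Im t = 0.\<close>
    assume e: "(norm u)\<^sup>2 = \<rho> * (norm w)\<^sup>2"
    have "(norm (x - y))\<^sup>2 * (norm a)\<^sup>2 = (norm (x - y))\<^sup>2 * (\<rho> * ((Im t)\<^sup>2 + b\<^sup>2))" using e by (simp add: n m)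
    then have e': "(norm a)\<^sup>2 = \<rho> * ((Im t)\<^sup>2 + b\<^sup>2)" using p by simp
    have "(norm a)\<^sup>2 \<le> \<rho> * (norm a)\<^sup>2" using \<rho> mult_right_mono[of 1 \<rho> "(norm a)\<^sup>2"] by simp
    then have "(norm a)\<^sup>2 \<le> b\<^sup>2" using b(2) by simp
    moreover have "(Im t)\<^sup>2 + b\<^sup>2 \<le> \<rho> * ((Im t)\<^sup>2 + b\<^sup>2)" using \<rho> mult_right_mono[of 1 \<rho> "(Im t)\<^sup>2 + b\<^sup>2"] by simp
    ultimately show ?thesis using e' zero_le_power2[of "Im t"] by linarith
  qed
  then have "t = 0" using t by (simp add: complex_eq_iff)
  then have "x + y = 0" using d by (simp add: t_def)
  then have "x = - y" by (simp add: eq_neg_iff_add_eq_0)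
  then show ?thesis by simp
qed simp

lemma norm_eigenvalue_unitary:
  assumes "unitary g" "v \<noteq> 0" "g *v v = x *s v"
  shows "norm x = 1"
proof -
  have "hip (g *v v) (g *v v) = hip v v" by (rule unitary_hip[OF assms(1)])
  then have e: "(x * cnj x) * hip v v = 1 * hip v v" unfolding assms(3) by (simp add: hip_def algebra_simps)
  have "hip v v \<noteq> 0"
  proof
    assume "hip v v = 0"
    then have "v = 0" using frame_decomp[OF assms(2), of v] by simp
    then show False using assms(2) by simp
  qed
  then have "x * cnj x = 1" using e by (metis mult_right_cancel)
  then have "of_real ((norm x)\<^sup>2) = (of_real 1 :: complex)" using complex_norm_square[of x] by simp
  then have "(norm x)\<^sup>2 = 1" by (simp only: of_real_eq_iff)
  then show ?thesis using norm_ge_zero[of x] by (simp add: power2_eq_1_iff)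
qed

text \<open>g is diagonal in the eigenframe of the involution B, so 2 g = (x + y) + (x - y) B.
  Applied to a vertex e this expresses the coordinates w and u of its image by x and y. The image is
  again a vertex, which restricts the moduli of w and u; \<rho> is the squared ratio of the moduli
  for the vertices off the coordinate lines.\<close>

lemma involution_exact:
  fixes g B :: "complex^2^2"
  assumes g: "unitary g" and B: "unitary B" "det B = -1" and v: "v \<noteq> 0" "B *v v = v"
    and gv: "g *v v = x *s v" "g *v perp v = y *s perp v"
    and e: "e \<noteq> 0" and Be: "B *v e = of_real b *s e + a *s e'"
    and ind: "e$1 * e'$2 - e$2 * e'$1 \<noteq> 0"
    and b: "b \<noteq> 0" "b\<^sup>2 = \<rho> * (norm a)\<^sup>2" and \<rho>: "\<rho> \<ge> 1"
    and cases: "\<And>u w. g *v e = w *s e + u *s e' \<Longrightarrow>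
      u = 0 \<or> w = 0 \<or> (norm w)\<^sup>2 = \<rho> * (norm u)\<^sup>2 \<or> (norm u)\<^sup>2 = \<rho> * (norm w)\<^sup>2"
  shows "x ^ 2 = y ^ 2"
proof -
  have nx: "norm x = 1" "norm y = 1"
    using norm_eigenvalue_unitary[OF g v(1) gv(1)] norm_eigenvalue_unitary[OF g _ gv(2)] v(1) by auto
  have Bv: "B *v v = 1 *s v" using v(2) by simp
  obtain d where d: "B *v perp v = d *s perp v" by (rule unitary_perp[OF B(1) v(1) Bv])
  have "d = -1" using frame_det(1)[OF v(1) Bv d] B(2) by simp
  then have Bp: "B *v perp v = (-1) *s perp v" using d by simp
  define h l where "h = hip e (perp v) / hip v v" and "l = hip e v / hip v v"
  have ee: "e = l *s v + h *s perp v" unfolding h_def l_def by (rule frame_decomp[OF v(1)])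
  have Be': "B *v e = l *s v - h *s perp v" unfolding ee mv_add mv_scale Bv Bp by (simp add: vec2_eq_iff)
  have ge: "g *v e = (l * x) *s v + (h * y) *s perp v"
    unfolding ee mv_add mv_scale gv by (simp add: vector_smult_assoc)
  have "2 * (g *v e) $ i = (x + y) * e $ i + (x - y) * (B *v e) $ i" for i
  proof -
    have "e $ i = l * v $ i + h * perp v $ i" using arg_cong[OF ee, of "\<lambda>x. x $ i"] by simp
    moreover have "(B *v e) $ i = l * v $ i - h * perp v $ i" using arg_cong[OF Be', of "\<lambda>x. x $ i"] by simp
    moreover have "(g *v e) $ i = l * x * v $ i + h * y * perp v $ i" using arg_cong[OF ge, of "\<lambda>x. x $ i"] by simp
    ultimately show ?thesis by (simp only:) (simp add: algebra_simps)
  qed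
  then have "(g *v e) $ i = (((x + y) + (x - y) * of_real b) / 2) * e $ i + (((x - y) * a) / 2) * e' $ i" for i
  proof -
    have "(B *v e) $ i = of_real b * e $ i + a * e' $ i" using arg_cong[OF Be, of "\<lambda>x. x $ i"] by simp
    then have "2 * (g *v e) $ i = ((x + y) + (x - y) * of_real b) * e $ i + ((x - y) * a) * e' $ i"
      using \<open>\<And>i. 2 * (g *v e) $ i = (x + y) * e $ i + (x - y) * (B *v e) $ i\<close>[of i]
      by (simp only:) (simp add: algebra_simps)
    then have "(g *v e) $ i = (((x + y) + (x - y) * of_real b) * e $ i + ((x - y) * a) * e' $ i) / 2"
      by (metis nonzero_mult_div_cancel_left zero_neq_numeral)
    then show ?thesis by (simp add: add_divide_distrib)
  qed
  then have "g *v e = (((x + y) + (x - y) * of_real b) / 2) *s e + (((x - y) * a) / 2) *s e'"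
    by (simp add: vec_eq_iff)
  from cases[OF this] have
    "(x - y) * a = 0 \<or> (x + y) + (x - y) * of_real b = 0 \<or>
     (norm ((x + y) + (x - y) * of_real b))\<^sup>2 = \<rho> * (norm ((x - y) * a))\<^sup>2 \<or>
     (norm ((x - y) * a))\<^sup>2 = \<rho> * (norm ((x + y) + (x - y) * of_real b))\<^sup>2"
    by (simp only: norm_divide power_divide) auto
  then show ?thesis by (rule eigenvalue_ratio_real[OF nx b \<rho> refl refl])
qed

section \<open>Matrices that preserve a function up to a constant factor\<close>

definition semi_invariants :: "(complex^2 \<Rightarrow> complex) \<Rightarrow> (complex^2^2) set" where
  "semi_invariants F = {g. invertible g \<and> (\<exists>c. c \<noteq> 0 \<and> (\<forall>x. F (g *v x) = c * F x))}"

lemma mat_group_semi_invariants: "mat_group (semi_invariants F)"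
  unfolding mat_group_def
proof (intro conjI ballI)
  have "invertible (mat 1 :: complex^2^2)" by (simp add: invertible_det_nz)
  then show "mat 1 \<in> semi_invariants F" by (auto simp: semi_invariants_def intro!: exI[of _ 1])
next
  fix g h assume "g \<in> semi_invariants F" "h \<in> semi_invariants F"
  then obtain c d where cd: "invertible g" "invertible h" "c \<noteq> 0" "d \<noteq> 0"
    "\<And>x. F (g *v x) = c * F x" "\<And>x. F (h *v x) = d * F x" by (auto simp: semi_invariants_def)
  have "F ((g ** h) *v x) = (c * d) * F x" for x
    by (simp add: matrix_vector_mul_assoc[symmetric] cd)
  then show "g ** h \<in> semi_invariants F"
    unfolding semi_invariants_def using cd by (auto simp: invertible_mult intro!: exI[of _ "c * d"])
next
  fix g assume "g \<in> semi_invariants F"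
  then obtain c where c: "invertible g" "c \<noteq> 0" "\<And>x. F (g *v x) = c * F x" by (auto simp: semi_invariants_def)
  note gi = inv_cancel[OF c(1)]
  have "F (matrix_inv g *v x) = (1 / c) * F x" for x
    using c(3)[of "matrix_inv g *v x"] c(2) by (simp add: gi)
  then have "matrix_inv g \<in> semi_invariants F"
    unfolding semi_invariants_def using c matrix_inv_eqI(2)[OF gi(1)] by (auto intro!: exI[of _ "1 / c"])
  then show "\<exists>h\<in>semi_invariants F. g ** h = mat 1 \<and> h ** g = mat 1" using gi by blast
qed

text \<open>On \<open>semi_invariants F\<close> this is the constant factor of F, read off at a
  sample point x where F does not vanish; it is then a linear character in g.\<close>

definition multiplier :: "(complex^2 \<Rightarrow> complex) \<Rightarrow> complex^2 \<Rightarrow> complex^2^2 \<Rightarrow> complex" where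
  "multiplier F x g = F (g *v x) / F x"

lemma multiplier:
  assumes "g \<in> semi_invariants F" "F x \<noteq> 0"
  shows "F (g *v y) = multiplier F x g * F y" "multiplier F x g \<noteq> 0"
proof -
  obtain c where c: "c \<noteq> 0" "\<And>y. F (g *v y) = c * F y" using assms(1) by (auto simp: semi_invariants_def)
  have "multiplier F x g = c" using assms(2) by (simp add: multiplier_def c)
  then show "F (g *v y) = multiplier F x g * F y" "multiplier F x g \<noteq> 0" using c by simp_all
qed

lemma multiplier_mult:
  assumes "g \<in> semi_invariants F" "h \<in> semi_invariants F" "F x \<noteq> 0"
  shows "multiplier F x (g ** h) = multiplier F x g * multiplier F x h"
  using multiplier(1)[OF assms(1,3), of "h *v x"] assms(3)
  by (simp add: multiplier_def matrix_vector_mul_assoc)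

text \<open>The scalars turn the collineations into reflections. The sign \<epsilon> = -1 replaces
  the involution by its negative, again a reflection, and changes the scalar product of the three
  generators to its negative; the Cartan matrix to be attained decides the sign.\<close>

definition octA :: "complex \<Rightarrow> nat \<Rightarrow> complex^2^2" where
  "octA \<epsilon> i = (if i = 0 then mat (\<epsilon> * \<i>) ** oct_S else if i = 1 then mat (- (zeta 3 ^ 2)) ** oct_T
     else vector [vector [\<i>, 0], vector [0, 1]])"

text \<open>The form of degree 6 whose zeros are the six vertices of the octahedron.\<close>

definition octF :: "complex^2 \<Rightarrow> complex" where
  "octF x = x$1 * x$2 * (x$1 ^ 4 - x$2 ^ 4)"

lemma octA_0: "octA \<epsilon> 0 = mat (\<epsilon> / csqrt 2) ** vector [vector [-1, \<i>], vector [-\<i>, 1]]"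
proof -
  obtain s where s: "csqrt 2 = s" by blast
  have "\<epsilon> * \<i> * \<i> = - \<epsilon>" by (simp add: mult.assoc)
  then show ?thesis unfolding octA_def oct_S_def s by (simp add: mat2_eq_iff mat2_mult_nth mat2_nth)
qed

lemma octA_1: "octA \<epsilon> 1 = mat (- (zeta 3 ^ 2) / 2) ** vector [vector [1 + \<i>, 1 + \<i>], vector [\<i> - 1, 1 - \<i>]]"
proof -
  have s: "csqrt 2 * csqrt 2 = 2" using csqrt_2(3) by (simp add: power2_eq_square)
  have z: "zeta 8 = (1 + \<i>) / csqrt 2" by (rule csqrt_2(2))
  have z3: "zeta 8 ^ 3 = (\<i> - 1) / csqrt 2"
  proof -
    have "zeta 8 ^ 3 = zeta 8 ^ 2 * zeta 8" by (simp add: power3_eq_cube power2_eq_square)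
    also have "\<dots> = \<i> * ((1 + \<i>) / csqrt 2)" by (simp only: zeta_8_pow csqrt_2(2)[symmetric])
    finally show ?thesis by (simp add: algebra_simps)
  qed
  have "zeta 8 ^ 7 = zeta 8 ^ 4 * zeta 8 ^ 3" by (simp flip: power_add)
  then have z7: "zeta 8 ^ 7 = (1 - \<i>) / csqrt 2" by (simp add: zeta_8_pow z3 minus_divide_left)
  obtain t where t: "csqrt 2 = t" by blast
  have t0: "t \<noteq> 0" using s t by auto
  have t2: "t * t = 2" using s unfolding t by simp
  show ?thesis
    unfolding octA_def oct_T_def z7 unfolding z3 unfolding z unfolding t
    by (simp add: mat2_eq_iff mat2_mult_nth mat2_nth t2)
qed

lemma octA_2: "octA \<epsilon> 2 = vector [vector [\<i>, 0], vector [0, 1]]"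
  by (simp add: octA_def)

lemma octA_generators: "octA \<epsilon> 0 ** octA \<epsilon> 1 ** octA \<epsilon> 2 = mat (\<epsilon> * zeta 24)"
proof -
  obtain t where t: "csqrt 2 = t" by blast
  have t2: "t * t = 2" using csqrt_2(3) unfolding t by (simp only: power2_eq_square)
  have t0: "t \<noteq> 0" using t2 by auto
  \<comment> \<open>25 = 16 + 6 + 3 splits the root of unity into a cube root, a fourth root and an
    eighth root.\<close>
  have "zeta 24 = zeta 24 ^ 25" using zeta_pow_mod[of 24 25] by simp
  also have "\<dots> = (zeta 24 ^ 8) ^ 2 * (zeta 24 ^ 3) ^ 2 * zeta 24 ^ 3" by (simp flip: power_mult power_add)
  also have "\<dots> = zeta 3 ^ 2 * zeta 8 ^ 2 * zeta 8" using zeta_eq_pow[of 8 3] zeta_eq_pow[of 3 8] by simp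
  finally have "zeta 24 = zeta 3 ^ 2 * (\<i> * zeta 8)" unfolding zeta_8_pow by (simp only: mult.assoc)
  then have z: "zeta 24 = zeta 3 ^ 2 * (\<i> * ((1 + \<i>) / t))" unfolding csqrt_2(2) t .
  obtain w where w: "zeta 3 ^ 2 = w" by blast
  show ?thesis
    unfolding octA_0 octA_1 octA_2 z t w using t0
    by (simp add: mat2_eq_iff mat2_mult_nth mat2_nth) (simp add: field_simps)
qed

lemma octA_det_trace:
  assumes "\<epsilon> = 1 \<or> \<epsilon> = -1"
  shows "det (octA \<epsilon> 0) = -1" "trace (octA \<epsilon> 0) = 0" "det (octA \<epsilon> 1) = zeta 3" "trace (octA \<epsilon> 1) = 1 + zeta 3"
    "det (octA \<epsilon> 2) = \<i>" "trace (octA \<epsilon> 2) = 1 + \<i>"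
proof -
  obtain t where t: "csqrt 2 = t" by blast
  have t2: "t * t = 2" using csqrt_2(3) unfolding t by (simp only: power2_eq_square)
  have e: "\<epsilon> * \<epsilon> = 1" using assms by auto
  have w: "zeta 3 ^ 2 * zeta 3 ^ 2 = zeta 3" using zeta_pow_mod[of 3 4] by (simp flip: power_add)
  obtain u where u: "zeta 3 ^ 2 = u" by blast
  have i: "\<i> * \<i> = -1" by simp
  show "det (octA \<epsilon> 0) = -1" "trace (octA \<epsilon> 0) = 0"
    unfolding octA_0 t det_mul det_mat2 trace_scale by (simp_all add: trace2 det_2 e t2)
  have "det (octA \<epsilon> 1) = u * u"
    unfolding octA_1 u det_mul det_mat2 by (simp add: det_2 algebra_simps)
  then show "det (octA \<epsilon> 1) = zeta 3" using w u by simp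
  have tr: "trace (octA \<epsilon> 1) = - u" unfolding octA_1 u trace_scale by (simp add: trace2)
  have "u = - 1 - zeta 3" using u zeta_3_eq by simp
  then show "trace (octA \<epsilon> 1) = 1 + zeta 3" unfolding tr by (simp only:) simp
  show "det (octA \<epsilon> 2) = \<i>" "trace (octA \<epsilon> 2) = 1 + \<i>"
    unfolding octA_2 by (simp_all add: det_2 trace2)
qed

lemma unitary_mat: "norm c = 1 \<Longrightarrow> unitary (mat c)"
proof -
  assume "norm c = 1"
  then have "c * cnj c = 1" using complex_norm_square[of c] by simp
  then show ?thesis by (simp add: unitary_def mat_adjoint_def mat2_simps)
qed

lemma product_quotient:
  fixes A B C :: "complex^2^2"
  assumes "A ** B ** C = mat z" "invertible A" "invertible C"
  shows "B = matrix_inv A ** mat z ** matrix_inv C"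
  unfolding assms(1)[symmetric] matrix_mul_assoc
  using inv_cancel(7)[OF assms(3)] inv_cancel(1)[OF assms(2)] by simp

lemma unitary_octA:
  assumes e: "\<epsilon> = 1 \<or> \<epsilon> = -1" and i: "i < 3"
  shows "unitary (octA \<epsilon> i)"
proof -
  obtain t where t: "csqrt 2 = t" by blast
  have t2: "t * t = 2" using csqrt_2(3) unfolding t by (simp only: power2_eq_square)
  have ct: "cnj t = t" using csqrt_2(4) unfolding t .
  have ee: "\<epsilon> * \<epsilon> = 1" "cnj \<epsilon> = \<epsilon>" "\<epsilon> * \<i> * (\<epsilon> * \<i>) = -1" using e by auto
  have 0: "unitary (octA \<epsilon> 0)"
    unfolding octA_0 t unitary_def mat_adjoint_def by (simp add: mat2_simps ct ee t2)
  have 2: "unitary (octA \<epsilon> 2)"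
    unfolding octA_2 unitary_def mat_adjoint_def by (simp add: mat2_simps)
  have "norm (\<epsilon> * zeta 24) = 1" using e by (auto simp: norm_mult)
  then have m: "unitary (mat (\<epsilon> * zeta 24))" by (rule unitary_mat)
  note U = mat_groupD[OF mat_group_unitary, simplified]
  \<comment> \<open>The generator of order 3 is recovered from the product relation, so it inherits
    the property from the other two and the scalar; this avoids a separate computation with cube
    roots of unity.\<close>
  have "octA \<epsilon> 1 = matrix_inv (octA \<epsilon> 0) ** mat (\<epsilon> * zeta 24) ** matrix_inv (octA \<epsilon> 2)"
    by (rule product_quotient[OF octA_generators]) (use 0 2 unitaryD in auto)
  then have 1: "unitary (octA \<epsilon> 1)" using U(2)[OF U(2)[OF U(3)[OF 0] m] U(3)[OF 2]] by simp
  have "i = 0 \<or> i = 1 \<or> i = 2" using i by auto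
  then show ?thesis using 0 1 2 by auto
qed

lemma octF_scale: "octF (c *s x) = c ^ 6 * octF x"
  by (simp add: octF_def power_mult_distrib eval_nat_numeral algebra_simps)

lemma octF_0: "\<epsilon> = 1 \<or> \<epsilon> = -1 \<Longrightarrow> octF (octA \<epsilon> 0 *v x) = octF x"
proof -
  assume e: "\<epsilon> = 1 \<or> \<epsilon> = -1"
  obtain t where t: "csqrt 2 = t" by blast
  have t2: "t ^ 2 = 2" using csqrt_2(3) unfolding t .
  have t0: "t \<noteq> 0" using t2 by auto
  have "t ^ 6 = (t ^ 2) ^ 3" by simp
  then have t6: "t ^ 6 = 8" unfolding t2 by simp
  have e6: "\<epsilon> ^ 6 = 1" using e by auto
  define c where "c = \<epsilon> / t"
  have c6: "c ^ 6 = 1 / 8" by (simp add: c_def power_divide t6 e6)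
  obtain u v where uv: "x$1 = u" "x$2 = v" by blast
  have g: "octA \<epsilon> 0 *v x = c *s vector [- u + \<i> * v, - \<i> * u + v]"
    unfolding octA_0 t by (simp add: vec2_eq_iff mat2_vec_nth mat2_mult_nth mat2_nth c_def uv algebra_simps)
  have "octF (octA \<epsilon> 0 *v x) = c ^ 6 * ((- u + \<i> * v) * (- \<i> * u + v) * ((- u + \<i> * v) ^ 4 - (- \<i> * u + v) ^ 4))"
    unfolding g octF_scale by (simp add: octF_def)
  also have "(- u + \<i> * v) * (- \<i> * u + v) = \<i> * (u ^ 2 + v ^ 2)"
    by (simp add: algebra_simps power2_eq_square)
  also have "(- u + \<i> * v) ^ 4 - (- \<i> * u + v) ^ 4 = - 8 * \<i> * (u * v) * (u ^ 2 - v ^ 2)"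
    by (simp add: algebra_simps power4_eq_xxxx power2_eq_square)
  also have "c ^ 6 * (\<i> * (u ^ 2 + v ^ 2) * (- 8 * \<i> * (u * v) * (u ^ 2 - v ^ 2))) = octF x"
    unfolding c6 octF_def uv by (simp add: algebra_simps power4_eq_xxxx power2_eq_square)
  finally show ?thesis .
qed

lemma octF_2: "octF (octA \<epsilon> 2 *v x) = \<i> * octF x"
proof -
  have "\<i> ^ 4 = 1" by simp
  then show ?thesis by (simp add: octF_def octA_2 mat2_vec_nth power_mult_distrib algebra_simps)
qed

lemma semi_invariant_zero_iff: "F (g *v y) = 0 \<longleftrightarrow> F y = 0" if g: "g \<in> semi_invariants F"
proof -
  obtain c where "c \<noteq> 0" "\<And>x. F (g *v x) = c * F x" using g by (auto simp: semi_invariants_def)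
  then show ?thesis by simp
qed

definition octL :: "(complex^2) set set" where
  "octL = {line (vector [1, 0]), line (vector [0, 1]), line (vector [1, 1]), line (vector [1, -1]),
     line (vector [1, \<i>]), line (vector [1, -\<i>])}"

text \<open>On the generators the determinant takes the values -1, \<open>zeta 3\<close>, \<i> and
  the multiplier of \<open>octF\<close> the values 1, 1, \<i>. The determinant alone cannot separate
  \<open>octA \<epsilon> 0\<close> from \<open>octA \<epsilon> 2\<close>, since -1 is a power of
  \<i>; dividing by the multiplier does. The exponents 3 and 4 kill the parts of the other orders.
  The point (2, 1) is not a zero of the form.\<close>

definition octpsi :: "nat \<Rightarrow> complex^2^2 \<Rightarrow> complex" where
  "octpsi i g = (let q = multiplier octF (vector [2, 1]) g in
     if i = 0 then (det g / q) ^ 3 else if i = 1 then det g ^ 4 else q)"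

lemma octF_base: "octF (vector [2, 1]) \<noteq> 0"
  by (simp add: octF_def)

lemma line_eqI: "v \<noteq> 0 \<Longrightarrow> w \<noteq> 0 \<Longrightarrow> v = c *s w \<Longrightarrow> line v = line w"
  using line_eq_iff by blast

lemma octF_zero_line:
  assumes y: "y \<noteq> 0" "octF y = 0"
  shows "line y \<in> octL"
proof -
  have lv: "line y = line (vector [a, b])" if "y = t *s vector [a, b]" for a b t
  proof (rule line_eqI[OF y(1) _ that])
    show "vector [a, b] \<noteq> (0 :: complex^2)" using y(1) that by auto
  qed
  consider "y$1 = 0" | "y$2 = 0" | "y$1 ^ 4 = y$2 ^ 4" "y$1 \<noteq> 0" using y(2) by (auto simp: octF_def)
  then show ?thesis
  proof cases
    case 1
    then have "y = y$2 *s vector [0, 1]" by (simp add: vec2_eq_iff)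
    from lv[OF this] show ?thesis by (simp add: octL_def)
  next
    case 2
    then have "y = y$1 *s vector [1, 0]" by (simp add: vec2_eq_iff)
    from lv[OF this] show ?thesis by (simp add: octL_def)
  next
    case 3
    have "(y$2 / y$1) ^ 4 = 1" unfolding power_divide 3(1)[symmetric] using 3(2) by simp
    then obtain j where j: "j < 4" "y$2 / y$1 = zeta 4 ^ j" using root_of_unity_zeta_pow[of 4] by auto
    have "y = y$1 *s vector [1, y$2 / y$1]" using 3(2) by (simp add: vec2_eq_iff)
    from lv[OF this] have "line y = line (vector [1, \<i> ^ j])" unfolding j zeta_4 .
    moreover have "j = 0 \<or> j = 1 \<or> j = 2 \<or> j = 3" using j(1) by linarith
    then have "\<i> ^ j = 1 \<or> \<i> ^ j = \<i> \<or> \<i> ^ j = -1 \<or> \<i> ^ j = - \<i>"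
      by (elim disjE) (simp_all add: power3_eq_cube)
    ultimately show ?thesis unfolding octL_def by (elim disjE) simp_all
  qed
qed

lemma octA_semi_invariant:
  assumes e: "\<epsilon> = 1 \<or> \<epsilon> = -1" and i: "i < 3"
  shows "octA \<epsilon> i \<in> semi_invariants octF"
proof -
  note C = mat_groupD[OF mat_group_semi_invariants[of octF]]
  have inv: "invertible (octA \<epsilon> j)" if "j < 3" for j using unitaryD(1)[OF unitary_octA[OF e that]] .
  have 0: "octA \<epsilon> 0 \<in> semi_invariants octF"
    using octF_0[OF e] inv[of 0] by (auto simp: semi_invariants_def intro!: exI[of _ 1])
  have 2: "octA \<epsilon> 2 \<in> semi_invariants octF"
    using octF_2 inv[of 2] by (auto simp: semi_invariants_def intro!: exI[of _ \<i>])
  have z: "\<epsilon> * zeta 24 \<noteq> 0" using e by auto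
  then have m: "mat (\<epsilon> * zeta 24) \<in> semi_invariants octF"
    by (auto simp: semi_invariants_def mat_vec octF_scale invertible_det_nz det_mat2 intro!: exI[of _ "(\<epsilon> * zeta 24) ^ 6"])
  have "octA \<epsilon> 1 = matrix_inv (octA \<epsilon> 0) ** mat (\<epsilon> * zeta 24) ** matrix_inv (octA \<epsilon> 2)"
    by (rule product_quotient[OF octA_generators inv inv]) auto
  then have 1: "octA \<epsilon> 1 \<in> semi_invariants octF" using C(2)[OF C(2)[OF C(3)[OF 0] m] C(3)[OF 2]] by simp
  have "i = 0 \<or> i = 1 \<or> i = 2" using i by auto
  then show ?thesis using 0 1 2 by auto
qed

lemma oct_multipliers:
  assumes e: "\<epsilon> = 1 \<or> \<epsilon> = -1"
  shows "multiplier octF (vector [2, 1]) (octA \<epsilon> 0) = 1" "multiplier octF (vector [2, 1]) (octA \<epsilon> 1) = 1"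
    "multiplier octF (vector [2, 1]) (octA \<epsilon> 2) = \<i>"
proof -
  let ?q = "multiplier octF (vector [2, 1])"
  show 0: "?q (octA \<epsilon> 0) = 1" and 2: "?q (octA \<epsilon> 2) = \<i>"
    using octF_base by (simp_all add: multiplier_def octF_0[OF e] octF_2)
  have S: "octA \<epsilon> i \<in> semi_invariants octF" if "i < 3" for i by (rule octA_semi_invariant[OF e that])
  note C = mat_groupD(2)[OF mat_group_semi_invariants[of octF]]
  have "?q (octA \<epsilon> 0 ** octA \<epsilon> 1 ** octA \<epsilon> 2) = ?q (octA \<epsilon> 0) * ?q (octA \<epsilon> 1) * ?q (octA \<epsilon> 2)"
    using multiplier_mult[OF C[OF S S] S octF_base, of 0 1 2] multiplier_mult[OF S S octF_base, of 0 1] by simp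
  moreover have "?q (octA \<epsilon> 0 ** octA \<epsilon> 1 ** octA \<epsilon> 2) = \<i>"
  proof -
    have "(\<epsilon> * zeta 24) ^ 6 = \<i>"
      using e zeta_eq_pow[of 6 4] by (auto simp: zeta_4 power_mult_distrib)
    then show ?thesis
      unfolding octA_generators using octF_base by (simp add: multiplier_def mat_vec octF_scale)
  qed
  ultimately show "?q (octA \<epsilon> 1) = 1" using 0 2 by simp
qed

lemma less_3_cases: "i < (3::nat) \<Longrightarrow> i = 0 \<or> i = 1 \<or> i = 2"
  by auto

lemma generated_in_semi_invariants:
  assumes "\<And>i. i < 3 \<Longrightarrow> A i \<in> semi_invariants F" "g \<in> generated_group (A ` {..<3})"
  shows "g \<in> semi_invariants F"
  using generated_group_subset[OF mat_group_semi_invariants, of "A ` {..<3}" F] assms by blast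

lemma generated_unitary:
  assumes "\<And>i. i < 3 \<Longrightarrow> unitary (A i)" "g \<in> generated_group (A ` {..<3})"
  shows "unitary g"
  using generated_group_subset[OF mat_group_unitary, of "A ` {..<3}"] assms by blast

theorem oct_triangle:
  assumes e: "\<epsilon> = 1 \<or> \<epsilon> = -1"
  shows "triangle_group (octA \<epsilon>) (\<epsilon> * zeta 24) 4 6 octpsi octL"
proof
  let ?od = "\<lambda>i. [2, 3, 4 :: nat] ! i" and ?G = "generated_group (octA \<epsilon> ` {..<3})"
  have S: "g \<in> semi_invariants octF" if "g \<in> ?G" for g
    by (rule generated_in_semi_invariants[OF octA_semi_invariant[OF e] that])
  have U: "unitary g" if "g \<in> ?G" for g
    by (rule generated_unitary[OF unitary_octA[OF e] that])
  show "octA \<epsilon> 0 ** octA \<epsilon> 1 ** octA \<epsilon> 2 = mat (\<epsilon> * zeta 24)" by (rule octA_generators)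
  show "(4 = (4::nat) \<and> 6 = (6::nat)) \<or> (4 = (5::nat) \<and> 6 = (12::nat))" by simp
  show "finite octL" by (simp add: octL_def)
  show "card octL \<le> 6" unfolding octL_def by (intro card_insert_le_m1) auto
  fix i :: nat
  show "unitary (octA \<epsilon> i)" if "i < 3" by (rule unitary_octA[OF e that])
  show "det (octA \<epsilon> i) = zeta (?od i)" if "i < 3"
    using less_3_cases[OF that] octA_det_trace[OF e] by (auto simp: zeta_2 zeta_4)
  show "trace (octA \<epsilon> i) = 1 + zeta (?od i)" if "i < 3"
    using less_3_cases[OF that] octA_det_trace[OF e] by (auto simp: zeta_2 zeta_4)
  have v2: "v $ 1 = 0" if "octA \<epsilon> 2 *v v = v" for v
  proof -
    have "\<i> * v $ 1 = 1 * v $ 1" using that by (simp add: octA_2 mat2_vec_nth vec2_eq_iff)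
    then show ?thesis by simp
  qed
  fix g assume g: "g \<in> ?G"
  have gi: "invertible g" by (rule unitaryD(1)[OF U[OF g]])
  fix v :: "complex^2" assume v: "v \<noteq> 0"
  show "line (g *v v) \<in> octL" if v2': "octA \<epsilon> 2 *v v = v"
  proof (rule octF_zero_line)
    show "g *v v \<noteq> 0" by (rule mult_vec_nonzero[OF gi v])
    show "octF (g *v v) = 0" unfolding semi_invariant_zero_iff[OF S[OF g]] using v2[OF v2'] by (simp add: octF_def)
  qed
  fix x y
  show "x ^ ?od i = y ^ ?od i" if i: "i = 0 \<or> i = 2" and Av: "octA \<epsilon> i *v v = v"
    and gv: "g *v v = x *s v" "g *v perp v = y *s perp v"
    using i
  proof
    assume i0: "i = 0"
    \<comment> \<open>All entries of \<open>octA \<epsilon> 0\<close> have modulus 1 / sqrt 2, and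
      the vertices off the coordinate lines have coordinates of equal modulus; hence \<rho> =
      1.\<close>
    obtain b :: real where b: "of_real b = \<epsilon> / csqrt 2" "b\<^sup>2 = 1 / 2"
    proof
      have "csqrt 2 = of_real (sqrt 2)" using csqrt_of_real_nonneg[of 2] by simp
      then show "of_real (Re \<epsilon> / sqrt 2) = \<epsilon> / csqrt 2" "(Re \<epsilon> / sqrt 2)\<^sup>2 = 1 / 2"
        using e by (auto simp: power_divide)
    qed
    have na: "(norm (\<epsilon> / csqrt 2 * \<i>))\<^sup>2 = 1 / 2"
      unfolding b(1)[symmetric] norm_mult by (simp add: b(2))
    have "x\<^sup>2 = y\<^sup>2"
    proof (rule involution_exact[OF U[OF g] _ _ v _ gv, where B = "octA \<epsilon> 0" and e = "vector [0, 1]" and e' = "vector [1, 0]"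
          and a = "\<epsilon> / csqrt 2 * \<i>" and b = b and \<rho> = 1])
      show "unitary (octA \<epsilon> 0)" "det (octA \<epsilon> 0) = -1" using unitary_octA[OF e] octA_det_trace[OF e] by auto
      show "octA \<epsilon> 0 *v v = v" using Av i0 by simp
      show "octA \<epsilon> 0 *v vector [0, 1] = of_real b *s vector [0, 1] + (\<epsilon> / csqrt 2 * \<i>) *s vector [1, 0]"
        unfolding octA_0 b(1) by (simp add: vec2_eq_iff mat2_vec_nth mat2_mult_nth mat2_nth)
      show "b \<noteq> 0" using b(2) by auto
      show "b\<^sup>2 = 1 * (norm (\<epsilon> / csqrt 2 * \<i>))\<^sup>2" unfolding na by (simp add: b(2))
      fix u w assume uw: "g *v vector [0, 1] = w *s vector [0, 1] + u *s vector [1, 0]"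
      have "octF (g *v vector [0, 1]) = 0" unfolding semi_invariant_zero_iff[OF S[OF g]] by (simp add: octF_def)
      then have "u = 0 \<or> w = 0 \<or> u ^ 4 = w ^ 4" unfolding uw by (simp add: octF_def)
      moreover have "(norm w)\<^sup>2 = (norm u)\<^sup>2" if uw4: "u ^ 4 = w ^ 4"
      proof -
        have "norm u ^ 4 = norm w ^ 4" using uw4 by (metis norm_power)
        then have "norm u = norm w" using power_eq_imp_eq_base[of "norm u" 4 "norm w"] by simp
        then show ?thesis by simp
      qed
      ultimately show "u = 0 \<or> w = 0 \<or> (norm w)\<^sup>2 = 1 * (norm u)\<^sup>2 \<or> (norm u)\<^sup>2 = 1 * (norm w)\<^sup>2" by auto
    qed (auto simp: vec2_eq_iff)
    then show ?thesis using i0 by simp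
  next
    assume i2: "i = 2"
    have v1: "v $ 1 = 0" using v2 Av i2 by simp
    then have v2n: "v $ 2 \<noteq> 0" using v by (simp add: vec2_eq_iff)
    have ge: "g$1$2 = 0" "g$2$2 = x" "g$1$1 = y" "g$2$1 = 0"
      using gv v1 v2n by (simp_all add: vec2_eq_iff mat2_vec_nth)
    \<comment> \<open>g is diagonal and sends the vertex (1, 1) to (y, x), again a zero of the form,
      whence x^4 = y^4.\<close>
    have "octF (g *v vector [1, 1]) = 0" unfolding semi_invariant_zero_iff[OF S[OF g]] by (simp add: octF_def)
    then have "y * x * (y ^ 4 - x ^ 4) = 0" by (simp add: octF_def mat2_vec_nth ge)
    moreover have "x * y \<noteq> 0" using gi by (simp add: invertible_det_nz det_2 ge mult.commute)
    ultimately show ?thesis using i2 by simp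
  qed
next
  let ?od = "\<lambda>i. [2, 3, 4 :: nat] ! i" and ?G = "generated_group (octA \<epsilon> ` {..<3})"
  have S: "g \<in> semi_invariants octF" if "g \<in> ?G" for g
    by (rule generated_in_semi_invariants[OF octA_semi_invariant[OF e] that])
  fix i :: nat
  fix g h assume "g \<in> ?G" "h \<in> ?G"
  then show "octpsi i (g ** h) = octpsi i g * octpsi i h"
    using multiplier_mult[OF S S octF_base, of g h]
    by (simp add: octpsi_def Let_def det_mul power_mult_distrib power_divide)
next
  fix i j :: nat assume ij: "i < 3" "j < 3" "i \<noteq> j"
  have "zeta 3 ^ 3 = 1" "zeta 3 ^ 4 \<noteq> 1" using zeta_pow_eq_1_iff[of 3] by auto
  then show "octpsi i (octA \<epsilon> j) = 1"
    using less_3_cases[OF ij(1)] less_3_cases[OF ij(2)] ij(3) octA_det_trace[OF e] oct_multipliers[OF e]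
    by (auto simp: octpsi_def Let_def)
next
  fix i k :: nat assume i: "i < 3" and k: "0 < k" "k < [2, 3, 4] ! i"
  have z4: "zeta 3 ^ 4 = zeta 3" using zeta_pow_mod[of 3 4] by simp
  have *: "octpsi 0 (octA \<epsilon> 0) = zeta 2" "octpsi 1 (octA \<epsilon> 1) = zeta 3" "octpsi 2 (octA \<epsilon> 2) = zeta 4"
    using octA_det_trace[OF e] oct_multipliers[OF e] z4 by (auto simp: octpsi_def Let_def zeta_2 zeta_4)
  have nd: "\<not> [2, 3, 4] ! i dvd k" using k by (metis dvd_imp_le not_le)
  show "octpsi i (octA \<epsilon> i) ^ k \<noteq> 1"
    using less_3_cases[OF i] nd * zeta_pow_eq_1_iff[of 2 k] zeta_pow_eq_1_iff[of 3 k] zeta_pow_eq_1_iff[of 4 k] by auto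
qed

section \<open>The icosahedral family\<close>

definition e5 :: complex where "e5 = zeta 5"
definition f5 :: complex where "f5 = 1 + 2 * e5 + 2 * e5 ^ 4"
text \<open>2 cos (2 pi / 5), the inverse of the golden ratio. \<open>f5\<close> is the square root
  of 5 written as a quadratic Gauss sum, so identities between all these numbers reduce to the
  minimal relation of \<open>e5\<close>.\<close>

definition t5 :: complex where "t5 = e5 + e5 ^ 4"

lemma e5_sum: "1 + e5 + e5 ^ 2 + e5 ^ 3 + e5 ^ 4 = 0"
proof -
  have "(e5 - 1) * (1 + e5 + e5 ^ 2 + e5 ^ 3 + e5 ^ 4) = e5 ^ 5 - 1" by (simp add: algebra_simps eval_nat_numeral)
  moreover have "e5 ^ 5 = 1" "e5 \<noteq> 1" using zeta_pow_eq_1_iff[of 5 5] zeta_pow_eq_1_iff[of 5 1] by (auto simp: e5_def)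
  ultimately show ?thesis by simp
qed

lemma e5_pow5: "e5 ^ 5 = 1"
  by (simp add: e5_def zeta_pow_self)

lemma e5_nonzero [simp]: "e5 \<noteq> 0"
  by (simp add: e5_def)

lemma cnj_e5: "cnj e5 = e5 ^ 4"
  using cnj_zeta[of 5] by (simp add: e5_def)

lemma t5_real: "t5 = of_real (2 * cos (2 * pi / 5))" "cos (2 * pi / 5) > 0"
proof -
  have "t5 = e5 + cnj e5" by (simp add: t5_def cnj_e5)
  also have "\<dots> = of_real (2 * Re e5)" by (rule complex_add_cnj)
  finally show "t5 = of_real (2 * cos (2 * pi / 5))" by (simp add: e5_def zeta_cis)
  have "- (pi / 2) < 2 * pi / 5" "2 * pi / 5 < pi / 2" using pi_gt_zero by argo+
  then show "cos (2 * pi / 5) > 0" by (rule cos_gt_zero_pi)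
qed

lemma t5_square: "t5 ^ 2 = 1 - t5"
  using e5_sum e5_pow5 unfolding t5_def by algebra

lemma f5_t5: "f5 = 1 + 2 * t5"
  by (simp add: f5_def t5_def)

lemma f5_square: "f5 ^ 2 = 5"
  using t5_square unfolding f5_t5 by algebra

lemma csqrt_5: "csqrt 5 = f5"
proof (rule csqrt_unique)
  show "f5 ^ 2 = 5" by (rule f5_square)
  have "f5 = of_real (1 + 4 * cos (2 * pi / 5))" by (simp add: f5_t5 t5_real)
  then have "Re f5 = 1 + 4 * cos (2 * pi / 5)" by (metis Re_complex_of_real)
  then show "0 < Re f5 \<or> Re f5 = 0 \<and> 0 \<le> Im f5" using t5_real(2) by simp
qed

lemma golden_eq: "golden = 1 + t5"
  by (simp add: golden_def csqrt_5 f5_t5)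

lemma f5_nonzero: "f5 \<noteq> 0"
  using f5_square by auto

definition icoA :: "nat \<Rightarrow> complex^2^2" where
  "icoA i = (if i = 0 then mat \<i> ** ico_S else if i = 1 then mat (zeta 3 ^ 2) ** ico_T
     else vector [vector [1, 0], vector [0, zeta 5]])"

lemma icoA_0: "icoA 0 = mat (\<i> / f5) ** vector [vector [e5 ^ 4 - e5, e5 ^ 2 - e5 ^ 3], vector [e5 ^ 2 - e5 ^ 3, e5 - e5 ^ 4]]"
  by (simp add: icoA_def ico_S_def csqrt_5 e5_def[symmetric] matrix_mul_assoc mat_mult_mat)

lemma icoA_1: "icoA 1 = mat (zeta 3 ^ 2 / f5) ** vector [vector [e5 ^ 2 - e5 ^ 4, e5 ^ 4 - 1], vector [1 - e5, e5 ^ 3 - e5]]"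
  by (simp add: icoA_def ico_T_def csqrt_5 e5_def[symmetric] matrix_mul_assoc mat_mult_mat)

lemma icoA_2: "icoA 2 = vector [vector [1, 0], vector [0, e5]]"
  by (simp add: icoA_def e5_def)

lemma zeta_60: "zeta 60 = - \<i> * zeta 3 ^ 2 * e5 ^ 3"
proof -
  \<comment> \<open>121 = 45 + 40 + 36 splits the root of unity into roots of orders 4, 3 and
    5.\<close>
  have "zeta 60 = zeta 60 ^ 121" using zeta_pow_mod[of 60 121] by simp
  also have "\<dots> = (zeta 60 ^ 15) ^ 3 * (zeta 60 ^ 20) ^ 2 * (zeta 60 ^ 12) ^ 3" by (simp flip: power_mult power_add)
  also have "\<dots> = \<i> ^ 3 * zeta 3 ^ 2 * e5 ^ 3"
    using zeta_eq_pow[of 15 4] zeta_eq_pow[of 20 3] zeta_eq_pow[of 12 5] by (simp add: zeta_4 e5_def)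
  finally show ?thesis by (simp add: power3_eq_cube)
qed

lemma icoA_generators: "icoA 0 ** icoA 1 ** icoA 2 = mat (zeta 60)"
proof -
  have f: "f5 * f5 = 5" using f5_square by (simp add: power2_eq_square)
  let ?M = "vector [vector [e5 ^ 4 - e5, e5 ^ 2 - e5 ^ 3], vector [e5 ^ 2 - e5 ^ 3, e5 - e5 ^ 4]] :: complex^2^2"
  let ?N = "vector [vector [e5 ^ 2 - e5 ^ 4, e5 ^ 4 - 1], vector [1 - e5, e5 ^ 3 - e5]] :: complex^2^2"
  have a: "(e5 ^ 4 - e5) * (e5 ^ 2 - e5 ^ 4) + (e5 ^ 2 - e5 ^ 3) * (1 - e5) = -5 * e5 ^ 3"
    "(e5 ^ 4 - e5) * (e5 ^ 4 - 1) + (e5 ^ 2 - e5 ^ 3) * (e5 ^ 3 - e5) = 0"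
    "(e5 ^ 2 - e5 ^ 3) * (e5 ^ 2 - e5 ^ 4) + (e5 - e5 ^ 4) * (1 - e5) = 0"
    "(e5 ^ 2 - e5 ^ 3) * (e5 ^ 4 - 1) + (e5 - e5 ^ 4) * (e5 ^ 3 - e5) = -5 * e5 ^ 2"
    using e5_sum e5_pow5 by algebra+
  have MN: "?M ** ?N = vector [vector [-5 * e5 ^ 3, 0], vector [0, -5 * e5 ^ 2]]"
    using a by (simp add: mat2_eq_iff mat2_mult_nth)
  have MNU: "?M ** ?N ** icoA 2 = mat (-5 * e5 ^ 3)"
    unfolding MN icoA_2 by (simp add: mat2_eq_iff mat2_mult_nth mat2_nth eval_nat_numeral)
  have "icoA 0 ** icoA 1 ** icoA 2 = (mat (\<i> / f5) ** ?M) ** (mat (zeta 3 ^ 2 / f5) ** ?N) ** icoA 2"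
    by (simp only: icoA_0 icoA_1)
  also have "\<dots> = mat (\<i> / f5 * (zeta 3 ^ 2 / f5)) ** (?M ** ?N ** icoA 2)"
    unfolding mat_mult_swap by (simp only: matrix_mul_assoc)
  also have "\<dots> = mat (\<i> / f5 * (zeta 3 ^ 2 / f5) * (-5 * e5 ^ 3))" by (simp only: MNU mat_mult_mat)
  also have "\<i> / f5 * (zeta 3 ^ 2 / f5) * (-5 * e5 ^ 3) = zeta 60"
    unfolding zeta_60 using f by simp
  finally show ?thesis .
qed

lemma icoA_det_trace:
  "det (icoA 0) = -1" "trace (icoA 0) = 0" "det (icoA 1) = zeta 3" "trace (icoA 1) = 1 + zeta 3"
  "det (icoA 2) = zeta 5" "trace (icoA 2) = 1 + zeta 5"
proof -
  have f: "f5 * f5 = 5" using f5_square by (simp add: power2_eq_square)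
  have w: "zeta 3 ^ 2 * zeta 3 ^ 2 = zeta 3" using zeta_pow_mod[of 3 4] by (simp flip: power_add)
  have d: "(e5 ^ 4 - e5) * (e5 - e5 ^ 4) - (e5 ^ 2 - e5 ^ 3) * (e5 ^ 2 - e5 ^ 3) = 5"
    "(e5 ^ 2 - e5 ^ 4) * (e5 ^ 3 - e5) - (e5 ^ 4 - 1) * (1 - e5) = 5"
    "e5 ^ 2 - e5 ^ 4 + (e5 ^ 3 - e5) = - f5"
    using e5_sum e5_pow5 unfolding f5_def by algebra+
  have "det (icoA 0) = (\<i> / f5) * (\<i> / f5) * 5"
    unfolding icoA_0 det_mul det_mat2 using d(1) by (simp add: det_2)
  then show "det (icoA 0) = -1" using f by simp
  show "trace (icoA 0) = 0" unfolding icoA_0 trace_scale by (simp add: trace2)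
  have "det (icoA 1) = (zeta 3 ^ 2 / f5) * (zeta 3 ^ 2 / f5) * 5"
    unfolding icoA_1 det_mul det_mat2 using d(2) by (simp add: det_2)
  then show "det (icoA 1) = zeta 3" using f w by simp
  have tr: "trace (icoA 1) = (zeta 3 ^ 2 / f5) * (- f5)" unfolding icoA_1 trace_scale using d(3) by (simp add: trace2)
  have "- (zeta 3 ^ 2) = 1 + zeta 3" unfolding zeta_3_eq by simp
  then show "trace (icoA 1) = 1 + zeta 3" unfolding tr using f5_nonzero by simp
  show "det (icoA 2) = zeta 5" "trace (icoA 2) = 1 + zeta 5"
    unfolding icoA_2 by (simp_all add: det_2 trace2 e5_def)
qed

lemma unitary_icoA:
  assumes i: "i < 3"
  shows "unitary (icoA i)"
proof -
  have f: "f5 * f5 = 5" using f5_square by (simp add: power2_eq_square)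
  have cf: "cnj f5 = f5" by (simp add: f5_t5 t5_real)
  have c: "cnj (e5 ^ 4 - e5) = e5 - e5 ^ 4" "cnj (e5 ^ 2 - e5 ^ 3) = e5 ^ 3 - e5 ^ 2"
  proof -
    have "e5 ^ 16 = e5" "e5 ^ 8 = e5 ^ 3" "e5 ^ 12 = e5 ^ 2" using e5_pow5 by algebra+
    then show "cnj (e5 ^ 4 - e5) = e5 - e5 ^ 4" "cnj (e5 ^ 2 - e5 ^ 3) = e5 ^ 3 - e5 ^ 2"
      by (simp_all add: cnj_e5 flip: power_mult)
  qed
  obtain p q where pq: "e5 ^ 4 - e5 = p" "e5 ^ 2 - e5 ^ 3 = q" by blast
  have m: "e5 - e5 ^ 4 = - p" by (simp flip: pq)
  have cp: "cnj p = - p" "cnj q = - q" unfolding pq[symmetric] c by simp_all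
  have "p * p + q * q = -5" using e5_sum e5_pow5 unfolding pq[symmetric] by algebra
  then have s: "p * p = -5 - q * q" by (simp add: algebra_simps)
  have 0: "unitary (icoA 0)"
    unfolding icoA_0 unitary_def mat_adjoint_def pq m
    by (simp add: mat2_simps cf cp f mult_ac) (simp add: s algebra_simps f field_simps)
  have "cnj e5 * e5 = 1" using e5_pow5 by (simp add: cnj_e5 flip: power_Suc2)
  then have 2: "unitary (icoA 2)"
    unfolding icoA_2 unitary_def mat_adjoint_def by (simp add: mat2_simps mult.commute)
  have m: "unitary (mat (zeta 60))" by (rule unitary_mat) simp
  note U = mat_groupD[OF mat_group_unitary, simplified]
  have "icoA 1 = matrix_inv (icoA 0) ** mat (zeta 60) ** matrix_inv (icoA 2)"
    by (rule product_quotient[OF icoA_generators]) (use 0 2 unitaryD in auto)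
  then have 1: "unitary (icoA 1)" using U(2)[OF U(2)[OF U(3)[OF 0] m] U(3)[OF 2]] by simp
  show ?thesis using less_3_cases[OF i] 0 1 2 by auto
qed

text \<open>The six axes of the icosahedron: \<open>icoQ k\<close> vanishes on a pair of antipodal vertices, the
  remaining pair consists of the two coordinate lines.\<close>

definition icoQ :: "nat \<Rightarrow> complex^2 \<Rightarrow> complex" where
  "icoQ k x = x$1 ^ 2 + e5 ^ k * x$1 * x$2 - e5 ^ (2 * k) * x$2 ^ 2"

text \<open>Klein's form x y (x^10 + 11 x^5 y^5 - y^10), kept in factors because
  \<open>icoA 0\<close> and \<open>icoA 2\<close> only permute the six axes, that is, the factors up
  to constants.\<close>

definition icoF :: "complex^2 \<Rightarrow> complex" where
  "icoF x = x$1 * x$2 * icoQ 0 x * icoQ 1 x * icoQ 2 x * icoQ 3 x * icoQ 4 x"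

lemma icoQ_scale: "icoQ k (c *s x) = c ^ 2 * icoQ k x"
  by (simp add: icoQ_def power_mult_distrib algebra_simps power2_eq_square)

lemma icoF_scale: "icoF (c *s x) = c ^ 12 * icoF x"
  unfolding icoF_def icoQ_scale by (simp add: eval_nat_numeral mult_ac)

lemma icoF_0: "icoF (icoA 0 *v x) = icoF x"
proof -
  let ?M = "vector [vector [e5 ^ 4 - e5, e5 ^ 2 - e5 ^ 3], vector [e5 ^ 2 - e5 ^ 3, e5 - e5 ^ 4]] :: complex^2^2"
  obtain u v where uv: "x$1 = u" "x$2 = v" by blast
  have M: "(?M *v x) $ 1 = (e5 ^ 4 - e5) * u + (e5 ^ 2 - e5 ^ 3) * v"
    "(?M *v x) $ 2 = (e5 ^ 2 - e5 ^ 3) * u + (e5 - e5 ^ 4) * v" by (simp_all add: mat2_vec_nth uv)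
  \<comment> \<open>\<open>icoA 0\<close> exchanges the pair of coordinate lines with
    \<open>icoQ 0\<close> and \<open>icoQ 1\<close> with \<open>icoQ 4\<close>, and preserves
    \<open>icoQ 2\<close> and \<open>icoQ 3\<close>. The constants multiply to 5^6, which cancels
    against the twelfth power of \<i> / \<open>f5\<close>.\<close>
  have Q: "(?M *v x) $ 1 * (?M *v x) $ 2 = f5 * icoQ 0 x" "icoQ 0 (?M *v x) = 5 * f5 * (x$1 * x$2)"
    "icoQ 1 (?M *v x) = 5 * e5 ^ 2 * icoQ 4 x" "icoQ 2 (?M *v x) = -5 * icoQ 2 x"
    "icoQ 3 (?M *v x) = -5 * icoQ 3 x" "icoQ 4 (?M *v x) = 5 * e5 ^ 3 * icoQ 1 x"
  proof -
    have e: "e5 ^ 8 = e5 ^ 3" "e5 ^ 6 = e5" using e5_pow5 by algebra+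
    have x: "icoQ 0 y = y$1 ^ 2 + y$1 * y$2 - y$2 ^ 2" "icoQ 1 y = y$1 ^ 2 + e5 * y$1 * y$2 - e5 ^ 2 * y$2 ^ 2"
      "icoQ 2 y = y$1 ^ 2 + e5 ^ 2 * y$1 * y$2 - e5 ^ 4 * y$2 ^ 2" "icoQ 3 y = y$1 ^ 2 + e5 ^ 3 * y$1 * y$2 - e5 * y$2 ^ 2"
      "icoQ 4 y = y$1 ^ 2 + e5 ^ 4 * y$1 * y$2 - e5 ^ 3 * y$2 ^ 2" for y
      by (simp_all add: icoQ_def e)
    note a = e5_sum e5_pow5
    show "(?M *v x) $ 1 * (?M *v x) $ 2 = f5 * icoQ 0 x" unfolding x M uv f5_def using a by algebra
    show "icoQ 0 (?M *v x) = 5 * f5 * (x$1 * x$2)" unfolding x M uv f5_def using a by algebra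
    show "icoQ 1 (?M *v x) = 5 * e5 ^ 2 * icoQ 4 x" unfolding x M uv f5_def using a by algebra
    show "icoQ 2 (?M *v x) = -5 * icoQ 2 x" unfolding x M uv f5_def using a by algebra
    show "icoQ 3 (?M *v x) = -5 * icoQ 3 x" unfolding x M uv f5_def using a by algebra
    show "icoQ 4 (?M *v x) = 5 * e5 ^ 3 * icoQ 1 x" unfolding x M uv f5_def using a by algebra
  qed
  have "icoF (?M *v x) = (f5 * f5) * (e5 ^ 5) * 3125 * icoF x"
  proof -
    have "e5 ^ 5 = e5 ^ 2 * e5 ^ 3" by (simp flip: power_add)
    then show ?thesis unfolding icoF_def Q by (simp only:) (simp add: mult_ac)
  qed
  then have "icoF (?M *v x) = 15625 * icoF x"
    using f5_square by (simp add: e5_pow5 power2_eq_square)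
  moreover have "(\<i> / f5) ^ 12 = 1 / 15625"
  proof -
    have "f5 ^ 12 = (f5 ^ 2) ^ 6" by (simp flip: power_mult)
    moreover have "\<i> ^ 12 = (\<i> ^ 4) ^ 3" by (simp only: flip: power_mult) simp
    ultimately show ?thesis by (simp add: power_divide f5_square)
  qed
  moreover have "icoA 0 *v x = (\<i> / f5) *s (?M *v x)"
    unfolding icoA_0 by (simp add: matrix_vector_mul_assoc[symmetric] mat_vec)
  ultimately show ?thesis by (simp add: icoF_scale)
qed

lemma icoF_2: "icoF (icoA 2 *v x) = e5 * icoF x"
proof -
  have n: "(icoA 2 *v x) $ 1 = x $ 1" "(icoA 2 *v x) $ 2 = e5 * x $ 2" by (simp_all add: icoA_2 mat2_vec_nth)
  have "icoQ k (icoA 2 *v x) = icoQ (Suc k) x" for k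
    unfolding icoQ_def n by (simp add: power_mult_distrib mult_ac power2_eq_square)
  moreover have "icoQ 5 x = icoQ 0 x"
  proof -
    have "e5 ^ 10 = 1" using e5_pow5 by algebra
    then show ?thesis by (simp add: icoQ_def e5_pow5)
  qed
  ultimately have "icoQ 0 (icoA 2 *v x) = icoQ 1 x" "icoQ 1 (icoA 2 *v x) = icoQ 2 x" "icoQ 2 (icoA 2 *v x) = icoQ 3 x"
    "icoQ 3 (icoA 2 *v x) = icoQ 4 x" "icoQ 4 (icoA 2 *v x) = icoQ 0 x"
    by (simp_all add: eval_nat_numeral)
  then show ?thesis unfolding icoF_def n by (simp add: mult_ac)
qed

lemma icoA_semi_invariant:
  assumes i: "i < 3"
  shows "icoA i \<in> semi_invariants icoF"
proof -
  note C = mat_groupD[OF mat_group_semi_invariants[of icoF]]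
  have inv: "invertible (icoA j)" if "j < 3" for j using unitaryD(1)[OF unitary_icoA[OF that]] .
  have 0: "icoA 0 \<in> semi_invariants icoF"
    using icoF_0 inv[of 0] by (auto simp: semi_invariants_def intro!: exI[of _ 1])
  have 2: "icoA 2 \<in> semi_invariants icoF"
    using icoF_2 inv[of 2] by (auto simp: semi_invariants_def intro!: exI[of _ e5])
  have m: "mat (zeta 60) \<in> semi_invariants icoF"
    by (auto simp: semi_invariants_def mat_vec icoF_scale invertible_det_nz det_mat2 intro!: exI[of _ "zeta 60 ^ 12"])
  have "icoA 1 = matrix_inv (icoA 0) ** mat (zeta 60) ** matrix_inv (icoA 2)"
    by (rule product_quotient[OF icoA_generators inv inv]) auto
  then have 1: "icoA 1 \<in> semi_invariants icoF" using C(2)[OF C(2)[OF C(3)[OF 0] m] C(3)[OF 2]] by simp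
  show ?thesis using less_3_cases[OF i] 0 1 2 by auto
qed

definition icoL :: "(complex^2) set set" where
  "icoL = {line (vector [1, 0]), line (vector [0, 1])} \<union>
     ((\<lambda>k. line (vector [- (1 + t5) * e5 ^ k, 1])) ` {..<5} \<union> (\<lambda>k. line (vector [t5 * e5 ^ k, 1])) ` {..<5})"

lemma icoQ_factor: "icoQ k x = (x$1 + (1 + t5) * e5 ^ k * x$2) * (x$1 - t5 * e5 ^ k * x$2)"
proof -
  obtain s where s: "e5 ^ k = s" by blast
  then have s': "e5 ^ (2 * k) = s ^ 2" by (metis power_mult mult.commute)
  show ?thesis unfolding icoQ_def s s' using t5_square by algebra
qed

lemma icoF_zero:
  assumes "icoF y = 0"
  shows "y$1 = 0 \<or> y$2 = 0 \<or> (\<exists>k<5. y$1 = - (1 + t5) * e5 ^ k * y$2 \<or> y$1 = t5 * e5 ^ k * y$2)"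
proof -
  have q: "y$1 = - (1 + t5) * e5 ^ k * y$2 \<or> y$1 = t5 * e5 ^ k * y$2" if "icoQ k y = 0" for k
    using that unfolding icoQ_factor mult_minus_left minus_mult_left[symmetric] eq_neg_iff_add_eq_0 by simp
  have "y$1 = 0 \<or> y$2 = 0 \<or> (\<exists>k<5. icoQ k y = 0)"
    using assms unfolding icoF_def by force
  then show ?thesis using q by blast
qed

lemma icoF_zero_line:
  assumes y: "y \<noteq> 0" "icoF y = 0"
  shows "line y \<in> icoL"
proof -
  have lv: "line y = line (vector [a, b])" if "y = t *s vector [a, b]" for a b t
  proof (rule line_eqI[OF y(1) _ that])
    show "vector [a, b] \<noteq> (0 :: complex^2)" using y(1) that by auto
  qed
  consider "y$1 = 0" | "y$2 = 0" | k where "k < 5" "y$1 = - (1 + t5) * e5 ^ k * y$2" | k where "k < 5" "y$1 = t5 * e5 ^ k * y$2"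
    using icoF_zero[OF y(2)] by blast
  then show ?thesis
  proof cases
    case 1
    then have "y = y$2 *s vector [0, 1]" by (simp add: vec2_eq_iff)
    from lv[OF this] show ?thesis by (simp add: icoL_def)
  next
    case 2
    then have "y = y$1 *s vector [1, 0]" by (simp add: vec2_eq_iff)
    from lv[OF this] show ?thesis by (simp add: icoL_def)
  next
    case 3
    then have "y = y$2 *s vector [- (1 + t5) * e5 ^ k, 1]" by (simp add: vec2_eq_iff mult.commute)
    from lv[OF this] show ?thesis using 3(1) unfolding icoL_def by blast
  next
    case 4
    then have "y = y$2 *s vector [t5 * e5 ^ k, 1]" by (simp add: vec2_eq_iff mult.commute)
    from lv[OF this] show ?thesis using 4(1) unfolding icoL_def by blast
  qed
qed

lemma norm_e5 [simp]: "norm e5 = 1"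
  by (simp add: e5_def)

text \<open>The determinants of the generators have the pairwise coprime orders 2, 3 and 5, so
  powers of the determinant suffice: 15, 10 and 6 are the idempotents modulo 30, each congruent to 1
  modulo one of these orders and to 0 modulo the other two.\<close>

definition icopsi :: "nat \<Rightarrow> complex^2^2 \<Rightarrow> complex" where
  "icopsi i g = det g ^ (if i = 0 then 15 else if i = 1 then 10 else 6)"

theorem ico_triangle: "triangle_group icoA (zeta 60) 5 12 icopsi icoL"
proof
  let ?od = "\<lambda>i. [2, 3, 5 :: nat] ! i" and ?G = "generated_group (icoA ` {..<3})"
  \<comment> \<open>By \<open>icoF_zero\<close>, off the coordinate lines the moduli of the
    coordinates of a vertex have ratio \<tau> or 1 + \<tau>, and these two numbers are inverse to
    each other.\<close>
  define \<tau> where "\<tau> = 2 * cos (2 * pi / 5)"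
  have t: "t5 = of_real \<tau>" "\<tau> > 0" using t5_real by (simp_all add: \<tau>_def)
  have "of_real (\<tau>\<^sup>2) = (of_real (1 - \<tau>) :: complex)" using t5_square by (simp add: t(1))
  then have \<tau>: "\<tau>\<^sup>2 = 1 - \<tau>" by (simp only: of_real_eq_iff)
  then have \<tau>1: "(1 + \<tau>) * \<tau> = 1" by (simp add: algebra_simps power2_eq_square)
  have n1: "norm (1 + t5) = 1 + \<tau>" "norm t5 = \<tau>"
  proof -
    have "1 + t5 = of_real (1 + \<tau>)" by (simp add: t(1))
    then show "norm (1 + t5) = 1 + \<tau>" using t(2) by (simp only: norm_of_real abs_of_pos)
    show "norm t5 = \<tau>" unfolding t(1) norm_of_real using t(2) by simp
  qed
  have S: "g \<in> semi_invariants icoF" if "g \<in> ?G" for g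
    by (rule generated_in_semi_invariants[OF icoA_semi_invariant that])
  have U: "unitary g" if "g \<in> ?G" for g
    by (rule generated_unitary[OF unitary_icoA that])
  show "icoA 0 ** icoA 1 ** icoA 2 = mat (zeta 60)" by (rule icoA_generators)
  show "(5 = (4::nat) \<and> 12 = (6::nat)) \<or> (5 = (5::nat) \<and> 12 = (12::nat))" by simp
  show "finite icoL" by (simp add: icoL_def)
  show "card icoL \<le> 12"
  proof -
    let ?a = "{line (vector [1, 0]), line (vector [0, 1])}"
    let ?b = "(\<lambda>k. line (vector [- (1 + t5) * e5 ^ k, 1])) ` {..<5::nat}"
    let ?c = "(\<lambda>k. line (vector [t5 * e5 ^ k, 1])) ` {..<5::nat}"
    have "card ?a \<le> 2" by (intro card_insert_le_m1) auto
    moreover have "card ?b \<le> 5" using card_image_le[of "{..<5::nat}" "\<lambda>k. line (vector [- (1 + t5) * e5 ^ k, 1])"] by simp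
    moreover have "card ?c \<le> 5" using card_image_le[of "{..<5::nat}" "\<lambda>k. line (vector [t5 * e5 ^ k, 1])"] by simp
    moreover have "card icoL \<le> card ?a + (card ?b + card ?c)"
      unfolding icoL_def using card_Un_le[of ?a "?b \<union> ?c"] card_Un_le[of ?b ?c] by linarith
    ultimately show ?thesis by linarith
  qed
  fix i :: nat
  show "unitary (icoA i)" if "i < 3" by (rule unitary_icoA[OF that])
  show "det (icoA i) = zeta (?od i)" if "i < 3"
    using less_3_cases[OF that] icoA_det_trace by (auto simp: zeta_2)
  show "trace (icoA i) = 1 + zeta (?od i)" if "i < 3"
    using less_3_cases[OF that] icoA_det_trace by (auto simp: zeta_2)
  have e51: "e5 \<noteq> 1" using zeta_pow_eq_1_iff[of 5 1] by (auto simp: e5_def)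
  have v2: "v $ 2 = 0" if "icoA 2 *v v = v" for v
  proof -
    have "e5 * v $ 2 = 1 * v $ 2" using that by (simp add: icoA_2 mat2_vec_nth vec2_eq_iff)
    then show ?thesis using e51 by (simp only: mult_cancel_right) simp
  qed
  fix g assume g: "g \<in> ?G"
  have gi: "invertible g" by (rule unitaryD(1)[OF U[OF g]])
  fix v :: "complex^2" assume v: "v \<noteq> 0"
  show "line (g *v v) \<in> icoL" if v2': "icoA 2 *v v = v"
  proof (rule icoF_zero_line)
    show "g *v v \<noteq> 0" by (rule mult_vec_nonzero[OF gi v])
    show "icoF (g *v v) = 0" unfolding semi_invariant_zero_iff[OF S[OF g]] using v2[OF v2'] by (simp add: icoF_def)
  qed
  fix x y
  show "x ^ ?od i = y ^ ?od i" if i: "i = 0 \<or> i = 2" and Av: "icoA i *v v = v"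
    and gv: "g *v v = x *s v" "g *v perp v = y *s perp v"
    using i
  proof
    assume i0: "i = 0"
    \<comment> \<open>(b', a') is the image of the vertex (1, 0) under \<open>icoA 0\<close>. Both
      entries are real, and their moduli have ratio 1 + \<tau>, the same as for vertices; so \<rho>
      is its square.\<close>
    define a' b' where "a' = \<i> / f5 * (e5 ^ 2 - e5 ^ 3)" and "b' = \<i> / f5 * (e5 ^ 4 - e5)"
    have cf: "cnj f5 = f5" by (simp add: f5_t5 t5_real)
    have ep: "e5 ^ 16 = e5" "e5 ^ 8 = e5 ^ 3" "e5 ^ 12 = e5 ^ 2" using e5_pow5 by algebra+
    have "cnj a' = a'" "cnj b' = b'"
      unfolding a'_def b'_def
      by (simp_all add: cnj_e5 cf ep algebra_simps diff_divide_distrib flip: power_mult)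
    then obtain a b where ab: "a' = of_real a" "b' = of_real b"
      using complex_cnj_cancel_iff Reals_cnj_iff Reals_cases by metis
    have "b' ^ 2 = (1 + t5) ^ 2 * a' ^ 2"
    proof -
      have "(e5 ^ 4 - e5) ^ 2 = (1 + t5) ^ 2 * (e5 ^ 2 - e5 ^ 3) ^ 2"
        using e5_sum unfolding t5_def by algebra
      then show ?thesis unfolding a'_def b'_def power_mult_distrib by simp
    qed
    then have "of_real (b\<^sup>2) = (of_real ((1 + \<tau>)\<^sup>2 * a\<^sup>2) :: complex)" by (simp add: ab t(1))
    then have ba: "b\<^sup>2 = (1 + \<tau>)\<^sup>2 * a\<^sup>2" by (simp only: of_real_eq_iff)
    have "b' ^ 2 + a' ^ 2 = 1"
    proof -
      have "(e5 ^ 4 - e5) ^ 2 + (e5 ^ 2 - e5 ^ 3) ^ 2 = - (f5 ^ 2)"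
        using e5_sum unfolding f5_square by algebra
      moreover have "b' ^ 2 + a' ^ 2 = (\<i> / f5) ^ 2 * ((e5 ^ 4 - e5) ^ 2 + (e5 ^ 2 - e5 ^ 3) ^ 2)"
        unfolding a'_def b'_def power_mult_distrib by (simp only: distrib_left)
      ultimately show ?thesis using f5_nonzero by (simp add: power_divide)
    qed
    then have b0: "b \<noteq> 0" using ba ab by auto (use t(2) in auto)
    have "x\<^sup>2 = y\<^sup>2"
    proof (rule involution_exact[OF U[OF g] _ _ v _ gv, where B = "icoA 0" and e = "vector [1, 0]" and e' = "vector [0, 1]"
          and a = a' and b = b and \<rho> = "(1 + \<tau>)\<^sup>2"])
      show "unitary (icoA 0)" "det (icoA 0) = -1" using unitary_icoA icoA_det_trace by auto
      show "icoA 0 *v v = v" using Av i0 by simp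
      show "icoA 0 *v vector [1, 0] = of_real b *s vector [1, 0] + a' *s vector [0, 1]"
        unfolding icoA_0 ab(2)[symmetric] a'_def b'_def by (simp add: vec2_eq_iff mat2_vec_nth mat2_mult_nth mat2_nth)
      show "b \<noteq> 0" by (rule b0)
      show "b\<^sup>2 = (1 + \<tau>)\<^sup>2 * (norm a')\<^sup>2" unfolding ab using ba by simp
      show "(1 + \<tau>)\<^sup>2 \<ge> 1" using t(2) one_le_power[of "1 + \<tau>" 2] by simp
      fix u w assume uw: "g *v vector [1, 0] = w *s vector [1, 0] + u *s vector [0, 1]"
      have F: "icoF (g *v vector [1, 0]) = 0" unfolding semi_invariant_zero_iff[OF S[OF g]] by (simp add: icoF_def)
      have gc: "(g *v vector [1, 0]) $ 1 = w" "(g *v vector [1, 0]) $ 2 = u" unfolding uw by simp_all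
      have k1: "(norm w)\<^sup>2 = (1 + \<tau>)\<^sup>2 * (norm u)\<^sup>2" if "w = - (1 + t5) * e5 ^ k * u" for k
        unfolding that norm_mult norm_minus_cancel n1 by (simp add: norm_power power_mult_distrib)
      have k2: "(norm u)\<^sup>2 = (1 + \<tau>)\<^sup>2 * (norm w)\<^sup>2" if "w = t5 * e5 ^ k * u" for k
      proof -
        have "(1 + \<tau>)\<^sup>2 * (norm w)\<^sup>2 = ((1 + \<tau>) * \<tau>)\<^sup>2 * (norm u)\<^sup>2"
          unfolding that norm_mult n1 by (simp add: norm_power power_mult_distrib)
        then show ?thesis by (simp add: \<tau>1)
      qed
      show "u = 0 \<or> w = 0 \<or> (norm w)\<^sup>2 = (1 + \<tau>)\<^sup>2 * (norm u)\<^sup>2 \<or> (norm u)\<^sup>2 = (1 + \<tau>)\<^sup>2 * (norm w)\<^sup>2"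
        using icoF_zero[OF F] k1 k2 unfolding gc by blast
    qed (auto simp: vec2_eq_iff)
    then show ?thesis using i0 by simp
  next
    assume i2: "i = 2"
    have v1: "v $ 2 = 0" using v2 Av i2 by simp
    then have v2n: "v $ 1 \<noteq> 0" using v by (simp add: vec2_eq_iff)
    have ge: "g$1$2 = 0" "g$1$1 = x" "g$2$2 = y" "g$2$1 = 0"
      using gv v1 v2n by (simp_all add: vec2_eq_iff mat2_vec_nth)
    have nx: "norm x = 1" "norm y = 1"
      using norm_eigenvalue_unitary[OF U[OF g] v gv(1)] norm_eigenvalue_unitary[OF U[OF g] _ gv(2)] v by auto
    \<comment> \<open>The diagonal matrix g sends the vertex (t5, 1) to (x t5, y). Since x and y
      have modulus 1, comparing moduli excludes the vertices with factor 1 + t5, and x / y is a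
      power of \<open>e5\<close>.\<close>
    have "icoQ 0 (vector [t5, 1]) = 0" unfolding icoQ_factor by simp
    then have F: "icoF (g *v vector [t5, 1]) = 0"
      unfolding semi_invariant_zero_iff[OF S[OF g]] by (simp add: icoF_def)
    have gt: "(g *v vector [t5, 1]) $ 1 = x * t5" "(g *v vector [t5, 1]) $ 2 = y"
      by (simp_all add: mat2_vec_nth ge)
    have xn: "x * t5 \<noteq> 0" "y \<noteq> 0" using nx t by auto
    obtain k where k: "x * t5 = - (1 + t5) * e5 ^ k * y \<or> x * t5 = t5 * e5 ^ k * y"
      using icoF_zero[OF F] xn unfolding gt by blast
    have "x * t5 \<noteq> - (1 + t5) * e5 ^ k * y"
    proof
      assume "x * t5 = - (1 + t5) * e5 ^ k * y"
      then have "norm (x * t5) = norm (- (1 + t5) * e5 ^ k * y)" by simp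
      then show False unfolding norm_mult norm_minus_cancel n1 by (simp add: nx norm_power)
    qed
    then have "x = e5 ^ k * y" using k xn by auto
    then have "x ^ 5 = (e5 ^ 5) ^ k * y ^ 5" by (simp add: power_mult_distrib mult.commute flip: power_mult)
    then show ?thesis using i2 by (simp add: e5_pow5)
  qed
next
  fix i :: nat
  fix g h :: "complex^2^2"
  show "icopsi i (g ** h) = icopsi i g * icopsi i h"
    by (simp add: icopsi_def det_mul power_mult_distrib)
next
  fix i j :: nat assume ij: "i < 3" "j < 3" "i \<noteq> j"
  have "zeta 3 ^ 15 = 1" "zeta 3 ^ 6 = 1" "zeta 5 ^ 15 = 1" "zeta 5 ^ 10 = 1" using zeta_pow_eq_1_iff by auto
  then show "icopsi i (icoA j) = 1"
    using less_3_cases[OF ij(1)] less_3_cases[OF ij(2)] ij(3) icoA_det_trace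
    by (auto simp: icopsi_def)
next
  fix i k :: nat assume i: "i < 3" and k: "0 < k" "k < [2, 3, 5] ! i"
  have z: "zeta 3 ^ 10 = zeta 3" "zeta 5 ^ 6 = zeta 5" using zeta_pow_mod[of 3 10] zeta_pow_mod[of 5 6] by simp_all
  have *: "icopsi 0 (icoA 0) = zeta 2" "icopsi 1 (icoA 1) = zeta 3" "icopsi 2 (icoA 2) = zeta 5"
    using icoA_det_trace z by (auto simp: icopsi_def zeta_2)
  have nd: "\<not> [2, 3, 5] ! i dvd k" using k by (metis dvd_imp_le not_le)
  show "icopsi i (icoA i) ^ k \<noteq> 1"
    using less_3_cases[OF i] nd * zeta_pow_eq_1_iff[of 2 k] zeta_pow_eq_1_iff[of 3 k] zeta_pow_eq_1_iff[of 5 k] by auto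
qed

section \<open>The groups as subgroups of triangle groups\<close>

lemma mpow_product:
  assumes "(X :: complex^2^2) ** Y = mat x"
  shows "mpow X n ** mpow Y n = mat (x ^ n)"
proof (induction n)
  case (Suc n)
  have "mpow Y (Suc n) = mpow Y n ** Y" using mpow_add[of Y n 1] by simp
  then have "mpow X (Suc n) ** mpow Y (Suc n) = X ** (mpow X n ** mpow Y n) ** Y"
    by (simp add: matrix_mul_assoc)
  also have "\<dots> = mat (x ^ n) ** (X ** Y)"
    unfolding Suc mat_comm[of X] by (simp add: matrix_mul_assoc)
  finally show ?case by (simp add: assms mat_mult_mat mult.commute)
qed simp

text \<open>\<open>Y ** X\<close> is conjugate to \<open>X ** Y\<close> by X, and a scalar matrix is
  its own conjugate.\<close>

lemma mpow_swap:
  assumes X: "invertible X" and n: "mpow (X ** Y) n = mat x"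
  shows "mpow (Y ** X) n = mat x"
proof -
  have "X ** mpow (Y ** X) n = mpow (X ** Y) n ** X"
  proof (induction n)
    case (Suc n)
    have "X ** mpow (Y ** X) (Suc n) = X ** Y ** (X ** mpow (Y ** X) n)" by (simp add: matrix_mul_assoc)
    then show ?case unfolding Suc by (simp add: matrix_mul_assoc)
  qed simp
  then have "matrix_inv X ** (X ** mpow (Y ** X) n) = matrix_inv X ** (X ** mat x)"
    unfolding n mat_comm by simp
  then show ?thesis unfolding inv_cancel(3)[OF X] .
qed

lemma mat_mpow: "mpow (mat x) n = mat (x ^ n)"
  by (induction n) (simp_all add: mat_mult_mat)

lemma scalar_in_field_of_definition:
  assumes "mat x \<in> (H :: (complex^2^2) set)"
  shows "x \<in> field_of_definition H"
proof -
  note kD = is_subfieldD[OF subfield_hull[of "trace ` H", folded field_of_definition_def]]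
  have "trace (mat x :: complex^2^2) \<in> field_of_definition H" by (rule field_of_definition_trace[OF assms])
  then have "2 * x \<in> field_of_definition H" by (simp add: trace2 mat2_nth)
  then have "2 * x / 2 \<in> field_of_definition H" using kD(8,11) by blast
  then show ?thesis by simp
qed

section \<open>Comparison of the given generating matrices with the reflections\<close>

context triangle_group
begin

text \<open>With X = \<open>A i ** A j\<close> and Y = \<open>A d\<close> the product X Y is a
  scalar, so X^n Y^n = z^n, and for n = \<open>od d\<close> the second factor disappears. The order
  of the third reflection thus gives the braid relation between the other two.\<close>

lemma pair_power:
  assumes d: "A i ** A j ** A d = mat z" and a: "i < 3" "j < 3" "d < 3"
  shows "mpow (A i ** A j) (od d) = mat (z ^ od d)" "mpow (A j ** A i) (od d) = mat (z ^ od d)"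
proof -
  show 1: "mpow (A i ** A j) (od d) = mat (z ^ od d)"
    using mpow_product[OF d, of "od d"] unfolding A_power_od[OF a(3)] by simp
  show "mpow (A j ** A i) (od d) = mat (z ^ od d)"
    by (rule mpow_swap[OF unitaryD(1)[OF unitary[OF a(1)]] 1])
qed

text \<open>These scalars serve twice: in comparing generating sets and, through their traces, in
  showing that roots of unity lie in the field of definition.\<close>

lemma scalar_in_sub:
  "mat (z ^ c) \<in> sub {0, 1}" "mat (z ^ 3) \<in> sub {0, 2}" "mat (z ^ 2) \<in> sub {1, 2}" "mat z \<in> sub {0, 1, 2}"
proof -
  have *: "mat (z ^ od d) \<in> sub I"
    if t: "A i ** A j ** A d = mat z" "d < 3" "I \<subseteq> {..<3}" "i \<in> I" "j \<in> I" "{0,1} \<subseteq> I \<or> {0,2} \<subseteq> I \<or> {1,2} \<subseteq> I" for i j d I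
    using mat_groupD(5)[OF mat_group_sub[OF t(3,6)] mat_groupD(2)[OF mat_group_sub[OF t(3,6)]
        A_in_sub[OF t(3,6,4)] A_in_sub[OF t(3,6,5)]], of "od d"]
      pair_power(1)[OF t(1) less_3_I[OF t(3,6,4)] less_3_I[OF t(3,6,5)] t(2)] by simp
  show "mat (z ^ c) \<in> sub {0, 1}" using *[OF prod_A, of "{0,1}"] by (simp add: od_def)
  show "mat (z ^ 3) \<in> sub {0, 2}" using *[OF prod_A_cyclic(2), of "{0,2}"] by (simp add: od_def)
  show "mat (z ^ 2) \<in> sub {1, 2}" using *[OF prod_A_cyclic(1), of "{1,2}"] by (simp add: od_def)
  have I: "{0,1,2} \<subseteq> {..<3::nat}" "{0,1} \<subseteq> {0,1,2::nat} \<or> {0,2} \<subseteq> {0,1,2::nat} \<or> {1,2} \<subseteq> {0,1,2::nat}" by auto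
  show "mat z \<in> sub {0, 1, 2}"
    unfolding prod_A[symmetric] by (intro mat_groupD(2)[OF mat_group_sub[OF I]] A_in_sub[OF I]) auto
qed

text \<open>The square of the first given generator, the cube of the second and the c-th power of
  their product are the scalars x^2, y^3 and (x y z)^c. Assumptions \<open>0\<close>,
  \<open>1\<close> and \<open>2\<close> say that they generate the scalars to be stripped off in
  order to reach \<open>A 0\<close>, \<open>A 1\<close> and \<open>A 2\<close>; the last is x y z
  times the inverse of the product of the given generators. Conversely, \<open>x\<close> and
  \<open>y\<close> place the given generators in \<open>sub I\<close> with the help of its scalar
  q.\<close>

theorem generated_eq_sub:
  assumes I: "I \<subseteq> {..<3}" "{0,1} \<subseteq> I \<or> {0,2} \<subseteq> I \<or> {1,2} \<subseteq> I"
    and xy: "x \<noteq> 0" "y \<noteq> 0" and q: "mat q \<in> sub I"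
    and 0: "0 \<in> I \<Longrightarrow> \<exists>i j l. x = (x ^ 2) ^ i * (y ^ 3) ^ j * ((x * y * z) ^ c) ^ l"
    and 1: "1 \<in> I \<Longrightarrow> \<exists>i j l. y = (x ^ 2) ^ i * (y ^ 3) ^ j * ((x * y * z) ^ c) ^ l"
    and 2: "2 \<in> I \<Longrightarrow> \<exists>i j l. x * y * z = (x ^ 2) ^ i * (y ^ 3) ^ j * ((x * y * z) ^ c) ^ l"
    and x: "\<exists>n. (if 0 \<in> I then x else x * z) = q ^ n"
    and y: "\<exists>n. (if 1 \<in> I then y else y * z) = q ^ n"
  shows "generated_group {mat x ** A 0, mat y ** A 1} = sub I"
proof -
  let ?B = "mat x ** A 0" and ?D = "mat y ** A 1"
  let ?H = "generated_group {?B, ?D}"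
  have A: "invertible (A i)" if "i < 3" for i using unitaryD(1)[OF unitary[OF that]] .
  have inv: "invertible (mat t ** A i)" if "t \<noteq> 0" "i < 3" for t i
    using that A[OF that(2)] by (simp add: invertible_det_nz det_mul det_mat2)
  have H: "mat_group ?H" by (rule mat_group_generated) (use inv[OF xy(1)] inv[OF xy(2)] in auto)
  note HD = mat_groupD[OF H]
  have BD: "?B \<in> ?H" "?D \<in> ?H" by (auto intro: generated_group.incl)
  have s: "mat (x ^ 2) \<in> ?H" "mat (y ^ 3) \<in> ?H" "mat ((x * y * z) ^ c) \<in> ?H"
  proof -
    have "mpow ?B 2 = mat (x ^ 2)" using A_power_od[of 0] by (simp add: mpow_scaled od_simps)
    then show "mat (x ^ 2) \<in> ?H" using HD(5)[OF BD(1), of 2] by simp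
    have "mpow ?D 3 = mat (y ^ 3)" using A_power_od[of 1] by (simp add: mpow_scaled od_simps)
    then show "mat (y ^ 3) \<in> ?H" using HD(5)[OF BD(2), of 3] by simp
    have "mpow (?B ** ?D) c = mat ((x * y * z) ^ c)"
      unfolding mat_mult_swap mpow_scaled using pair_power(1)[OF prod_A] unfolding od_simps
      by (simp add: mat_mult_mat power_mult_distrib)
    then show "mat ((x * y * z) ^ c) \<in> ?H" using HD(5)[OF HD(2)[OF BD], of c] by simp
  qed
  have sc: "mat t \<in> ?H" if ex: "\<exists>i j l. t = (x ^ 2) ^ i * (y ^ 3) ^ j * ((x * y * z) ^ c) ^ l" for t
  proof -
    obtain i j l where t: "t = (x ^ 2) ^ i * (y ^ 3) ^ j * ((x * y * z) ^ c) ^ l" using ex by blast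
    have "mpow (mat (x ^ 2)) i ** mpow (mat (y ^ 3)) j ** mpow (mat ((x * y * z) ^ c)) l \<in> ?H"
      by (intro HD(2,5) s)
    then show ?thesis unfolding t by (simp add: mat_mpow mat_mult_mat)
  qed
  have quot: "g \<in> M" if M: "mat_group M" and t: "mat t \<in> M" "h \<in> M" "h ** g = mat t" for M g h and t
  proof -
    have "matrix_inv h ** (h ** g) \<in> M" unfolding t(3) using mat_groupD(2,3)[OF M] t by blast
    then show ?thesis using inv_cancel(3)[OF mat_groupD(4)[OF M t(2)]] by simp
  qed
  have unscale: "g \<in> M" if M: "mat_group M" and t: "mat t \<in> M" "mat t ** g \<in> M" for M g and t
    using mat_groupD(2)[OF M mat_groupD(3)[OF M t(1)] t(2)] inv_cancel(3)[OF mat_groupD(4)[OF M t(1)]] by simp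
  note S = mat_group_sub[OF I]
  have qs: "mat (q ^ n) \<in> sub I" for n
    unfolding mat_mpow[symmetric] by (rule mat_groupD(5)[OF S q])
  show ?thesis
    unfolding sub_def
  proof (rule generated_group_eqI)
    show "invertible g" if "g \<in> {?B, ?D}" for g using that inv[OF xy(1)] inv[OF xy(2)] by auto
    show "invertible g" if "g \<in> A ` I" for g using that A less_3_I[OF I] by auto
    have "?B \<in> sub I"
    proof (cases "0 \<in> I")
      case True
      then show ?thesis using x qs by (auto intro!: mat_groupD(2)[OF S] A_in_sub[OF I])
    next
      case False
      then have "1 \<in> I" "2 \<in> I" using I(2) by auto
      moreover have "(A 1 ** A 2) ** ?B = mat (x * z)"
      proof -
        have "(A 1 ** A 2) ** ?B = mat x ** (A 1 ** A 2 ** A 0)"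
          unfolding matrix_mul_assoc mat_comm[of "A 1 ** A 2"] ..
        then show ?thesis unfolding prod_A_cyclic mat_mult_mat .
      qed
      moreover have "mat (x * z) \<in> sub I" using x qs False by auto
      ultimately show ?thesis using quot[OF S] mat_groupD(2)[OF S] A_in_sub[OF I] by blast
    qed
    moreover have "?D \<in> sub I"
    proof (cases "1 \<in> I")
      case True
      then show ?thesis using y qs by (auto intro!: mat_groupD(2)[OF S] A_in_sub[OF I])
    next
      case False
      then have "0 \<in> I" "2 \<in> I" using I(2) by auto
      moreover have "(A 2 ** A 0) ** ?D = mat (y * z)"
      proof -
        have "(A 2 ** A 0) ** ?D = mat y ** (A 2 ** A 0 ** A 1)"
          unfolding matrix_mul_assoc mat_comm[of "A 2 ** A 0"] ..
        then show ?thesis unfolding prod_A_cyclic mat_mult_mat .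
      qed
      moreover have "mat (y * z) \<in> sub I" using y qs False by auto
      ultimately show ?thesis using quot[OF S] mat_groupD(2)[OF S] A_in_sub[OF I] by blast
    qed
    ultimately show "{?B, ?D} \<subseteq> generated_group (A ` I)" by (simp add: sub_def)
    have "A i \<in> ?H" if i: "i \<in> I" for i
    proof -
      consider "i = 0" | "i = 1" | "i = 2" using less_3_I[OF I i] by fastforce
      then show ?thesis
      proof cases
        case 1
        then show ?thesis using unscale[OF H sc BD(1)] 0 i by blast
      next
        case 2
        then show ?thesis using unscale[OF H sc BD(2)] 1 i by blast
      next
        case 3
        have "?B ** ?D ** A 2 = mat (x * y) ** (A 0 ** A 1 ** A 2)"
          unfolding mat_mult_swap by (simp add: matrix_mul_assoc)
        then have "?B ** ?D ** A 2 = mat (x * y * z)" unfolding prod_A mat_mult_mat .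
        then show ?thesis using quot[OF H sc HD(2)[OF BD]] 2 i 3 by blast
      qed
    qed
    then show "A ` I \<subseteq> ?H" by blast
  qed
qed

text \<open>All scalars are powers of one root of unity, so that only their exponents matter.\<close>

corollary generated_eq_sub_exponents:
  assumes I: "I \<subseteq> {..<3}" "{0,1} \<subseteq> I \<or> {0,2} \<subseteq> I \<or> {1,2} \<subseteq> I"
    and N: "N > 0" and z: "z = zeta N ^ p" and q: "mat (z ^ s) \<in> sub I"
    and 0: "0 \<in> I \<Longrightarrow> \<exists>i j l. (2 * e * i + 3 * f * j + c * (e + f + p) * l) mod N = e mod N"
    and 1: "1 \<in> I \<Longrightarrow> \<exists>i j l. (2 * e * i + 3 * f * j + c * (e + f + p) * l) mod N = f mod N"
    and 2: "2 \<in> I \<Longrightarrow> \<exists>i j l. (2 * e * i + 3 * f * j + c * (e + f + p) * l) mod N = (e + f + p) mod N"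
    and x: "\<exists>n. (if 0 \<in> I then e else e + p) mod N = (p * s * n) mod N"
    and y: "\<exists>n. (if 1 \<in> I then f else f + p) mod N = (p * s * n) mod N"
  shows "generated_group {mat (zeta N ^ e) ** A 0, mat (zeta N ^ f) ** A 1} = sub I"
proof (rule generated_eq_sub[OF I _ _ q])
  let ?v = "zeta N"
  have eq: "?v ^ t = ?v ^ u" if "t mod N = u mod N" for t u
    by (metis zeta_pow_mod[OF N] that)
  have *: "((?v ^ e) ^ 2) ^ i * ((?v ^ f) ^ 3) ^ j * ((?v ^ e * ?v ^ f * z) ^ c) ^ l =
      ?v ^ (2 * e * i + 3 * f * j + c * (e + f + p) * l)" for i j l
    unfolding z by (simp add: power_mult[symmetric] power_add[symmetric] ac_simps)
  show "\<exists>i j l. ?v ^ e = ((?v ^ e) ^ 2) ^ i * ((?v ^ f) ^ 3) ^ j * ((?v ^ e * ?v ^ f * z) ^ c) ^ l" if "0 \<in> I"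
    unfolding * using 0[OF that] eq by metis
  show "\<exists>i j l. ?v ^ f = ((?v ^ e) ^ 2) ^ i * ((?v ^ f) ^ 3) ^ j * ((?v ^ e * ?v ^ f * z) ^ c) ^ l" if "1 \<in> I"
    unfolding * using 1[OF that] eq by metis
  show "\<exists>i j l. ?v ^ e * ?v ^ f * z = ((?v ^ e) ^ 2) ^ i * ((?v ^ f) ^ 3) ^ j * ((?v ^ e * ?v ^ f * z) ^ c) ^ l" if "2 \<in> I"
    unfolding * using 2[OF that] eq unfolding z power_add[symmetric] by metis
  have q: "(z ^ s) ^ n = ?v ^ (p * s * n)" for n unfolding z by (simp flip: power_mult)
  show "\<exists>n. (if 0 \<in> I then ?v ^ e else ?v ^ e * z) = (z ^ s) ^ n"
    unfolding q using x eq unfolding z power_add[symmetric] by (metis (full_types))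
  show "\<exists>n. (if 1 \<in> I then ?v ^ f else ?v ^ f * z) = (z ^ s) ^ n"
    unfolding q using y eq unfolding z power_add[symmetric] by (metis (full_types))
qed auto

lemma subfield_sub: "is_subfield (field_of_definition (sub I))"
  by (simp add: field_of_definition_def subfield_hull)

lemma diagonal_entry:
  assumes "i \<in> I" "i < 3"
  shows "1 - zeta (od i) \<in> field_of_definition (sub I)" "algebraic_int (1 - zeta (od i))"
proof -
  note kD = is_subfieldD[OF subfield_sub[of I]]
  have "A i \<in> sub I" using assms by (auto simp: sub_def intro: generated_group.incl)
  then have "1 + zeta (od i) \<in> field_of_definition (sub I)"
    using field_of_definition_trace trace_A[OF assms(2)] by metis
  then have "2 - (1 + zeta (od i)) \<in> field_of_definition (sub I)" using kD(3,11) by blast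
  then show "1 - zeta (od i) \<in> field_of_definition (sub I)" by simp
  have "algebraic_int (zeta (od i))"
    using algebraic_int_root_of_unity[OF zeta_pow_self] od_bounds(3)[OF assms(2)] by blast
  then show "algebraic_int (1 - zeta (od i))" by (intro algebraic_int_diff) auto
qed

lemma pair_trace:
  "trace ((mat 1 - A 0) ** (mat 1 - A 1)) = 1 - zeta 3 + z * (1 + 1 / zeta c)"
  "trace ((mat 1 - A 0) ** (mat 1 - A 2)) = 1 - zeta c - z * zeta 3"
  "trace ((mat 1 - A 1) ** (mat 1 - A 2)) = - zeta 3 - zeta c"
  "trace ((mat 1 - A 0) ** (mat 1 - A 1) ** (mat 1 - A 2)) =
    - zeta 3 - zeta c + z * (1 + 1 / zeta c) - z * zeta 3 - 2 * z"
proof -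
  have w: "1 + 1 / zeta 3 = - zeta 3"
  proof -
    have "zeta 3 * (1 + 1 / zeta 3) = zeta 3 * (- zeta 3)" using zeta_3_eq by (simp add: power2_eq_square distrib_left)
    then show ?thesis unfolding mult_left_cancel[OF zeta_nonzero] .
  qed
  show "trace ((mat 1 - A 0) ** (mat 1 - A 1)) = 1 - zeta 3 + z * (1 + 1 / zeta c)"
    "trace ((mat 1 - A 0) ** (mat 1 - A 2)) = 1 - zeta c - z * zeta 3"
    "trace ((mat 1 - A 1) ** (mat 1 - A 2)) = - zeta 3 - zeta c"
    "trace ((mat 1 - A 0) ** (mat 1 - A 1) ** (mat 1 - A 2)) =
      - zeta 3 - zeta c + z * (1 + 1 / zeta c) - z * zeta 3 - 2 * z"
    unfolding trace_complement_pair trace_complement_triple trace_pairs w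
    using trace_A[of 0] trace_A[of 1] trace_A[of 2] by (simp_all add: od_def zeta_2 algebra_simps)
qed

lemma word_product_alternating:
  "word_product [X, Y] (concat (replicate n [0, 1])) = mpow (X ** Y) n"
  "word_product [X, Y] (concat (replicate n [1, 0])) = mpow (Y ** X) n"
  for X Y :: "complex^2^2"
  by (induction n) (simp_all add: word_product_def matrix_mul_assoc[symmetric])

end

section \<open>Reduction of the statement to identities and units for two or three
  generators\<close>

definition unique_root_system_data :: "st_type \<Rightarrow> bool" where
  "unique_root_system_data T \<longleftrightarrow> (\<forall>k r. k = field_of_definition (st_group T) \<longrightarrow> r = length (st_orders T) \<longrightarrow>
    (\<exists>V W p. realization (st_group T) V W p) \<and>
    (\<forall>V W p. realization (st_group T) V W p \<longrightarrow>
       unique_genus (st_group T) V W p \<and>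
       (\<exists>ss. standard_generators T V ss \<and> is_cartan_matrix k V W p ss (st_cartan T))) \<and>
    (\<forall>d. (\<forall>i<r. d i \<in> k \<and> d i \<noteq> 0) \<and>
         (\<forall>i<r. \<forall>j<r. diag_conj d (st_cartan T) i j \<in> ring_of_integers k) \<longrightarrow>
       (\<exists>u. (\<forall>i<r. u i \<in> integral_units k) \<and>
            (\<forall>i<r. \<forall>j<r. diag_conj d (st_cartan T) i j = diag_conj u (st_cartan T) i j))))"

context triangle_group
begin

text \<open>The inverse y is only asked to be an algebraic integer; as the inverse of an element of
  the field it lies in the field by itself.\<close>

definition integral_unit_of :: "nat set \<Rightarrow> complex \<Rightarrow> bool" where
  "integral_unit_of I x \<longleftrightarrow> x \<in> field_of_definition (sub I) \<and> algebraic_int x \<and> (\<exists>y. algebraic_int y \<and> x * y = 1)"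

lemma integral_unit_ofI:
  assumes "x \<in> field_of_definition (sub I)" "x * y = 1" "algebraic_int x" "algebraic_int y"
  shows "integral_unit_of I x"
  using assms by (auto simp: integral_unit_of_def)

lemma integral_unit_of_one: "integral_unit_of I 1" "integral_unit_of I (- 1)"
  using is_subfieldD(1,4)[OF subfield_sub[of I]]
  by (auto intro!: integral_unit_ofI[of 1 _ 1] integral_unit_ofI[of "- 1" _ "- 1"] int_imp_algebraic_int)

lemma integral_unit_ofD:
  assumes "integral_unit_of I x"
  shows "x \<in> field_of_definition (sub I)" "algebraic_int x" "x \<noteq> 0" "algebraic_int (inverse x)"
proof -
  show "x \<in> field_of_definition (sub I)" "algebraic_int x" using assms by (auto simp: integral_unit_of_def)
  obtain y where y: "algebraic_int y" "x * y = 1" using assms by (auto simp: integral_unit_of_def)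
  then show "x \<noteq> 0" by auto
  show "algebraic_int (inverse x)" using y inverse_unique[OF y(2)] by simp
qed

text \<open>l is the omitted generator. Both alternating words with \<open>od l\<close> repetitions
  equal the scalar \<open>z ^ od l\<close> by \<open>pair_power\<close>, which is the braid
  relation. With two generators the Cartan matrix is fixed by its diagonal and one product.\<close>

theorem two_generators:
  assumes ij: "(i = 0 \<and> j = 1 \<and> l = 2) \<or> (i = 0 \<and> j = 2 \<and> l = 1) \<or> (i = 1 \<and> j = 2 \<and> l = 0)"
    and T: "st_group T = sub {i, j}" "st_orders T = [od i, od j]"
      "st_cartan T = [[1 - zeta (od i), p], [q, 1 - zeta (od j)]]"
      "st_braid_relations T = [(concat (replicate (od l) [0, 1]), concat (replicate (od l) [1, 0]))]"
    and pq: "p * q = trace ((mat 1 - A i) ** (mat 1 - A j))"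
    and units: "integral_unit_of {i, j} p" "integral_unit_of {i, j} q"
    and det: "(1 - zeta (od i)) * (1 - zeta (od j)) \<noteq> p * q"
  shows "unique_root_system_data T"
proof -
  let ?C = "st_cartan T" and ?k = "field_of_definition (sub {i, j})"
  have ij3: "i < 3" "j < 3" "l < 3" using ij by auto
  have two: "n = 0 \<or> n = 1" if "n < length [i, j]" for n using that by (auto simp: less_Suc_eq)
  have ct: "cartan_triangle A z c m \<psi> LL [i, j] ?C ?k"
  proof unfold_locales
    show "[i, j] = [0, 1] \<or> [i, j] = [0, 2] \<or> [i, j] = [1, 2] \<or> [i, j] = [0, 1, 2]" using ij by auto
    show "?k = field_of_definition (sub (set [i, j]))" by simp
    show "length ?C = length [i, j]" by (simp add: T)
    show "length row = length [i, j]" if "row \<in> set ?C" for row using that by (auto simp: T)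
    show "?C ! n ! n = 1 - zeta ([2, 3, c] ! ([i, j] ! n))" if "n < length [i, j]" for n
      unfolding od_def[symmetric] using two[OF that] by (auto simp: T)
    show "?C ! n ! n' * ?C ! n' ! n = trace ((mat 1 - A ([i, j] ! n)) ** (mat 1 - A ([i, j] ! n')))"
      if "n < n'" "n' < length [i, j]" for n n'
    proof -
      have "n = 0" "n' = 1" using that by auto
      then show ?thesis using pq by (simp add: T)
    qed
    show "?C ! 0 ! 2 * ?C ! 2 ! 1 * ?C ! 1 ! 0 = trace ((mat 1 - A 0) ** (mat 1 - A 1) ** (mat 1 - A 2))"
      if "length [i, j] = 3" using that by simp
    note d = diagonal_entry[of _ "{i, j}"] and u = integral_unit_ofD[OF units(1)] integral_unit_ofD[OF units(2)]
    show "?C ! n ! n' \<in> ?k" if "n < length [i, j]" "n' < length [i, j]" for n n'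
      using two[OF that(1)] two[OF that(2)] d(1) ij3 u by (auto simp: T)
    show "algebraic_int (?C ! n ! n')" if "n < length [i, j]" "n' < length [i, j]" for n n'
      using two[OF that(1)] two[OF that(2)] d(2) ij3 u by (auto simp: T)
    show "?C ! n ! n' \<noteq> 0 \<and> algebraic_int (inverse (?C ! n ! n'))"
      if "n < length [i, j]" "n' < length [i, j]" "n \<noteq> n'" for n n'
      using two[OF that(1)] two[OF that(2)] that(3) u by (auto simp: T)
    show "?C ! 0 ! 0 * ?C ! 1 ! 1 - ?C ! 0 ! 1 * ?C ! 1 ! 0 \<noteq> 0" using det by (simp add: T)
  qed
  have prod: "mpow (A i ** A j) (od l) = mat (z ^ od l)" "mpow (A j ** A i) (od l) = mat (z ^ od l)"
    using ij pair_power[OF prod_A] pair_power[OF prod_A_cyclic(1)] pair_power[OF prod_A_cyclic(2)] by auto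
  have "word_product (map A [i, j]) w1 = word_product (map A [i, j]) w2"
    if "(w1, w2) \<in> set (st_braid_relations T)" for w1 w2
  proof -
    have "w1 = concat (replicate (od l) [0, 1])" "w2 = concat (replicate (od l) [1, 0])" using that by (auto simp: T)
    then show ?thesis unfolding list.map using word_product_alternating[of "A i" "A j" "od l"] prod by simp
  qed
  then show ?thesis
    unfolding unique_root_system_data_def
    using cartan_triangle.main_statement[OF ct, of T, folded od_def] T(1,2) by simp
qed

text \<open>All cyclic rotations of the product of the generators equal the same scalar z, which
  gives the braid relations. The fourth product in \<open>pq\<close> is the 3-cycle that the
  pairwise products leave undetermined.\<close>

theorem three_generators:
  assumes T: "st_group T = sub {0, 1, 2}" "st_orders T = [2, 3, c]"
      "st_cartan T = [[2, p_st, p_su], [p_ts, 1 - zeta 3, p_tu], [p_us, p_ut, 1 - zeta c]]"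
      "st_braid_relations T = [([0,1,2], [1,2,0]), ([1,2,0], [2,0,1])]"
    and pq: "p_st * p_ts = trace ((mat 1 - A 0) ** (mat 1 - A 1))"
      "p_su * p_us = trace ((mat 1 - A 0) ** (mat 1 - A 2))"
      "p_tu * p_ut = trace ((mat 1 - A 1) ** (mat 1 - A 2))"
      "p_su * p_ut * p_ts = trace ((mat 1 - A 0) ** (mat 1 - A 1) ** (mat 1 - A 2))"
    and units: "integral_unit_of {0, 1, 2} p_st" "integral_unit_of {0, 1, 2} p_su" "integral_unit_of {0, 1, 2} p_ts"
      "integral_unit_of {0, 1, 2} p_tu" "integral_unit_of {0, 1, 2} p_us" "integral_unit_of {0, 1, 2} p_ut"
    and det: "2 * (1 - zeta 3) \<noteq> p_st * p_ts"
  shows "unique_root_system_data T"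
proof -
  let ?C = "st_cartan T" and ?k = "field_of_definition (sub {0, 1, 2})"
  have three: "n = 0 \<or> n = 1 \<or> n = 2" if "n < length [0, 1, 2 :: nat]" for n using that by (auto simp: less_Suc_eq)
  note T3 = T(3)
  have d0: "2 = 1 - zeta (od 0)" "1 - zeta 3 = 1 - zeta (od 1)" "1 - zeta c = 1 - zeta (od 2)"
    by (simp_all add: od_def zeta_2)
  have C: "?C ! 0 ! 0 = 1 - zeta (od 0)" "?C ! 0 ! 1 = p_st" "?C ! 0 ! 2 = p_su" "?C ! 1 ! 0 = p_ts"
    "?C ! 1 ! 1 = 1 - zeta (od 1)" "?C ! 1 ! 2 = p_tu" "?C ! 2 ! 0 = p_us" "?C ! 2 ! 1 = p_ut" "?C ! 2 ! 2 = 1 - zeta (od 2)"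
    unfolding d0[symmetric] by (simp_all add: T3)
  have ct: "cartan_triangle A z c m \<psi> LL [0, 1, 2] ?C ?k"
  proof unfold_locales
    show "[0, 1, 2 :: nat] = [0, 1] \<or> [0, 1, 2 :: nat] = [0, 2] \<or> [0, 1, 2 :: nat] = [1, 2] \<or> [0, 1, 2 :: nat] = [0, 1, 2]" by simp
    show "?k = field_of_definition (sub (set [0, 1, 2]))" by simp
    show "length ?C = length [0, 1, 2 :: nat]" by (simp add: T)
    show "length row = length [0, 1, 2 :: nat]" if "row \<in> set ?C" for row using that by (auto simp: T)
    show "?C ! n ! n = 1 - zeta ([2, 3, c] ! ([0, 1, 2] ! n))" if "n < length [0, 1, 2 :: nat]" for n
      unfolding od_def[symmetric] using three[OF that] C by (elim disjE) simp_all
    show "?C ! n ! n' * ?C ! n' ! n = trace ((mat 1 - A ([0, 1, 2] ! n)) ** (mat 1 - A ([0, 1, 2] ! n')))"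
      if "n < n'" "n' < length [0, 1, 2 :: nat]" for n n'
    proof -
      have "(n = 0 \<and> n' = 1) \<or> (n = 0 \<and> n' = 2) \<or> (n = 1 \<and> n' = 2)" using that by auto
      then show ?thesis using C pq by (elim disjE) simp_all
    qed
    show "?C ! 0 ! 2 * ?C ! 2 ! 1 * ?C ! 1 ! 0 = trace ((mat 1 - A 0) ** (mat 1 - A 1) ** (mat 1 - A 2))"
      unfolding C by (rule pq)
    have I: "0 \<in> {0, 1, 2 :: nat}" "1 \<in> {0, 1, 2 :: nat}" "2 \<in> {0, 1, 2 :: nat}" "0 < (3::nat)" "1 < (3::nat)" "2 < (3::nat)" by simp_all
    note d = diagonal_entry[OF I(1,4)] diagonal_entry[OF I(2,5)] diagonal_entry[OF I(3,6)]
      and u = integral_unit_ofD[OF units(1)] integral_unit_ofD[OF units(2)] integral_unit_ofD[OF units(3)]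
        integral_unit_ofD[OF units(4)] integral_unit_ofD[OF units(5)] integral_unit_ofD[OF units(6)]
    show "?C ! n ! n' \<in> ?k" if "n < length [0, 1, 2 :: nat]" "n' < length [0, 1, 2 :: nat]" for n n'
      using three[OF that(1)] three[OF that(2)] by (elim disjE; simp only: C d u)
    show "algebraic_int (?C ! n ! n')" if "n < length [0, 1, 2 :: nat]" "n' < length [0, 1, 2 :: nat]" for n n'
      using three[OF that(1)] three[OF that(2)] by (elim disjE; simp only: C d u)
    show "?C ! n ! n' \<noteq> 0 \<and> algebraic_int (inverse (?C ! n ! n'))"
      if "n < length [0, 1, 2 :: nat]" "n' < length [0, 1, 2 :: nat]" "n \<noteq> n'" for n n'
      using three[OF that(1)] three[OF that(2)] that(3) by (elim disjE; simp only: C u simp_thms)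
    show "?C ! 0 ! 0 * ?C ! 1 ! 1 - ?C ! 0 ! 1 * ?C ! 1 ! 0 \<noteq> 0" using det unfolding C d0[symmetric] by simp
  qed
  have "word_product (map A [0, 1, 2]) w1 = word_product (map A [0, 1, 2]) w2"
    if "(w1, w2) \<in> set (st_braid_relations T)" for w1 w2
  proof -
    have w: "word_product (map A [0, 1, 2]) [0,1,2] = mat z" "word_product (map A [0, 1, 2]) [1,2,0] = mat z"
      "word_product (map A [0, 1, 2]) [2,0,1] = mat z"
      using prod_A prod_A_cyclic by (simp_all add: word_product_def matrix_mul_assoc)
    have "(w1 = [0,1,2] \<and> w2 = [1,2,0]) \<or> (w1 = [1,2,0] \<and> w2 = [2,0,1])" using that by (auto simp: T)
    then show ?thesis by (elim disjE conjE; simp only: w)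
  qed
  moreover have "map od [0, 1, 2] = [2, 3, c]" by (simp add: od_def)
  ultimately show ?thesis
    unfolding unique_root_system_data_def
    using cartan_triangle.main_statement[OF ct, of T, folded od_def] T(1,2) by simp
qed

end

section \<open>The eight groups\<close>

lemmas algebraic_int_intros = algebraic_int_add_mult algebraic_int_diff algebraic_int_pow algebraic_int_minus

lemma algebraic_int_numeral_complex: "algebraic_int (numeral n :: complex)" "algebraic_int (1 :: complex)"
  by (auto intro: int_imp_algebraic_int)

lemma algebraic_int_zeta: "n > 0 \<Longrightarrow> algebraic_int (zeta n)"
  using algebraic_int_root_of_unity[OF zeta_pow_self] by blast

lemma csqrt_minus_2: "csqrt (-2) = \<i> * csqrt 2"
proof -
  have c: "csqrt 2 = of_real (sqrt 2)" using csqrt_of_real_nonneg[of 2] by simp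
  obtain s where s: "csqrt 2 = s" by blast
  show ?thesis
    unfolding s
  proof (rule csqrt_unique)
    show "(\<i> * s) ^ 2 = -2" using csqrt_2(3) unfolding s power_mult_distrib by simp
    have "s = of_real (sqrt 2)" using c s by simp
    then show "0 < Re (\<i> * s) \<or> Re (\<i> * s) = 0 \<and> 0 \<le> Im (\<i> * s)" by simp
  qed
qed

lemma csqrt_minus_3: "csqrt (-3) = 1 + 2 * zeta 3"
proof (rule csqrt_unique)
  show "(1 + 2 * zeta 3) ^ 2 = -3" using zeta_3_eq by algebra
  have "zeta 3 = Complex (- 1 / 2) (sqrt 3 / 2)" by (simp add: zeta_cis cis.code cos_120 sin_120)
  then show "0 < Re (1 + 2 * zeta 3) \<or> Re (1 + 2 * zeta 3) = 0 \<and> 0 \<le> Im (1 + 2 * zeta 3)" by simp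
qed

lemma zeta_24_powers: "zeta 8 = zeta 24 ^ 3" "zeta 3 = zeta 24 ^ 8" "\<i> = zeta 24 ^ 6" "- 1 = zeta 24 ^ 12"
  using zeta_eq_pow[of 3 8] zeta_eq_pow[of 8 3] zeta_eq_pow[of 6 4] zeta_eq_pow[of 12 2] by (simp_all add: zeta_2 zeta_4)

lemma zeta_60_powers: "\<i> = zeta 60 ^ 15" "zeta 3 = zeta 60 ^ 20" "zeta 5 = zeta 60 ^ 12" "zeta 20 = zeta 60 ^ 3"
  "zeta 12 = zeta 60 ^ 5" "zeta 15 = zeta 60 ^ 4" "- 1 = zeta 60 ^ 30"
  using zeta_eq_pow[of 15 4] zeta_eq_pow[of 20 3] zeta_eq_pow[of 12 5] zeta_eq_pow[of 3 20] zeta_eq_pow[of 5 12]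
    zeta_eq_pow[of 4 15] zeta_eq_pow[of 30 2] by (simp_all add: zeta_2 zeta_4)

lemma minus_zeta_24: "- (zeta 24 ^ n) = zeta 24 ^ (n + 12)"
  unfolding power_add zeta_24_powers(4)[symmetric] by simp

lemma minus_zeta_60: "- (zeta 60 ^ n) = zeta 60 ^ (n + 30)"
  unfolding power_add zeta_60_powers(7)[symmetric] by simp

lemma zeta_24_eq: "zeta 24 = zeta 3 ^ 2 * zeta 8 ^ 3"
  using zeta_pow_mod[of 24 25] by (simp add: zeta_24_powers flip: power_mult power_add)

lemma oct_scaled:
  "s = x * (\<epsilon> * \<i>) \<Longrightarrow> mat s ** oct_S = mat x ** octA \<epsilon> 0"
  "t = y * - (zeta 3 ^ 2) \<Longrightarrow> mat t ** oct_T = mat y ** octA \<epsilon> 1"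
  by (simp_all add: octA_def matrix_mul_assoc mat_mult_mat)

lemma ico_scaled:
  "s = x * \<i> \<Longrightarrow> mat s ** ico_S = mat x ** icoA 0"
  "t = y * zeta 3 ^ 2 \<Longrightarrow> mat t ** ico_T = mat y ** icoA 1"
  by (simp_all add: icoA_def matrix_mul_assoc mat_mult_mat)

text \<open>With an eighth root v and a cube root w as variables, every identity for the octahedral
  groups becomes a polynomial identity modulo v^4 + 1 and w^2 + w + 1, which can be decided by
  algebra.\<close>

lemma oct_numbers:
  obtains v w where "zeta 8 = v" "zeta 3 = w" "\<i> = v ^ 2" "zeta 24 = w ^ 2 * v ^ 3" "csqrt 2 = v - v ^ 3"
    "csqrt (-3) = 1 + 2 * w" "csqrt (-2) = v + v ^ 3" "v ^ 4 = -1" "w ^ 2 = -1 - w" "algebraic_int v" "algebraic_int w"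
proof -
  have "csqrt (-2) = zeta 8 ^ 2 * (zeta 8 - zeta 8 ^ 3)"
    unfolding csqrt_minus_2 csqrt_2(1) zeta_8_pow(1) ..
  then have "csqrt (-2) = zeta 8 + zeta 8 ^ 3" using zeta_8_pow(2) by algebra
  then show ?thesis
    using that[of "zeta 8" "zeta 3"] zeta_8_pow zeta_24_eq csqrt_2(1) csqrt_minus_3 zeta_3_eq
      algebraic_int_zeta[of 8] algebraic_int_zeta[of 3] by simp
qed

lemma ico_numbers:
  obtains j w e where "\<i> = j" "zeta 3 = w" "zeta 5 = e" "zeta 60 = - j * w ^ 2 * e ^ 3" "golden = 1 + e + e ^ 4"
    "j ^ 2 = -1" "w ^ 2 = -1 - w" "1 + e + e ^ 2 + e ^ 3 + e ^ 4 = 0" "algebraic_int j" "algebraic_int w" "algebraic_int e"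
proof -
  have "golden = 1 + zeta 5 + zeta 5 ^ 4" by (simp add: golden_eq t5_def e5_def)
  then show ?thesis
    using that[of "\<i>" "zeta 3" "zeta 5"] zeta_60 e5_sum zeta_3_eq algebraic_int_zeta[of 4] algebraic_int_zeta[of 3]
      algebraic_int_zeta[of 5] by (simp add: e5_def zeta_4)
qed

lemma oct_triangle_plus: "triangle_group (octA 1) (zeta 24) 4 6 octpsi octL"
  using oct_triangle[of 1] by simp

lemma oct_triangle_minus: "triangle_group (octA (- 1)) (- zeta 24) 4 6 octpsi octL"
  using oct_triangle[of "- 1"] by simp

lemma inverse_zeta: "n > 0 \<Longrightarrow> inverse (zeta n) = zeta n ^ (n - 1)"
  using zeta_pow_self[of n] by (intro inverse_unique) (simp add: power_eq_if)

lemma inverse_zeta_pow: "n > 0 \<Longrightarrow> k \<le> n \<Longrightarrow> inverse (zeta n ^ k) = zeta n ^ (n - k)"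
  by (intro inverse_unique) (simp add: zeta_pow_self flip: power_add)

lemma list_nth_3: "[a, b, c] ! 0 = a" "[a, b, c] ! 1 = b" "[a, b, c] ! 2 = c"
  by simp_all

lemma data_G9: "unique_root_system_data G9"
proof -
  interpret triangle_group "octA 1" "zeta 24" 4 6 octpsi octL "(!) [2, 3, 4]" "generated_group (octA 1 ` {..<3})"
    by (rule oct_triangle_plus) simp_all
  note kD = is_subfieldD[OF subfield_sub[of "{0, 2}"]]
  obtain v w where n: "zeta 8 = v" "zeta 3 = w" "\<i> = v ^ 2" "zeta 24 = w ^ 2 * v ^ 3" "csqrt 2 = v - v ^ 3"
    and h: "v ^ 4 = -1" "w ^ 2 = -1 - w" and a: "algebraic_int v" "algebraic_int w" by (rule oct_numbers)
  have "generated_group {mat (zeta 24 ^ 0) ** octA 1 0, mat (zeta 24 ^ 23) ** octA 1 1} = sub {0, 2}"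
  \<comment> \<open>z = \<open>zeta 24\<close> has exponent p = 1, and \<open>sub {0, 2}\<close>
    contains z^3. The exponents 0 and 23 are those of the scalars by which the two given generators
    differ from the reflections.\<close>
  proof (rule generated_eq_sub_exponents[where p = 1 and s = 3])
    show "\<exists>i j l. (2 * 0 * i + 3 * 23 * j + 4 * (0 + 23 + 1) * l) mod 24 = 0 mod (24::nat)"
      by (intro exI[of _ 0]) simp
  qed (use scalar_in_sub(2) in \<open>auto intro: exI[of _ 0]\<close>)
  moreover have "zeta 24 ^ 23 * - (zeta 3 ^ 2) = zeta 8"
    using zeta_pow_mod[of 24 51] by (simp add: zeta_24_powers minus_zeta_24 flip: power_mult power_add)
  ultimately have G: "st_group G9 = sub {0, 2}"
    using oct_scaled(1)[of "\<i>" 1 1] oct_scaled(2)[of "zeta 8" "zeta 24 ^ 23" 1] by simp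
  define p where "p = - ((2 + csqrt 2) / (\<i> + 1))"
  \<comment> \<open>The listed fraction is an algebraic integer: the denominator 1 + v^2 divides the
    numerator 2 + v - v^3 in the ring generated by v.\<close>
  have "(2 + csqrt 2) = (1 - v ^ 2 - v ^ 3) * (\<i> + 1)" unfolding n using h by algebra
  moreover have "\<i> + 1 \<noteq> 0" by (simp add: complex_eq_iff)
  ultimately have p: "p = - 1 + v ^ 2 + v ^ 3" by (simp add: p_def)
  have "mat (zeta 24 ^ 3) \<in> sub {0, 2}" by (rule scalar_in_sub)
  then have k: "v \<in> field_of_definition (sub {0, 2})"
    using scalar_in_field_of_definition by (simp add: n(1)[symmetric] zeta_24_powers)
  show ?thesis
  proof (rule two_generators[where i = 0 and j = 2 and l = 1 and p = p and q = "-1"])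
    show "st_cartan G9 = [[1 - zeta ([2, 3, 4 :: nat] ! 0), p], [- 1, 1 - zeta ([2, 3, 4 :: nat] ! 2)]]"
      by (simp add: p_def zeta_2 zeta_4)
    show "p * - 1 = trace ((mat 1 - octA 1 0) ** (mat 1 - octA 1 2))"
      unfolding pair_trace zeta_4 n p using h by algebra
    show "integral_unit_of {0, 2} p"
      unfolding integral_unit_of_def
    proof (intro conjI exI)
      show "p \<in> field_of_definition (sub {0, 2})" unfolding p by (intro kD(1,3,4,5,6,9,11) k)
      show "algebraic_int p" unfolding p by (intro algebraic_int_intros a algebraic_int_numeral_complex)
      \<comment> \<open>The inverse of p as a polynomial in v, by v^4 = -1.\<close>
      show "algebraic_int (- 1 + v - v ^ 2)" by (intro algebraic_int_intros a algebraic_int_numeral_complex)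
      show "p * (- 1 + v - v ^ 2) = 1" unfolding p using h by algebra
    qed
    show "integral_unit_of {0, 2} (-1)"
      unfolding integral_unit_of_def by (intro conjI exI[of _ "-1"] kD(1,4) algebraic_int_intros algebraic_int_numeral_complex) simp
    \<comment> \<open>A certificate that the determinant of the Cartan matrix is nonzero: the
      cofactor is its inverse modulo the relation for v. The same device is used for the other
      groups.\<close>
    have "((1 - zeta ([2, 3, 4 :: nat] ! 0)) * (1 - zeta ([2, 3, 4 :: nat] ! 2)) - p * - 1) * (1 + v + v ^ 2) = 1"
      unfolding od_simps zeta_2 zeta_4 n p using h by algebra
    then show "(1 - zeta ([2, 3, 4 :: nat] ! 0)) * (1 - zeta ([2, 3, 4 :: nat] ! 2)) \<noteq> p * - 1" by auto
  qed (use G in \<open>auto simp: eval_nat_numeral\<close>)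
qed

lemma data_G10: "unique_root_system_data G10"
proof -
  interpret triangle_group "octA 1" "zeta 24" 4 6 octpsi octL "(!) [2, 3, 4]" "generated_group (octA 1 ` {..<3})"
    by (rule oct_triangle_plus) simp_all
  let ?k = "field_of_definition (sub {1, 2})"
  note kD = is_subfieldD(1,3-7,9,11)[OF subfield_sub[of "{1, 2}"]]
  obtain v w where n: "zeta 8 = v" "zeta 3 = w" "\<i> = v ^ 2" "zeta 24 = w ^ 2 * v ^ 3" "csqrt 2 = v - v ^ 3"
      "csqrt (-3) = 1 + 2 * w" "csqrt (-2) = v + v ^ 3"
    and h: "v ^ 4 = -1" "w ^ 2 = -1 - w" and a: "algebraic_int v" "algebraic_int w" by (rule oct_numbers)
  have "generated_group {mat (zeta 24 ^ 7) ** octA 1 0, mat (zeta 24 ^ 16) ** octA 1 1} = sub {1, 2}"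
  proof (rule generated_eq_sub_exponents[where p = 1 and s = 2])
    show "\<exists>i j l. (2 * 7 * i + 3 * 16 * j + 4 * (7 + 16 + 1) * l) mod 24 = 16 mod (24::nat)"
      by (rule exI[of _ 8], rule exI[of _ 0], rule exI[of _ 0]) simp
    show "\<exists>i j l. (2 * 7 * i + 3 * 16 * j + 4 * (7 + 16 + 1) * l) mod 24 = (7 + 16 + 1) mod (24::nat)"
      by (rule exI[of _ 0], rule exI[of _ 0], rule exI[of _ 0]) simp
    show "\<exists>n. (if (0::nat) \<in> {1, 2} then 7 else 7 + 1) mod 24 = (1 * 2 * n) mod (24::nat)"
      by (rule exI[of _ 4]) simp
    show "\<exists>n. (if (1::nat) \<in> {1, 2} then 16 else 16 + 1) mod 24 = (1 * 2 * n) mod (24::nat)"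
      by (rule exI[of _ 8]) simp
  qed (use scalar_in_sub(3) in auto)
  moreover have "zeta 8 ^ 7 * zeta 3 ^ 2 = zeta 24 ^ 7 * (1 * \<i>)" "- zeta 3 = zeta 24 ^ 16 * - (zeta 3 ^ 2)"
    by (simp_all add: zeta_24_powers minus_zeta_24 zeta_pow_mod[of 24 37] zeta_pow_mod[of 24 44] flip: power_mult power_add)
  ultimately have G: "st_group G10 = sub {1, 2}"
    unfolding st_group.simps using oct_scaled(1)[of "zeta 8 ^ 7 * zeta 3 ^ 2" "zeta 24 ^ 7" "1"] oct_scaled(2)[of "- zeta 3" "zeta 24 ^ 16" "1"] by simp
  have "mat (zeta 24 ^ 2) \<in> sub {1, 2}" by (rule scalar_in_sub)
  then have "zeta 24 ^ 2 \<in> ?k" by (rule scalar_in_field_of_definition)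
  then have zp: "(zeta 24 ^ 2) ^ n \<in> ?k" for n by (rule kD)
  have zt: "\<i> = (zeta 24 ^ 2) ^ 3" "zeta 3 = (zeta 24 ^ 2) ^ 4"
    by (simp_all add: zeta_24_powers minus_zeta_24 flip: power_mult)
  have k: "\<i> \<in> ?k" "zeta 3 \<in> ?k"
    using zp[of 3, folded zt(1)] zp[of 4, folded zt(2)] by blast+
  have zc: "1 / zeta 4 = - (v ^ 2)" unfolding n(3)[symmetric] zeta_4 by simp
  define q where "q = - \<i> - zeta 3"
  have q: "q = - w - v ^ 2"
    unfolding q_def n by (simp add: algebra_simps)
  show ?thesis
  proof (rule two_generators[where i = 1 and j = 2 and l = 0 and p = "1" and q = "q"])
    show "st_cartan G10 = [[1 - zeta ([2, 3, 4 :: nat] ! 1), 1], [q, 1 - zeta ([2, 3, 4 :: nat] ! 2)]]"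
      by (simp add: q_def zeta_2 zeta_4)
    show "1 * q = trace ((mat 1 - octA 1 1) ** (mat 1 - octA 1 2))"
      unfolding pair_trace zc unfolding zeta_4 q n by (simp add: algebra_simps)
    show "integral_unit_of {1, 2} q"
    proof (rule integral_unit_ofI[where y = "1 + v ^ 2 + v ^ 2 * w"])
      show "q \<in> ?k" unfolding q_def by (intro kD k)
      show "algebraic_int q" unfolding q by (intro algebraic_int_intros a algebraic_int_numeral_complex)
      show "q * (1 + v ^ 2 + v ^ 2 * w) = 1" unfolding q using h by algebra
    qed (intro algebraic_int_intros a algebraic_int_numeral_complex)
    show "integral_unit_of {1, 2} 1" by (rule integral_unit_of_one)
    have "((1 - zeta ([2, 3, 4 :: nat] ! 1)) * (1 - zeta ([2, 3, 4 :: nat] ! 2)) - 1 * q) * (1 + w + v ^ 2) = 1"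
      unfolding list_nth_3 zeta_2 zeta_4 q n using h by algebra
    then show "(1 - zeta ([2, 3, 4 :: nat] ! 1)) * (1 - zeta ([2, 3, 4 :: nat] ! 2)) \<noteq> 1 * q" by auto
  qed (use G in \<open>auto simp: eval_nat_numeral\<close>)
qed

text \<open>The cyclic products of the listed matrix belong to the scalar - \<open>zeta 24\<close>,
  not to \<open>zeta 24\<close>; hence the family with \<epsilon> = -1.\<close>

lemma data_G11: "unique_root_system_data G11"
proof -
  interpret triangle_group "octA (- 1)" "- zeta 24" 4 6 octpsi octL "(!) [2, 3, 4]" "generated_group (octA (- 1) ` {..<3})"
    by (rule oct_triangle_minus) simp_all
  have z: "- zeta 24 = zeta 24 ^ 13" using minus_zeta_24[of 1] by simp
  let ?k = "field_of_definition (sub {0, 1, 2})"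
  note kD = is_subfieldD(1,3-7,9,11)[OF subfield_sub[of "{0, 1, 2}"]]
  obtain v w where n: "zeta 8 = v" "zeta 3 = w" "\<i> = v ^ 2" "zeta 24 = w ^ 2 * v ^ 3" "csqrt 2 = v - v ^ 3"
      "csqrt (-3) = 1 + 2 * w" "csqrt (-2) = v + v ^ 3"
    and h: "v ^ 4 = -1" "w ^ 2 = -1 - w" and a: "algebraic_int v" "algebraic_int w" by (rule oct_numbers)
  have "generated_group {mat (zeta 24 ^ 12) ** octA (- 1) 0, mat (zeta 24 ^ 7) ** octA (- 1) 1} = sub {0, 1, 2}"
  \<comment> \<open>The exponent 13 encodes - \<open>zeta 24\<close>, and the exponent 12 of the
    first generator undoes the sign \<epsilon>.\<close>
  proof (rule generated_eq_sub_exponents[where p = 13 and s = 1])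
    show "\<exists>i j l. (2 * 12 * i + 3 * 7 * j + 4 * (12 + 7 + 13) * l) mod 24 = 12 mod (24::nat)"
      by (rule exI[of _ 0], rule exI[of _ 4], rule exI[of _ 0]) simp
    show "\<exists>i j l. (2 * 12 * i + 3 * 7 * j + 4 * (12 + 7 + 13) * l) mod 24 = 7 mod (24::nat)"
      by (rule exI[of _ 0], rule exI[of _ 3], rule exI[of _ 2]) simp
    show "\<exists>i j l. (2 * 12 * i + 3 * 7 * j + 4 * (12 + 7 + 13) * l) mod 24 = (12 + 7 + 13) mod (24::nat)"
      by (rule exI[of _ 0], rule exI[of _ 0], rule exI[of _ 1]) simp
    show "\<exists>n. (if (0::nat) \<in> {0, 1, 2} then 12 else 12 + 13) mod 24 = (13 * 1 * n) mod (24::nat)"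
      by (rule exI[of _ 12]) simp
    show "\<exists>n. (if (1::nat) \<in> {0, 1, 2} then 7 else 7 + 13) mod 24 = (13 * 1 * n) mod (24::nat)"
      by (rule exI[of _ 19]) simp
  qed (use scalar_in_sub(4) z in auto)
  moreover have "\<i> = zeta 24 ^ 12 * ((- 1) * \<i>)" "zeta 8 * zeta 3 = zeta 24 ^ 7 * - (zeta 3 ^ 2)"
    by (simp_all add: zeta_24_powers minus_zeta_24 zeta_pow_mod[of 24 30] zeta_pow_mod[of 24 35] flip: power_mult power_add)
  ultimately have G: "st_group G11 = sub {0, 1, 2}"
    unfolding st_group.simps using oct_scaled(1)[of "\<i>" "zeta 24 ^ 12" "(- 1)"] oct_scaled(2)[of "zeta 8 * zeta 3" "zeta 24 ^ 7" "(- 1)"] by simp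
  have "mat (- zeta 24) \<in> sub {0, 1, 2}" by (rule scalar_in_sub)
  then have "zeta 24 ^ 13 \<in> ?k" unfolding z by (rule scalar_in_field_of_definition)
  then have zp: "(zeta 24 ^ 13) ^ n \<in> ?k" for n by (rule kD)
  have zt: "zeta 24 = (zeta 24 ^ 13) ^ 13" "zeta 3 = (zeta 24 ^ 13) ^ 8" "zeta 8 = (zeta 24 ^ 13) ^ 15"
    by (simp_all add: zeta_24_powers minus_zeta_24 zeta_pow_mod[of 24 104] zeta_pow_mod[of 24 169] zeta_pow_mod[of 24 195] flip: power_mult)
  have k: "zeta 24 \<in> ?k" "zeta 3 \<in> ?k" "zeta 8 \<in> ?k"
    using zp[of 13, folded zt(1)] zp[of 8, folded zt(2)] zp[of 15, folded zt(3)] by blast+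
  have k3: "csqrt (-3) \<in> ?k" unfolding csqrt_minus_3 by (intro kD k)
  have "csqrt (-2) = zeta 8 + zeta 8 ^ 3" unfolding n ..
  then have k2: "csqrt (-2) \<in> ?k" using kD(4)[OF k(3) kD(7)[OF k(3)]] by simp
  have zc: "1 / zeta 4 = - (v ^ 2)" unfolding n(3)[symmetric] zeta_4 by simp
  have m: "zeta 24 ^ 13 = - (zeta 3 ^ 2 * zeta 8 ^ 3)" "zeta 24 ^ 5 = - (zeta 8 ^ 3 * zeta 3)" "zeta 24 ^ 7 = - (zeta 3 ^ 2 * zeta 8)"
    by (simp_all add: zeta_24_powers minus_zeta_24 zeta_pow_mod[of 24 29] zeta_pow_mod[of 24 31] zeta_pow_mod[of 24 37] flip: power_mult power_add)
  define p_st where "p_st = zeta 3 ^ 2 * (csqrt (-3) - csqrt (-2))"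
  have p_st: "p_st = 1 - w + v + v * w + v ^ 3 + v ^ 3 * w"
    unfolding p_st_def m unfolding n using h by algebra
  define p_su where "p_su = 1 - zeta 24"
  have p_su: "p_su = 1 + v ^ 3 + v ^ 3 * w"
    unfolding p_su_def m unfolding n using h by algebra
  define p_tu where "p_tu = zeta 24 ^ 13"
  have p_tu: "p_tu = v ^ 3 + v ^ 3 * w"
    unfolding p_tu_def m unfolding n using h by algebra
  define p_us where "p_us = 1 + zeta 24 ^ 5"
  have p_us: "p_us = 1 - v ^ 3 * w"
    unfolding p_us_def m unfolding n by (simp add: algebra_simps)
  define p_ut where "p_ut = zeta 24 ^ 7 + zeta 24 ^ 5"
  have p_ut: "p_ut = v + v * w - v ^ 3 * w"
    unfolding p_ut_def m unfolding n using h by algebra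
  show ?thesis
  proof (rule three_generators[where p_st = "p_st" and p_su = "p_su" and p_ts = "1" and p_tu = "p_tu" and p_us = "p_us" and p_ut = "p_ut"])
    show "st_cartan G11 = [[2, p_st, p_su], [1, 1 - zeta 3, p_tu], [p_us, p_ut, 1 - zeta 4]]"
      by (simp add: p_st_def p_su_def p_tu_def p_us_def p_ut_def zeta_4)
    show "p_st * 1 = trace ((mat 1 - octA (- 1) 0) ** (mat 1 - octA (- 1) 1))"
      unfolding pair_trace zc unfolding zeta_4 p_st p_su p_tu p_us p_ut n using h by algebra
    show "p_su * p_us = trace ((mat 1 - octA (- 1) 0) ** (mat 1 - octA (- 1) 2))"
      unfolding pair_trace zc unfolding zeta_4 p_st p_su p_tu p_us p_ut n using h by algebra
    show "p_tu * p_ut = trace ((mat 1 - octA (- 1) 1) ** (mat 1 - octA (- 1) 2))"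
      unfolding pair_trace zc unfolding zeta_4 p_st p_su p_tu p_us p_ut n using h by algebra
    show "p_su * p_ut * 1 = trace ((mat 1 - octA (- 1) 0) ** (mat 1 - octA (- 1) 1) ** (mat 1 - octA (- 1) 2))"
      unfolding pair_trace zc unfolding zeta_4 p_st p_su p_tu p_us p_ut n using h by algebra
    show "integral_unit_of {0, 1, 2} p_st"
    proof (rule integral_unit_ofI[where y = "2 + w - v * w - v ^ 3 * w"])
      show "p_st \<in> ?k" unfolding p_st_def by (intro kD k k3 k2)
      show "algebraic_int p_st" unfolding p_st by (intro algebraic_int_intros a algebraic_int_numeral_complex)
      show "p_st * (2 + w - v * w - v ^ 3 * w) = 1" unfolding p_st using h by algebra
    qed (intro algebraic_int_intros a algebraic_int_numeral_complex)
    show "integral_unit_of {0, 1, 2} p_su"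
    proof (rule integral_unit_ofI[where y = "1 + w + v + v * w + v ^ 2 - v ^ 3 * w"])
      show "p_su \<in> ?k" unfolding p_su_def by (intro kD k k3 k2)
      show "algebraic_int p_su" unfolding p_su by (intro algebraic_int_intros a algebraic_int_numeral_complex)
      show "p_su * (1 + w + v + v * w + v ^ 2 - v ^ 3 * w) = 1" unfolding p_su using h by algebra
    qed (intro algebraic_int_intros a algebraic_int_numeral_complex)
    show "integral_unit_of {0, 1, 2} p_tu"
    proof (rule integral_unit_ofI[where y = "v * w"])
      show "p_tu \<in> ?k" unfolding p_tu_def by (intro kD k k3 k2)
      show "algebraic_int p_tu" unfolding p_tu by (intro algebraic_int_intros a algebraic_int_numeral_complex)
      show "p_tu * (v * w) = 1" unfolding p_tu using h by algebra
    qed (intro algebraic_int_intros a algebraic_int_numeral_complex)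
    show "integral_unit_of {0, 1, 2} p_us"
    proof (rule integral_unit_ofI[where y = "- w - v * w + v ^ 2 + v ^ 3 + v ^ 3 * w"])
      show "p_us \<in> ?k" unfolding p_us_def by (intro kD k k3 k2)
      show "algebraic_int p_us" unfolding p_us by (intro algebraic_int_intros a algebraic_int_numeral_complex)
      show "p_us * (- w - v * w + v ^ 2 + v ^ 3 + v ^ 3 * w) = 1" unfolding p_us using h by algebra
    qed (intro algebraic_int_intros a algebraic_int_numeral_complex)
    show "integral_unit_of {0, 1, 2} p_ut"
    proof (rule integral_unit_ofI[where y = "- v * w + v ^ 3 + v ^ 3 * w"])
      show "p_ut \<in> ?k" unfolding p_ut_def by (intro kD k k3 k2)
      show "algebraic_int p_ut" unfolding p_ut by (intro algebraic_int_intros a algebraic_int_numeral_complex)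
      show "p_ut * (- v * w + v ^ 3 + v ^ 3 * w) = 1" unfolding p_ut using h by algebra
    qed (intro algebraic_int_intros a algebraic_int_numeral_complex)
    show "integral_unit_of {0, 1, 2} 1" by (rule integral_unit_of_one)
    have "(2 * (1 - zeta 3) - p_st * 1) * (2 + w + v * w + v ^ 3 * w) = 1"
      unfolding p_st p_su p_tu p_us p_ut n using h by algebra
    then show "2 * (1 - zeta 3) \<noteq> p_st * 1" by auto
  qed (use G in auto)
qed

lemma data_G14: "unique_root_system_data G14"
proof -
  interpret triangle_group "octA 1" "zeta 24" 4 6 octpsi octL "(!) [2, 3, 4]" "generated_group (octA 1 ` {..<3})"
    by (rule oct_triangle_plus) simp_all
  let ?k = "field_of_definition (sub {0, 1})"
  note kD = is_subfieldD(1,3-7,9,11)[OF subfield_sub[of "{0, 1}"]]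
  obtain v w where n: "zeta 8 = v" "zeta 3 = w" "\<i> = v ^ 2" "zeta 24 = w ^ 2 * v ^ 3" "csqrt 2 = v - v ^ 3"
      "csqrt (-3) = 1 + 2 * w" "csqrt (-2) = v + v ^ 3"
    and h: "v ^ 4 = -1" "w ^ 2 = -1 - w" and a: "algebraic_int v" "algebraic_int w" by (rule oct_numbers)
  have "generated_group {mat (zeta 24 ^ 0) ** octA 1 0, mat (zeta 24 ^ 16) ** octA 1 1} = sub {0, 1}"
  proof (rule generated_eq_sub_exponents[where p = 1 and s = 4])
    show "\<exists>i j l. (2 * 0 * i + 3 * 16 * j + 4 * (0 + 16 + 1) * l) mod 24 = 0 mod (24::nat)"
      by (rule exI[of _ 0], rule exI[of _ 0], rule exI[of _ 0]) simp
    show "\<exists>i j l. (2 * 0 * i + 3 * 16 * j + 4 * (0 + 16 + 1) * l) mod 24 = 16 mod (24::nat)"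
      by (rule exI[of _ 0], rule exI[of _ 0], rule exI[of _ 2]) simp
    show "\<exists>n. (if (0::nat) \<in> {0, 1} then 0 else 0 + 1) mod 24 = (1 * 4 * n) mod (24::nat)"
      by (rule exI[of _ 0]) simp
    show "\<exists>n. (if (1::nat) \<in> {0, 1} then 16 else 16 + 1) mod 24 = (1 * 4 * n) mod (24::nat)"
      by (rule exI[of _ 4]) simp
  qed (use scalar_in_sub(1) in auto)
  moreover have "\<i> = zeta 24 ^ 0 * (1 * \<i>)" "- zeta 3 = zeta 24 ^ 16 * - (zeta 3 ^ 2)"
    by (simp_all add: zeta_24_powers minus_zeta_24 zeta_pow_mod[of 24 44] flip: power_mult power_add)
  ultimately have G: "st_group G14 = sub {0, 1}"
    unfolding st_group.simps using oct_scaled(1)[of "\<i>" "zeta 24 ^ 0" "1"] oct_scaled(2)[of "- zeta 3" "zeta 24 ^ 16" "1"] by simp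
  have "mat (zeta 24 ^ 4) \<in> sub {0, 1}" by (rule scalar_in_sub)
  then have "zeta 24 ^ 4 \<in> ?k" by (rule scalar_in_field_of_definition)
  then have zp: "(zeta 24 ^ 4) ^ n \<in> ?k" for n by (rule kD)
  have zt: "zeta 3 = (zeta 24 ^ 4) ^ 2"
    by (simp_all add: zeta_24_powers minus_zeta_24 flip: power_mult)
  have k: "zeta 3 \<in> ?k"
    using zp[of 2, folded zt] by blast+
  have k3: "csqrt (-3) \<in> ?k" unfolding csqrt_minus_3 by (intro kD k)
  \<comment> \<open>The scalar \<open>zeta 24 ^ 4\<close> yields \<open>zeta 3\<close> but not the
    square root of -2; the trace of the product of the two generators supplies it.\<close>
  have "octA 1 0 ** octA 1 1 \<in> sub {0, 1}"
    unfolding sub_def by (intro generated_group.mult generated_group.incl) auto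
  then have tr: "trace (octA 1 0 ** octA 1 1) \<in> ?k" by (rule field_of_definition_trace)
  have zc: "1 / zeta 4 = - (v ^ 2)" unfolding n(3)[symmetric] zeta_4 by simp
  have "csqrt (-2) = zeta 3 * trace (octA 1 0 ** octA 1 1)"
    unfolding trace_pairs zc unfolding n using h by algebra
  then have k2: "csqrt (-2) \<in> ?k" using kD(5)[OF k(1) tr] by simp
  define q where "q = - (zeta 3 ^ 2) * (csqrt (-3) + csqrt (-2))"
  have q: "q = - 1 + w + v + v * w + v ^ 3 + v ^ 3 * w"
    unfolding q_def n using h by algebra
  show ?thesis
  proof (rule two_generators[where i = 0 and j = 1 and l = 2 and p = "-1" and q = "q"])
    show "st_cartan G14 = [[1 - zeta ([2, 3, 4 :: nat] ! 0), -1], [q, 1 - zeta ([2, 3, 4 :: nat] ! 1)]]"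
      by (simp add: q_def zeta_2 zeta_4)
    show "-1 * q = trace ((mat 1 - octA 1 0) ** (mat 1 - octA 1 1))"
      unfolding pair_trace zc unfolding zeta_4 q n using h by algebra
    show "integral_unit_of {0, 1} q"
    proof (rule integral_unit_ofI[where y = "- 2 - w - v * w - v ^ 3 * w"])
      show "q \<in> ?k" unfolding q_def by (intro kD k k3 k2)
      show "algebraic_int q" unfolding q by (intro algebraic_int_intros a algebraic_int_numeral_complex)
      show "q * (- 2 - w - v * w - v ^ 3 * w) = 1" unfolding q using h by algebra
    qed (intro algebraic_int_intros a algebraic_int_numeral_complex)
    show "integral_unit_of {0, 1} (- 1)" by (rule integral_unit_of_one)
    have "((1 - zeta ([2, 3, 4 :: nat] ! 0)) * (1 - zeta ([2, 3, 4 :: nat] ! 1)) - -1 * q) * (2 + w - v * w - v ^ 3 * w) = 1"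
      unfolding list_nth_3 zeta_2 zeta_4 q n using h by algebra
    then show "(1 - zeta ([2, 3, 4 :: nat] ! 0)) * (1 - zeta ([2, 3, 4 :: nat] ! 1)) \<noteq> -1 * q" by auto
  qed (use G in \<open>auto simp: eval_nat_numeral\<close>)
qed

lemma data_G17: "unique_root_system_data G17"
proof -
  interpret triangle_group icoA "zeta 60" 5 12 icopsi icoL "(!) [2, 3, 5]" "generated_group (icoA ` {..<3})"
    by (rule ico_triangle) simp_all
  let ?k = "field_of_definition (sub {0, 2})"
  note kD = is_subfieldD(1,3-7,9,11)[OF subfield_sub[of "{0, 2}"]]
  obtain j w e where n: "\<i> = j" "zeta 3 = w" "zeta 5 = e" "zeta 60 = - j * w ^ 2 * e ^ 3" "golden = 1 + e + e ^ 4"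
    and h: "j ^ 2 = -1" "w ^ 2 = -1 - w" "1 + e + e ^ 2 + e ^ 3 + e ^ 4 = 0"
    and a: "algebraic_int j" "algebraic_int w" "algebraic_int e" by (rule ico_numbers)
  have "generated_group {mat (zeta 60 ^ 0) ** icoA 0, mat (zeta 60 ^ 11) ** icoA 1} = sub {0, 2}"
  proof (rule generated_eq_sub_exponents[where p = 1 and s = 3])
    show "\<exists>i j l. (2 * 0 * i + 3 * 11 * j + 5 * (0 + 11 + 1) * l) mod 60 = 0 mod (60::nat)"
      by (rule exI[of _ 0], rule exI[of _ 0], rule exI[of _ 0]) simp
    show "\<exists>i j l. (2 * 0 * i + 3 * 11 * j + 5 * (0 + 11 + 1) * l) mod 60 = (0 + 11 + 1) mod (60::nat)"
      by (rule exI[of _ 0], rule exI[of _ 4], rule exI[of _ 0]) simp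
    show "\<exists>n. (if (0::nat) \<in> {0, 2} then 0 else 0 + 1) mod 60 = (1 * 3 * n) mod (60::nat)"
      by (rule exI[of _ 0]) simp
    show "\<exists>n. (if (1::nat) \<in> {0, 2} then 11 else 11 + 1) mod 60 = (1 * 3 * n) mod (60::nat)"
      by (rule exI[of _ 4]) simp
  qed (use scalar_in_sub(2) in auto)
  moreover have "\<i> = zeta 60 ^ 0 * \<i>" "\<i> * zeta 5 ^ 3 = zeta 60 ^ 11 * zeta 3 ^ 2"
    by (simp_all add: zeta_60_powers minus_zeta_60 flip: power_mult power_add)
  ultimately have G: "st_group G17 = sub {0, 2}"
    unfolding st_group.simps using ico_scaled(1)[of "\<i>" "zeta 60 ^ 0"] ico_scaled(2)[of "\<i> * zeta 5 ^ 3" "zeta 60 ^ 11"] by simp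
  have "mat (zeta 60 ^ 3) \<in> sub {0, 2}" by (rule scalar_in_sub)
  then have "zeta 60 ^ 3 \<in> ?k" by (rule scalar_in_field_of_definition)
  then have zp: "(zeta 60 ^ 3) ^ n \<in> ?k" for n by (rule kD)
  have zt: "zeta 20 = (zeta 60 ^ 3) ^ 1" "zeta 5 = (zeta 60 ^ 3) ^ 4"
    by (simp_all add: zeta_60_powers minus_zeta_60 flip: power_mult)
  have k: "zeta 20 \<in> ?k" "zeta 5 \<in> ?k"
    using zp[of 1, folded zt(1)] zp[of 4, folded zt(2)] by blast+
  have zc: "1 / zeta 5 = e ^ 4" using inverse_zeta[of 5] by (simp add: n divide_inverse)
  have m: "zeta 20 ^ 7 = - (\<i> * zeta 5 ^ 3)"
    by (simp_all add: zeta_60_powers minus_zeta_60 zeta_pow_mod[of 60 81] flip: power_mult power_add)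
  define q where "q = 1 - zeta 5 - zeta 20 ^ 7"
  have q: "q = 1 - e + j * e ^ 3"
    unfolding q_def m unfolding n by (simp add: algebra_simps)
  show ?thesis
  proof (rule two_generators[where i = 0 and j = 2 and l = 1 and p = "1" and q = "q"])
    show "st_cartan G17 = [[1 - zeta ([2, 3, 5 :: nat] ! 0), 1], [q, 1 - zeta ([2, 3, 5 :: nat] ! 2)]]"
      by (simp add: q_def zeta_2)
    show "1 * q = trace ((mat 1 - icoA 0) ** (mat 1 - icoA 2))"
      unfolding pair_trace zc unfolding q n using h by algebra
    show "integral_unit_of {0, 2} q"
    proof (rule integral_unit_ofI[where y = "2 + 2 * e + e ^ 2 + j * e + 2 * j * e ^ 2 + j * e ^ 3"])
      show "q \<in> ?k" unfolding q_def by (intro kD k)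
      show "algebraic_int q" unfolding q by (intro algebraic_int_intros a algebraic_int_numeral_complex)
      show "q * (2 + 2 * e + e ^ 2 + j * e + 2 * j * e ^ 2 + j * e ^ 3) = 1" unfolding q using h by algebra
    qed (intro algebraic_int_intros a algebraic_int_numeral_complex)
    show "integral_unit_of {0, 2} 1" by (rule integral_unit_of_one)
    have "((1 - zeta ([2, 3, 5 :: nat] ! 0)) * (1 - zeta ([2, 3, 5 :: nat] ! 2)) - 1 * q) * (2 + 2 * e + e ^ 2 - j * e - 2 * j * e ^ 2 - j * e ^ 3) = 1"
      unfolding list_nth_3 zeta_2 q n using h by algebra
    then show "(1 - zeta ([2, 3, 5 :: nat] ! 0)) * (1 - zeta ([2, 3, 5 :: nat] ! 2)) \<noteq> 1 * q" by auto
  qed (use G in \<open>auto simp: eval_nat_numeral\<close>)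
qed

lemma data_G18: "unique_root_system_data G18"
proof -
  interpret triangle_group icoA "zeta 60" 5 12 icopsi icoL "(!) [2, 3, 5]" "generated_group (icoA ` {..<3})"
    by (rule ico_triangle) simp_all
  let ?k = "field_of_definition (sub {1, 2})"
  note kD = is_subfieldD(1,3-7,9,11)[OF subfield_sub[of "{1, 2}"]]
  obtain j w e where n: "\<i> = j" "zeta 3 = w" "zeta 5 = e" "zeta 60 = - j * w ^ 2 * e ^ 3" "golden = 1 + e + e ^ 4"
    and h: "j ^ 2 = -1" "w ^ 2 = -1 - w" "1 + e + e ^ 2 + e ^ 3 + e ^ 4 = 0"
    and a: "algebraic_int j" "algebraic_int w" "algebraic_int e" by (rule ico_numbers)
  have "generated_group {mat (zeta 60 ^ 11) ** icoA 0, mat (zeta 60 ^ 0) ** icoA 1} = sub {1, 2}"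
  proof (rule generated_eq_sub_exponents[where p = 1 and s = 2])
    show "\<exists>i j l. (2 * 11 * i + 3 * 0 * j + 5 * (11 + 0 + 1) * l) mod 60 = 0 mod (60::nat)"
      by (rule exI[of _ 0], rule exI[of _ 0], rule exI[of _ 0]) simp
    show "\<exists>i j l. (2 * 11 * i + 3 * 0 * j + 5 * (11 + 0 + 1) * l) mod 60 = (11 + 0 + 1) mod (60::nat)"
      by (rule exI[of _ 6], rule exI[of _ 0], rule exI[of _ 0]) simp
    show "\<exists>n. (if (0::nat) \<in> {1, 2} then 11 else 11 + 1) mod 60 = (1 * 2 * n) mod (60::nat)"
      by (rule exI[of _ 6]) simp
    show "\<exists>n. (if (1::nat) \<in> {1, 2} then 0 else 0 + 1) mod 60 = (1 * 2 * n) mod (60::nat)"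
      by (rule exI[of _ 0]) simp
  qed (use scalar_in_sub(3) in auto)
  moreover have "- (zeta 3 * zeta 5 ^ 3) = zeta 60 ^ 11 * \<i>" "zeta 3 ^ 2 = zeta 60 ^ 0 * zeta 3 ^ 2"
    by (simp_all add: zeta_60_powers minus_zeta_60 zeta_pow_mod[of 60 86] flip: power_mult power_add)
  ultimately have G: "st_group G18 = sub {1, 2}"
    unfolding st_group.simps using ico_scaled(1)[of "- (zeta 3 * zeta 5 ^ 3)" "zeta 60 ^ 11"] ico_scaled(2)[of "zeta 3 ^ 2" "zeta 60 ^ 0"] by simp
  have "mat (zeta 60 ^ 2) \<in> sub {1, 2}" by (rule scalar_in_sub)
  then have "zeta 60 ^ 2 \<in> ?k" by (rule scalar_in_field_of_definition)
  then have zp: "(zeta 60 ^ 2) ^ n \<in> ?k" for n by (rule kD)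
  have zt: "zeta 15 = (zeta 60 ^ 2) ^ 2"
    by (simp_all add: zeta_60_powers minus_zeta_60 flip: power_mult)
  have k: "zeta 15 \<in> ?k"
    using zp[of 2, folded zt] by blast+
  have zc: "1 / zeta 5 = e ^ 4" using inverse_zeta[of 5] by (simp add: n divide_inverse)
  have m: "inverse (zeta 15) = zeta 3 * zeta 5 ^ 3" "zeta 15 ^ 4 = zeta 3 ^ 2 * zeta 5 ^ 3" "zeta 15 = zeta 3 ^ 2 * zeta 5 ^ 2"
    by (simp_all add: inverse_zeta inverse_zeta_pow zeta_60_powers minus_zeta_60 zeta_pow_mod[of 60 64] zeta_pow_mod[of 60 76] flip: power_mult power_add)
  define p where "p = - (zeta 15 ^ 4)"
  have p: "p = e ^ 3 + w * e ^ 3"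
    unfolding p_def m(1,2) unfolding m unfolding n using h by algebra
  define q where "q = inverse (zeta 15) + zeta 15"
  have q: "q = - (e ^ 2) - w * e ^ 2 + w * e ^ 3"
    unfolding q_def m(1,2) unfolding m unfolding n using h by algebra
  show ?thesis
  proof (rule two_generators[where i = 1 and j = 2 and l = 0 and p = "p" and q = "q"])
    show "st_cartan G18 = [[1 - zeta ([2, 3, 5 :: nat] ! 1), p], [q, 1 - zeta ([2, 3, 5 :: nat] ! 2)]]"
      by (simp add: p_def q_def zeta_2)
    show "p * q = trace ((mat 1 - icoA 1) ** (mat 1 - icoA 2))"
      unfolding pair_trace zc unfolding p q n using h by algebra
    show "integral_unit_of {1, 2} p"
    proof (rule integral_unit_ofI[where y = "- w * e ^ 2"])
      show "p \<in> ?k" unfolding p_def by (intro kD k)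
      show "algebraic_int p" unfolding p by (intro algebraic_int_intros a algebraic_int_numeral_complex)
      show "p * (- w * e ^ 2) = 1" unfolding p using h by algebra
    qed (intro algebraic_int_intros a algebraic_int_numeral_complex)
    show "integral_unit_of {1, 2} q"
    proof (rule integral_unit_ofI[where y = "- 1 - e + e ^ 3 - w - 2 * w * e - 2 * w * e ^ 2"])
      show "q \<in> ?k" unfolding q_def by (intro kD k)
      show "algebraic_int q" unfolding q by (intro algebraic_int_intros a algebraic_int_numeral_complex)
      show "q * (- 1 - e + e ^ 3 - w - 2 * w * e - 2 * w * e ^ 2) = 1" unfolding q using h by algebra
    qed (intro algebraic_int_intros a algebraic_int_numeral_complex)
    have "((1 - zeta ([2, 3, 5 :: nat] ! 1)) * (1 - zeta ([2, 3, 5 :: nat] ! 2)) - p * q) * (2 + 2 * e + e ^ 2 + w - w * e ^ 2 - w * e ^ 3) = 1"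
      unfolding list_nth_3 zeta_2 p q n using h by algebra
    then show "(1 - zeta ([2, 3, 5 :: nat] ! 1)) * (1 - zeta ([2, 3, 5 :: nat] ! 2)) \<noteq> p * q" by auto
  qed (use G in \<open>auto simp: eval_nat_numeral\<close>)
qed

lemma data_G19: "unique_root_system_data G19"
proof -
  interpret triangle_group icoA "zeta 60" 5 12 icopsi icoL "(!) [2, 3, 5]" "generated_group (icoA ` {..<3})"
    by (rule ico_triangle) simp_all
  let ?k = "field_of_definition (sub {0, 1, 2})"
  note kD = is_subfieldD(1,3-7,9,11)[OF subfield_sub[of "{0, 1, 2}"]]
  obtain j w e where n: "\<i> = j" "zeta 3 = w" "zeta 5 = e" "zeta 60 = - j * w ^ 2 * e ^ 3" "golden = 1 + e + e ^ 4"
    and h: "j ^ 2 = -1" "w ^ 2 = -1 - w" "1 + e + e ^ 2 + e ^ 3 + e ^ 4 = 0"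
    and a: "algebraic_int j" "algebraic_int w" "algebraic_int e" by (rule ico_numbers)
  have "generated_group {mat (zeta 60 ^ 0) ** icoA 0, mat (zeta 60 ^ 31) ** icoA 1} = sub {0, 1, 2}"
  proof (rule generated_eq_sub_exponents[where p = 1 and s = 1])
    show "\<exists>i j l. (2 * 0 * i + 3 * 31 * j + 5 * (0 + 31 + 1) * l) mod 60 = 0 mod (60::nat)"
      by (rule exI[of _ 0], rule exI[of _ 0], rule exI[of _ 0]) simp
    show "\<exists>i j l. (2 * 0 * i + 3 * 31 * j + 5 * (0 + 31 + 1) * l) mod 60 = 31 mod (60::nat)"
      by (rule exI[of _ 0], rule exI[of _ 7], rule exI[of _ 1]) simp
    show "\<exists>i j l. (2 * 0 * i + 3 * 31 * j + 5 * (0 + 31 + 1) * l) mod 60 = (0 + 31 + 1) mod (60::nat)"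
      by (rule exI[of _ 0], rule exI[of _ 4], rule exI[of _ 2]) simp
    show "\<exists>n. (if (0::nat) \<in> {0, 1, 2} then 0 else 0 + 1) mod 60 = (1 * 1 * n) mod (60::nat)"
      by (rule exI[of _ 0]) simp
    show "\<exists>n. (if (1::nat) \<in> {0, 1, 2} then 31 else 31 + 1) mod 60 = (1 * 1 * n) mod (60::nat)"
      by (rule exI[of _ 31]) simp
  qed (use scalar_in_sub(4) in auto)
  moreover have "\<i> = zeta 60 ^ 0 * \<i>" "\<i> * zeta 3 * zeta 5 ^ 3 = zeta 60 ^ 31 * zeta 3 ^ 2"
    by (simp_all add: zeta_60_powers minus_zeta_60 zeta_pow_mod[of 60 71] flip: power_mult power_add)
  ultimately have G: "st_group G19 = sub {0, 1, 2}"
    unfolding st_group.simps using ico_scaled(1)[of "\<i>" "zeta 60 ^ 0"] ico_scaled(2)[of "\<i> * zeta 3 * zeta 5 ^ 3" "zeta 60 ^ 31"] by simp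
  have "mat (zeta 60) \<in> sub {0, 1, 2}" by (rule scalar_in_sub)
  then have "zeta 60 \<in> ?k" by (rule scalar_in_field_of_definition)
  then have zp: "(zeta 60) ^ n \<in> ?k" for n by (rule kD)
  have zt: "zeta 60 = (zeta 60) ^ 1" "zeta 3 = (zeta 60) ^ 20" "zeta 5 = (zeta 60) ^ 12" "zeta 20 = (zeta 60) ^ 3"
    by (simp_all add: zeta_60_powers minus_zeta_60 flip: power_mult)
  have k: "zeta 60 \<in> ?k" "zeta 3 \<in> ?k" "zeta 5 \<in> ?k" "zeta 20 \<in> ?k"
    using zp[of 1, folded zt(1)] zp[of 20, folded zt(2)] zp[of 12, folded zt(3)] zp[of 3, folded zt(4)] by blast+
  have zc: "1 / zeta 5 = e ^ 4" using inverse_zeta[of 5] by (simp add: n divide_inverse)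
  have m: "inverse (zeta 60) = \<i> * zeta 3 * zeta 5 ^ 2" "zeta 20 ^ 7 = - (\<i> * zeta 5 ^ 3)" "zeta 60 ^ 19 = \<i> * zeta 3 ^ 2 * zeta 5 ^ 2" "zeta 60 ^ 11 = \<i> * zeta 3 * zeta 5 ^ 3"
    by (simp_all add: inverse_zeta inverse_zeta_pow zeta_60_powers minus_zeta_60 zeta_pow_mod[of 60 71] zeta_pow_mod[of 60 79] zeta_pow_mod[of 60 81] flip: power_mult power_add)
  define p_st where "p_st = 1 - zeta 3 * inverse (zeta 60)"
  have p_st: "p_st = 1 + j * e ^ 2 + j * w * e ^ 2"
    unfolding p_st_def m unfolding n using h by algebra
  define p_ts where "p_ts = 1 + zeta 60"
  have p_ts: "p_ts = 1 + j * e ^ 3 + j * w * e ^ 3"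
    unfolding p_ts_def m unfolding n using h by algebra
  define p_tu where "p_tu = - zeta 60"
  have p_tu: "p_tu = - j * e ^ 3 - j * w * e ^ 3"
    unfolding p_tu_def m unfolding n using h by algebra
  define p_us where "p_us = zeta 5 - 1 + zeta 20 ^ 7"
  have p_us: "p_us = - 1 + e - j * e ^ 3"
    unfolding p_us_def m unfolding n by (simp add: algebra_simps)
  define p_ut where "p_ut = zeta 60 ^ 19 + zeta 60 ^ 11"
  have p_ut: "p_ut = - j * e ^ 2 - j * w * e ^ 2 + j * w * e ^ 3"
    unfolding p_ut_def m unfolding n using h by algebra
  show ?thesis
  proof (rule three_generators[where p_st = "p_st" and p_su = "-1" and p_ts = "p_ts" and p_tu = "p_tu" and p_us = "p_us" and p_ut = "p_ut"])
    show "st_cartan G19 = [[2, p_st, -1], [p_ts, 1 - zeta 3, p_tu], [p_us, p_ut, 1 - zeta 5]]"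
      by (simp add: p_st_def p_ts_def p_tu_def p_us_def p_ut_def)
    show "p_st * p_ts = trace ((mat 1 - icoA 0) ** (mat 1 - icoA 1))"
      unfolding pair_trace zc unfolding p_st p_ts p_tu p_us p_ut n using h by algebra
    show "-1 * p_us = trace ((mat 1 - icoA 0) ** (mat 1 - icoA 2))"
      unfolding pair_trace zc unfolding p_st p_ts p_tu p_us p_ut n using h by algebra
    show "p_tu * p_ut = trace ((mat 1 - icoA 1) ** (mat 1 - icoA 2))"
      unfolding pair_trace zc unfolding p_st p_ts p_tu p_us p_ut n using h by algebra
    show "-1 * p_ut * p_ts = trace ((mat 1 - icoA 0) ** (mat 1 - icoA 1) ** (mat 1 - icoA 2))"
      unfolding pair_trace zc unfolding p_st p_ts p_tu p_us p_ut n using h by algebra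
    show "integral_unit_of {0, 1, 2} p_st"
    \<comment> \<open>The inverse of the entry, written in products of powers of j, w and e; the
      identity shown below certifies it.\<close>
    proof (rule integral_unit_ofI[where y = "- 2 * e - 2 * e ^ 2 - e ^ 3 + w - w * e ^ 2 - w * e ^ 3 - j - j * e + j * e ^ 3 - j * w - 2 * j * w * e - 2 * j * w * e ^ 2"])
      show "p_st \<in> ?k" unfolding p_st_def by (intro kD k)
      show "algebraic_int p_st" unfolding p_st by (intro algebraic_int_intros a algebraic_int_numeral_complex)
      show "p_st * (- 2 * e - 2 * e ^ 2 - e ^ 3 + w - w * e ^ 2 - w * e ^ 3 - j - j * e + j * e ^ 3 - j * w - 2 * j * w * e - 2 * j * w * e ^ 2) = 1" unfolding p_st using h by algebra
    qed (intro algebraic_int_intros a algebraic_int_numeral_complex)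
    show "integral_unit_of {0, 1, 2} p_ts"
    proof (rule integral_unit_ofI[where y = "2 + 2 * e + e ^ 2 + w - w * e ^ 2 - w * e ^ 3 + j * e + 2 * j * e ^ 2 + j * e ^ 3 + j * w + 2 * j * w * e + 2 * j * w * e ^ 2"])
      show "p_ts \<in> ?k" unfolding p_ts_def by (intro kD k)
      show "algebraic_int p_ts" unfolding p_ts by (intro algebraic_int_intros a algebraic_int_numeral_complex)
      show "p_ts * (2 + 2 * e + e ^ 2 + w - w * e ^ 2 - w * e ^ 3 + j * e + 2 * j * e ^ 2 + j * e ^ 3 + j * w + 2 * j * w * e + 2 * j * w * e ^ 2) = 1" unfolding p_ts using h by algebra
    qed (intro algebraic_int_intros a algebraic_int_numeral_complex)
    show "integral_unit_of {0, 1, 2} p_tu"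
    proof (rule integral_unit_ofI[where y = "- j * w * e ^ 2"])
      show "p_tu \<in> ?k" unfolding p_tu_def by (intro kD k)
      show "algebraic_int p_tu" unfolding p_tu by (intro algebraic_int_intros a algebraic_int_numeral_complex)
      show "p_tu * (- j * w * e ^ 2) = 1" unfolding p_tu using h by algebra
    qed (intro algebraic_int_intros a algebraic_int_numeral_complex)
    show "integral_unit_of {0, 1, 2} p_us"
    proof (rule integral_unit_ofI[where y = "- 2 - 2 * e - e ^ 2 - j * e - 2 * j * e ^ 2 - j * e ^ 3"])
      show "p_us \<in> ?k" unfolding p_us_def by (intro kD k)
      show "algebraic_int p_us" unfolding p_us by (intro algebraic_int_intros a algebraic_int_numeral_complex)
      show "p_us * (- 2 - 2 * e - e ^ 2 - j * e - 2 * j * e ^ 2 - j * e ^ 3) = 1" unfolding p_us using h by algebra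
    qed (intro algebraic_int_intros a algebraic_int_numeral_complex)
    show "integral_unit_of {0, 1, 2} p_ut"
    proof (rule integral_unit_ofI[where y = "j + j * e - j * e ^ 3 + j * w + 2 * j * w * e + 2 * j * w * e ^ 2"])
      show "p_ut \<in> ?k" unfolding p_ut_def by (intro kD k)
      show "algebraic_int p_ut" unfolding p_ut by (intro algebraic_int_intros a algebraic_int_numeral_complex)
      show "p_ut * (j + j * e - j * e ^ 3 + j * w + 2 * j * w * e + 2 * j * w * e ^ 2) = 1" unfolding p_ut using h by algebra
    qed (intro algebraic_int_intros a algebraic_int_numeral_complex)
    show "integral_unit_of {0, 1, 2} (- 1)" by (rule integral_unit_of_one)
    have "(2 * (1 - zeta 3) - p_st * p_ts) * (2 - 2 * e ^ 2 - 2 * e ^ 3 + w - w * e ^ 2 - w * e ^ 3 - j * w + 2 * j * w * e ^ 2 + 2 * j * w * e ^ 3) = 1"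
      unfolding p_st p_ts p_tu p_us p_ut n using h by algebra
    then show "2 * (1 - zeta 3) \<noteq> p_st * p_ts" by auto
  qed (use G in auto)
qed

lemma data_G21: "unique_root_system_data G21"
proof -
  interpret triangle_group icoA "zeta 60" 5 12 icopsi icoL "(!) [2, 3, 5]" "generated_group (icoA ` {..<3})"
    by (rule ico_triangle) simp_all
  let ?k = "field_of_definition (sub {0, 1})"
  note kD = is_subfieldD(1,3-7,9,11)[OF subfield_sub[of "{0, 1}"]]
  obtain j w e where n: "\<i> = j" "zeta 3 = w" "zeta 5 = e" "zeta 60 = - j * w ^ 2 * e ^ 3" "golden = 1 + e + e ^ 4"
    and h: "j ^ 2 = -1" "w ^ 2 = -1 - w" "1 + e + e ^ 2 + e ^ 3 + e ^ 4 = 0"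
    and a: "algebraic_int j" "algebraic_int w" "algebraic_int e" by (rule ico_numbers)
  have "generated_group {mat (zeta 60 ^ 0) ** icoA 0, mat (zeta 60 ^ 0) ** icoA 1} = sub {0, 1}"
  proof (rule generated_eq_sub_exponents[where p = 1 and s = 5])
    show "\<exists>i j l. (2 * 0 * i + 3 * 0 * j + 5 * (0 + 0 + 1) * l) mod 60 = 0 mod (60::nat)"
      by (rule exI[of _ 0], rule exI[of _ 0], rule exI[of _ 0]) simp
    show "\<exists>i j l. (2 * 0 * i + 3 * 0 * j + 5 * (0 + 0 + 1) * l) mod 60 = 0 mod (60::nat)"
      by (rule exI[of _ 0], rule exI[of _ 0], rule exI[of _ 0]) simp
    show "\<exists>n. (if (0::nat) \<in> {0, 1} then 0 else 0 + 1) mod 60 = (1 * 5 * n) mod (60::nat)"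
      by (rule exI[of _ 0]) simp
    show "\<exists>n. (if (1::nat) \<in> {0, 1} then 0 else 0 + 1) mod 60 = (1 * 5 * n) mod (60::nat)"
      by (rule exI[of _ 0]) simp
  qed (use scalar_in_sub(1) in auto)
  moreover have "\<i> = zeta 60 ^ 0 * \<i>" "zeta 3 ^ 2 = zeta 60 ^ 0 * zeta 3 ^ 2"
    by (simp_all add: zeta_60_powers minus_zeta_60 flip: power_mult power_add)
  ultimately have G: "st_group G21 = sub {0, 1}"
    unfolding st_group.simps using ico_scaled(1)[of "\<i>" "zeta 60 ^ 0"] ico_scaled(2)[of "zeta 3 ^ 2" "zeta 60 ^ 0"] by simp
  have "mat (zeta 60 ^ 5) \<in> sub {0, 1}" by (rule scalar_in_sub)
  then have "zeta 60 ^ 5 \<in> ?k" by (rule scalar_in_field_of_definition)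
  then have zp: "(zeta 60 ^ 5) ^ n \<in> ?k" for n by (rule kD)
  have zt: "zeta 12 = (zeta 60 ^ 5) ^ 1" "zeta 3 = (zeta 60 ^ 5) ^ 4"
    by (simp_all add: zeta_60_powers minus_zeta_60 flip: power_mult)
  have k: "zeta 12 \<in> ?k" "zeta 3 \<in> ?k"
    using zp[of 1, folded zt(1)] zp[of 4, folded zt(2)] by blast+
  \<comment> \<open>The golden ratio does not lie in the field of \<open>zeta 12\<close>, which is
    all that the scalar provides; it is \<open>zeta 12\<close> times the trace of the product of the
    two generators.\<close>
  have "icoA 0 ** icoA 1 \<in> sub {0, 1}"
    unfolding sub_def by (intro generated_group.mult generated_group.incl) auto
  then have tr: "trace (icoA 0 ** icoA 1) \<in> ?k" by (rule field_of_definition_trace)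
  have zc: "1 / zeta 5 = e ^ 4" using inverse_zeta[of 5] by (simp add: n divide_inverse)
  have z12: "zeta 12 = - (\<i> * zeta 3)"
    by (simp add: zeta_60_powers minus_zeta_60 zeta_pow_mod[of 60 65] flip: power_mult power_add)
  have "golden = zeta 12 * trace (icoA 0 ** icoA 1)"
    unfolding trace_pairs zc unfolding z12 n using h by algebra
  then have kg: "golden \<in> ?k" using kD(5)[OF k(1) tr] by simp
  have m: "inverse (zeta 12) = \<i> * zeta 3 ^ 2"
    by (simp_all add: inverse_zeta inverse_zeta_pow zeta_60_powers minus_zeta_60 flip: power_mult power_add)
  define q where "q = 1 - zeta 3 + golden * inverse (zeta 12)"
  have q: "q = 1 - w + j * e ^ 2 + j * e ^ 3 + j * w * e ^ 2 + j * w * e ^ 3"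
    unfolding q_def m unfolding n using h by algebra
  show ?thesis
  proof (rule two_generators[where i = 0 and j = 1 and l = 2 and p = "1" and q = "q"])
    show "st_cartan G21 = [[1 - zeta ([2, 3, 5 :: nat] ! 0), 1], [q, 1 - zeta ([2, 3, 5 :: nat] ! 1)]]"
      by (simp add: q_def zeta_2)
    show "1 * q = trace ((mat 1 - icoA 0) ** (mat 1 - icoA 1))"
      unfolding pair_trace zc unfolding q n using h by algebra
    show "integral_unit_of {0, 1} q"
    proof (rule integral_unit_ofI[where y = "2 - 2 * e ^ 2 - 2 * e ^ 3 + w - w * e ^ 2 - w * e ^ 3 + j * w - 2 * j * w * e ^ 2 - 2 * j * w * e ^ 3"])
      show "q \<in> ?k" unfolding q_def by (intro kD k kg)
      show "algebraic_int q" unfolding q by (intro algebraic_int_intros a algebraic_int_numeral_complex)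
      show "q * (2 - 2 * e ^ 2 - 2 * e ^ 3 + w - w * e ^ 2 - w * e ^ 3 + j * w - 2 * j * w * e ^ 2 - 2 * j * w * e ^ 3) = 1" unfolding q using h by algebra
    qed (intro algebraic_int_intros a algebraic_int_numeral_complex)
    show "integral_unit_of {0, 1} 1" by (rule integral_unit_of_one)
    have "((1 - zeta ([2, 3, 5 :: nat] ! 0)) * (1 - zeta ([2, 3, 5 :: nat] ! 1)) - 1 * q) * (2 - 2 * e ^ 2 - 2 * e ^ 3 + w - w * e ^ 2 - w * e ^ 3 - j * w + 2 * j * w * e ^ 2 + 2 * j * w * e ^ 3) = 1"
      unfolding list_nth_3 zeta_2 q n using h by algebra
    then show "(1 - zeta ([2, 3, 5 :: nat] ! 0)) * (1 - zeta ([2, 3, 5 :: nat] ! 1)) \<noteq> 1 * q" by auto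
  qed (use G in \<open>auto simp: eval_nat_numeral\<close>)
qed

theorem proposition9p1:
  fixes T :: st_type and k :: "complex set" and r :: nat
  assumes k: "k = field_of_definition (st_group T)"
    and r: "r = length (st_orders T)"
  shows "(\<exists>V W p. realization (st_group T) V W p) \<and>
    (\<forall>V W p. realization (st_group T) V W p \<longrightarrow>
       unique_genus (st_group T) V W p \<and>
       (\<exists>ss. standard_generators T V ss \<and> is_cartan_matrix k V W p ss (st_cartan T))) \<and>
    (\<forall>d. (\<forall>i<r. d i \<in> k \<and> d i \<noteq> 0) \<and>
         (\<forall>i<r. \<forall>j<r. diag_conj d (st_cartan T) i j \<in> ring_of_integers k) \<longrightarrow>
       (\<exists>u. (\<forall>i<r. u i \<in> integral_units k) \<and>
            (\<forall>i<r. \<forall>j<r. diag_conj d (st_cartan T) i j = diag_conj u (st_cartan T) i j)))"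
proof -
  have "unique_root_system_data T"
    by (cases T) (simp_all only: data_G9 data_G10 data_G11 data_G14 data_G17 data_G18 data_G19 data_G21)
  from this[unfolded unique_root_system_data_def, THEN spec, THEN spec, THEN mp, THEN mp, OF k r] show ?thesis .
qed

end
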